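(* Let $(\mathcal A,\mathcal H,D)$ be a finitely summable spectral triple, let $\varphi_1,\varphi_2,\dots$ be an orthonormal basis of eigenvectors of $D$ with eigenvalues $\lambda_1,\lambda_2,\dots$, let $N\in\mathbb N$ (a cutoff), and let $f\in C^\infty(\mathbb R)$ satisfy $f'[\lambda_i,\lambda_j]>0$ for all $i,j\le N$. Let $\langle\!\langle\cdot\rangle\!\rangle_N^{1L}$ be the one-loop bracket at level $N$ defined in the context, with the standing convention stated there on its arguments. Then there exist $(b,B)$-cocycles $\phi^N$ (even) and $\tilde\psi^N$ (odd), namely those given by $$\phi^N_n(a_0,\dots,a_n):=\langle\!\langle a_0[D,a_1],[D,a_2],\dots,[D,a_n]\rangle\!\rangle_N^{1L}\quad(n\ge 1,\ a_0,\dots,a_n\in\mathcal A),$$ $$\psi^N_{2k-1}:=\phi^N_{2k-1}-\tfrac12 B_0\phi^N_{2k},\qquad \tilde\psi^N_{2k-1}:=(-1)^{k-1}\frac{(k-1)!}{(2k-1)!}\,\psi^N_{2k-1}\quad(k\ge1),$$ where the even cocycle is the sequence $(\phi^N_{2k})_{k\ge1}$ and the odd cocycle is the sequence $(\tilde\psi^N_{2k-1})_{k\ge1}$, for which the one-loop quantum effective spectral action, i.e. the formal series $\sum_{n\ge1}\frac1n\langle\!\langle V,\dots,V\rangle\!\rangle_N^{1L}$ with $V=\pi_D(A)$, $A\in\Omega^1(\mathcal A)$, can be expanded as $$\sum_{n=1}^\infty\frac1n\langle\!\langle V,\dots,V\rangle\!\rangle_N^{1L}\;\sim\;\sum_{k=1}^\infty\left(\int_{\psi^N_{2k-1}}\mathrm{cs}_{2k-1}(A)+\frac1{2k}\int_{\phi^N_{2k}}F^k\right),$$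 where $F=dA+A^2$ and $\mathrm{cs}_{2k-1}(A)=\int_0^1A\,(t\,dA+t^2A^2)^{k-1}\,dt$. Here $\sim$ means: for every $K\in\mathbb N$ there exist forms $\omega_l\in\Omega^l(\mathcal A)$, $l=K+1,\dots,2K+1$, such that $$\sum_{n=1}^K\frac1n\langle\!\langle \underbrace{V,\dots,V}_{n}\rangle\!\rangle_N^{1L}-\sum_{k=1}^K\left(\int_{\psi^N_{2k-1}}\mathrm{cs}_{2k-1}(A)+\frac1{2k}\int_{\phi^N_{2k}}F^k\right)=\sum_{l=K+1}^{2K+1}\int_{\phi^N_l}\omega_l .$$
   Context: **Spectral triple and forms.** A spectral triple $(\mathcal A,\mathcal H,D)$ consists of a unital $*$-algebra $\mathcal A$ represented by bounded operators on a Hilbert space $\mathcal H$ and a self-adjoint operator $D$ in $\mathcal H$ with compact resolvent such that $[D,a]$ is bounded for all $a\in\mathcal A$; it is finitely summable if $(i-D)^{-s}$ is trace-class for some $s$. For an operator $Q$ write $Q_{ij}=\langle\varphi_i,Q\varphi_j\rangle$. $\Omega^\bullet(\mathcal A)$ is the universal differential graded algebra of $\mathcal A$; for $A=\sum_j a_j\,db_j\in\Omega^1(\mathcal A)$ put $\pi_D(A)=\sum_j a_j[D,b_j]$. **Truncations and standing convention.** For $K\in\mathbb N$, $M_K:=\mathrm{span}\{|\varphi_i\rangle\langle\varphi_j| : i,j\le K\}$ and $H_K:=(M_K)_{\mathrm{sa}}$ is its self-adjoint part, with Lebesgue measure $dQ$ in the coordinates $\mathrm{Re}(Q_{ij})$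 ($i\le j$), $\mathrm{Im}(Q_{ij})$ ($i<j$). For simplicity, the perturbations $V_1,\dots,V_n$ put into brackets and amplitudes are assumed to lie in $\bigcup_K H_K$; brackets and amplitudes are multilinear, and the same expressions are used for non-self-adjoint arguments such as $a_0[D,a_1]$. **Cochains.** $\mathcal C^n(\mathcal A)$ is the space of $(n+1)$-linear functionals $\phi$ on $\mathcal A$ with $\phi(a_0,\dots,a_n)=0$ whenever $a_j=1$ for some $j\ge1$. For $\phi\in\mathcal C^n(\mathcal A)$ the map $\int_\phi$ on $\Omega^n(\mathcal A)$ is the linear extension of $\int_\phi a_0\,da_1\cdots da_n:=\phi(a_0,\dots,a_n)$. Define $b:\mathcal C^n\to\mathcal C^{n+1}$ and $B_0,B$ lowering degree by one by $$b\phi(a_0,\dots,a_{n+1})=\sum_{j=0}^n(-1)^j\phi(a_0,\dots,a_ja_{j+1},\dots,a_{n+1})+(-1)^{n+1}\phi(a_{n+1}a_0,a_1,\dots,a_n),$$ $$B_0\phi(a_0,\dots,a_n)=\phi(1,a_0,\dots,a_n),\qquad B\phi(a_0,\dots,a_n)=\sum_{j=0}^n(-1)^{nj}\phi(1,a_j,a_{j+1},\dots,a_{j-1})\quad(\phi\in\mathcal C^{n+1}),$$ with indices cyclic. An odd $(b,B)$-cocycle is a (possibly infinite) sequence $(\phi_1,\phi_3,\dots)$, $\phi_{2k+1}\in\mathcal C^{2k+1}(\mathcal A)$, with $b\phi_{2k+1}+B\phi_{2k+3}=0$ for all $k\ge0$ and $B\phi_1=0$. An even $(b,B)$-cocycle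 is a sequence $(\phi_0,\phi_2,\dots)$, $\phi_{2k}\in\mathcal C^{2k}(\mathcal A)$, with $b\phi_{2k}+B\phi_{2k+2}=0$ for all $k\ge0$; $(\phi_2,\phi_4,\dots)$ is regarded as such a sequence with $\phi_0=0$. **Classical bracket.** $g[x_0,\dots,x_n]$ denotes the divided difference of a smooth function $g$ (extended continuously to coinciding arguments). The bracket is $$\langle V_1,\dots,V_n\rangle:=\sum_{i_1,\dots,i_n\in\mathbb N}f'[\lambda_{i_1},\dots,\lambda_{i_n}]\,(V_1)_{i_1i_2}\cdots(V_{n-1})_{i_{n-1}i_n}(V_n)_{i_ni_1}.$$ **Noncommutative Feynman diagrams.** A Feynman diagram is a finite multigraph with some marked vertices of degree 1 (external vertices); the other vertices are called (internal) vertices. An edge is external if it meets an external vertex, otherwise internal. An $n$-point diagram has $n$ external edges, marked $1,\dots,n$. In a noncommutative Feynman diagram each internal vertex carries a cyclic order on the edges incident to it. A diagram with $v$ internal vertices and $e$ internal edges has loop order $1-v+e$. It is one-particle-irreducible if any multigraph obtained by removing one internal edge is connected. **Amplitudes.** The amplitude $\Gamma_N^G(V_1,\dots,V_n)$ at level $N$ of a diagram $G$ (each connected component of which contains at least one vertex of nonzero degree) is defined recursively: (1) if $G$ has precisely one vertex and the markings $1,\dots,n$ respect its cyclic order, then $\Gamma_N^G(V_1,\dots,V_n)=\langle V_1,\dots,V_n\rangle$; (2) the amplitude of a disjoint union is the product of the amplitudes; (3) if $G'$ is obtained from $G$ by connecting the external edges $i\ne j$ into one internal edge, then $$\Gamma_N^{G'}(V_1,\dots,\widehat{V_i},\dots,\widehat{V_j},\dots,V_n)=-\frac{\int_{H_N}\Gamma_N^G(V_1,\dots,\overset{i}{Q},\dots,\overset{j}{Q},\dots,V_n)\,e^{-\frac12\langle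 Q,Q\rangle}dQ}{\int_{H_N}e^{-\frac12\langle Q,Q\rangle}dQ}.$$ **One-loop bracket.** $$\langle\!\langle V_1,\dots,V_n\rangle\!\rangle_N^{1L}:=\sum_G\Gamma_N^G(V_1,\dots,V_n),$$ the sum being over all planar one-loop one-particle-irreducible $n$-point noncommutative Feynman diagrams $G$ with clockwise vertices of degree $\ge3$ and with external edges outside the loop and marked cyclically.
   Formalization: Added: for all a,b in A the matrix entries of a[D,b] between φ_i (i≤N) and φ_j (j>N) vanish; without it the claim fails, e.g. A=C1+M_3, N=1, where bφ_2+Bφ_4 at (E22,E21,E13,E32) is a nonzero multiple of f'[λ1,λ1,λ2,λ3]. *)

theory Defs
  imports
    "HOL-Analysis.Analysis"
    "HOL-Combinatorics.Combinatorics"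
    "HOL-Library.Poly_Mapping"
begin

section \<open>Complex vector spaces, *-algebras and Hilbert spaces\<close>

class complex_vs = ab_group_add +
  fixes cscale :: "complex \<Rightarrow> 'a \<Rightarrow> 'a" (infixr "*\<^sub>C" 75)
  assumes cscale_add_right: "c *\<^sub>C (x + y) = c *\<^sub>C x + c *\<^sub>C y"
    and cscale_add_left: "(c + d) *\<^sub>C x = c *\<^sub>C x + d *\<^sub>C x"
    and cscale_cscale: "c *\<^sub>C d *\<^sub>C x = (c * d) *\<^sub>C x"
    and cscale_one: "1 *\<^sub>C x = x"

class complex_algebra_1 = complex_vs + ring_1 +
  assumes cscale_mult_left: "(c *\<^sub>C x) * y = c *\<^sub>C (x * y)"
    and cscale_mult_right: "x * (c *\<^sub>C y) = c *\<^sub>C (x * y)"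

class star_algebra = complex_algebra_1 +
  fixes star :: "'a \<Rightarrow> 'a"
  assumes star_star: "star (star x) = x"
    and star_add: "star (x + y) = star x + star y"
    and star_mult: "star (x * y) = star y * star x"
    and star_cscale: "star (c *\<^sub>C x) = cnj c *\<^sub>C star x"

text \<open>The inner product is linear in the second argument, as in bra-ket notation.\<close>

class hilbert_space = complex_vs + banach +
  fixes cinner :: "'a \<Rightarrow> 'a \<Rightarrow> complex"
  assumes scaleR_cscale: "scaleR r x = complex_of_real r *\<^sub>C x"
    and cinner_commute: "cinner x y = cnj (cinner y x)"
    and cinner_add_right: "cinner x (y + z) = cinner x y + cinner x z"
    and cinner_cscale_right: "cinner x (c *\<^sub>C y) = c * cinner x y"
    and cinner_self: "cinner x x = complex_of_real ((norm x)\<^sup>2)"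

instantiation complex :: complex_vs
begin
definition cscale_complex :: "complex \<Rightarrow> complex \<Rightarrow> complex"
  where "cscale_complex c x = c * x"
instance by standard (simp_all add: cscale_complex_def algebra_simps)
end

lemma cscale_zero_left [simp]: "0 *\<^sub>C (x :: 'a :: complex_vs) = 0"
  using cscale_add_left[of 0 0 x] by simp

lemma cscale_zero_right [simp]: "c *\<^sub>C (0 :: 'a :: complex_vs) = 0"
  using cscale_add_right[of c "0 :: 'a" 0] by simp

lemma cscale_minus_right: "c *\<^sub>C (- (x :: 'a :: complex_vs)) = - (c *\<^sub>C x)"
  using cscale_add_right[of c x "- x"] by (simp add: eq_neg_iff_add_eq_0 add.commute)

lemma cscale_diff_right: "c *\<^sub>C (x - (y :: 'a :: complex_vs)) = c *\<^sub>C x - c *\<^sub>C y"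
  using cscale_add_right[of c x "- y"] by (simp add: cscale_minus_right)

lemma cscale_minus_left: "(- c) *\<^sub>C (x :: 'a :: complex_vs) = - (c *\<^sub>C x)"
  using cscale_add_left[of "- c" c x] by (simp add: eq_neg_iff_add_eq_0)

lemma cscale_sum_right:
  "c *\<^sub>C (\<Sum>i\<in>I. g i) = (\<Sum>i\<in>I. c *\<^sub>C (g i :: 'a :: complex_vs))"
  by (induction I rule: infinite_finite_induct) (simp_all add: cscale_add_right)

definition clinear_map :: "('a :: complex_vs \<Rightarrow> 'b :: complex_vs) \<Rightarrow> bool" where
  "clinear_map T \<longleftrightarrow> (\<forall>x y. T (x + y) = T x + T y) \<and> (\<forall>c x. T (c *\<^sub>C x) = c *\<^sub>C T x)"

definition bounded_op :: "('h :: hilbert_space \<Rightarrow> 'h) \<Rightarrow> bool" where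
  "bounded_op T \<longleftrightarrow> clinear_map T \<and> (\<exists>C. \<forall>x. norm (T x) \<le> C * norm x)"

definition compact_op :: "('h :: hilbert_space \<Rightarrow> 'h) \<Rightarrow> bool" where
  "compact_op T \<longleftrightarrow> bounded_op T \<and> compact (closure (T ` cball 0 1))"

definition is_onb :: "'h :: hilbert_space set \<Rightarrow> bool" where
  "is_onb E \<longleftrightarrow> (\<forall>e\<in>E. \<forall>e'\<in>E. cinner e e' = (if e = e' then 1 else 0))
     \<and> (\<forall>x. (\<forall>e\<in>E. cinner e x = 0) \<longrightarrow> x = 0)"

definition positive_op :: "('h :: hilbert_space \<Rightarrow> 'h) \<Rightarrow> bool" where
  "positive_op P \<longleftrightarrow> bounded_op P \<and> (\<forall>x. Im (cinner x (P x)) = 0 \<and> Re (cinner x (P x)) \<ge> 0)"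

text \<open>In \<open>trace_class\<close>, \<open>P\<close> is \<open>\<bar>T\<bar>\<close>: it is positive and \<open>P\<^sup>2 = T\<^sup>* T\<close>.\<close>

definition trace_class :: "('h :: hilbert_space \<Rightarrow> 'h) \<Rightarrow> bool" where
  "trace_class T \<longleftrightarrow> bounded_op T \<and>
     (\<exists>P. positive_op P \<and> (\<forall>x y. cinner (P x) (P y) = cinner (T x) (T y)) \<and>
        (\<forall>E. is_onb E \<longrightarrow> (\<lambda>e. Re (cinner e (P e))) summable_on E))"


section \<open>Spectral triples\<close>

text \<open>An unbounded operator is given by its domain \<open>Dom\<close> and a function \<open>D\<close>, whose values outside
  \<open>Dom\<close> are irrelevant.  The last clause says that the graph of the adjoint is the graph of \<open>D\<close>.\<close>

definition selfadjoint :: "'h :: hilbert_space set \<Rightarrow> ('h \<Rightarrow> 'h) \<Rightarrow> bool" where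
  "selfadjoint Dom D \<longleftrightarrow>
     0 \<in> Dom \<and> (\<forall>x\<in>Dom. \<forall>y\<in>Dom. x + y \<in> Dom \<and> D (x + y) = D x + D y) \<and>
     (\<forall>c. \<forall>x\<in>Dom. c *\<^sub>C x \<in> Dom \<and> D (c *\<^sub>C x) = c *\<^sub>C D x) \<and>
     closure Dom = UNIV \<and>
     (\<forall>y z. (\<forall>x\<in>Dom. cinner y (D x) = cinner z x) \<longleftrightarrow> y \<in> Dom \<and> z = D y)"

text \<open>\<open>resolvent Dom D\<close> is \<open>(i - D)\<^sup>-\<^sup>1\<close>.\<close>

definition resolvent :: "'h :: hilbert_space set \<Rightarrow> ('h \<Rightarrow> 'h) \<Rightarrow> 'h \<Rightarrow> 'h" where
  "resolvent Dom D = inv_into Dom (\<lambda>x. \<i> *\<^sub>C x - D x)"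

definition star_representation :: "('a :: star_algebra \<Rightarrow> 'h :: hilbert_space \<Rightarrow> 'h) \<Rightarrow> bool" where
  "star_representation \<pi> \<longleftrightarrow>
     (\<forall>a. bounded_op (\<pi> a)) \<and>
     (\<forall>a b x. \<pi> (a + b) x = \<pi> a x + \<pi> b x) \<and>
     (\<forall>c a x. \<pi> (c *\<^sub>C a) x = c *\<^sub>C \<pi> a x) \<and>
     (\<forall>a b x. \<pi> (a * b) x = \<pi> a (\<pi> b x)) \<and>
     (\<forall>x. \<pi> 1 x = x) \<and>
     (\<forall>a x y. cinner (\<pi> (star a) x) y = cinner x (\<pi> a y))"

text \<open>\<open>is_comm Dom D a T\<close>: the commutator of \<open>D\<close> and \<open>a\<close>, defined on \<open>Dom\<close>, extends to the bounded
  operator \<open>T\<close>.  Since \<open>Dom\<close> is dense, \<open>T\<close> is unique.\<close>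

definition is_comm :: "'h :: hilbert_space set \<Rightarrow> ('h \<Rightarrow> 'h) \<Rightarrow> ('h \<Rightarrow> 'h) \<Rightarrow> ('h \<Rightarrow> 'h) \<Rightarrow> bool" where
  "is_comm Dom D a T \<longleftrightarrow> bounded_op T \<and> (\<forall>x\<in>Dom. a x \<in> Dom \<and> T x = D (a x) - a (D x))"

definition comm :: "'h :: hilbert_space set \<Rightarrow> ('h \<Rightarrow> 'h) \<Rightarrow> ('h \<Rightarrow> 'h) \<Rightarrow> 'h \<Rightarrow> 'h" where
  "comm Dom D a = (THE T. is_comm Dom D a T)"

definition spectral_triple ::
  "('a :: star_algebra \<Rightarrow> 'h :: hilbert_space \<Rightarrow> 'h) \<Rightarrow> 'h set \<Rightarrow> ('h \<Rightarrow> 'h) \<Rightarrow> bool" where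
  "spectral_triple \<pi> Dom D \<longleftrightarrow> star_representation \<pi> \<and> selfadjoint Dom D \<and>
     compact_op (resolvent Dom D) \<and> (\<forall>a. \<exists>T. is_comm Dom D (\<pi> a) T)"

definition finitely_summable :: "'h :: hilbert_space set \<Rightarrow> ('h \<Rightarrow> 'h) \<Rightarrow> bool" where
  "finitely_summable Dom D \<longleftrightarrow> (\<exists>s. trace_class (resolvent Dom D ^^ s))"


section \<open>Linear extension\<close>

definition lext :: "('w \<Rightarrow> 'v :: complex_vs) \<Rightarrow> ('w, complex) poly_mapping \<Rightarrow> 'v" where
  "lext g x = (\<Sum>w\<in>Poly_Mapping.keys x. Poly_Mapping.lookup x w *\<^sub>C g w)"

definition pscale :: "complex \<Rightarrow> ('w, complex) poly_mapping \<Rightarrow> ('w, complex) poly_mapping" where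
  "pscale c x = Poly_Mapping.map (\<lambda>v. c * v) x"

abbreviation word1 :: "'w \<Rightarrow> ('w, complex) poly_mapping" where
  "word1 w \<equiv> Poly_Mapping.single w 1"

lemma lookup_pscale [simp]: "Poly_Mapping.lookup (pscale c x) w = c * Poly_Mapping.lookup x w"
  unfolding pscale_def by transfer (simp add: when_def)

lemma lext_superset:
  assumes "finite S" "Poly_Mapping.keys x \<subseteq> S"
  shows "lext g x = (\<Sum>w\<in>S. Poly_Mapping.lookup x w *\<^sub>C g w)"
  unfolding lext_def using assms
  by (intro sum.mono_neutral_left) (auto simp: in_keys_iff)

lemma lext_add: "lext g (x + y) = lext g x + lext g y"
proof -
  let ?S = "Poly_Mapping.keys x \<union> Poly_Mapping.keys y"
  have "lext g (x + y) = (\<Sum>w\<in>?S. Poly_Mapping.lookup (x + y) w *\<^sub>C g w)"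
    by (rule lext_superset) (use Poly_Mapping.keys_add[of x y] in auto)
  also have "\<dots> = (\<Sum>w\<in>?S. Poly_Mapping.lookup x w *\<^sub>C g w) + (\<Sum>w\<in>?S. Poly_Mapping.lookup y w *\<^sub>C g w)"
    by (simp add: lookup_add cscale_add_left sum.distrib)
  also have "\<dots> = lext g x + lext g y"
    by (subst (1 2) lext_superset[of ?S]) auto
  finally show ?thesis .
qed

lemma lext_pscale: "lext g (pscale c x) = c *\<^sub>C lext g x"
proof -
  have "lext g (pscale c x) = (\<Sum>w\<in>Poly_Mapping.keys x. Poly_Mapping.lookup (pscale c x) w *\<^sub>C g w)"
    by (rule lext_superset) (auto simp: in_keys_iff)
  also have "\<dots> = c *\<^sub>C lext g x"
    by (simp add: lext_def cscale_sum_right cscale_cscale)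
  finally show ?thesis .
qed

lemma lext_zero [simp]: "lext g 0 = 0"
  by (simp add: lext_def)

lemma lext_uminus: "lext g (- x) = - lext g x"
  using lext_add[of g x "- x"] by (simp add: eq_neg_iff_add_eq_0 add.commute)

lemma lext_diff: "lext g (x - y) = lext g x - lext g y"
  using lext_add[of g x "- y"] by (simp add: lext_uminus)

lemma lext_single [simp]: "lext g (Poly_Mapping.single w c) = c *\<^sub>C g w"
proof -
  have "lext g (Poly_Mapping.single w c)
      = (\<Sum>v\<in>{w}. Poly_Mapping.lookup (Poly_Mapping.single w c) v *\<^sub>C g v)"
    by (rule lext_superset) auto
  then show ?thesis by simp
qed

lemma pscale_add: "pscale c (x + y) = pscale c x + pscale c y"
  by (rule poly_mapping_eqI) (simp add: lookup_add algebra_simps)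

lemma pscale_diff: "pscale c (x - y) = pscale c x - pscale c y"
  by (rule poly_mapping_eqI) (simp add: lookup_minus algebra_simps)

lemma pscale_minus_one: "pscale (- 1) x = - x"
  by (rule poly_mapping_eqI) simp


section \<open>The universal differential graded algebra\<close>

text \<open>The word \<open>(a\<^sub>0, [a\<^sub>1, \<dots>, a\<^sub>n])\<close> stands for \<open>a\<^sub>0 da\<^sub>1 \<cdots> da\<^sub>n\<close>.  The space of forms is the space of
  formal complex combinations of words modulo \<open>form_null\<close>, so that its part of degree \<open>n\<close> is the
  tensor product of \<open>A\<close> with \<open>n\<close> copies of \<open>A / \<complex>1\<close>.\<close>

type_synonym 'a word = "'a \<times> 'a list"

inductive_set form_null :: "('a :: complex_algebra_1 word, complex) poly_mapping set" where
  zero: "0 \<in> form_null"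
| add: "x \<in> form_null \<Longrightarrow> y \<in> form_null \<Longrightarrow> x + y \<in> form_null"
| scale: "x \<in> form_null \<Longrightarrow> pscale c x \<in> form_null"
| head_add: "word1 (a + b, ws) - word1 (a, ws) - word1 (b, ws) \<in> form_null"
| head_scale: "word1 (c *\<^sub>C a, ws) - Poly_Mapping.single (a, ws) c \<in> form_null"
| tail_add: "word1 (a, us @ (x + y) # vs) - word1 (a, us @ x # vs) - word1 (a, us @ y # vs) \<in> form_null"
| tail_scale: "word1 (a, us @ (c *\<^sub>C x) # vs) - Poly_Mapping.single (a, us @ x # vs) c \<in> form_null"
| tail_one: "word1 (a, us @ 1 # vs) \<in> form_null"

lemma form_null_uminus: "x \<in> form_null \<Longrightarrow> - x \<in> form_null"
  using form_null.scale[of x "- 1"] by (simp add: pscale_minus_one)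

lemma form_null_diff: "x \<in> form_null \<Longrightarrow> y \<in> form_null \<Longrightarrow> x - y \<in> form_null"
  using form_null.add[of x "- y"] form_null_uminus[of y] by simp

lemma form_null_trans: "x - y \<in> form_null \<Longrightarrow> y - z \<in> form_null \<Longrightarrow> x - z \<in> form_null"
  using form_null.add[of "x - y" "y - z"] by simp

quotient_type (overloaded) 'a form = "('a :: complex_algebra_1 word, complex) poly_mapping"
  / "\<lambda>x y. x - y \<in> form_null"
proof (rule equivpI)
  show "reflp (\<lambda>x y. x - y \<in> form_null)"
    by (auto intro!: reflpI form_null.zero)
  show "symp (\<lambda>x y. x - y \<in> form_null)"
    by (rule sympI) (metis form_null_uminus minus_diff_eq)
  show "transp (\<lambda>x y. x - y \<in> form_null)"
    by (rule transpI) (rule form_null_trans)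
qed

instantiation form :: (complex_algebra_1) complex_vs
begin

lift_definition zero_form :: "'a form" is 0 .

lift_definition plus_form :: "'a form \<Rightarrow> 'a form \<Rightarrow> 'a form" is "(+)"
proof -
  fix x x' y y' :: "('a word, complex) poly_mapping"
  assume "x - x' \<in> form_null" "y - y' \<in> form_null"
  from form_null.add[OF this] show "x + y - (x' + y') \<in> form_null"
    by (simp add: algebra_simps)
qed

lift_definition uminus_form :: "'a form \<Rightarrow> 'a form" is uminus
  by (metis form_null_uminus minus_diff_minus)

lift_definition minus_form :: "'a form \<Rightarrow> 'a form \<Rightarrow> 'a form" is "(-)"
proof -
  fix x x' y y' :: "('a word, complex) poly_mapping"
  assume "x - x' \<in> form_null" "y - y' \<in> form_null"
  from form_null_diff[OF this] show "x - y - (x' - y') \<in> form_null"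
    by (simp add: algebra_simps)
qed

lift_definition cscale_form :: "complex \<Rightarrow> 'a form \<Rightarrow> 'a form" is pscale
  by (metis form_null.scale pscale_diff)

instance
proof
  fix x y z :: "'a form" and c d :: complex
  note eq = form_null.zero
  show "x + y + z = x + (y + z)" by transfer (simp add: eq add.assoc)
  show "x + y = y + x" by transfer (simp add: eq add.commute)
  show "0 + x = x" by transfer (simp add: eq)
  show "- x + x = 0" by transfer (simp add: eq)
  show "x - y = x + - y" by transfer (simp add: eq)
  show "c *\<^sub>C (x + y) = c *\<^sub>C x + c *\<^sub>C y" by transfer (simp add: eq pscale_add)
  show "(c + d) *\<^sub>C x = c *\<^sub>C x + d *\<^sub>C x"
  proof transfer
    fix c d :: complex and x :: "('a word, complex) poly_mapping"
    have "pscale (c + d) x = pscale c x + pscale d x"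
      by (rule poly_mapping_eqI) (simp add: lookup_add algebra_simps)
    then show "pscale (c + d) x - (pscale c x + pscale d x) \<in> form_null" by (simp add: eq)
  qed
  show "c *\<^sub>C d *\<^sub>C x = (c * d) *\<^sub>C x"
  proof transfer
    fix c d :: complex and x :: "('a word, complex) poly_mapping"
    have "pscale c (pscale d x) = pscale (c * d) x"
      by (rule poly_mapping_eqI) (simp add: algebra_simps)
    then show "pscale c (pscale d x) - pscale (c * d) x \<in> form_null" by (simp add: eq)
  qed
  show "1 *\<^sub>C x = x"
  proof transfer
    fix x :: "('a word, complex) poly_mapping"
    have "pscale 1 x = x" by (rule poly_mapping_eqI) simp
    then show "pscale 1 x - x \<in> form_null" by (simp add: eq)
  qed
qed

end

lemma lext_null_zero:
  assumes "x \<in> form_null"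
    and "\<And>a b ws. g (a + b, ws) = g (a, ws) + g (b, ws)"
    and "\<And>c a ws. g (c *\<^sub>C a, ws) = c *\<^sub>C g (a, ws)"
    and "\<And>a us x y vs. g (a, us @ (x + y) # vs) = g (a, us @ x # vs) + g (a, us @ y # vs)"
    and "\<And>a us c x vs. g (a, us @ (c *\<^sub>C x) # vs) = c *\<^sub>C g (a, us @ x # vs)"
    and "\<And>a us vs. g (a, us @ 1 # vs) = 0"
  shows "lext g x = 0"
  using assms(1)
  by (induction rule: form_null.induct)
     (simp_all add: lext_add lext_pscale lext_diff assms(2-) cscale_one)

lift_definition word_form :: "'a :: complex_algebra_1 word \<Rightarrow> 'a form" is word1 .

lemma word_form_head_add: "word_form (a + b, ws) = word_form (a, ws) + word_form (b, ws)"
  by transfer (metis diff_diff_eq form_null.head_add)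

lemma word_form_head_scale: "word_form (c *\<^sub>C a, ws) = c *\<^sub>C word_form (a, ws)"
proof transfer
  fix c and a :: 'a and ws :: "'a list"
  have "pscale c (word1 (a, ws)) = Poly_Mapping.single (a, ws) c"
    by (rule poly_mapping_eqI) (simp add: lookup_single when_def)
  then show "word1 (c *\<^sub>C a, ws) - pscale c (word1 (a, ws)) \<in> form_null"
    by (simp add: form_null.head_scale)
qed

lemma word_form_tail_add:
  "word_form (a, us @ (x + y) # vs) = word_form (a, us @ x # vs) + word_form (a, us @ y # vs)"
  by transfer (metis diff_diff_eq form_null.tail_add)

lemma word_form_tail_scale: "word_form (a, us @ (c *\<^sub>C x) # vs) = c *\<^sub>C word_form (a, us @ x # vs)"
proof transfer
  fix c and a x :: 'a and us vs :: "'a list"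
  have "pscale c (word1 (a, us @ x # vs)) = Poly_Mapping.single (a, us @ x # vs) c"
    by (rule poly_mapping_eqI) (simp add: lookup_single when_def)
  then show "word1 (a, us @ (c *\<^sub>C x) # vs) - pscale c (word1 (a, us @ x # vs)) \<in> form_null"
    by (simp add: form_null.tail_scale)
qed

lemma word_form_tail_one: "word_form (a, us @ 1 # vs) = 0"
  by transfer (simp add: form_null.tail_one)

text \<open>The differential: \<open>d (a\<^sub>0 da\<^sub>1 \<cdots> da\<^sub>n) = da\<^sub>0 da\<^sub>1 \<cdots> da\<^sub>n\<close>.\<close>

lift_definition fd :: "'a :: complex_algebra_1 form \<Rightarrow> 'a form"
  is "lext (\<lambda>(a, as). word_form (1, a # as))"
proof -
  fix x y :: "('a word, complex) poly_mapping"
  assume "x - y \<in> form_null"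
  then have "lext (\<lambda>(a, as). word_form (1, a # as)) (x - y) = 0"
    by (rule lext_null_zero)
       (use word_form_tail_add[of _ "[]"] word_form_tail_scale[of _ "[]"]
            word_form_tail_add[of _ "_ # _"] word_form_tail_scale[of _ "_ # _"]
            word_form_tail_one[of _ "_ # _"] in simp_all)
  then show "lext (\<lambda>(a, as). word_form (1, a # as)) x = lext (\<lambda>(a, as). word_form (1, a # as)) y"
    by (simp add: lext_diff)
qed

text \<open>Left multiplication by an element of the algebra.\<close>

lift_definition fleft :: "'a :: complex_algebra_1 \<Rightarrow> 'a form \<Rightarrow> 'a form"
  is "\<lambda>a. lext (\<lambda>(b, bs). word_form (a * b, bs))"
proof -
  fix a :: 'a and x y :: "('a word, complex) poly_mapping"
  assume "x - y \<in> form_null"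
  then have "lext (\<lambda>(b, bs). word_form (a * b, bs)) (x - y) = 0"
    by (rule lext_null_zero)
       (simp_all add: distrib_left cscale_mult_right word_form_head_add word_form_head_scale
          word_form_tail_add word_form_tail_scale word_form_tail_one)
  then show "lext (\<lambda>(b, bs). word_form (a * b, bs)) x = lext (\<lambda>(b, bs). word_form (a * b, bs)) y"
    by (simp add: lext_diff)
qed

lemma fd_add: "fd (\<omega> + \<eta>) = fd \<omega> + fd \<eta>"
  by transfer (simp add: lext_add)

lemma fd_cscale: "fd (c *\<^sub>C \<omega>) = c *\<^sub>C fd \<omega>"
  by transfer (simp add: lext_pscale)

lemma fleft_add: "fleft a (\<omega> + \<eta>) = fleft a \<omega> + fleft a \<eta>"
  by transfer (simp add: lext_add)

lemma fleft_cscale: "fleft a (c *\<^sub>C \<omega>) = c *\<^sub>C fleft a \<omega>"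
  by transfer (simp add: lext_pscale)

lemma fleft_diff: "fleft a (\<omega> - \<eta>) = fleft a \<omega> - fleft a \<eta>"
  by transfer (simp add: lext_diff)

lemma fleft_zero: "fleft a 0 = 0"
  using fleft_cscale[of a 0 0] by simp

lemma fd_word: "fd (word_form (a, as)) = word_form (1, a # as)"
  by transfer (simp add: cscale_one)

lemma fleft_word: "fleft a (word_form (b, bs)) = word_form (a * b, bs)"
  by transfer (simp add: cscale_one)

lemma form_induct [case_names zero add cscale word]:
  assumes "P 0" "\<And>\<omega> \<eta>. P \<omega> \<Longrightarrow> P \<eta> \<Longrightarrow> P (\<omega> + \<eta>)" "\<And>c \<omega>. P \<omega> \<Longrightarrow> P (c *\<^sub>C \<omega>)"
    and "\<And>a as. P (word_form (a, as))"
  shows "P (\<omega> :: 'a :: complex_algebra_1 form)"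
proof (induction \<omega> rule: form.abs_induct)
  case (1 x)
  show ?case
  proof (induction x rule: update_induct)
    case const
    then show ?case using assms(1) by (simp add: zero_form.abs_eq)
  next
    case (update x w c)
    have "abs_form (Poly_Mapping.single w c) = c *\<^sub>C word_form w"
      unfolding word_form.abs_eq cscale_form.abs_eq
      by (rule arg_cong[where f = abs_form], rule poly_mapping_eqI)
         (simp add: lookup_single when_def)
    moreover have "Poly_Mapping.update w c x = x + Poly_Mapping.single w c"
      using update(1)
      by (intro poly_mapping_eqI) (auto simp: lookup_update lookup_add lookup_single when_def in_keys_iff)
    ultimately have "abs_form (Poly_Mapping.update w c x) = abs_form x + c *\<^sub>C word_form w"
      by (metis plus_form.abs_eq)
    then show ?case using assms(2-4) update by (cases w) simp
  qed
qed

text \<open>\<open>fdleft a\<close> is left multiplication by \<open>da\<close>, which by the Leibniz rule must be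
  \<open>\<omega> \<mapsto> d (a \<omega>) - a d\<omega>\<close>.\<close>

definition fdleft :: "'a :: complex_algebra_1 \<Rightarrow> 'a form \<Rightarrow> 'a form" where
  "fdleft a \<omega> = fd (fleft a \<omega>) - fleft a (fd \<omega>)"

definition word_act :: "'a :: complex_algebra_1 word \<Rightarrow> 'a form \<Rightarrow> 'a form" where
  "word_act = (\<lambda>(a, as) \<omega>. fleft a (foldr fdleft as \<omega>))"

lemma fleft_add_left: "fleft (a + b) \<omega> = fleft a \<omega> + fleft b \<omega>"
proof (induction \<omega> rule: form_induct)
  case (word c cs)
  then show ?case by (simp add: fleft_word distrib_right word_form_head_add)
qed (simp_all add: fleft_zero fleft_add fleft_cscale cscale_add_right)

lemma fleft_cscale_left: "fleft (c *\<^sub>C a) \<omega> = c *\<^sub>C fleft a \<omega>"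
proof (induction \<omega> rule: form_induct)
  case (word b bs)
  then show ?case by (simp add: fleft_word cscale_mult_left word_form_head_scale)
qed (simp_all add: fleft_zero fleft_add fleft_cscale cscale_add_right cscale_cscale mult.commute)

lemma fleft_one: "fleft 1 \<omega> = \<omega>"
proof (induction \<omega> rule: form_induct)
qed (simp_all add: fleft_zero fleft_add fleft_cscale fleft_word)

lemma fleft_fleft: "fleft a (fleft b \<omega>) = fleft (a * b) \<omega>"
proof (induction \<omega> rule: form_induct)
qed (simp_all add: fleft_zero fleft_add fleft_cscale fleft_word mult.assoc)

lemma fdleft_add: "fdleft a (\<omega> + \<eta>) = fdleft a \<omega> + fdleft a \<eta>"
  by (simp add: fdleft_def fd_add fleft_add)

lemma fdleft_cscale: "fdleft a (c *\<^sub>C \<omega>) = c *\<^sub>C fdleft a \<omega>"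
  by (simp add: fdleft_def fd_cscale fleft_cscale cscale_diff_right)

lemma fdleft_add_left: "fdleft (a + b) \<omega> = fdleft a \<omega> + fdleft b \<omega>"
  by (simp add: fdleft_def fd_add fleft_add_left)

lemma fdleft_cscale_left: "fdleft (c *\<^sub>C a) \<omega> = c *\<^sub>C fdleft a \<omega>"
  by (simp add: fdleft_def fd_cscale fleft_cscale_left cscale_diff_right)

lemma fdleft_one: "fdleft 1 \<omega> = 0"
  by (simp add: fdleft_def fleft_one)

lemma foldr_fdleft_add: "foldr fdleft as (\<omega> + \<eta>) = foldr fdleft as \<omega> + foldr fdleft as \<eta>"
  by (induction as) (simp_all add: fdleft_add)

lemma foldr_fdleft_cscale: "foldr fdleft as (c *\<^sub>C \<omega>) = c *\<^sub>C foldr fdleft as \<omega>"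
  by (induction as) (simp_all add: fdleft_cscale)

lemma foldr_fdleft_zero: "foldr fdleft as 0 = 0"
  using foldr_fdleft_cscale[of as 0 0] by simp

lemma lext_word_act_cong:
  assumes "x - y \<in> form_null"
  shows "lext (\<lambda>w. word_act w \<eta>) x = lext (\<lambda>w. word_act w \<eta>) y"
proof -
  from assms have "lext (\<lambda>w. word_act w \<eta>) (x - y) = 0"
    by (rule lext_null_zero)
       (simp_all add: word_act_def fleft_add fleft_cscale fleft_add_left fleft_cscale_left
          fdleft_add_left fdleft_cscale_left fdleft_one foldr_fdleft_add foldr_fdleft_cscale
          foldr_fdleft_zero fleft_zero)
  then show ?thesis
    by (simp add: lext_diff)
qed

instantiation form :: (complex_algebra_1) "{one, times}"
begin

lift_definition one_form :: "'a form" is "word1 (1, [])" .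

lift_definition times_form :: "'a form \<Rightarrow> 'a form \<Rightarrow> 'a form"
  is "\<lambda>x \<eta>. lext (\<lambda>w. word_act w \<eta>) x"
  by (rule ext) (simp add: lext_word_act_cong)

instance ..

end

lemma times_word: "word_form w * \<eta> = word_act w \<eta>"
  by transfer (simp add: cscale_one)

lemma times_form_add_left: "(\<omega> + \<omega>') * (\<eta> :: 'a :: complex_algebra_1 form) = \<omega> * \<eta> + \<omega>' * \<eta>"
  by transfer (simp add: lext_add)

lemma times_form_cscale_left: "(c *\<^sub>C \<omega>) * (\<eta> :: 'a :: complex_algebra_1 form) = c *\<^sub>C (\<omega> * \<eta>)"
  by transfer (simp add: lext_pscale)

lemma times_form_zero_left: "0 * (\<eta> :: 'a :: complex_algebra_1 form) = 0"
  using times_form_cscale_left[of 0 0 \<eta>] by simp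

lemma word_act_add: "word_act w (\<eta> + \<zeta>) = word_act w \<eta> + word_act w \<zeta>"
  by (cases w) (simp add: word_act_def foldr_fdleft_add fleft_add)

lemma word_act_cscale: "word_act w (c *\<^sub>C \<eta>) = c *\<^sub>C word_act w \<eta>"
  by (cases w) (simp add: word_act_def foldr_fdleft_cscale fleft_cscale)

lemma times_form_add_right: "\<omega> * (\<eta> + \<zeta>) = \<omega> * \<eta> + \<omega> * (\<zeta> :: 'a :: complex_algebra_1 form)"
  by (induction \<omega> rule: form_induct)
     (simp_all add: times_form_zero_left times_form_add_left times_form_cscale_left times_word
        word_act_add cscale_add_right add_ac)

lemma times_form_cscale_right: "\<omega> * (c *\<^sub>C \<eta>) = c *\<^sub>C (\<omega> * (\<eta> :: 'a :: complex_algebra_1 form))"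
  by (induction \<omega> rule: form_induct)
     (simp_all add: times_form_zero_left times_form_add_left times_form_cscale_left times_word
        word_act_cscale cscale_add_right cscale_cscale mult.commute)

lemma word_act_Cons: "word_act (a, b # bs) \<omega> = fleft a (fdleft b (foldr fdleft bs \<omega>))"
  by (simp add: word_act_def)

lemma fleft_times: "fleft a (\<omega> * \<eta>) = fleft a \<omega> * \<eta>"
  by (induction \<omega> rule: form_induct)
     (auto simp: times_form_zero_left times_form_add_left times_form_cscale_left times_word
        fleft_zero fleft_add fleft_cscale fleft_word word_act_def fleft_fleft)

lemma fd_zero: "fd 0 = 0"
  using fd_cscale[of 0 0] by simp

lemma fdleft_times: "fdleft a (\<omega> * \<eta>) = fdleft a \<omega> * \<eta>"
proof (induction \<omega> rule: form_induct)
  case zero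
  then show ?case by (simp add: times_form_zero_left fdleft_def fd_zero fleft_zero)
next
  case (word b bs)
  have diff: "(\<omega> - \<omega>') * \<eta> = \<omega> * \<eta> - \<omega>' * \<eta>" for \<omega> \<omega>'
    using times_form_add_left[of "\<omega> - \<omega>'" \<omega>' \<eta>] by simp
  have "fdleft a (word_form (b, bs)) * \<eta> = word_act (1, (a * b) # bs) \<eta> - word_act (a, b # bs) \<eta>"
    by (simp add: fdleft_def fleft_word fd_word diff times_word)
  then show ?case
    by (simp add: times_word word_act_Cons fleft_one)
       (simp add: word_act_def fdleft_def fleft_fleft algebra_simps fleft_diff)
qed (simp_all add: times_form_add_left times_form_cscale_left fdleft_add fdleft_cscale)

lemma fd_fd: "fd (fd \<omega>) = 0"
proof (induction \<omega> rule: form_induct)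
  case (word a as)
  then show ?case using word_form_tail_one[of 1 "[]" "a # as"] by (simp add: fd_word)
qed (simp_all add: fd_zero fd_add fd_cscale)

instance form :: (complex_algebra_1) complex_algebra_1
proof
  fix \<omega> \<eta> \<zeta> :: "'a form" and c :: complex
  show "(\<omega> + \<eta>) * \<zeta> = \<omega> * \<zeta> + \<eta> * \<zeta>" by (rule times_form_add_left)
  show "\<omega> * (\<eta> + \<zeta>) = \<omega> * \<eta> + \<omega> * \<zeta>" by (rule times_form_add_right)
  show "(c *\<^sub>C \<omega>) * \<eta> = c *\<^sub>C (\<omega> * \<eta>)" by (rule times_form_cscale_left)
  show "\<omega> * (c *\<^sub>C \<eta>) = c *\<^sub>C (\<omega> * \<eta>)" by (rule times_form_cscale_right)
  have one: "(1 :: 'a form) = word_form (1, [])" by transfer (simp add: form_null.zero)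
  show "1 * \<omega> = \<omega>" by (simp add: one times_word word_act_def fleft_one)
  have unit: "word_act (a, as) 1 = word_form (a, as)" for a :: 'a and as
  proof (induction as arbitrary: a)
    case Nil
    then show ?case by (simp add: word_act_def one fleft_word)
  next
    case (Cons b bs)
    have "foldr fdleft bs 1 = word_form (1, bs)"
      using Cons[of 1] by (simp add: word_act_def fleft_one)
    then show ?case
      using word_form_tail_one[of b "[]" bs]
      by (simp add: word_act_Cons fdleft_def fleft_word fd_word)
  qed
  show "\<omega> * 1 = \<omega>"
    by (induction \<omega> rule: form_induct)
       (simp_all add: times_form_zero_left times_form_add_left times_form_cscale_left times_word unit)
  show "\<omega> * \<eta> * \<zeta> = \<omega> * (\<eta> * \<zeta>)"
  proof (induction \<omega> rule: form_induct)
    case (word a as)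
    have "foldr fdleft as \<eta> * \<zeta> = foldr fdleft as (\<eta> * \<zeta>)"
      by (induction as) (simp_all add: fdleft_times[symmetric])
    then show ?case by (simp add: times_word word_act_def fleft_times[symmetric])
  qed (simp_all add: times_form_zero_left times_form_add_left times_form_cscale_left)
  show "(0 :: 'a form) \<noteq> 1"
  proof
    assume "(0 :: 'a form) = 1"
    then have "(0 :: ('a word, complex) poly_mapping) - word1 (1, []) \<in> form_null"
      by transfer
    then have "lext (\<lambda>(a :: 'a, as :: 'a list). if as = [] then a else 0) (0 - word1 (1, [])) = 0"
      by (rule lext_null_zero) simp_all
    then show False by (simp add: lext_uminus cscale_one)
  qed
qed

definition Omega :: "nat \<Rightarrow> 'a :: complex_algebra_1 form set" where
  "Omega n = {abs_form x | x. \<forall>w\<in>Poly_Mapping.keys x. length (snd w) = n}"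

definition curvature :: "'a :: complex_algebra_1 form \<Rightarrow> 'a form" where
  "curvature A = fd A + A ^ 2"

text \<open>The integral over \<open>[0, 1]\<close> of a curve of forms, taken weakly: it commutes with every linear
  functional.  Linear functionals separate points, so the value is unique.\<close>

definition form_integral :: "(real \<Rightarrow> 'a :: complex_algebra_1 form) \<Rightarrow> 'a form" where
  "form_integral g = (THE \<eta>. \<forall>l :: 'a form \<Rightarrow> complex. clinear_map l \<longrightarrow>
     ((\<lambda>t. l (g t)) has_integral l \<eta>) {0..1})"

text \<open>\<open>chern_simons k A\<close> is the form of degree \<open>2 k - 1\<close>.\<close>

definition chern_simons :: "nat \<Rightarrow> 'a :: complex_algebra_1 form \<Rightarrow> 'a form" where
  "chern_simons k A = form_integral (\<lambda>t.
     A * (complex_of_real t *\<^sub>C fd A + complex_of_real (t\<^sup>2) *\<^sub>C A ^ 2) ^ (k - 1))"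


section \<open>Cochains and cocycles\<close>

text \<open>An \<open>n\<close>-cochain is a function of the list \<open>[a\<^sub>0, \<dots>, a\<^sub>n]\<close>; its values on lists of other lengths
  are irrelevant.\<close>

type_synonym 'a cochain = "'a list \<Rightarrow> complex"

definition cochains :: "nat \<Rightarrow> 'a :: complex_algebra_1 cochain set" where
  "cochains n = {\<phi>.
     (\<forall>us vs x y. length us + length vs = n \<longrightarrow>
        \<phi> (us @ (x + y) # vs) = \<phi> (us @ x # vs) + \<phi> (us @ y # vs)) \<and>
     (\<forall>us vs c x. length us + length vs = n \<longrightarrow> \<phi> (us @ (c *\<^sub>C x) # vs) = c * \<phi> (us @ x # vs)) \<and>
     (\<forall>us vs. length us + length vs = n \<and> us \<noteq> [] \<longrightarrow> \<phi> (us @ 1 # vs) = 0)}"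

definition cint :: "nat \<Rightarrow> 'a :: complex_algebra_1 cochain \<Rightarrow> 'a form \<Rightarrow> complex" where
  "cint n \<phi> \<omega> = lext (\<lambda>(a, as). if length as = n then \<phi> (a # as) else 0) (rep_form \<omega>)"

lemma rep_form_rel: "rep_form (abs_form x) - x \<in> form_null"
  using form_null.zero by (intro rep_abs_rsp_left[OF Quotient3_form]) simp

lemma cint_abs_form:
  assumes "\<phi> \<in> cochains n"
  shows "cint n \<phi> (abs_form x) = lext (\<lambda>(a, as). if length as = n then \<phi> (a # as) else 0) x"
proof -
  have add: "\<phi> (us @ (x + y) # vs) = \<phi> (us @ x # vs) + \<phi> (us @ y # vs)"
    and scale: "\<phi> (us @ (c *\<^sub>C x) # vs) = c * \<phi> (us @ x # vs)"
    and one: "us \<noteq> [] \<Longrightarrow> \<phi> (us @ 1 # vs) = 0"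
    if "length us + length vs = n" for us vs x y c
    using assms that unfolding cochains_def by auto
  have "lext (\<lambda>(a, as). if length as = n then \<phi> (a # as) else 0) (rep_form (abs_form x) - x) = 0"
    using rep_form_rel
    by (rule lext_null_zero)
       (use add[of "[]"] scale[of "[]"] add[of "_ # _"] scale[of "_ # _"] one[of "_ # _"] in
         \<open>simp_all add: cscale_complex_def\<close>)
  then show ?thesis by (simp add: lext_diff cint_def)
qed

definition hoch_b :: "nat \<Rightarrow> 'a :: complex_algebra_1 cochain \<Rightarrow> 'a cochain" where
  "hoch_b n \<phi> as =
     (\<Sum>j\<le>n. (- 1) ^ j * \<phi> (take j as @ (as ! j * as ! Suc j) # drop (j + 2) as))
     + (- 1) ^ (n + 1) * \<phi> ((as ! (n + 1) * as ! 0) # map (\<lambda>j. as ! j) [1..<n + 1])"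

definition B0 :: "'a :: complex_algebra_1 cochain \<Rightarrow> 'a cochain" where
  "B0 \<phi> as = \<phi> (1 # as)"

text \<open>\<open>connes_B n\<close> maps \<open>(n + 1)\<close>-cochains to \<open>n\<close>-cochains, \<open>hoch_b n\<close> maps \<open>n\<close>-cochains to
  \<open>(n + 1)\<close>-cochains.\<close>

definition connes_B :: "nat \<Rightarrow> 'a :: complex_algebra_1 cochain \<Rightarrow> 'a cochain" where
  "connes_B n \<phi> as = (\<Sum>j\<le>n. (- 1) ^ (n * j) * \<phi> (1 # rotate j as))"

text \<open>The \<open>k\<close>-th member of \<open>\<Phi>\<close> has degree \<open>2 k + 1\<close> in the odd case and \<open>2 k\<close> in the even case.\<close>

definition odd_cocycle :: "(nat \<Rightarrow> 'a :: complex_algebra_1 cochain) \<Rightarrow> bool" where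
  "odd_cocycle \<Phi> \<longleftrightarrow> (\<forall>k. \<Phi> k \<in> cochains (2 * k + 1)) \<and>
     (\<forall>k as. length as = 2 * k + 3 \<longrightarrow>
        hoch_b (2 * k + 1) (\<Phi> k) as + connes_B (2 * k + 2) (\<Phi> (k + 1)) as = 0) \<and>
     (\<forall>as. length as = 1 \<longrightarrow> connes_B 0 (\<Phi> 0) as = 0)"

definition even_cocycle :: "(nat \<Rightarrow> 'a :: complex_algebra_1 cochain) \<Rightarrow> bool" where
  "even_cocycle \<Phi> \<longleftrightarrow> (\<forall>k. \<Phi> k \<in> cochains (2 * k)) \<and>
     (\<forall>k as. length as = 2 * k + 2 \<longrightarrow>
        hoch_b (2 * k) (\<Phi> k) as + connes_B (2 * k + 1) (\<Phi> (k + 1)) as = 0)"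


section \<open>Divided differences and the classical bracket\<close>

definition smooth :: "(real \<Rightarrow> real) \<Rightarrow> bool" where
  "smooth g \<longleftrightarrow> (\<forall>k x. (deriv ^^ k) g differentiable at x)"

text \<open>Divided difference at pairwise distinct arguments.\<close>

function ddiff0 :: "(real \<Rightarrow> real) \<Rightarrow> real list \<Rightarrow> real" where
  "ddiff0 g [] = 0"
| "ddiff0 g [x] = g x"
| "ddiff0 g (x # y # zs) =
     (ddiff0 g (butlast (x # y # zs)) - ddiff0 g (y # zs)) / (x - last (y # zs))"
  by pat_completeness auto
termination by (relation "Wellfounded.measure (\<lambda>(g, xs). length xs)") auto

text \<open>The continuous extension: the limit along all tuples of distinct arguments tending to \<open>xs\<close>.\<close>

definition ddiff :: "(real \<Rightarrow> real) \<Rightarrow> real list \<Rightarrow> real" where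
  "ddiff g xs = (THE l. \<forall>ys :: nat \<Rightarrow> real list.
     (\<forall>m. length (ys m) = length xs \<and> distinct (ys m)) \<and>
     (\<forall>i<length xs. (\<lambda>m. ys m ! i) \<longlonglongrightarrow> xs ! i)
     \<longrightarrow> (\<lambda>m. ddiff0 g (ys m)) \<longlonglongrightarrow> l)"

text \<open>From here on \<open>\<phi>\<close> is the orthonormal basis of eigenvectors and \<open>lam\<close> the sequence of
  eigenvalues.  Indices start at 0, so that the index set \<open>{i. i \<le> N}\<close> of the text with basis
  \<open>\<phi>\<^sub>1, \<phi>\<^sub>2, \<dots>\<close> becomes \<open>{i. i < N}\<close>.\<close>

definition entry :: "(nat \<Rightarrow> 'h :: hilbert_space) \<Rightarrow> ('h \<Rightarrow> 'h) \<Rightarrow> nat \<Rightarrow> nat \<Rightarrow> complex" where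
  "entry \<phi> Q i j = cinner (\<phi> i) (Q (\<phi> j))"

definition mat_op :: "(nat \<Rightarrow> 'h :: hilbert_space) \<Rightarrow> nat \<Rightarrow> (nat \<Rightarrow> nat \<Rightarrow> complex) \<Rightarrow> 'h \<Rightarrow> 'h" where
  "mat_op \<phi> K q v = (\<Sum>i<K. \<Sum>j<K. (q i j * cinner (\<phi> j) v) *\<^sub>C \<phi> i)"

text \<open>\<open>MK \<phi> K\<close> is the span of the operators \<open>|\<phi>\<^sub>i\<rangle>\<langle>\<phi>\<^sub>j|\<close> with \<open>i, j < K\<close>.\<close>

definition MK :: "(nat \<Rightarrow> 'h :: hilbert_space) \<Rightarrow> nat \<Rightarrow> ('h \<Rightarrow> 'h) set" where
  "MK \<phi> K = range (mat_op \<phi> K)"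

definition HK :: "(nat \<Rightarrow> 'h :: hilbert_space) \<Rightarrow> nat \<Rightarrow> ('h \<Rightarrow> 'h) set" where
  "HK \<phi> K = {Q \<in> MK \<phi> K. \<forall>x y. cinner (Q x) y = cinner x (Q y)}"

definition bracket ::
  "(nat \<Rightarrow> 'h :: hilbert_space) \<Rightarrow> (nat \<Rightarrow> real) \<Rightarrow> (real \<Rightarrow> real) \<Rightarrow> ('h \<Rightarrow> 'h) list \<Rightarrow> complex" where
  "bracket \<phi> lam f Vs =
     (\<Sum>\<^sub>\<infinity>is\<in>{is. length is = length Vs}. complex_of_real (ddiff (deriv f) (map lam is)) *
        (\<Prod>k<length Vs. entry \<phi> (Vs ! k) (is ! k) (is ! (Suc k mod length Vs))))"

text \<open>The coordinates of \<open>Q\<close> in \<open>HK \<phi> N\<close> are collected in one family \<open>x\<close> indexed by pairs: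
  \<open>x (i, j)\<close> is the real part of \<open>Q\<^sub>i\<^sub>j\<close> if \<open>i \<le> j\<close>, and \<open>x (j, i)\<close> is the imaginary part of \<open>Q\<^sub>i\<^sub>j\<close> if
  \<open>i < j\<close>.\<close>

definition herm_mat :: "(nat \<times> nat \<Rightarrow> real) \<Rightarrow> nat \<Rightarrow> nat \<Rightarrow> complex" where
  "herm_mat x i j = (if i < j then Complex (x (i, j)) (x (j, i))
     else if i = j then complex_of_real (x (i, i)) else Complex (x (j, i)) (- x (i, j)))"

definition HK_integral ::
  "(nat \<Rightarrow> 'h :: hilbert_space) \<Rightarrow> nat \<Rightarrow> (('h \<Rightarrow> 'h) \<Rightarrow> complex) \<Rightarrow> complex" where
  "HK_integral \<phi> N F =
     (LINT x | Pi\<^sub>M ({..<N} \<times> {..<N}) (\<lambda>_. lborel). F (mat_op \<phi> N (herm_mat x)))"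


section \<open>Noncommutative Feynman diagrams\<close>

text \<open>A diagram is given by its darts (half-edges at internal vertices).  \<open>nxt\<close> sends a dart to the
  next dart, in clockwise order, at the same vertex; the vertices are its orbits.  \<open>opp\<close> exchanges
  the two darts of an internal edge and fixes the dart of each external edge; \<open>mark\<close> numbers the
  external edges \<open>0, \<dots>, n - 1\<close>.  External vertices are not represented explicitly.\<close>

record nc_diagram =
  darts :: "nat set"
  nxt :: "nat \<Rightarrow> nat"
  opp :: "nat \<Rightarrow> nat"
  mark :: "nat \<Rightarrow> nat"

definition ext_darts :: "nc_diagram \<Rightarrow> nat set" where
  "ext_darts G = {h \<in> darts G. opp G h = h}"

definition point_diagram :: "nat \<Rightarrow> nc_diagram \<Rightarrow> bool" where
  "point_diagram n G \<longleftrightarrow> finite (darts G) \<and> nxt G permutes darts G \<and> opp G permutes darts G \<and>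
     (\<forall>h. opp G (opp G h) = h) \<and> bij_betw (mark G) (ext_darts G) {..<n}"

definition vertices :: "nc_diagram \<Rightarrow> nat set set" where
  "vertices G = orbit (nxt G) ` darts G"

definition internal_edges :: "nc_diagram \<Rightarrow> nat set set" where
  "internal_edges G = {{h, opp G h} | h. h \<in> darts G - ext_darts G}"

definition loop_order :: "nc_diagram \<Rightarrow> int" where
  "loop_order G = 1 - int (card (vertices G)) + int (card (internal_edges G))"

definition connected_darts :: "nat set \<Rightarrow> (nat \<Rightarrow> nat) \<Rightarrow> (nat \<Rightarrow> nat) \<Rightarrow> bool" where
  "connected_darts H \<sigma> \<alpha> \<longleftrightarrow>
     (\<forall>h\<in>H. \<forall>h'\<in>H. (h, h') \<in> ({(x, \<sigma> x) | x. x \<in> H} \<union> {(x, \<alpha> x) | x. x \<in> H})\<^sup>*)"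

text \<open>Removing the internal edge of the dart \<open>h\<close> is done by making \<open>opp\<close> fix both of its darts, which
  keeps all internal vertices.\<close>

definition one_particle_irreducible :: "nc_diagram \<Rightarrow> bool" where
  "one_particle_irreducible G \<longleftrightarrow> (\<forall>h \<in> darts G - ext_darts G.
     connected_darts (darts G) (nxt G) ((opp G)(h := h, opp G h := opp G h)))"

text \<open>A face is followed by going to the next dart at the vertex and, if it belongs to an internal
  edge, crossing that edge.  A connected diagram can be drawn in the plane with all vertices
  clockwise and non-crossing edges iff its Euler characteristic is 2.\<close>

definition face_step :: "nc_diagram \<Rightarrow> nat \<Rightarrow> nat" where
  "face_step G h = opp G (nxt G h)"

definition faces :: "nc_diagram \<Rightarrow> nat set set" where
  "faces G = orbit (face_step G) ` darts G"

definition planar_clockwise :: "nc_diagram \<Rightarrow> bool" where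
  "planar_clockwise G \<longleftrightarrow> connected_darts (darts G) (nxt G) (opp G) \<and>
     int (card (vertices G)) - int (card (internal_edges G)) + int (card (faces G)) = 2"

text \<open>All external edges lie in one and the same face (in a planar one-loop diagram, the side of the
  loop which is taken to be the outside), and following that face one meets them in the cyclic order
  of their marks.\<close>

definition outside_cyclic :: "nat \<Rightarrow> nc_diagram \<Rightarrow> bool" where
  "outside_cyclic n G \<longleftrightarrow> (\<forall>h \<in> ext_darts G. \<exists>m>0.
     (face_step G ^^ m) h \<in> ext_darts G \<and> mark G ((face_step G ^^ m) h) = Suc (mark G h) mod n \<and>
     (\<forall>j. 0 < j \<and> j < m \<longrightarrow> (face_step G ^^ j) h \<notin> ext_darts G))"

definition one_loop_diagram :: "nat \<Rightarrow> nc_diagram \<Rightarrow> bool" where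
  "one_loop_diagram n G \<longleftrightarrow> point_diagram n G \<and> planar_clockwise G \<and> loop_order G = 1 \<and>
     one_particle_irreducible G \<and> (\<forall>v\<in>vertices G. card v \<ge> 3) \<and> outside_cyclic n G"

definition diagram_iso :: "nc_diagram \<Rightarrow> nc_diagram \<Rightarrow> bool" where
  "diagram_iso G G' \<longleftrightarrow> (\<exists>g. bij_betw g (darts G) (darts G') \<and>
     (\<forall>h\<in>darts G. g (nxt G h) = nxt G' (g h) \<and> g (opp G h) = opp G' (g h)) \<and>
     (\<forall>h\<in>ext_darts G. mark G' (g h) = mark G h))"


section \<open>Amplitudes and the one-loop bracket\<close>

definition cycle_from :: "(nat \<Rightarrow> nat) \<Rightarrow> nat \<Rightarrow> nat list" where
  "cycle_from \<sigma> h = map (\<lambda>k. (\<sigma> ^^ k) h) [0..<card (orbit \<sigma> h)]"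

text \<open>\<open>amplitude \<phi> lam f N \<sigma> H \<alpha> V z\<close>: the diagram with darts \<open>H\<close>, \<open>nxt = \<sigma>\<close> and \<open>opp = \<alpha>\<close> has
  amplitude \<open>z\<close> at level \<open>N\<close> when the operator \<open>V h\<close> is put at each external dart \<open>h\<close>.  The rules
  treat a single vertex, a disjoint union, and the connection of the external edges \<open>h\<close> and \<open>h'\<close>.\<close>

inductive amplitude ::
  "(nat \<Rightarrow> 'h :: hilbert_space) \<Rightarrow> (nat \<Rightarrow> real) \<Rightarrow> (real \<Rightarrow> real) \<Rightarrow> nat \<Rightarrow> (nat \<Rightarrow> nat) \<Rightarrow>
    nat set \<Rightarrow> (nat \<Rightarrow> nat) \<Rightarrow> (nat \<Rightarrow> 'h \<Rightarrow> 'h) \<Rightarrow> complex \<Rightarrow> bool"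
  for \<phi> lam f N \<sigma> where
  vertex: "amplitude \<phi> lam f N \<sigma> H \<alpha> V (bracket \<phi> lam f (map V (cycle_from \<sigma> h)))"
    if "h \<in> H" "H = orbit \<sigma> h" "\<forall>x\<in>H. \<alpha> x = x"
| union: "amplitude \<phi> lam f N \<sigma> (H1 \<union> H2) \<alpha> V (z1 * z2)"
    if "amplitude \<phi> lam f N \<sigma> H1 \<alpha> V z1" "amplitude \<phi> lam f N \<sigma> H2 \<alpha> V z2" "H1 \<inter> H2 = {}"
      "\<sigma> ` H1 \<subseteq> H1" "\<alpha> ` H1 \<subseteq> H1" "\<sigma> ` H2 \<subseteq> H2" "\<alpha> ` H2 \<subseteq> H2"
| connect: "amplitude \<phi> lam f N \<sigma> H (\<alpha>(h := h', h' := h)) V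
      (- (HK_integral \<phi> N (\<lambda>Q. F Q * exp (- bracket \<phi> lam f [Q, Q] / 2))
          / HK_integral \<phi> N (\<lambda>Q. exp (- bracket \<phi> lam f [Q, Q] / 2))))"
    if "h \<in> H" "h' \<in> H" "h \<noteq> h'" "\<alpha> h = h" "\<alpha> h' = h'"
      "\<forall>Q\<in>HK \<phi> N. amplitude \<phi> lam f N \<sigma> H \<alpha> (V(h := Q, h' := Q)) (F Q)"

definition Gamma_amp ::
  "(nat \<Rightarrow> 'h :: hilbert_space) \<Rightarrow> (nat \<Rightarrow> real) \<Rightarrow> (real \<Rightarrow> real) \<Rightarrow> nat \<Rightarrow>
    nc_diagram \<Rightarrow> ('h \<Rightarrow> 'h) list \<Rightarrow> complex" where
  "Gamma_amp \<phi> lam f N G Vs =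
     (THE z. amplitude \<phi> lam f N (nxt G) (darts G) (opp G) (\<lambda>h. Vs ! mark G h) z)"

text \<open>The sum runs over isomorphism classes of diagrams, each represented by one of its members.\<close>

definition one_loop_bracket ::
  "(nat \<Rightarrow> 'h :: hilbert_space) \<Rightarrow> (nat \<Rightarrow> real) \<Rightarrow> (real \<Rightarrow> real) \<Rightarrow> nat \<Rightarrow>
    ('h \<Rightarrow> 'h) list \<Rightarrow> complex" where
  "one_loop_bracket \<phi> lam f N Vs =
     (\<Sum>C \<in> {G. one_loop_diagram (length Vs) G} //
          {(G, G'). one_loop_diagram (length Vs) G \<and> one_loop_diagram (length Vs) G' \<and> diagram_iso G G'}.
        Gamma_amp \<phi> lam f N (SOME G. G \<in> C) Vs)"


section \<open>The cocycles\<close>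

definition one_form_op ::
  "('a :: star_algebra \<Rightarrow> 'h :: hilbert_space \<Rightarrow> 'h) \<Rightarrow> 'h set \<Rightarrow> ('h \<Rightarrow> 'h) \<Rightarrow> 'a \<Rightarrow> 'a \<Rightarrow> 'h \<Rightarrow> 'h" where
  "one_form_op \<pi> Dom D a b x = \<pi> a (comm Dom D (\<pi> b) x)"

text \<open>The one-forms \<open>a [D, b]\<close> do not couple the span of the first \<open>N\<close> basis vectors, on which the
  cut-off field \<open>Q\<close> lives, to its orthogonal complement.  This holds, for instance, if they all lie
  in \<open>MK \<phi> N\<close>, or if \<open>\<pi> a\<close> commutes with the projection onto that span for every \<open>a\<close>.  Without
  it the cut-off breaks the Ward identity of the one-loop bracket: take \<open>\<complex>1\<close> plus the operators in
  \<open>MK \<phi> 3\<close> as algebra, \<open>N = 1\<close>, pairwise distinct \<open>\<lambda>\<^sub>1, \<lambda>\<^sub>2, \<lambda>\<^sub>3\<close>, and let \<open>E\<^sub>i\<^sub>j\<close> be the matrix units; then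
  \<open>b \<phi>\<^sub>2 (E\<^sub>2\<^sub>2, E\<^sub>2\<^sub>1, E\<^sub>1\<^sub>3, E\<^sub>3\<^sub>2)\<close> is a nonzero multiple of \<open>f'[\<lambda>\<^sub>1, \<lambda>\<^sub>1, \<lambda>\<^sub>2, \<lambda>\<^sub>3]\<close>.\<close>

definition cutoff_compatible ::
  "('a :: star_algebra \<Rightarrow> 'h :: hilbert_space \<Rightarrow> 'h) \<Rightarrow> 'h set \<Rightarrow> ('h \<Rightarrow> 'h) \<Rightarrow> (nat \<Rightarrow> 'h) \<Rightarrow> nat \<Rightarrow> bool" where
  "cutoff_compatible \<pi> Dom D \<phi> N \<longleftrightarrow> (\<forall>a b i j. i < N \<longrightarrow> N \<le> j \<longrightarrow>
     entry \<phi> (one_form_op \<pi> Dom D a b) i j = 0 \<and> entry \<phi> (one_form_op \<pi> Dom D a b) j i = 0)"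

text \<open>\<open>pi_D\<close> is the linear extension of \<open>a db \<mapsto> a [D, b]\<close> on one-forms.  For a spectral triple its
  value does not depend on the representative, since \<open>[D, b]\<close> is linear in \<open>b\<close> and \<open>[D, 1] = 0\<close>.\<close>

definition pi_D ::
  "('a :: star_algebra \<Rightarrow> 'h :: hilbert_space \<Rightarrow> 'h) \<Rightarrow> 'h set \<Rightarrow> ('h \<Rightarrow> 'h) \<Rightarrow> 'a form \<Rightarrow> 'h \<Rightarrow> 'h" where
  "pi_D \<pi> Dom D A x =
     lext (\<lambda>(a, as). if length as = 1 then one_form_op \<pi> Dom D a (hd as) x else 0) (rep_form A)"

definition phi_N ::
  "('a :: star_algebra \<Rightarrow> 'h :: hilbert_space \<Rightarrow> 'h) \<Rightarrow> 'h set \<Rightarrow> ('h \<Rightarrow> 'h) \<Rightarrow> (nat \<Rightarrow> 'h) \<Rightarrow>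
    (nat \<Rightarrow> real) \<Rightarrow> (real \<Rightarrow> real) \<Rightarrow> nat \<Rightarrow> nat \<Rightarrow> 'a cochain" where
  "phi_N \<pi> Dom D \<phi> lam f N n as = one_loop_bracket \<phi> lam f N
     (one_form_op \<pi> Dom D (as ! 0) (as ! 1) # map (\<lambda>j. comm Dom D (\<pi> (as ! j))) [2..<n + 1])"

text \<open>\<open>psi_N \<dots> k\<close> and \<open>psi_tilde_N \<dots> k\<close> are the cochains of degree \<open>2 k - 1\<close>, for \<open>k \<ge> 1\<close>.\<close>

definition psi_N ::
  "('a :: star_algebra \<Rightarrow> 'h :: hilbert_space \<Rightarrow> 'h) \<Rightarrow> 'h set \<Rightarrow> ('h \<Rightarrow> 'h) \<Rightarrow> (nat \<Rightarrow> 'h) \<Rightarrow>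
    (nat \<Rightarrow> real) \<Rightarrow> (real \<Rightarrow> real) \<Rightarrow> nat \<Rightarrow> nat \<Rightarrow> 'a cochain" where
  "psi_N \<pi> Dom D \<phi> lam f N k as =
     phi_N \<pi> Dom D \<phi> lam f N (2 * k - 1) as - 1 / 2 * B0 (phi_N \<pi> Dom D \<phi> lam f N (2 * k)) as"

definition psi_tilde_N ::
  "('a :: star_algebra \<Rightarrow> 'h :: hilbert_space \<Rightarrow> 'h) \<Rightarrow> 'h set \<Rightarrow> ('h \<Rightarrow> 'h) \<Rightarrow> (nat \<Rightarrow> 'h) \<Rightarrow>
    (nat \<Rightarrow> real) \<Rightarrow> (real \<Rightarrow> real) \<Rightarrow> nat \<Rightarrow> nat \<Rightarrow> 'a cochain" where
  "psi_tilde_N \<pi> Dom D \<phi> lam f N k as =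
     (- 1) ^ (k - 1) * (fact (k - 1) / fact (2 * k - 1)) * psi_N \<pi> Dom D \<phi> lam f N k as"

end

theory Submission
  imports Defs "HOL-Probability.Distributions"
begin

text \<open>
  A planar one-loop one-particle-irreducible diagram with its external edges outside the loop is a circle
  of external edges, cut at a nonempty set of places into the vertices of the loop.  Gaussian integration
  over \<open>H\<^sub>N\<close> turns its amplitude into a sum over indices below \<open>N\<close>: one index for each external edge
  and one for the inside of the loop, a divided difference of \<open>f'\<close> for each vertex and
  \<open>- 1 / f'[\<lambda>\<^sub>k, \<lambda>\<^sub>i]\<close> for each cut.  Hence the one-loop bracket depends only on the blocks of size
  \<open>N\<close> of its arguments, it is cyclic, and as divided differences telescope it satisfies the Ward identity
  \<open>\<langle>\<langle>a V\<^sub>1, \<dots>, V\<^sub>n\<rangle>\<rangle> - \<langle>\<langle>V\<^sub>1, \<dots>, V\<^sub>n a\<rangle>\<rangle> = \<langle>\<langle>[D, a], V\<^sub>1, \<dots>, V\<^sub>n\<rangle>\<rangle>\<close>.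

  Cyclicity and the Ward identity say together that the linear extension \<open>T\<close> of
  \<open>a\<^sub>0 da\<^sub>1 \<cdots> da\<^sub>n \<mapsto> \<langle>\<langle>a\<^sub>0 [D, a\<^sub>1], [D, a\<^sub>2], \<dots>, [D, a\<^sub>n]\<rangle>\<rangle>\<close> is a trace for the Fedosov product
  \<open>\<omega> \<eta> + \<omega>\<^sub>o\<^sub>d\<^sub>d d\<eta>\<close> on forms.  The cocycle identities are instances of the trace property.  Moreover
  the bracket of \<open>n\<close> copies of \<open>\<pi>\<^sub>D(A)\<close> is the value of \<open>T\<close> at the \<open>n\<close>-th Fedosov power of \<open>A\<close>.
  In \<open>\<Sum>\<^sub>n A\<^sup>n / n\<close>, the words in \<open>dA\<close> and \<open>A\<^sup>2\<close> preceded by \<open>A\<close> add up to the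
  Chern--Simons forms, and the terms of even degree to the powers of the curvature after integration of
  \<open>d/dt T((t dA + t\<^sup>2 A\<^sup>2)\<^sup>k)\<close>, in which the trace property moves all factors to the front.
\<close>

section \<open>Divided differences of smooth functions\<close>

text \<open>Amplitudes and divided differences are given by definite descriptions, so both need
  existence and uniqueness before anything can be computed: \<open>amp_value\<close> provides this
  for amplitudes, the Hermite--Genocchi integral for divided differences. The Ward identity hinges
  on a cut carrying minus the inverse of the two-point function; with that constant the boundary
  terms of the telescoping cancel. A further obstacle is that all index sums stop at
  \<open>N\<close>, where truncated matrices of algebra elements need not multiply like the
  elements. They do so next to a one-form, which is a block by \<open>cutoff_compatible\<close>, and
  the identities are arranged accordingly. The correction in the Fedosov product mirrors the extra
  commutator in the Ward identity. The 1/2 in \<psi> comes from the transgression: half the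
  differential of the Chern--Simons form separates the even terms of the action from the powers of
  the curvature. The factorials follow from it: b sends \<psi> in degree 2k+1 to half of
  \<open>B0\<close> of \<phi> in degree 2k+3, while B sends \<psi> in degree 2k+3 to 2k+3 times the
  same cochain.\<close>

lemma smooth_deriv: "smooth g \<Longrightarrow> smooth (deriv g)"
  unfolding smooth_def by (metis funpow_swap1 comp_apply funpow.simps(2))

lemma smooth_has_derivative: "smooth g \<Longrightarrow> (g has_real_derivative deriv g x) (at x within S)"
  unfolding smooth_def
  by (metis DERIV_deriv_iff_real_differentiable funpow_0 has_field_derivative_at_within)

lemma smooth_continuous: "smooth g \<Longrightarrow> continuous_on S g"
  by (meson DERIV_continuous_on smooth_has_derivative)

text \<open>Lagrange form of the divided difference; being indexed by a set of nodes, it forgets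
  their order.\<close>

definition lagrange_sum :: "(real \<Rightarrow> real) \<Rightarrow> real set \<Rightarrow> real" where
  "lagrange_sum g S = (\<Sum>x\<in>S. g x / (\<Prod>y\<in>S - {x}. x - y))"

text \<open>Removing a node \<open>c\<close> multiplies the summand at \<open>x\<close> by
  \<open>x - c\<close>, which also lets the summand at \<open>c\<close> itself be kept as zero. The
  two factors \<open>x - b\<close> and \<open>x - a\<close> differ by the constant
  \<open>a - b\<close>.\<close>

lemma lagrange_sum_step:
  assumes "finite S" "a \<in> S" "b \<in> S" "a \<noteq> b"
  shows "lagrange_sum g (S - {b}) - lagrange_sum g (S - {a}) = (a - b) * lagrange_sum g S"
proof -
  have drop: "lagrange_sum g (S - {c}) = (\<Sum>x\<in>S. (x - c) * (g x / (\<Prod>y\<in>S - {x}. x - y)))" if "c \<in> S" for c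
  proof -
    have "lagrange_sum g (S - {c}) = (\<Sum>x\<in>S - {c}. (x - c) * (g x / (\<Prod>y\<in>S - {x}. x - y)))"
      unfolding lagrange_sum_def
    proof (rule sum.cong)
      fix x assume x: "x \<in> S - {c}"
      then have "(\<Prod>y\<in>S - {x}. x - y) = (x - c) * (\<Prod>y\<in>S - {x} - {c}. x - y)"
        using assms(1) that by (intro prod.remove) auto
      moreover have "S - {x} - {c} = S - {c} - {x}" by auto
      ultimately show "g x / (\<Prod>y\<in>S - {c} - {x}. x - y) = (x - c) * (g x / (\<Prod>y\<in>S - {x}. x - y))"
        using x by simp
    qed simp
    also have "\<dots> = (\<Sum>x\<in>S. (x - c) * (g x / (\<Prod>y\<in>S - {x}. x - y)))"
      using assms(1) by (intro sum.mono_neutral_left) auto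
    finally show ?thesis .
  qed
  show ?thesis
    unfolding drop[OF assms(3)] drop[OF assms(2)]
    unfolding lagrange_sum_def sum_subtractf[symmetric] sum_distrib_left
    by (rule sum.cong) (simp_all add: algebra_simps add_divide_distrib[symmetric])
qed

text \<open>Removing either of two nodes gives zero by induction, and their difference in
  \<open>lagrange_sum_step\<close> is nonzero. In the Hermite--Genocchi formula this identifies the
  coefficient of the value at the base point.\<close>

lemma lagrange_sum_const:
  assumes "finite S" "card S \<ge> 2"
  shows "lagrange_sum (\<lambda>_. 1) S = 0"
  using assms
proof (induction "card S" arbitrary: S rule: less_induct)
  case less
  obtain a b T where S: "S = insert a (insert b T)" "a \<noteq> b" "a \<notin> T" "b \<notin> T" "finite T"
    using less.prems
    by (metis card_2_iff' card_le_Suc_iff numeral_2_eq_2 finite_insert insertCI)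
  show ?case
  proof (cases "T = {}")
    case True
    then show ?thesis using S(2) S(2)[symmetric] by (auto simp: S(1) lagrange_sum_def insert_Diff_if divide_simps)
  next
    case False
    then have "card T \<ge> 1" using S by (simp add: Suc_leI card_gt_0_iff)
    moreover have "S - {b} = insert a T" "S - {a} = insert b T" using S by auto
    ultimately have "lagrange_sum (\<lambda>_. 1) (S - {b}) = 0" "lagrange_sum (\<lambda>_. 1) (S - {a}) = 0"
      using S less.hyps[of "insert a T"] less.hyps[of "insert b T"] by simp_all
    then show ?thesis using lagrange_sum_step[of S a b "\<lambda>_. 1"] S by simp
  qed
qed

text \<open>The recursion omits the last and the first argument, which is
  \<open>lagrange_sum_step\<close> for these two nodes.\<close>

lemma ddiff0_lagrange_sum: "distinct xs \<Longrightarrow> ddiff0 g xs = lagrange_sum g (set xs)"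
proof (induction g xs rule: ddiff0.induct)
  case (3 g x y zs)
  let ?S = "set (x # y # zs)" and ?b = "last (y # zs)"
  have b: "?b \<in> ?S" "x \<noteq> ?b" using "3.prems" by auto
  have bl: "set (butlast (x # y # zs)) = ?S - {?b}"
  proof -
    have "set us = set (us @ [c]) - {c}" if "distinct (us @ [c])" for us and c :: real
      using that by auto
    moreover have "butlast (x # y # zs) @ [?b] = x # y # zs"
      using append_butlast_last_id[of "x # y # zs"] by simp
    ultimately show ?thesis using "3.prems" by metis
  qed
  have tl: "set (y # zs) = ?S - {x}" using "3.prems" by auto
  have "ddiff0 g (butlast (x # y # zs)) = lagrange_sum g (?S - {?b})"
    using 3 bl distinct_butlast by metis
  moreover have "ddiff0 g (y # zs) = lagrange_sum g (?S - {x})" using 3 tl by auto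
  ultimately have "ddiff0 g (x # y # zs) = (lagrange_sum g (?S - {?b}) - lagrange_sum g (?S - {x})) / (x - ?b)"
    by simp
  also have "\<dots> = lagrange_sum g ?S"
    by (subst lagrange_sum_step) (use b in auto)
  finally show ?case .
qed (simp_all add: lagrange_sum_def)

text \<open>The Hermite--Genocchi formula, in a form that reduces the number of arguments by one.\<close>

fun hermite_genocchi :: "(real \<Rightarrow> real) \<Rightarrow> nat \<Rightarrow> (nat \<Rightarrow> real) \<Rightarrow> real" where
  "hermite_genocchi g 0 x = g (x 0)"
| "hermite_genocchi g (Suc n) x =
     integral {0..1} (\<lambda>t. t ^ n * hermite_genocchi (deriv g) n (\<lambda>i. x 0 + t * (x (Suc i) - x 0)))"

text \<open>The arguments form a point of a product space: continuity there turns coordinatewise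
  convergence of the nodes into convergence of values, and each recursion step is a parameter
  integral over a compact interval.\<close>

lemma continuous_hermite_genocchi:
  "smooth g \<Longrightarrow> continuous_on UNIV (hermite_genocchi g n)"
proof (induction n arbitrary: g)
  case 0
  have "continuous_on UNIV (\<lambda>x :: nat \<Rightarrow> real. g (x 0))"
    by (rule continuous_on_compose2[OF smooth_continuous[OF 0, of UNIV]])
       (auto intro!: continuous_on_product_then_coordinatewise continuous_on_id)
  then show ?case by (simp add: fun_eq_iff cong: continuous_on_cong)
next
  case (Suc n)
  have coord: "continuous_on UNIV (\<lambda>p :: (nat \<Rightarrow> real) \<times> real. fst p i)" for i
    by (rule continuous_on_product_then_coordinatewise) (intro continuous_intros)
  have "continuous_on UNIV (\<lambda>p :: (nat \<Rightarrow> real) \<times> real. \<lambda>i. fst p 0 + snd p * (fst p (Suc i) - fst p 0))"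
    by (intro continuous_on_coordinatewise_then_product continuous_intros coord)
  from continuous_on_compose2[OF Suc.IH[OF smooth_deriv[OF Suc.prems]] this]
  have "continuous_on UNIV (\<lambda>p :: (nat \<Rightarrow> real) \<times> real.
      snd p ^ n * hermite_genocchi (deriv g) n (\<lambda>i. fst p 0 + snd p * (fst p (Suc i) - fst p 0)))"
    by (intro continuous_intros) auto
  then have "continuous_on (UNIV \<times> cbox 0 1) (\<lambda>(x :: nat \<Rightarrow> real, t :: real).
      t ^ n * hermite_genocchi (deriv g) n (\<lambda>i. x 0 + t * (x (Suc i) - x 0)))"
    unfolding case_prod_unfold by (rule continuous_on_subset) simp
  from integral_continuous_on_param[OF this] show ?case by (simp cong: continuous_on_cong)
qed

lemma lagrange_sum_image:
  assumes "inj_on x I" "finite I"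
  shows "lagrange_sum g (x ` I) = (\<Sum>i\<in>I. g (x i) / (\<Prod>j\<in>I - {i}. x i - x j))"
  unfolding lagrange_sum_def
proof (subst sum.reindex[OF assms(1)], rule sum.cong)
  fix i assume i: "i \<in> I"
  have "x ` I - {x i} = x ` (I - {i})"
    using assms(1) i by (auto simp: inj_on_def)
  then have "(\<Prod>y\<in>x ` I - {x i}. x i - y) = (\<Prod>j\<in>I - {i}. x i - x j)"
    using assms(1) by (simp add: prod.reindex inj_on_diff)
  then show "((\<lambda>z. g z / (\<Prod>y\<in>x ` I - {z}. z - y)) \<circ> x) i = g (x i) / (\<Prod>j\<in>I - {i}. x i - x j)"
    by simp
qed simp

text \<open>For distinct nodes the induction hypothesis writes the integrand as a combination of
  values of \<open>deriv g\<close>, the power of \<open>t\<close> cancelling the \<open>n\<close>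
  rescaled differences in each denominator; the fundamental theorem of calculus then integrates
  every summand.\<close>

lemma hermite_genocchi_lagrange_sum:
  "smooth g \<Longrightarrow> inj_on x {..n} \<Longrightarrow> hermite_genocchi g n x = lagrange_sum g (x ` {..n})"
proof (induction n arbitrary: g x)
  case 0
  then show ?case by (simp add: lagrange_sum_def)
next
  case (Suc n)
  define y where "y i = x (Suc i)" for i
  define P where "P i = (\<Prod>j\<in>{..n} - {i}. y i - y j)" for i
  have inj: "inj_on y {..n}" using Suc.prems(2) by (auto simp: inj_on_def y_def)
  have ne: "y i \<noteq> x 0" if "i \<le> n" for i
    using Suc.prems(2) that unfolding y_def inj_on_def by (metis Suc_le_mono atMost_iff nat.distinct(1) zero_le)
  have set: "x ` {..Suc n} = insert (x 0) (y ` {..n})"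
    by (simp add: atMost_Suc_eq_insert_0 y_def image_image)
  have split: "lagrange_sum h (x ` {..Suc n}) =
      h (x 0) / (\<Prod>j\<le>n. x 0 - y j) + (\<Sum>i\<le>n. h (y i) / ((y i - x 0) * P i))" for h
  proof -
    have "lagrange_sum h (x ` {..Suc n}) = (\<Sum>i\<le>Suc n. h (x i) / (\<Prod>j\<in>{..Suc n} - {i}. x i - x j))"
      by (rule lagrange_sum_image) (use Suc.prems in auto)
    also have "\<dots> = h (x 0) / (\<Prod>j\<in>{..Suc n} - {0}. x 0 - x j)
        + (\<Sum>i\<le>n. h (x (Suc i)) / (\<Prod>j\<in>{..Suc n} - {Suc i}. x (Suc i) - x j))"
      by (simp only: sum.atMost_Suc_shift)
    also have "(\<Prod>j\<in>{..Suc n} - {0}. x 0 - x j) = (\<Prod>j\<le>n. x 0 - y j)"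
      by (simp add: atMost_Suc_eq_insert_0 y_def prod.reindex)
    also have "(\<Sum>i\<le>n. h (x (Suc i)) / (\<Prod>j\<in>{..Suc n} - {Suc i}. x (Suc i) - x j))
        = (\<Sum>i\<le>n. h (y i) / ((y i - x 0) * P i))"
    proof (rule sum.cong)
      fix i assume "i \<in> {..n}"
      have "{..Suc n} - {Suc i} = insert 0 (Suc ` ({..n} - {i}))"
        by (auto simp: atMost_Suc_eq_insert_0)
      then show "h (x (Suc i)) / (\<Prod>j\<in>{..Suc n} - {Suc i}. x (Suc i) - x j) = h (y i) / ((y i - x 0) * P i)"
        by (simp add: y_def P_def prod.reindex)
    qed simp
    finally show ?thesis .
  qed
  have integrand: "t ^ n * hermite_genocchi (deriv g) n (\<lambda>i. x 0 + t * (x (Suc i) - x 0))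
      = (\<Sum>i\<le>n. deriv g (x 0 + t * (y i - x 0)) / P i)" if "t \<noteq> 0" for t
  proof -
    have "inj_on (\<lambda>i. x 0 + t * (y i - x 0)) {..n}"
      using inj that by (auto simp: inj_on_def)
    then have "hermite_genocchi (deriv g) n (\<lambda>i. x 0 + t * (y i - x 0))
        = (\<Sum>i\<le>n. deriv g (x 0 + t * (y i - x 0)) / (\<Prod>j\<in>{..n} - {i}. t * (y i - y j)))"
      using Suc.IH[OF smooth_deriv[OF Suc.prems(1)]] by (simp add: lagrange_sum_image algebra_simps)
    also have "t ^ n * \<dots> = (\<Sum>i\<le>n. deriv g (x 0 + t * (y i - x 0)) / P i)"
      unfolding sum_distrib_left
      by (rule sum.cong) (use that in \<open>simp_all add: prod.distrib P_def\<close>)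
    finally show ?thesis by (simp add: y_def)
  qed
  have "((\<lambda>t. \<Sum>i\<le>n. deriv g (x 0 + t * (y i - x 0)) / P i) has_integral
      (\<Sum>i\<le>n. (g (y i) - g (x 0)) / (y i - x 0) / P i)) {0..1}"
  proof (intro has_integral_sum has_integral_divide)
    fix i assume i: "i \<in> {..n}"
    have "((\<lambda>t. g (x 0 + t * (y i - x 0)) / (y i - x 0)) has_real_derivative deriv g (x 0 + t * (y i - x 0)))
        (at t within {0..1})" for t
      using ne[of i] i
      by (auto intro!: derivative_eq_intros DERIV_chain2[OF smooth_has_derivative[OF Suc.prems(1)]])
    then show "((\<lambda>t. deriv g (x 0 + t * (y i - x 0))) has_integral (g (y i) - g (x 0)) / (y i - x 0)) {0..1}"
      using fundamental_theorem_of_calculus[of 0 1 "\<lambda>t. g (x 0 + t * (y i - x 0)) / (y i - x 0)"]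
      by (simp add: has_real_derivative_iff_has_vector_derivative diff_divide_distrib)
  qed simp
  \<comment> \<open>At \<open>t = 0\<close> all rescaled nodes coincide and \<open>integrand\<close>
    says nothing; one point does not affect the integral.\<close>
  then have "((\<lambda>t. t ^ n * hermite_genocchi (deriv g) n (\<lambda>i. x 0 + t * (x (Suc i) - x 0))) has_integral
      (\<Sum>i\<le>n. (g (y i) - g (x 0)) / (y i - x 0) / P i)) {0..1}"
    by (rule has_integral_spike_finite[of "{0}", rotated 2]) (simp_all add: integrand)
  then have "hermite_genocchi g (Suc n) x = (\<Sum>i\<le>n. (g (y i) - g (x 0)) / (y i - x 0) / P i)"
    by (simp add: integral_unique)
  also have "\<dots> = (\<Sum>i\<le>n. g (y i) / ((y i - x 0) * P i)) - g (x 0) * (\<Sum>i\<le>n. 1 / ((y i - x 0) * P i))"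
    by (simp add: sum_subtractf diff_divide_distrib sum_distrib_left)
  \<comment> \<open>The case of the constant function 1 in \<open>split\<close>, whose left side is
    zero.\<close>
  also have "(\<Sum>i\<le>n. 1 / ((y i - x 0) * P i)) = - (1 / (\<Prod>j\<le>n. x 0 - y j))"
    using split[of "\<lambda>_. 1"] lagrange_sum_const[of "x ` {..Suc n}"] Suc.prems(2)
    by (simp add: card_image eq_neg_iff_add_eq_0 add.commute)
  finally show ?case unfolding split by simp
qed

lemma distinct_approximation:
  fixes xs :: "real list"
  shows "\<exists>ys :: nat \<Rightarrow> real list. (\<forall>m. length (ys m) = length xs \<and> distinct (ys m)) \<and>
    (\<forall>i<length xs. (\<lambda>m. ys m ! i) \<longlonglongrightarrow> xs ! i)"
proof -
  let ?n = "length xs"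
  \<comment> \<open>\<open>B\<close> contains every step size at which two of the shifted arguments
    would collide; below \<open>e\<close> it has no positive member. The denominator
    \<open>m + 2\<close> keeps the step strictly below \<open>e\<close>.\<close>
  define B where "B = (\<lambda>(i, j). (xs ! j - xs ! i) / (real i - real j)) ` ({..<?n} \<times> {..<?n})"
  define e where "e = Min (insert 1 {b \<in> B. b > 0})"
  have fin: "finite B" by (simp add: B_def)
  then have e: "e > 0" unfolding e_def by (subst Min_gr_iff) auto
  have avoid: "b \<notin> B" if "0 < b" "b < e" for b
    using that fin unfolding e_def by (subst (asm) Min_gr_iff) auto
  define ys where "ys m = map (\<lambda>i. xs ! i + real i * (e / real (m + 2))) [0..<?n]" for m
  have "distinct (ys m)" for m
    unfolding ys_def distinct_map
  proof (intro conjI inj_onI)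
    fix i j assume ij: "i \<in> set [0..<?n]" "j \<in> set [0..<?n]"
      and eq: "xs ! i + real i * (e / real (m + 2)) = xs ! j + real j * (e / real (m + 2))"
    let ?d = "e / real (m + 2)"
    have d: "0 < ?d" "?d < e" using e by (auto simp: divide_simps)
    show "i = j"
    proof (rule ccontr)
      assume "i \<noteq> j"
      have "(real i - real j) * ?d = xs ! j - xs ! i" using eq by (simp only: left_diff_distrib)
      then have "?d = (xs ! j - xs ! i) / (real i - real j)" using \<open>i \<noteq> j\<close> by (simp add: nonzero_eq_divide_eq mult.commute)
      then have "?d \<in> B" using ij unfolding B_def by force
      with avoid d show False by blast
    qed
  qed simp
  moreover have "(\<lambda>m. ys m ! i) \<longlonglongrightarrow> xs ! i" if "i < ?n" for i
  proof -
    have "(\<lambda>m. e / real (m + 2)) \<longlonglongrightarrow> 0"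
      by (rule LIMSEQ_ignore_initial_segment[OF lim_const_over_n])
    then have "(\<lambda>m. xs ! i + real i * (e / real (m + 2))) \<longlonglongrightarrow> xs ! i + real i * 0"
      by (intro tendsto_intros)
    then show ?thesis using that by (simp add: ys_def)
  qed
  ultimately show ?thesis by (intro exI[of _ ys]) (simp add: ys_def)
qed

text \<open>On distinct tuples the divided difference is the Hermite--Genocchi integral, which is
  continuous at coinciding arguments too. So the limit required in \<open>ddiff\<close> exists, and
  it is unique because \<open>distinct_approximation\<close> supplies a sequence to compare
  along.\<close>

lemma tendsto_ddiff:
  assumes "smooth g" "\<And>m. length (ys m) = length xs" "\<And>m. distinct (ys m)"
    "\<And>i. i < length xs \<Longrightarrow> (\<lambda>m. ys m ! i) \<longlonglongrightarrow> xs ! i"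
  shows "(\<lambda>m. ddiff0 g (ys m)) \<longlonglongrightarrow> ddiff g xs"
proof -
  \<comment> \<open>Tuples are padded by zeros to points of the product space; only the first
    \<open>length xs\<close> coordinates enter the integral.\<close>
  define ev :: "real list \<Rightarrow> nat \<Rightarrow> real" where "ev zs i = (if i < length zs then zs ! i else 0)" for zs i
  define L where "L = (if xs = [] then 0 else hermite_genocchi g (length xs - 1) (ev xs))"
  have lim: "(\<lambda>m. ddiff0 g (zs m)) \<longlonglongrightarrow> L"
    if len: "\<And>m. length (zs m) = length xs" and dist: "\<And>m. distinct (zs m)"
      and conv: "\<And>i. i < length xs \<Longrightarrow> (\<lambda>m. zs m ! i) \<longlonglongrightarrow> xs ! i" for zs
  proof (cases "xs = []")
    case True
    then show ?thesis using len by (simp add: L_def)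
  next
    case False
    have eq: "ddiff0 g (zs m) = hermite_genocchi g (length xs - 1) (ev (zs m))" for m
    proof -
      have "inj_on (ev (zs m)) {..length xs - 1}"
        using False dist[of m] len[of m] by (auto simp: inj_on_def ev_def nth_eq_iff_index_eq)
      moreover have "ev (zs m) ` {..length xs - 1} = set (zs m)"
      proof -
        have "{..length xs - 1} = {..<length (zs m)}" using False len by (auto simp: less_Suc_eq_le[symmetric])
        then show ?thesis by (auto simp: ev_def set_conv_nth)
      qed
      ultimately show ?thesis
        using hermite_genocchi_lagrange_sum[OF assms(1)] ddiff0_lagrange_sum[OF dist] by simp
    qed
    have "limitin (product_topology (\<lambda>_. euclidean) UNIV) (\<lambda>m. ev (zs m)) (ev xs) sequentially"
      unfolding limitin_componentwise using len conv by (auto simp: ev_def)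
    then have "(\<lambda>m. ev (zs m)) \<longlonglongrightarrow> ev xs"
      by (simp add: euclidean_product_topology)
    from continuous_on_tendsto_compose[OF continuous_hermite_genocchi[OF assms(1)] this]
    show ?thesis using False by (simp add: eq L_def)
  qed
  obtain zs where ex: "(\<forall>m. length (zs m) = length xs \<and> distinct (zs m)) \<and>
      (\<forall>i<length xs. (\<lambda>m. zs m ! i) \<longlonglongrightarrow> xs ! i)"
    using distinct_approximation[of "xs"] by (rule exE)
  have zs: "length (zs m) = length xs" "distinct (zs m)" for m using ex by simp_all
  have conv: "(\<lambda>m. zs m ! i) \<longlonglongrightarrow> xs ! i" if "i < length xs" for i
    by (rule conjunct2[OF ex, rule_format, OF that])
  have "ddiff g xs = L"
    unfolding ddiff_def
  proof (rule the_equality)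
    show "\<forall>ys. (\<forall>m. length (ys m) = length xs \<and> distinct (ys m)) \<and>
      (\<forall>i<length xs. (\<lambda>m. ys m ! i) \<longlonglongrightarrow> xs ! i) \<longrightarrow> (\<lambda>m. ddiff0 g (ys m)) \<longlonglongrightarrow> L"
      by (intro allI impI lim) simp_all
    fix l
    assume l: "\<forall>ys. (\<forall>m. length (ys m) = length xs \<and> distinct (ys m)) \<and>
      (\<forall>i<length xs. (\<lambda>m. ys m ! i) \<longlonglongrightarrow> xs ! i) \<longrightarrow> (\<lambda>m. ddiff0 g (ys m)) \<longlonglongrightarrow> l"
    show "l = L" by (rule LIMSEQ_unique[OF mp[OF spec[OF l] ex] lim[OF zs conv]])
  qed
  then show ?thesis using lim[OF assms(2-4)] by simp
qed

text \<open>Lagrange sums depend only on the set of nodes, and this symmetry passes to the limit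
  along a permuted approximating sequence.\<close>

lemma ddiff_permute:
  assumes "smooth g" "mset xs = mset ys"
  shows "ddiff g xs = ddiff g ys"
proof -
  obtain p where p: "p permutes {..<length ys}" "permute_list p ys = xs"
    using mset_eq_permutation[OF assms(2)] by auto
  obtain zs where ex: "(\<forall>m. length (zs m) = length ys \<and> distinct (zs m)) \<and>
      (\<forall>i<length ys. (\<lambda>m. zs m ! i) \<longlonglongrightarrow> ys ! i)"
    using distinct_approximation[of "ys"] by (rule exE)
  have zs: "length (zs m) = length ys" "distinct (zs m)" for m using ex by simp_all
  have conv: "(\<lambda>m. zs m ! i) \<longlonglongrightarrow> ys ! i" if "i < length ys" for i
    by (rule conjunct2[OF ex, rule_format, OF that])
  have "(\<lambda>m. ddiff0 g (zs m)) \<longlonglongrightarrow> ddiff g ys" by (rule tendsto_ddiff[OF assms(1) zs conv])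
  moreover have "(\<lambda>m. ddiff0 g (permute_list p (zs m))) \<longlonglongrightarrow> ddiff g xs"
  proof (rule tendsto_ddiff[OF assms(1)])
    fix i assume "i < length xs"
    then show "(\<lambda>m. permute_list p (zs m) ! i) \<longlonglongrightarrow> xs ! i"
      using p zs(1) conv[of "p i"] permutes_in_image[OF p(1), of i]
      by (auto simp: permute_list_nth)
  qed (use p zs in auto)
  moreover have "ddiff0 g (permute_list p (zs m)) = ddiff0 g (zs m)" for m
    using zs p by (simp add: ddiff0_lagrange_sum)
  ultimately show ?thesis using LIMSEQ_unique by simp
qed

text \<open>The telescoping that drives the Ward identity. Written as a product, it survives the
  limit to coinciding arguments, where dividing by \<open>x - y\<close> would fail.\<close>

lemma ddiff_step:
  assumes "smooth g"
  shows "(x - y) * ddiff g (x # y # zs) = ddiff g (x # zs) - ddiff g (y # zs)"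
proof -
  obtain ws where ex: "(\<forall>m. length (ws m) = length (x # y # zs) \<and> distinct (ws m)) \<and>
      (\<forall>i<length (x # y # zs). (\<lambda>m. ws m ! i) \<longlonglongrightarrow> (x # y # zs) ! i)"
    using distinct_approximation[of "x # y # zs"] by (rule exE)
  have ws: "length (ws m) = length (x # y # zs)" "distinct (ws m)" for m using ex by simp_all
  have conv: "(\<lambda>m. ws m ! i) \<longlonglongrightarrow> (x # y # zs) ! i" if "i < length (x # y # zs)" for i
    by (rule conjunct2[OF ex, rule_format, OF that])
  define a b c where "a m = ws m ! 0" and "b m = ws m ! 1" and "c m = drop 2 (ws m)" for m
  have ws_eq: "ws m = a m # b m # c m" for m
    using ws(1)[of m] unfolding a_def b_def c_def by (cases "ws m"; cases "tl (ws m)") auto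
  have lenc: "length (c m) = length zs" for m using ws(1)[of m] by (simp add: c_def)
  have la: "a \<longlonglongrightarrow> x" and lb: "b \<longlonglongrightarrow> y" using conv[of 0] conv[of 1] by (simp_all add: a_def[abs_def] b_def[abs_def])
  have lc: "(\<lambda>m. c m ! i) \<longlonglongrightarrow> zs ! i" if "i < length zs" for i
    using conv[of "Suc (Suc i)"] that by (simp add: ws_eq)
  have dist: "distinct (a m # b m # c m)" for m using ws(2)[of m] by (simp add: ws_eq)
  have "(\<lambda>m. (a m - b m) * ddiff0 g (ws m)) \<longlonglongrightarrow> (x - y) * ddiff g (x # y # zs)"
    by (intro tendsto_intros la lb tendsto_ddiff[OF assms] ws conv)
  moreover have "(a m - b m) * ddiff0 g (ws m) = ddiff0 g (a m # c m) - ddiff0 g (b m # c m)" for m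
  proof -
    have "insert (a m) (insert (b m) (set (c m))) - {b m} = set (a m # c m)"
      "insert (a m) (insert (b m) (set (c m))) - {a m} = set (b m # c m)"
      using dist[of m] by auto
    moreover have "distinct (a m # c m)" "distinct (b m # c m)" using dist[of m] by auto
    ultimately show ?thesis
      using dist[of m] lagrange_sum_step[of "set (ws m)" "a m" "b m" g] ws(2)[of m]
      by (simp only: ddiff0_lagrange_sum) (simp add: ws_eq)
  qed
  moreover have "(\<lambda>m. ddiff0 g (a m # c m) - ddiff0 g (b m # c m)) \<longlonglongrightarrow> ddiff g (x # zs) - ddiff g (y # zs)"
    using la lb lc lenc dist by (intro tendsto_diff tendsto_ddiff[OF assms]) (auto simp: nth_Cons split: nat.splits)
  ultimately show ?thesis using LIMSEQ_unique by simp
qed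

section \<open>The one-loop diagrams with given cut points\<close>

abbreviation dart_graph :: "nat set \<Rightarrow> (nat \<Rightarrow> nat) \<Rightarrow> (nat \<Rightarrow> nat) \<Rightarrow> (nat \<times> nat) set" where
  "dart_graph H \<sigma> \<alpha> \<equiv> {(x, \<sigma> x) | x. x \<in> H} \<union> {(x, \<alpha> x) | x. x \<in> H}"

lemma permutes_imp_permutation: "finite H \<Longrightarrow> \<sigma> permutes H \<Longrightarrow> permutation \<sigma>"
  by (auto simp: permutation_permutes)

lemma orbit_rtrancl:
  assumes "y \<in> orbit \<sigma> x" "\<sigma> permutes H" "x \<in> H" "\<And>x. x \<in> H \<Longrightarrow> (x, \<sigma> x) \<in> R"
  shows "(x, y) \<in> R\<^sup>*"
  using assms(1)
proof induction
  case base
  then show ?case using assms by auto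
next
  case (step y)
  have "y \<in> H" using permutes_orbit_subset[OF assms(2,3)] step by auto
  then show ?case using step assms(4) by (meson rtrancl.rtrancl_into_rtrancl)
qed

text \<open>A permutation of a finite set returns to \<open>x\<close> from its successor after
  finitely many further steps, so every edge of the graph can be undone by a path.\<close>

lemma sym_dart_graph:
  assumes "finite H" "\<sigma> permutes H" "\<alpha> permutes H"
  shows "sym ((dart_graph H \<sigma> \<alpha>)\<^sup>*)"
proof -
  have converse: "(f x, x) \<in> R\<^sup>*" if "f permutes H" "x \<in> H" "\<And>x. x \<in> H \<Longrightarrow> (x, f x) \<in> R" for f R and x :: nat
  proof (rule orbit_rtrancl[OF _ that(1)])
    have "permutation f" using assms(1) that(1) by (rule permutes_imp_permutation)
    then show "x \<in> orbit f (f x)"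
      by (simp add: permutation_orbit_step permutation_self_in_orbit)
  qed (use that permutes_in_image in \<open>auto simp: permutes_in_image\<close>)
  have "(y, x) \<in> (dart_graph H \<sigma> \<alpha>)\<^sup>*" if "(x, y) \<in> (dart_graph H \<sigma> \<alpha>)\<^sup>*" for x y
    using that
  proof induction
    case (step y z)
    then have "(z, y) \<in> (dart_graph H \<sigma> \<alpha>)\<^sup>*"
      using converse[OF assms(2)] converse[OF assms(3)] by auto
    then show ?case using step.IH by (rule rtrancl_trans)
  qed simp
  then show ?thesis by (blast intro: symI)
qed

lemma connected_dartsI:
  assumes "finite H" "\<sigma> permutes H" "\<alpha> permutes H"
    and "\<And>h. h \<in> H \<Longrightarrow> (r, h) \<in> (dart_graph H \<sigma> \<alpha>)\<^sup>*"
  shows "connected_darts H \<sigma> \<alpha>"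
  unfolding connected_darts_def
proof (intro ballI)
  fix h h' assume "h \<in> H" "h' \<in> H"
  then show "(h, h') \<in> (dart_graph H \<sigma> \<alpha>)\<^sup>*"
    using assms(4) rtrancl_trans[OF symD[OF sym_dart_graph[OF assms(1-3)]]] by blast
qed

text \<open>The external edge \<open>m\<close> is attached to the same vertex as the external edge \<open>owner S m\<close>, the last
  point of \<open>S\<close> met when going back from \<open>m\<close> around the loop.\<close>

definition cpred :: "nat \<Rightarrow> nat \<Rightarrow> nat" where
  "cpred n m = (if m = 0 then n - 1 else m - 1)"

definition owner :: "nat set \<Rightarrow> nat \<Rightarrow> nat" where
  "owner S m = (if \<exists>s\<in>S. s \<le> m then Max {s \<in> S. s \<le> m} else Max S)"

definition csucc :: "nat \<Rightarrow> nat \<Rightarrow> nat" where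
  "csucc n m = (if Suc m = n then 0 else Suc m)"

text \<open>\<open>S\<close> is the set of those \<open>m\<close> for which the loop is entered between the external edges \<open>m - 1\<close>
  and \<open>m\<close>.  The dart of the external edge \<open>m\<close> is \<open>3 m\<close>; for \<open>m \<in> S\<close> the loop edge at this place has
  the darts \<open>3 m + 1\<close>, at the vertex of \<open>m\<close>, and \<open>3 m + 2\<close>, at the vertex of \<open>m - 1\<close>.\<close>

definition loop_darts :: "nat \<Rightarrow> nat set \<Rightarrow> nat set" where
  "loop_darts n S = (\<lambda>m. 3 * m) ` {..<n} \<union> (\<lambda>m. 3 * m + 1) ` S \<union> (\<lambda>m. 3 * m + 2) ` S"

text \<open>Clockwise at the vertex of the cut \<open>s\<close>: the incoming loop dart
  \<open>3 s + 1\<close>, the external darts from \<open>3 s\<close> up to the last one before the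
  next cut \<open>m\<close>, the outgoing loop dart \<open>3 m + 2\<close>, then again
  \<open>3 s + 1\<close>.\<close>

definition loop_nxt :: "nat \<Rightarrow> nat set \<Rightarrow> nat \<Rightarrow> nat" where
  "loop_nxt n S h = (if h \<notin> loop_darts n S then h
     else if h mod 3 = 0 then 3 * csucc n (h div 3) + (if csucc n (h div 3) \<in> S then 2 else 0)
     else if h mod 3 = 1 then h - 1
     else 3 * owner S (cpred n (h div 3)) + 1)"

definition loop_opp :: "nat \<Rightarrow> nat set \<Rightarrow> nat \<Rightarrow> nat" where
  "loop_opp n S h = (if h \<notin> loop_darts n S \<or> h mod 3 = 0 then h else if h mod 3 = 1 then h + 1 else h - 1)"

definition loop_diagram :: "nat \<Rightarrow> nat set \<Rightarrow> nc_diagram" where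
  "loop_diagram n S = \<lparr>darts = loop_darts n S, nxt = loop_nxt n S, opp = loop_opp n S, mark = (\<lambda>h. h div 3)\<rparr>"

locale cut_points =
  fixes n :: nat and S :: "nat set"
  assumes S_sub: "S \<subseteq> {..<n}" and S_ne: "S \<noteq> {}"
begin

lemma fin_S: "finite S"
  using S_sub finite_subset by blast

lemma S_less: "s \<in> S \<Longrightarrow> s < n"
  using S_sub by auto

lemma n_pos: "n > 0"
  using S_sub S_ne by auto

lemma owner_in: "owner S m \<in> S"
proof (cases "\<exists>s\<in>S. s \<le> m")
  case True
  then have "Max {s \<in> S. s \<le> m} \<in> {s \<in> S. s \<le> m}" using fin_S by (intro Max_in) auto
  then show ?thesis using True by (simp add: owner_def)
next
  case False
  then show ?thesis using fin_S S_ne by (simp add: owner_def)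
qed

lemma owner_le: "s \<in> S \<Longrightarrow> s \<le> m \<Longrightarrow> s \<le> owner S m \<and> owner S m \<le> m"
  unfolding owner_def using fin_S by (auto simp: Max_ge_iff intro!: Max.boundedI)

lemma owner_none: "\<not> (\<exists>s\<in>S. s \<le> m) \<Longrightarrow> owner S m = Max S"
  by (simp add: owner_def)

lemma owner_self: "m \<in> S \<Longrightarrow> owner S m = m"
  using owner_le[of m m] by auto

lemma owner_last: "owner S (n - 1) = Max S"
proof -
  have "{s \<in> S. s \<le> n - 1} = S" using S_less by fastforce
  then show ?thesis by (simp add: owner_def)
qed

lemma owner_csucc: "m < n \<Longrightarrow> csucc n m \<notin> S \<Longrightarrow> owner S (csucc n m) = owner S m"
proof (cases "Suc m = n")
  case True
  assume "csucc n m \<notin> S"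
  with True have "\<not> (\<exists>s\<in>S. s \<le> 0)" by (auto simp: csucc_def)
  moreover have "m = n - 1" using True by simp
  ultimately show ?thesis using True owner_last by (simp add: csucc_def owner_none)
next
  case False
  assume "csucc n m \<notin> S"
  then have "{s \<in> S. s \<le> Suc m} = {s \<in> S. s \<le> m}" using False by (auto simp: csucc_def le_Suc_eq)
  moreover from this have "(\<exists>s\<in>S. s \<le> Suc m) \<longleftrightarrow> (\<exists>s\<in>S. s \<le> m)" by auto
  ultimately show ?thesis using False by (simp add: csucc_def owner_def)
qed

lemma cpred_less: "m < n \<Longrightarrow> cpred n m < n"
  using n_pos by (auto simp: cpred_def)

lemma csucc_less: "m < n \<Longrightarrow> csucc n m < n"
  using n_pos by (auto simp: csucc_def)

lemma csucc_cpred: "m < n \<Longrightarrow> csucc n (cpred n m) = m"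
  by (auto simp: csucc_def cpred_def)

lemma cpred_csucc: "m < n \<Longrightarrow> cpred n (csucc n m) = m"
  by (auto simp: csucc_def cpred_def)

lemma csucc_inj: "m < n \<Longrightarrow> m' < n \<Longrightarrow> csucc n m = csucc n m' \<longleftrightarrow> m = m'"
  by (metis cpred_csucc)

text \<open>Going back from just before \<open>m\<close> stops at a cut that is at least
  \<open>m'\<close> and below \<open>m\<close>, while going back from just before \<open>m'\<close>
  stops below \<open>m'\<close> or wraps around to \<open>Max S\<close>, which is at least
  \<open>m\<close>. Hence outgoing loop darts belong to different vertices and
  \<open>loop_nxt\<close> is injective.\<close>

lemma owner_cpred_neq:
  assumes "m \<in> S" "m' \<in> S" "m' < m"
  shows "owner S (cpred n m) \<noteq> owner S (cpred n m')"
proof -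
  have "m' \<le> cpred n m" "cpred n m < m" using assms by (auto simp: cpred_def)
  with owner_le[OF assms(2)] have 1: "m' \<le> owner S (cpred n m)" "owner S (cpred n m) < m"
    by (auto intro: le_less_trans)
  have max: "m \<le> Max S" using assms fin_S by simp
  show ?thesis
  proof (cases "m' = 0")
    case True
    then show ?thesis using owner_last max 1(2) by (metis cpred_def leD)
  next
    case False
    then have "cpred n m' < m'" by (simp add: cpred_def)
    then show ?thesis
      using owner_le[of _ "cpred n m'"] owner_none[of "cpred n m'"] max 1
      by (metis le_less_trans less_irrefl not_le)
  qed
qed

lemma owner_cpred_inj: "m \<in> S \<Longrightarrow> m' \<in> S \<Longrightarrow> owner S (cpred n m) = owner S (cpred n m') \<longleftrightarrow> m = m'"
  using owner_cpred_neq by (metis linorder_neqE_nat)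

lemma mem_loop_darts [simp]:
  "3 * m \<in> loop_darts n S \<longleftrightarrow> m < n"
  "Suc (3 * m) \<in> loop_darts n S \<longleftrightarrow> m \<in> S"
  "Suc (Suc (3 * m)) \<in> loop_darts n S \<longleftrightarrow> m \<in> S"
proof -
  have mods: "3 * m \<noteq> Suc (3 * k)" "3 * m \<noteq> Suc (Suc (3 * k))" "Suc (3 * m) \<noteq> Suc (Suc (3 * k))"
    "Suc (3 * m) \<noteq> 3 * k" "Suc (Suc (3 * m)) \<noteq> Suc (3 * k)" "Suc (Suc (3 * m)) \<noteq> 3 * k" for k
    by presburger+
  show "3 * m \<in> loop_darts n S \<longleftrightarrow> m < n" "Suc (3 * m) \<in> loop_darts n S \<longleftrightarrow> m \<in> S"
    "Suc (Suc (3 * m)) \<in> loop_darts n S \<longleftrightarrow> m \<in> S"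
    using mods by (auto simp: loop_darts_def)
qed

lemma loop_dart_cases [consumes 1, case_names ext into out]:
  assumes "h \<in> loop_darts n S"
  obtains m where "h = 3 * m" "m < n" | m where "h = Suc (3 * m)" "m \<in> S" | m where "h = Suc (Suc (3 * m))" "m \<in> S"
  using assms by (auto simp: loop_darts_def)

lemma mod3 [simp]: "Suc (3 * m) mod 3 = 1" "Suc (Suc (3 * m)) mod 3 = 2"
  "Suc (3 * m) div 3 = m" "Suc (Suc (3 * m)) div 3 = m" for m :: nat
  by presburger+

lemma loop_nxt_simps [simp]:
  "m < n \<Longrightarrow> loop_nxt n S (3 * m) = (if csucc n m \<in> S then Suc (Suc (3 * csucc n m)) else 3 * csucc n m)"
  "m \<in> S \<Longrightarrow> loop_nxt n S (Suc (3 * m)) = 3 * m"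
  "m \<in> S \<Longrightarrow> loop_nxt n S (Suc (Suc (3 * m))) = Suc (3 * owner S (cpred n m))"
  by (simp_all add: loop_nxt_def)

lemma loop_opp_simps [simp]:
  "loop_opp n S (3 * m) = 3 * m"
  "m \<in> S \<Longrightarrow> loop_opp n S (Suc (3 * m)) = Suc (Suc (3 * m))"
  "m \<in> S \<Longrightarrow> loop_opp n S (Suc (Suc (3 * m))) = Suc (3 * m)"
  by (simp_all add: loop_opp_def)

lemma finite_loop_darts [simp]: "finite (loop_darts n S)"
  by (simp add: loop_darts_def fin_S)

lemma mod3_neq [simp]:
  "3 * m \<noteq> Suc (3 * k)" "3 * m \<noteq> Suc (Suc (3 * k))" "Suc (3 * m) \<noteq> Suc (Suc (3 * k))"
  "Suc (3 * m) \<noteq> 3 * k" "Suc (Suc (3 * m)) \<noteq> Suc (3 * k)" "Suc (Suc (3 * m)) \<noteq> 3 * k" for m k :: nat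
  by presburger+

section \<open>Vertices and internal edges of the loop diagrams\<close>

lemma loop_nxt_permutes: "loop_nxt n S permutes loop_darts n S"
proof -
  have "loop_nxt n S ` loop_darts n S \<subseteq> loop_darts n S"
    by (auto elim!: loop_dart_cases simp: owner_in S_less csucc_less)
  moreover have "inj_on (loop_nxt n S) (loop_darts n S)"
  proof (rule inj_onI)
    fix x y assume x: "x \<in> loop_darts n S" and y: "y \<in> loop_darts n S" and eq: "loop_nxt n S x = loop_nxt n S y"
    from x y eq show "x = y"
      by (elim loop_dart_cases)
         (auto simp: owner_in S_less csucc_less csucc_inj owner_cpred_inj split: if_splits)
  qed
  ultimately have "bij_betw (loop_nxt n S) (loop_darts n S) (loop_darts n S)"
    by (simp add: bij_betw_def endo_inj_surj)
  then show ?thesis by (rule bij_imp_permutes) (simp add: loop_nxt_def)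
qed

lemma loop_opp_opp: "loop_opp n S (loop_opp n S h) = h"
proof (cases "h \<in> loop_darts n S")
  case True
  then show ?thesis by (cases rule: loop_dart_cases) simp_all
qed (simp add: loop_opp_def)

lemma loop_opp_permutes: "loop_opp n S permutes loop_darts n S"
proof -
  have "loop_opp n S ` loop_darts n S \<subseteq> loop_darts n S"
    by (auto elim!: loop_dart_cases)
  moreover have "inj_on (loop_opp n S) (loop_darts n S)"
    by (metis inj_onI loop_opp_opp)
  ultimately have "bij_betw (loop_opp n S) (loop_darts n S) (loop_darts n S)"
    by (simp add: bij_betw_def endo_inj_surj)
  then show ?thesis by (rule bij_imp_permutes) (simp add: loop_opp_def)
qed

lemma ext_darts_loop: "ext_darts (loop_diagram n S) = (\<lambda>m. 3 * m) ` {..<n}"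
  by (auto simp: ext_darts_def loop_diagram_def elim!: loop_dart_cases)

lemma point_diagram_loop: "point_diagram n (loop_diagram n S)"
  unfolding point_diagram_def ext_darts_loop
  by (auto simp: loop_diagram_def loop_nxt_permutes loop_opp_permutes loop_opp_opp
      intro!: bij_betwI[where g = "\<lambda>m. 3 * m"])

text \<open>An invariant of \<open>loop_nxt\<close> that names a vertex by the cut at which the loop
  enters it; \<open>orbit_loop_nxt\<close> shows that it separates the orbits.\<close>

definition vertex_of :: "nat \<Rightarrow> nat" where
  "vertex_of h = (if h mod 3 = 0 then owner S (h div 3) else if h mod 3 = 1 then h div 3
     else owner S (cpred n (h div 3)))"

lemma vertex_of_simps [simp]:
  "vertex_of (3 * m) = owner S m" "vertex_of (Suc (3 * m)) = m"
  "vertex_of (Suc (Suc (3 * m))) = owner S (cpred n m)"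
  by (simp_all add: vertex_of_def)

lemma vertex_of_in: "h \<in> loop_darts n S \<Longrightarrow> vertex_of h \<in> S"
  by (auto elim!: loop_dart_cases simp: owner_in)

lemma vertex_of_nxt: "h \<in> loop_darts n S \<Longrightarrow> vertex_of (loop_nxt n S h) = vertex_of h"
  by (auto elim!: loop_dart_cases simp: owner_self owner_csucc cpred_csucc)

text \<open>Walking up from a cut reaches all external darts that have a cut at or before them. The
  last edge \<open>n - 1\<close> is one of these, so the walk continues past it to 0 and covers the
  edges before the first cut.\<close>

lemma ext_in_orbit: "m < n \<Longrightarrow> 3 * m \<in> orbit (loop_nxt n S) (Suc (3 * owner S m))"
proof -
  have self: "3 * m \<in> orbit (loop_nxt n S) (Suc (3 * owner S m))" if "m \<in> S" for m
    using orbit.base[of "loop_nxt n S" "Suc (3 * m)"] that by (simp add: owner_self)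
  have step: "3 * csucc n m \<in> orbit (loop_nxt n S) (Suc (3 * owner S (csucc n m)))"
    if "3 * m \<in> orbit (loop_nxt n S) (Suc (3 * owner S m))" "m < n" for m
    using self[of "csucc n m"] orbit.step[OF that(1)] that(2)
    by (cases "csucc n m \<in> S") (simp_all add: owner_csucc)
  have 1: "m < n \<Longrightarrow> \<exists>s\<in>S. s \<le> m \<Longrightarrow> 3 * m \<in> orbit (loop_nxt n S) (Suc (3 * owner S m))" for m
  proof (induction m)
    case 0
    then show ?case using self[of 0] by simp
  next
    case (Suc m)
    show ?case
    proof (cases "Suc m \<in> S")
      case True
      then show ?thesis by (rule self)
    next
      case False
      then have "\<exists>s\<in>S. s \<le> m" using Suc.prems by (auto simp: le_Suc_eq)
      then show ?thesis using step[of m] Suc by (simp add: csucc_def)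
    qed
  qed
  have last: "\<exists>s\<in>S. s \<le> n - 1" using S_less S_ne by fastforce
  show "m < n \<Longrightarrow> 3 * m \<in> orbit (loop_nxt n S) (Suc (3 * owner S m))"
  proof (induction m)
    case 0
    then show ?case using step[of "n - 1"] 1[of "n - 1"] last n_pos by (simp add: csucc_def)
  next
    case (Suc m)
    then show ?case using step[of m] by (simp add: csucc_def)
  qed
qed

lemma in_orbit_vertex_of:
  assumes "h \<in> loop_darts n S"
  shows "h \<in> orbit (loop_nxt n S) (Suc (3 * vertex_of h))"
  using assms
proof (cases rule: loop_dart_cases)
  case (ext m)
  then show ?thesis using ext_in_orbit by simp
next
  case (into m)
  then show ?thesis
    using permutes_imp_permutation[OF finite_loop_darts loop_nxt_permutes] permutation_self_in_orbit by simp
next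
  case (out m)
  then show ?thesis
    using orbit.step[OF ext_in_orbit[OF cpred_less[OF S_less[of m]]]]
    by (simp add: csucc_cpred cpred_less S_less)
qed

lemma orbit_loop_nxt:
  assumes "s \<in> S"
  shows "orbit (loop_nxt n S) (Suc (3 * s)) = {h \<in> loop_darts n S. vertex_of h = s}"
proof
  show "orbit (loop_nxt n S) (Suc (3 * s)) \<subseteq> {h \<in> loop_darts n S. vertex_of h = s}"
  proof
    fix h assume "h \<in> orbit (loop_nxt n S) (Suc (3 * s))"
    then show "h \<in> {h \<in> loop_darts n S. vertex_of h = s}"
    proof induction
      case base
      then show ?case using assms by (simp add: S_less owner_self)
    next
      case (step y)
      then show ?case using vertex_of_nxt permutes_in_image[OF loop_nxt_permutes] by simp
    qed
  qed
qed (use in_orbit_vertex_of in auto)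

lemma vertices_loop: "vertices (loop_diagram n S) = (\<lambda>s. {h \<in> loop_darts n S. vertex_of h = s}) ` S"
proof -
  have "orbit (loop_nxt n S) h = {h' \<in> loop_darts n S. vertex_of h' = vertex_of h}" if "h \<in> loop_darts n S" for h
    using orbit_cyclic_eq3[OF cyclic_on_orbit[OF loop_nxt_permutes finite_loop_darts] in_orbit_vertex_of[OF that]]
      orbit_loop_nxt[OF vertex_of_in[OF that]] by simp
  then have "vertices (loop_diagram n S) = (\<lambda>h. {h' \<in> loop_darts n S. vertex_of h' = vertex_of h}) ` loop_darts n S"
    by (simp add: vertices_def loop_diagram_def)
  also have "\<dots> = (\<lambda>s. {h \<in> loop_darts n S. vertex_of h = s}) ` (vertex_of ` loop_darts n S)"
    by (simp add: image_image)
  also have "vertex_of ` loop_darts n S = S"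
  proof
    show "S \<subseteq> vertex_of ` loop_darts n S"
    proof
      fix s assume "s \<in> S"
      then have "Suc (3 * s) \<in> loop_darts n S" "vertex_of (Suc (3 * s)) = s" by simp_all
      then show "s \<in> vertex_of ` loop_darts n S" by (metis image_eqI)
    qed
  qed (use vertex_of_in in auto)
  finally show ?thesis .
qed

lemma inj_loop_vertex: "inj_on (\<lambda>s. {h \<in> loop_darts n S. vertex_of h = s}) S"
proof (rule inj_onI)
  fix s t assume s: "s \<in> S" and eq: "{h \<in> loop_darts n S. vertex_of h = s} = {h \<in> loop_darts n S. vertex_of h = t}"
  have "Suc (3 * s) \<in> {h \<in> loop_darts n S. vertex_of h = s}" using s by simp
  then show "s = t" unfolding eq by simp
qed

lemma card_vertices_loop: "card (vertices (loop_diagram n S)) = card S"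
  by (simp add: vertices_loop card_image inj_loop_vertex)

text \<open>The vertex of \<open>s\<close> contains the external dart \<open>3 s\<close>, the
  incoming loop dart, and the dart preceding the incoming one, which is an outgoing loop
  dart.\<close>

lemma loop_vertex_degree: "v \<in> vertices (loop_diagram n S) \<Longrightarrow> card v \<ge> 3"
proof -
  assume "v \<in> vertices (loop_diagram n S)"
  then obtain s where s: "s \<in> S" and v: "v = {h \<in> loop_darts n S. vertex_of h = s}"
    by (auto simp: vertices_loop)
  obtain h where h: "h \<in> loop_darts n S" "loop_nxt n S h = Suc (3 * s)"
    using permutes_surj[OF loop_nxt_permutes] permutes_in_image[OF loop_nxt_permutes] s mem_loop_darts(2)
    by (metis surjD)
  then obtain m where m: "h = Suc (Suc (3 * m))"
    by (auto elim!: loop_dart_cases split: if_splits)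
  have "{3 * s, Suc (3 * s), h} \<subseteq> v"
    using s h vertex_of_nxt[OF h(1)] by (auto simp: v S_less owner_self)
  moreover have "finite v" by (simp add: v)
  moreover have "card {3 * s, Suc (3 * s), h} = 3" by (simp add: m)
  ultimately show ?thesis using card_mono by metis
qed

lemma internal_edges_loop: "internal_edges (loop_diagram n S) = (\<lambda>m. {Suc (3 * m), Suc (Suc (3 * m))}) ` S"
proof -
  have "internal_edges (loop_diagram n S)
      = (\<lambda>h. {h, loop_opp n S h}) ` (loop_darts n S - (\<lambda>m. 3 * m) ` {..<n})"
    unfolding internal_edges_def ext_darts_loop by (auto simp: loop_diagram_def)
  also have "loop_darts n S - (\<lambda>m. 3 * m) ` {..<n} = (\<lambda>m. Suc (3 * m)) ` S \<union> (\<lambda>m. Suc (Suc (3 * m))) ` S"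
    by (auto simp: loop_darts_def)
  finally show ?thesis by (auto simp: image_Un image_image insert_commute)
qed

lemma card_internal_edges_loop: "card (internal_edges (loop_diagram n S)) = card S"
  unfolding internal_edges_loop by (rule card_image) (auto simp: inj_on_def doubleton_eq_iff)

lemma loop_order_loop: "loop_order (loop_diagram n S) = 1"
  by (simp add: loop_order_def card_vertices_loop card_internal_edges_loop)

text \<open>The first two rules stay among external and incoming darts and trace the outside of the
  loop; the third stays among outgoing darts and traces its inside.\<close>

lemma face_step_loop [simp]:
  "m < n \<Longrightarrow> face_step (loop_diagram n S) (3 * m)
    = (if csucc n m \<in> S then Suc (3 * csucc n m) else 3 * csucc n m)"
  "m \<in> S \<Longrightarrow> face_step (loop_diagram n S) (Suc (3 * m)) = 3 * m"
  "m \<in> S \<Longrightarrow> face_step (loop_diagram n S) (Suc (Suc (3 * m))) = Suc (Suc (3 * owner S (cpred n m)))"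
  by (simp_all add: face_step_def loop_diagram_def owner_in)

lemma face_step_permutes: "face_step (loop_diagram n S) permutes loop_darts n S"
  unfolding face_step_def loop_diagram_def
  using permutes_compose[OF loop_nxt_permutes loop_opp_permutes] by (simp add: comp_def)

lemma face_orbit_self: "h \<in> orbit (face_step (loop_diagram n S)) h"
  by (intro permutation_self_in_orbit permutes_imp_permutation[OF finite_loop_darts face_step_permutes])

lemma outer_face: "m < n \<Longrightarrow> 3 * m \<in> orbit (face_step (loop_diagram n S)) 0"
proof (induction m)
  case 0
  then show ?case using face_orbit_self[of 0] by simp
next
  case (Suc m)
  then have m: "m < n" "3 * m \<in> orbit (face_step (loop_diagram n S)) 0" by simp_all
  have "3 * csucc n m \<in> orbit (face_step (loop_diagram n S)) 0"
    using orbit.step[OF m(2)] orbit.step[OF orbit.step[OF m(2)]] m(1)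
    by (cases "csucc n m \<in> S") simp_all
  moreover have "csucc n m = Suc m" using Suc.prems by (simp add: csucc_def)
  ultimately show ?case by (simp only:)
qed

lemma outer_face_into: "m \<in> S \<Longrightarrow> Suc (3 * m) \<in> orbit (face_step (loop_diagram n S)) 0"
  using orbit.step[OF outer_face[OF cpred_less[OF S_less[of m]]]]
  by (simp add: csucc_cpred cpred_less S_less)

text \<open>Each face step leads from an outgoing dart to that of an earlier cut until the smallest
  cut is reached, so the inside of the loop is a single face.\<close>

lemma inner_face:
  "m \<in> S \<Longrightarrow> Suc (Suc (3 * Min S)) \<in> orbit (face_step (loop_diagram n S)) (Suc (Suc (3 * m)))"
proof (induction m rule: less_induct)
  case (less m)
  show ?case
  proof (cases "m = Min S")
    case True
    then show ?thesis using face_orbit_self by simp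
  next
    case False
    then have lt: "Min S < m" using less.prems fin_S by (simp add: order_neq_le_trans)
    moreover have "Min S \<in> S" using fin_S S_ne by simp
    ultimately have "owner S (cpred n m) \<le> cpred n m" "cpred n m < m"
      using owner_le[of "Min S" "cpred n m"] by (auto simp: cpred_def)
    then have "Suc (Suc (3 * Min S)) \<in> orbit (face_step (loop_diagram n S)) (Suc (Suc (3 * owner S (cpred n m))))"
      using less.IH owner_in by simp
    then show ?thesis
      using orbit_subset[of _ "face_step (loop_diagram n S)" "Suc (Suc (3 * m))"] less.prems by simp
  qed
qed

lemma card_faces_loop: "card (faces (loop_diagram n S)) = 2"
proof -
  let ?F = "face_step (loop_diagram n S)" and ?i = "Suc (Suc (3 * Min S))"
  have Min: "Min S \<in> S" using fin_S S_ne by simp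
  have cyc: "cyclic_on ?F (orbit ?F h)" for h
    by (rule cyclic_on_orbit[OF face_step_permutes finite_loop_darts])
  have "orbit ?F h = orbit ?F 0 \<or> orbit ?F h = orbit ?F ?i" if "h \<in> loop_darts n S" for h
    using that
  proof (cases rule: loop_dart_cases)
    case (ext m)
    then show ?thesis using orbit_cyclic_eq3[OF cyc outer_face] by blast
  next
    case (into m)
    then show ?thesis using orbit_cyclic_eq3[OF cyc outer_face_into] by blast
  next
    case (out m)
    then show ?thesis using orbit_cyclic_eq3[OF cyc inner_face[of m]] by simp
  qed
  moreover have "0 \<in> loop_darts n S" "?i \<in> loop_darts n S"
    using mem_loop_darts(1)[of 0] n_pos Min by simp_all
  ultimately have "faces (loop_diagram n S) = {orbit ?F 0, orbit ?F ?i}"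
    by (auto simp: faces_def loop_diagram_def)
  \<comment> \<open>The residue 2 modulo 3 is preserved along the inner face, and 0 does not have
    it.\<close>
  moreover have "0 \<notin> orbit ?F ?i"
  proof -
    have "h mod 3 = 2 \<and> h \<in> loop_darts n S" if "h \<in> orbit ?F ?i" for h
      using that
    proof induction
      case base
      then show ?case using Min by (simp add: owner_in)
    next
      case (step h)
      then obtain m where "h = Suc (Suc (3 * m))" "m \<in> S" by (auto elim!: loop_dart_cases)
      then show ?case by (simp add: owner_in)
    qed
    then show ?thesis by force
  qed
  moreover have "0 \<in> orbit ?F 0" by (rule face_orbit_self)
  ultimately show ?thesis by (auto simp: card_2_iff)
qed

text \<open>One walk serves both connectedness and irreducibility: starting at the external edge
  \<open>s\<close>, it follows the external edges once around without crossing the loop edge at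
  \<open>s\<close>, so it works whether or not \<alpha> still joins the two darts of that
  edge.\<close>

lemma connected_without:
  assumes s: "s \<in> S" and opp: "\<alpha> permutes loop_darts n S"
    and eq: "\<And>m. m \<in> S \<Longrightarrow> m \<noteq> s \<Longrightarrow> \<alpha> (Suc (Suc (3 * m))) = Suc (3 * m)"
  shows "connected_darts (loop_darts n S) (loop_nxt n S) \<alpha>"
proof (rule connected_dartsI[OF finite_loop_darts loop_nxt_permutes opp])
  let ?R = "dart_graph (loop_darts n S) (loop_nxt n S) \<alpha>"
  have nxt: "(h, loop_nxt n S h) \<in> ?R" and opp: "(h, \<alpha> h) \<in> ?R" if "h \<in> loop_darts n S" for h
    using that by auto
  have step: "(3 * m, 3 * csucc n m) \<in> ?R\<^sup>*" if "m < n" "csucc n m \<noteq> s" for m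
  proof (cases "csucc n m \<in> S")
    case True
    have "(3 * m, Suc (Suc (3 * csucc n m))) \<in> ?R" using nxt[of "3 * m"] that True by simp
    moreover have "(Suc (Suc (3 * csucc n m)), Suc (3 * csucc n m)) \<in> ?R"
      using opp[of "Suc (Suc (3 * csucc n m))"] that True eq by simp
    moreover have "(Suc (3 * csucc n m), 3 * csucc n m) \<in> ?R"
      using nxt[of "Suc (3 * csucc n m)"] True by simp
    ultimately show ?thesis by (meson rtrancl.rtrancl_refl rtrancl.rtrancl_into_rtrancl)
  next
    case False
    then show ?thesis using nxt[of "3 * m"] that by auto
  qed
  have up: "s + d < n \<Longrightarrow> (3 * s, 3 * (s + d)) \<in> ?R\<^sup>*" for d
  proof (induction d)
    case (Suc d)
    have "(3 * (s + d), 3 * csucc n (s + d)) \<in> ?R\<^sup>*"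
      using Suc.prems by (intro step) (auto simp: csucc_def)
    then show ?case using Suc by (simp add: csucc_def split: if_splits)
  qed simp
  have low: "m < s \<Longrightarrow> (3 * s, 3 * m) \<in> ?R\<^sup>*" for m
  proof (induction m)
    case 0
    have "(3 * s, 3 * (n - 1)) \<in> ?R\<^sup>*" using up[of "n - 1 - s"] S_less[OF s] by simp
    moreover have "(3 * (n - 1), 3 * csucc n (n - 1)) \<in> ?R\<^sup>*"
      using 0 n_pos by (intro step) (auto simp: csucc_def)
    ultimately show ?case using n_pos by (simp add: csucc_def)
  next
    case (Suc m)
    have "(3 * m, 3 * csucc n m) \<in> ?R\<^sup>*"
      using Suc.prems S_less[OF s] by (intro step) (auto simp: csucc_def)
    moreover have "csucc n m = Suc m" using Suc.prems S_less[OF s] by (simp add: csucc_def)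
    ultimately show ?case using Suc by simp
  qed
  have ext: "(3 * s, 3 * m) \<in> ?R\<^sup>*" if "m < n" for m
    using up[of "m - s"] low[of m] that by (cases "m < s") simp_all
  have out: "(3 * s, Suc (Suc (3 * m))) \<in> ?R\<^sup>*" if "m \<in> S" for m
    using ext[OF cpred_less[OF S_less[OF that]]] nxt[of "3 * cpred n m"] that
    by (simp add: csucc_cpred cpred_less S_less rtrancl.rtrancl_into_rtrancl)
  fix h assume "h \<in> loop_darts n S"
  then show "(3 * s, h) \<in> ?R\<^sup>*"
  proof (cases rule: loop_dart_cases)
    case (into m)
    obtain x where x: "x \<in> loop_darts n S" "loop_nxt n S x = Suc (3 * m)"
      using permutes_surj[OF loop_nxt_permutes] permutes_in_image[OF loop_nxt_permutes] into mem_loop_darts(2)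
      by (metis surjD)
    then obtain k where k: "x = Suc (Suc (3 * k))" "k \<in> S"
      by (auto elim!: loop_dart_cases split: if_splits)
    show ?thesis using rtrancl_into_rtrancl[OF out[OF k(2)] nxt[OF x(1)[unfolded k(1)]]] x k into by simp
  qed (use ext out in auto)
qed

lemma planar_loop: "planar_clockwise (loop_diagram n S)"
proof -
  obtain s where "s \<in> S" using S_ne by auto
  then have "connected_darts (loop_darts n S) (loop_nxt n S) (loop_opp n S)"
    by (rule connected_without[OF _ loop_opp_permutes]) simp
  then show ?thesis
    by (simp add: planar_clockwise_def card_faces_loop card_vertices_loop card_internal_edges_loop)
       (simp add: loop_diagram_def)
qed

lemma irreducible_loop: "one_particle_irreducible (loop_diagram n S)"
  unfolding one_particle_irreducible_def
proof
  fix h assume "h \<in> darts (loop_diagram n S) - ext_darts (loop_diagram n S)"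
  then obtain s where s: "s \<in> S" and h: "h = Suc (3 * s) \<or> h = Suc (Suc (3 * s))"
    unfolding ext_darts_loop by (auto simp: loop_diagram_def elim!: loop_dart_cases)
  let ?\<alpha> = "(loop_opp n S)(h := h, loop_opp n S h := loop_opp n S h)"
  have \<alpha>: "?\<alpha> = (loop_opp n S)(Suc (3 * s) := Suc (3 * s), Suc (Suc (3 * s)) := Suc (Suc (3 * s)))"
    using h s by (auto simp: fun_eq_iff)
  have inv: "?\<alpha> (?\<alpha> x) = x" for x
    unfolding \<alpha> using loop_opp_opp[of x] s by auto
  have "?\<alpha> ` loop_darts n S \<subseteq> loop_darts n S"
    unfolding \<alpha> using permutes_in_image[OF loop_opp_permutes] s by auto
  moreover have "inj_on ?\<alpha> (loop_darts n S)"
    by (rule inj_on_inverseI[of _ ?\<alpha>]) (rule inv)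
  ultimately have "bij_betw ?\<alpha> (loop_darts n S) (loop_darts n S)"
    by (simp only: bij_betw_def endo_inj_surj finite_loop_darts simp_thms)
  then have "?\<alpha> permutes loop_darts n S"
    by (rule bij_imp_permutes) (use s h in \<open>auto simp: loop_opp_def\<close>)
  then have "connected_darts (loop_darts n S) (loop_nxt n S) ?\<alpha>"
    by (rule connected_without[OF s]) (unfold \<alpha>, simp)
  then show "connected_darts (darts (loop_diagram n S)) (nxt (loop_diagram n S))
      ((opp (loop_diagram n S))(h := h, opp (loop_diagram n S) h := opp (loop_diagram n S) h))"
    by (simp add: loop_diagram_def)
qed

lemma csucc_mod: "m < n \<Longrightarrow> csucc n m = Suc m mod n"
  by (simp add: csucc_def)

lemma outside_cyclic_loop: "outside_cyclic n (loop_diagram n S)"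
  unfolding outside_cyclic_def ext_darts_loop
proof
  fix h assume "h \<in> (\<lambda>m. 3 * m) ` {..<n}"
  then obtain m where m: "m < n" "h = 3 * m" by auto
  let ?F = "face_step (loop_diagram n S)" and ?E = "(\<lambda>m. 3 * m) ` {..<n}"
  show "\<exists>k>0. (?F ^^ k) h \<in> ?E \<and>
      mark (loop_diagram n S) ((?F ^^ k) h) = Suc (mark (loop_diagram n S) h) mod n \<and>
      (\<forall>j. 0 < j \<and> j < k \<longrightarrow> (?F ^^ j) h \<notin> ?E)"
  \<comment> \<open>If the loop is entered before the next external edge, the face first visits an
    incoming dart and needs two steps; otherwise it needs one.\<close>
  proof (cases "csucc n m \<in> S")
    case True
    have "(?F ^^ j) h = ?F h" if "0 < j" "j < 2" for j
      using that by (simp add: less_2_cases_iff)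
    then show ?thesis using True m csucc_less csucc_mod
      by (intro exI[of _ 2]) (auto simp: numeral_2_eq_2 loop_diagram_def[THEN arg_cong[where f = mark]])
  next
    case False
    then show ?thesis using m csucc_less csucc_mod
      by (intro exI[of _ 1]) (auto simp: loop_diagram_def[THEN arg_cong[where f = mark]])
  qed
qed

theorem one_loop_diagram_loop: "one_loop_diagram n (loop_diagram n S)"
  unfolding one_loop_diagram_def
  using point_diagram_loop planar_loop loop_order_loop irreducible_loop loop_vertex_degree outside_cyclic_loop
  by blast

end

section \<open>Classification of the one-loop diagrams\<close>

lemma connected_darts_closed:
  assumes "connected_darts H \<sigma> \<alpha>" "A \<subseteq> H" "A \<noteq> {}" "\<And>x. x \<in> A \<Longrightarrow> \<sigma> x \<in> A" "\<And>x. x \<in> A \<Longrightarrow> \<alpha> x \<in> A"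
  shows "A = H"
proof -
  obtain a where a: "a \<in> A" using assms(3) by auto
  have "h \<in> A" if "(a, h) \<in> (dart_graph H \<sigma> \<alpha>)\<^sup>*" for h
    using that
  proof induction
    case base
    then show ?case by (rule a)
  next
    case (step y z)
    then have "z = \<sigma> y \<or> z = \<alpha> y" by auto
    then show ?case using step.IH assms(4,5) by auto
  qed
  then have "H \<subseteq> A" using assms(1,2) a unfolding connected_darts_def by auto
  then show ?thesis using assms(2) by auto
qed

locale one_loop =
  fixes G :: nc_diagram and n :: nat
  assumes one_loop: "one_loop_diagram n G" and n_pos: "n > 0"
begin

abbreviation "H \<equiv> darts G"
abbreviation "\<sigma> \<equiv> nxt G"
abbreviation "\<alpha> \<equiv> opp G"
abbreviation "F \<equiv> face_step G"
abbreviation "X \<equiv> ext_darts G"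
abbreviation "internal \<equiv> H - X"

lemma finite_H: "finite H" and \<sigma>: "\<sigma> permutes H" and \<alpha>: "\<alpha> permutes H" and \<alpha>\<alpha>: "\<alpha> (\<alpha> h) = h"
  and mark: "bij_betw (mark G) X {..<n}"
  using one_loop by (auto simp: one_loop_diagram_def point_diagram_def)

lemma \<sigma>_in [simp]: "\<sigma> h \<in> H \<longleftrightarrow> h \<in> H" and \<alpha>_in [simp]: "\<alpha> h \<in> H \<longleftrightarrow> h \<in> H"
  using permutes_in_image[OF \<sigma>] permutes_in_image[OF \<alpha>] by auto

lemma \<sigma>_eq: "\<sigma> x = \<sigma> y \<longleftrightarrow> x = y"
  using permutes_inj[OF \<sigma>] by (auto dest: injD)

lemma ext_iff: "h \<in> X \<longleftrightarrow> h \<in> H \<and> \<alpha> h = h"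
  by (auto simp: ext_darts_def)

lemma F_eq: "F h = \<alpha> (\<sigma> h)"
  by (simp add: face_step_def)

lemma F_permutes: "F permutes H"
  using permutes_compose[OF \<sigma> \<alpha>] by (simp add: comp_def face_step_def[abs_def])

lemma \<sigma>_self: "h \<in> orbit \<sigma> h"
  by (intro permutation_self_in_orbit permutes_imp_permutation[OF finite_H \<sigma>])

lemma F_self: "h \<in> orbit F h"
  by (intro permutation_self_in_orbit permutes_imp_permutation[OF finite_H F_permutes])

lemma \<sigma>_orbit: "x \<in> orbit \<sigma> y \<Longrightarrow> orbit \<sigma> x = orbit \<sigma> y"
  by (rule orbit_cyclic_eq3[OF cyclic_on_orbit[OF \<sigma> finite_H]])

lemma F_orbit: "x \<in> orbit F y \<Longrightarrow> orbit F x = orbit F y"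
  by (rule orbit_cyclic_eq3[OF cyclic_on_orbit[OF F_permutes finite_H]])

lemma connected: "connected_darts H \<sigma> \<alpha>"
  using one_loop by (simp add: one_loop_diagram_def planar_clockwise_def)

lemma card_vertices: "card (vertices G) = card (internal_edges G)"
  using one_loop by (simp add: one_loop_diagram_def loop_order_def)

lemma card_faces: "card (faces G) = 2"
  using one_loop card_vertices by (simp add: one_loop_diagram_def planar_clockwise_def)

lemma vertex_degree: "h \<in> H \<Longrightarrow> card (orbit \<sigma> h) \<ge> 3"
  using one_loop by (simp add: one_loop_diagram_def vertices_def)

lemma finite_vertices: "finite (vertices G)"
  by (simp add: vertices_def finite_H)

lemma vertex_subset: "h \<in> H \<Longrightarrow> orbit \<sigma> h \<subseteq> H"
  by (rule permutes_orbit_subset[OF \<sigma>])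

lemma internal_edges_eq: "internal_edges G = (\<lambda>h. {h, \<alpha> h}) ` internal"
  unfolding internal_edges_def by auto

lemma internal_edge_unique: "c \<in> internal_edges G \<Longrightarrow> x \<in> c \<Longrightarrow> c = {x, \<alpha> x}"
  by (auto simp: internal_edges_eq \<alpha>\<alpha>)

lemma \<alpha>_internal: "h \<in> internal \<Longrightarrow> \<alpha> h \<in> internal"
  using \<alpha>\<alpha>[of h] by (auto simp: ext_iff)

lemma card_inner: "card internal = 2 * card (internal_edges G)"
proof -
  have eq: "\<Union> (internal_edges G) = internal"
    unfolding internal_edges_eq using \<alpha>_internal by blast
  have "2 * card (internal_edges G) = card (\<Union> (internal_edges G))"
  proof (rule card_partition)
    show "finite (internal_edges G)"
      using finite_H by (simp add: internal_edges_eq)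
    show "card c = 2" if c: "c \<in> internal_edges G" for c
    proof -
      obtain h where "c = {h, \<alpha> h}" "h \<in> internal" using c by (auto simp: internal_edges_eq)
      moreover from this have "\<alpha> h \<noteq> h" by (simp add: ext_iff)
      ultimately show ?thesis by simp
    qed
    show "c1 \<inter> c2 = {}" if "c1 \<in> internal_edges G" "c2 \<in> internal_edges G" "c1 \<noteq> c2" for c1 c2
    proof (rule equals0I)
      fix x assume "x \<in> c1 \<inter> c2"
      then have "c1 = {x, \<alpha> x}" "c2 = {x, \<alpha> x}"
        by (auto intro!: internal_edge_unique that(1,2))
      then show False using that(3) by (simp only:)
    qed
  qed (simp add: eq finite_H)
  then show ?thesis by (simp add: eq)
qed

lemma vertex_unique: "v \<in> vertices G \<Longrightarrow> x \<in> v \<Longrightarrow> v = orbit \<sigma> x"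
  using \<sigma>_orbit by (auto simp: vertices_def)

lemma vertices_disjoint: "v \<in> vertices G \<Longrightarrow> w \<in> vertices G \<Longrightarrow> v \<noteq> w \<Longrightarrow> v \<inter> w = {}"
  using vertex_unique by blast

lemma sum_inner_degree: "(\<Sum>v\<in>vertices G. card (v \<inter> internal)) = card internal"
proof -
  have "internal = (\<Union>v\<in>vertices G. v \<inter> internal)"
    using \<sigma>_self by (auto simp: vertices_def)
  moreover have "card (\<Union>v\<in>vertices G. v \<inter> internal) = (\<Sum>v\<in>vertices G. card (v \<inter> internal))"
    by (rule card_UN_disjoint) (use finite_vertices finite_H vertices_disjoint in auto)
  ultimately show ?thesis by simp
qed

text \<open>A vertex without internal darts would be a whole connected component, hence the whole
  diagram, with no internal edge and so no vertex. A vertex with exactly one would be cut off by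
  removing its edge, contrary to irreducibility.\<close>

lemma inner_degree_ge: 
  assumes "v \<in> vertices G"
  shows "card (v \<inter> internal) \<ge> 2"
proof (rule ccontr)
  assume "\<not> card (v \<inter> internal) \<ge> 2"
  then have "card (v \<inter> internal) = 0 \<or> card (v \<inter> internal) = 1" by linarith
  obtain h where h: "h \<in> H" "v = orbit \<sigma> h" using assms by (auto simp: vertices_def)
  have v: "v \<subseteq> H" "v \<noteq> {}" using vertex_subset h \<sigma>_self by auto
  have fin: "finite v" using v(1) finite_H finite_subset by auto
  have closed: "\<sigma> x \<in> v" if "x \<in> v" for x using that h by (auto intro: orbit.step)
  from \<open>card (v \<inter> internal) = 0 \<or> card (v \<inter> internal) = 1\<close> show False
  proof
    assume "card (v \<inter> internal) = 0"
    then have none: "v \<inter> internal = {}" using fin by simp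
    then have "\<alpha> x = x" if "x \<in> v" for x using that v by (auto simp: ext_iff)
    then have "v = H" by (intro connected_darts_closed[OF connected v]) (auto simp: closed)
    then have "internal = {}" using none by blast
    then have "card internal = 0" by (simp only: card.empty)
    then have "card (vertices G) = 0" using card_inner card_vertices by simp
    then show False using assms finite_vertices by auto
  next
    assume "card (v \<inter> internal) = 1"
    then obtain x where x: "v \<inter> internal = {x}" by (auto simp: card_1_singleton_iff)
    let ?\<alpha> = "\<alpha>(x := x, \<alpha> x := \<alpha> x)"
    have xin: "x \<in> internal" "x \<in> v" using x by auto
    have conn: "connected_darts H \<sigma> ?\<alpha>"
      using one_loop xin(1) by (simp add: one_loop_diagram_def one_particle_irreducible_def)
    have closed': "?\<alpha> y \<in> v" if "y \<in> v" for y
    proof (cases "y = x \<or> y = \<alpha> x")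
      case False
      then have "y \<in> X" using that x v by auto
      then show ?thesis using False that by (auto simp: ext_iff)
    qed (use that xin in auto)
    have "v = H" by (rule connected_darts_closed[OF conn v closed closed'])
    then have "\<alpha> x \<in> v \<inter> internal" using xin by (auto simp: ext_iff \<alpha>\<alpha>)
    then have "\<alpha> x = x" using x by auto
    then show False using xin by (simp add: ext_iff)
  qed
qed

text \<open>Loop order one means as many vertices as internal edges, so the average number of
  internal darts at a vertex is 2, which is also a lower bound.\<close>

lemma inner_degree:
  assumes "v \<in> vertices G"
  shows "card (v \<inter> internal) = 2"
proof (rule ccontr)
  assume "card (v \<inter> internal) \<noteq> 2"
  then have "card (v \<inter> internal) > 2" using inner_degree_ge[OF assms] by linarith
  then have "(\<Sum>v\<in>vertices G. 2) < (\<Sum>v\<in>vertices G. card (v \<inter> internal))"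
    using inner_degree_ge assms by (intro sum_strict_mono_ex1 finite_vertices) auto
  then show False using sum_inner_degree card_inner card_vertices by simp
qed

text \<open>Along the face the next external dart comes one step after \<open>h\<close> if no
  internal edge intervenes and two steps after if a single one does; \<open>outside_cyclic\<close>
  fixes its mark.\<close>

lemma mark_step:
  assumes "h \<in> X"
  shows "\<sigma> h \<in> X \<Longrightarrow> mark G (\<sigma> h) = csucc n (mark G h)"
    and "\<sigma> h \<notin> X \<Longrightarrow> \<alpha> (\<sigma> h) \<notin> X \<Longrightarrow> \<sigma> (\<alpha> (\<sigma> h)) \<in> X \<Longrightarrow>
      mark G (\<sigma> (\<alpha> (\<sigma> h))) = csucc n (mark G h)"
proof -
  have lt: "mark G h < n" using mark assms by (auto simp: bij_betw_def)
  then have cs: "csucc n (mark G h) = Suc (mark G h) mod n"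
    by (simp add: csucc_def)
  obtain m where m: "m > 0" "(F ^^ m) h \<in> X" "mark G ((F ^^ m) h) = Suc (mark G h) mod n"
    "\<And>j. 0 < j \<Longrightarrow> j < m \<Longrightarrow> (F ^^ j) h \<notin> X"
    using one_loop assms unfolding one_loop_diagram_def outside_cyclic_def by blast
  show "mark G (\<sigma> h) = csucc n (mark G h)" if "\<sigma> h \<in> X"
  proof -
    have "(F ^^ 1) h = \<sigma> h" using that by (simp add: F_eq ext_iff)
    with m(4)[of 1] that m(1) have "m = 1" by fastforce
    then show ?thesis using m(3) cs \<open>(F ^^ 1) h = \<sigma> h\<close> by simp
  qed
  show "mark G (\<sigma> (\<alpha> (\<sigma> h))) = csucc n (mark G h)"
    if "\<sigma> h \<notin> X" "\<alpha> (\<sigma> h) \<notin> X" "\<sigma> (\<alpha> (\<sigma> h)) \<in> X"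
  proof -
    have 1: "(F ^^ 1) h \<notin> X" using that by (simp add: F_eq)
    have 2: "(F ^^ 2) h = \<sigma> (\<alpha> (\<sigma> h))" using that by (simp add: F_eq ext_iff numeral_2_eq_2)
    with m(4)[of 2] m(1,2) 1 that have "m = 2" by (metis less_one linorder_neqE_nat less_2_cases_iff neq0_conv zero_less_numeral)
    then show ?thesis using m(3) cs 2 by simp
  qed
qed

lemma ext_same_face:
  assumes "h \<in> X" "h' \<in> X"
  shows "h' \<in> orbit F h"
proof -
  obtain h0 where h0: "h0 \<in> X" "mark G h0 = 0"
    using mark n_pos by (metis bij_betw_imp_surj_on imageE lessThan_iff)
  have reach: "m < n \<Longrightarrow> \<exists>h\<in>X. mark G h = m \<and> h \<in> orbit F h0" for m
  proof (induction m)
    case 0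
    then show ?case using h0 F_self by auto
  next
    case (Suc m)
    then obtain h where h: "h \<in> X" "mark G h = m" "h \<in> orbit F h0" by auto
    obtain k where k: "k > 0" "(F ^^ k) h \<in> X" "mark G ((F ^^ k) h) = Suc (mark G h) mod n"
      using one_loop h(1) unfolding one_loop_diagram_def outside_cyclic_def by blast
    then show ?case using h Suc.prems funpow_in_orbit[OF h(3)] by (intro bexI[of _ "(F ^^ k) h"]) auto
  qed
  have "x \<in> orbit F h0" if "x \<in> X" for x
  proof -
    have "mark G x < n" using mark that by (auto simp: bij_betw_def)
    from reach[OF this] obtain y where "y \<in> X" "mark G y = mark G x" "y \<in> orbit F h0" by auto
    then show ?thesis using mark that by (auto simp: bij_betw_def inj_on_def)
  qed
  then show ?thesis using assms F_orbit by metis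
qed

text \<open>There are two faces, and all external darts share one of them.\<close>

lemma inner_face_ex: "\<exists>y\<in>H. orbit F y \<inter> X = {}"
proof -
  obtain A B where AB: "faces G = {A, B}" "A \<noteq> B" using card_faces by (auto simp: card_2_iff)
  obtain a b where ab: "a \<in> H" "A = orbit F a" "b \<in> H" "B = orbit F b"
  proof -
    have "A \<in> faces G" "B \<in> faces G" using AB(1) by simp_all
    then show ?thesis using that unfolding faces_def by blast
  qed
  show ?thesis
  proof (rule ccontr)
    assume "\<not> ?thesis"
    then obtain x y where xy: "x \<in> orbit F a" "x \<in> X" "y \<in> orbit F b" "y \<in> X" using ab by blast
    then have "y \<in> orbit F x" using ext_same_face by simp
    then have "orbit F a = orbit F b" using F_orbit xy by metis
    then show False using AB ab by simp
  qed
qed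

text \<open>The inside of the loop, as a face without external darts; its darts turn into the darts
  \<open>3 m + 2\<close> of a loop diagram.\<close>

definition I :: "nat set" where
  "I = orbit F (SOME y. y \<in> H \<and> orbit F y \<inter> X = {})"

lemma I_orbit: obtains y where "y \<in> H" "I = orbit F y" "I \<inter> X = {}"
  using someI_ex[of "\<lambda>y. y \<in> H \<and> orbit F y \<inter> X = {}"] inner_face_ex unfolding I_def by blast

lemma I_sub: "I \<subseteq> H" "I \<inter> X = {}" "I \<noteq> {}"
proof -
  obtain y where y: "y \<in> H" "I = orbit F y" "I \<inter> X = {}" by (rule I_orbit)
  then show "I \<subseteq> H" "I \<inter> X = {}" "I \<noteq> {}"
    using permutes_orbit_subset[OF F_permutes y(1)] orbit.base[of F y] by auto
qed

lemma I_F: "F x \<in> I \<longleftrightarrow> x \<in> I"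
proof -
  obtain y where y: "y \<in> H" "I = orbit F y" by (rule I_orbit)
  show ?thesis unfolding y
    using cyclic_on_f_in[OF F_permutes cyclic_on_orbit[OF F_permutes finite_H, of y]] orbit.step by metis
qed

lemma I_pre: "x \<in> I \<Longrightarrow> \<exists>x'\<in>I. \<alpha> x = \<sigma> x'"
  using I_F permutes_surj[OF F_permutes] by (metis F_eq \<alpha>\<alpha> surjD)

text \<open>An external dart is its own image under \<open>opp\<close>, so it would lie on the inner
  face if it followed a dart of that face. Hence the other internal dart of the vertex comes next,
  and degree at least 3 puts an external dart after it.\<close>

lemma I_nxt:
  assumes "x \<in> I"
  shows "\<sigma> x \<in> internal" "\<sigma> x \<noteq> x" "orbit \<sigma> x \<inter> internal = {x, \<sigma> x}" "\<sigma> (\<sigma> x) \<noteq> x" "\<sigma> x \<notin> I" "\<sigma> (\<sigma> x) \<in> X"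
proof -
  have x: "x \<in> H" "x \<in> internal" using assms I_sub by auto
  show 1: "\<sigma> x \<in> internal"
  proof (rule ccontr)
    assume "\<sigma> x \<notin> internal"
    then have "\<sigma> x \<in> X" using x by auto
    then have "F x \<in> X" by (simp add: F_eq ext_iff)
    then show False using I_F assms I_sub by auto
  qed
  show 2: "\<sigma> x \<noteq> x"
    using vertex_degree[OF x(1)] orbit_eq_singleton_iff[of \<sigma> x] by auto
  have "card (orbit \<sigma> x \<inter> internal) = 2" using inner_degree x by (simp add: vertices_def)
  moreover have "{x, \<sigma> x} \<subseteq> orbit \<sigma> x \<inter> internal" using x 1 \<sigma>_self orbit.base by auto
  moreover have "finite (orbit \<sigma> x \<inter> internal)" using finite_H by simp
  ultimately show 3: "orbit \<sigma> x \<inter> internal = {x, \<sigma> x}"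
    using 2 by (metis card_2_iff card_subset_eq)
  show 4: "\<sigma> (\<sigma> x) \<noteq> x"
  proof
    assume eq: "\<sigma> (\<sigma> x) = x"
    have "y \<in> {x, \<sigma> x}" if "y \<in> orbit \<sigma> x" for y
      using that by induction (auto simp: eq)
    then have "orbit \<sigma> x \<subseteq> {x, \<sigma> x}" by auto
    then have "card (orbit \<sigma> x) \<le> card {x, \<sigma> x}" by (rule card_mono[rotated]) simp
    also have "\<dots> \<le> 2" by (simp add: card_insert_if)
    finally show False using vertex_degree[OF x(1)] by simp
  qed
  have 5: "\<sigma> (\<sigma> x) \<notin> internal"
  proof
    assume "\<sigma> (\<sigma> x) \<in> internal"
    moreover have "\<sigma> (\<sigma> x) \<in> orbit \<sigma> x" by (intro orbit.intros)
    ultimately have "\<sigma> (\<sigma> x) \<in> orbit \<sigma> x \<inter> internal" by blast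
    then have "\<sigma> (\<sigma> x) \<in> {x, \<sigma> x}" unfolding 3 .
    then show False using 4 2 by (auto simp: \<sigma>_eq)
  qed
  then show "\<sigma> (\<sigma> x) \<in> X" using x by auto
  show "\<sigma> x \<notin> I"
  proof
    assume "\<sigma> x \<in> I"
    then have "F (\<sigma> x) \<in> I" by (simp add: I_F)
    moreover have "F (\<sigma> x) \<in> X" using \<open>\<sigma> (\<sigma> x) \<in> X\<close> by (simp add: F_eq ext_iff)
    ultimately show False using I_sub by auto
  qed
qed

text \<open>The darts at vertices touched by the inner face are closed under both permutations, so
  by connectedness they are all darts; at such a vertex the internal darts are \<open>x\<close> and
  its successor.\<close>

lemma inner_cases:
  assumes "h \<in> internal"
  obtains "h \<in> I" | x where "x \<in> I" "h = \<sigma> x"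
proof -
  let ?A = "{h \<in> H. \<exists>x\<in>I. h \<in> orbit \<sigma> x}"
  have inA: "h \<in> {x, \<sigma> x}" if "h \<in> internal" "h \<in> orbit \<sigma> x" "x \<in> I" for h x
    unfolding I_nxt(3)[OF that(3), symmetric] using that by blast
  have "?A = H"
  proof (rule connected_darts_closed[OF connected])
    obtain x where "x \<in> I" using I_sub(3) by auto
    then have "x \<in> ?A" using I_sub(1) \<sigma>_self by auto
    then show "?A \<noteq> {}" by auto
    show "\<sigma> x \<in> ?A" if "x \<in> ?A" for x using that by (auto intro: orbit.step)
    fix h assume h: "h \<in> ?A"
    show "\<alpha> h \<in> ?A"
    proof (cases "h \<in> X")
      case True
      then show ?thesis using h by (simp add: ext_iff)
    next
      case False
      then obtain x where x: "x \<in> I" "h = x \<or> h = \<sigma> x" using h inA by blast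
      have "\<exists>x'\<in>I. \<alpha> h \<in> orbit \<sigma> x'"
      proof (cases "h = x")
        case True
        then show ?thesis using I_pre[OF x(1)] orbit.base by metis
      next
        case False
        then have "\<alpha> h \<in> I" using x I_F[of x] by (simp add: F_eq)
        then show ?thesis using \<sigma>_self by blast
      qed
      then show ?thesis using h by simp
    qed
  qed auto
  then obtain x where "x \<in> I" "h \<in> orbit \<sigma> x" using assms by blast
  then show thesis using inA[OF assms] that by auto
qed

text \<open>For a dart \<open>x\<close> of the inner face, \<sigma> x is the incoming loop dart at
  the same vertex, and the dart after it carries the first external edge of that vertex.\<close>

definition cuts :: "nat set" where
  "cuts = (\<lambda>x. mark G (\<sigma> (\<sigma> x))) ` I"

lemma cut_in: "x \<in> I \<Longrightarrow> mark G (\<sigma> (\<sigma> x)) \<in> cuts"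
  by (simp add: cuts_def)

lemma mark_less: "h \<in> X \<Longrightarrow> mark G h < n"
  using mark by (auto simp: bij_betw_def)

lemma mark_eq: "h \<in> X \<Longrightarrow> h' \<in> X \<Longrightarrow> mark G h = mark G h' \<longleftrightarrow> h = h'"
  using mark by (auto simp: bij_betw_def inj_on_def)

sublocale cut_points n cuts
proof
  show "cuts \<subseteq> {..<n}" using I_nxt(6) mark_less by (auto simp: cuts_def)
  show "cuts \<noteq> {}" using I_sub by (simp add: cuts_def)
qed

lemma ext_nxt:
  assumes "h \<in> X"
  obtains (ext) "\<sigma> h \<in> X" "mark G (\<sigma> h) = csucc n (mark G h)" "csucc n (mark G h) \<notin> cuts"
  | (internal) "\<sigma> h \<in> I" "mark G (\<sigma> (\<alpha> (\<sigma> h))) = csucc n (mark G h)" "csucc n (mark G h) \<in> cuts"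
proof (cases "\<sigma> h \<in> X")
  case True
  have "mark G (\<sigma> h) \<notin> cuts"
  proof
    assume "mark G (\<sigma> h) \<in> cuts"
    then obtain x where x: "x \<in> I" "mark G (\<sigma> h) = mark G (\<sigma> (\<sigma> x))" by (auto simp: cuts_def)
    then have "h = \<sigma> x" using mark_eq[OF True I_nxt(6)[OF x(1)]] by (simp add: \<sigma>_eq)
    then show False using I_nxt(1)[OF x(1)] assms by simp
  qed
  then show ?thesis using ext True mark_step(1)[OF assms True] by simp
next
  case False
  then have "\<sigma> h \<in> internal" using assms by (simp add: ext_iff)
  then have "\<sigma> h \<in> I"
  proof (cases rule: inner_cases)
    case (2 x)
    then have "h \<in> I" by (simp add: \<sigma>_eq)
    then show ?thesis using assms I_sub by auto
  qed
  then obtain x where x: "x \<in> I" "\<alpha> (\<sigma> h) = \<sigma> x" using I_pre by blast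
  have "mark G (\<sigma> (\<alpha> (\<sigma> h))) = csucc n (mark G h)"
    using mark_step(2)[OF assms False] I_nxt[OF x(1)] x(2) by simp
  moreover have "mark G (\<sigma> (\<alpha> (\<sigma> h))) \<in> cuts" using x by (simp add: cuts_def)
  ultimately show ?thesis using internal \<open>\<sigma> h \<in> I\<close> by simp
qed

text \<open>The owner stays constant from one external dart to the next at a vertex, because a new
  cut is met only where the walk leaves the external darts.\<close>

lemma owner_vertex:
  assumes x: "x \<in> I" and "h \<in> orbit \<sigma> x" "h \<in> X"
  shows "owner cuts (mark G h) = mark G (\<sigma> (\<sigma> x))"
  using assms(2,3)
proof induction
  case base
  then show ?case using I_nxt(1)[OF x] by simp
next
  case (step h)
  show ?case
  proof (cases "h \<in> X")
    case True
    then show ?thesis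
    proof (cases rule: ext_nxt)
      case ext
      then show ?thesis using step True owner_csucc mark_less by simp
    next
      case internal
      then show ?thesis using step.prems I_sub by auto
    qed
  next
    case False
    have "h \<in> H" using step(1) vertex_subset[of x] x I_sub(1) by auto
    then have "h \<in> {x, \<sigma> x}" using False step(1) I_nxt(3)[OF x] by auto
    then show ?thesis using step.prems I_nxt(1)[OF x] x cut_in[OF x] by (auto simp: owner_self)
  qed
qed

definition relabel :: "nat \<Rightarrow> nat" where
  "relabel h = (if h \<in> X then 3 * mark G h else if h \<in> I then Suc (Suc (3 * mark G (\<sigma> (\<alpha> h))))
     else Suc (3 * mark G (\<sigma> h)))"

lemma relabel_ext: "h \<in> X \<Longrightarrow> relabel h = 3 * mark G h"
  and relabel_out: "h \<in> I \<Longrightarrow> relabel h = Suc (Suc (3 * mark G (\<sigma> (\<alpha> h))))"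
  and relabel_into: "x \<in> I \<Longrightarrow> relabel (\<sigma> x) = Suc (3 * mark G (\<sigma> (\<sigma> x)))"
  using I_sub I_nxt[of x] by (auto simp: relabel_def)

lemma dart_cases [consumes 1, case_names ext out into]:
  assumes "h \<in> H"
  obtains "h \<in> X" | "h \<in> I" | x where "x \<in> I" "h = \<sigma> x"
  using assms inner_cases[of h] by blast

lemma out_cuts: "x \<in> I \<Longrightarrow> \<sigma> (\<alpha> x) \<in> X \<and> mark G (\<sigma> (\<alpha> x)) \<in> cuts"
  using I_pre[of x] I_nxt(6) by (auto simp: cuts_def)

lemma \<alpha>_eq: "\<alpha> x = \<alpha> y \<longleftrightarrow> x = y"
  by (metis \<alpha>\<alpha>)

lemma bij_relabel: "bij_betw relabel H (loop_darts n cuts)"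
proof -
  have "inj_on relabel H"
  proof (rule inj_onI)
    fix h h' assume "h \<in> H" "h' \<in> H" "relabel h = relabel h'"
    then show "h = h'"
      by (elim dart_cases)
         (auto simp: relabel_ext relabel_out relabel_into mark_eq out_cuts I_nxt \<sigma>_eq \<alpha>_eq)
  qed
  moreover have "relabel ` H \<subseteq> loop_darts n cuts"
    by (auto elim!: dart_cases simp: relabel_ext relabel_out relabel_into mark_less out_cuts cut_in)
  moreover have "loop_darts n cuts \<subseteq> relabel ` H"
  proof
    fix k assume "k \<in> loop_darts n cuts"
    then show "k \<in> relabel ` H"
    proof (cases rule: loop_dart_cases)
      case (ext m)
      then obtain h where "h \<in> X" "mark G h = m"
        using mark by (metis bij_betw_imp_surj_on imageE lessThan_iff)
      then show ?thesis using ext by (intro image_eqI[of _ _ h]) (auto simp: relabel_ext ext_iff)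
    next
      case (into m)
      then obtain x where "x \<in> I" "m = mark G (\<sigma> (\<sigma> x))" by (auto simp: cuts_def)
      then show ?thesis using into I_sub by (intro image_eqI[of _ _ "\<sigma> x"]) (auto simp: relabel_into)
    next
      case (out m)
      then obtain x where x: "x \<in> I" "m = mark G (\<sigma> (\<sigma> x))" by (auto simp: cuts_def)
      then have "\<alpha> (\<sigma> x) \<in> I" using I_F[of x] by (simp add: F_eq)
      then show ?thesis using out x I_sub
        by (intro image_eqI[of _ _ "\<alpha> (\<sigma> x)"]) (auto simp: relabel_out \<alpha>\<alpha>)
    qed
  qed
  ultimately show ?thesis by (auto simp: bij_betw_def)
qed

lemma relabel_nxt:
  assumes "h \<in> H"
  shows "relabel (\<sigma> h) = loop_nxt n cuts (relabel h)"
  using assms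
proof (cases rule: dart_cases)
  case ext
  then show ?thesis
  proof (cases rule: ext_nxt)
    case ext
    then show ?thesis using \<open>h \<in> X\<close> by (simp add: relabel_ext mark_less)
  next
    case internal
    then show ?thesis using \<open>h \<in> X\<close> by (simp add: relabel_ext relabel_out mark_less)
  qed
next
  case out
  \<comment> \<open>The external dart \<open>e\<close> just before the outgoing dart
    \<open>h\<close> tells both the owner of the vertex and, through its mark, the cut to which
    \<open>h\<close> belongs.\<close>
  obtain e where e: "\<sigma> e = h" using permutes_surj[OF \<sigma>] by (metis surjD)
  have "e \<in> H" using assms e by (metis \<sigma>_in)
  have orb: "e \<in> orbit \<sigma> h"
    using \<sigma>_self[of e] \<sigma>_orbit[of "\<sigma> e" e] orbit.base[of \<sigma> e] e by simp
  have eX: "e \<in> X"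
  proof (rule ccontr)
    assume "e \<notin> X"
    then have "e \<in> {h, \<sigma> h}" using orb \<open>e \<in> H\<close> I_nxt(3)[OF out] by auto
    then show False using e I_nxt(2,4)[OF out] by auto
  qed
  then have "mark G (\<sigma> (\<alpha> h)) = csucc n (mark G e)"
  proof (cases rule: ext_nxt)
    case ext
    then show ?thesis using e out I_sub by auto
  next
    case internal
    then show ?thesis using e by simp
  qed
  then have "owner cuts (cpred n (mark G (\<sigma> (\<alpha> h)))) = mark G (\<sigma> (\<sigma> h))"
    using owner_vertex[OF out orb eX] cpred_csucc[OF mark_less[OF eX]] by simp
  then show ?thesis using out out_cuts by (simp add: relabel_out relabel_into)
next
  case (into x)
  then have "mark G (\<sigma> (\<sigma> x)) \<in> cuts" by (simp add: cuts_def)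
  then show ?thesis using into I_nxt(6) by (simp add: relabel_into relabel_ext)
qed

lemma relabel_opp:
  assumes "h \<in> H"
  shows "relabel (\<alpha> h) = loop_opp n cuts (relabel h)"
  using assms
proof (cases rule: dart_cases)
  case ext
  then show ?thesis by (simp add: relabel_ext) (simp add: ext_iff relabel_ext)
next
  case out
  then obtain x where "x \<in> I" "\<alpha> h = \<sigma> x" using I_pre by blast
  then show ?thesis using out cut_in[of x] by (simp add: relabel_out relabel_into)
next
  case (into x)
  then have "mark G (\<sigma> (\<sigma> x)) \<in> cuts" "\<alpha> h \<in> I" using I_F[of x] by (auto simp: F_eq cuts_def)
  then show ?thesis using into by (simp add: relabel_out relabel_into \<alpha>\<alpha>)
qed

lemma iso_loop_diagram: "diagram_iso G (loop_diagram n cuts)"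
  unfolding diagram_iso_def
proof (intro exI[of _ relabel] conjI ballI)
  show "bij_betw relabel H (darts (loop_diagram n cuts))"
    using bij_relabel by (simp add: loop_diagram_def)
  show "relabel (\<sigma> h) = nxt (loop_diagram n cuts) (relabel h)" if "h \<in> H" for h
    using relabel_nxt[OF that] by (simp add: loop_diagram_def)
  show "relabel (\<alpha> h) = opp (loop_diagram n cuts) (relabel h)" if "h \<in> H" for h
    using relabel_opp[OF that] by (simp add: loop_diagram_def)
  show "mark (loop_diagram n cuts) (relabel h) = mark G h" if "h \<in> X" for h
    using relabel_ext[OF that] by (simp add: loop_diagram_def)
qed

end

section \<open>Isomorphism classes of one-loop diagrams\<close>

lemma point_diagram_opp_in: "point_diagram n G \<Longrightarrow> h \<in> darts G \<Longrightarrow> opp G h \<in> darts G"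
  and point_diagram_nxt_in: "point_diagram n G \<Longrightarrow> h \<in> darts G \<Longrightarrow> nxt G h \<in> darts G"
  by (auto simp: point_diagram_def permutes_in_image)

lemma iso_ext_iff:
  assumes "point_diagram n G" "bij_betw g (darts G) (darts G')"
    "\<And>h. h \<in> darts G \<Longrightarrow> g (opp G h) = opp G' (g h)" "h \<in> darts G"
  shows "g h \<in> ext_darts G' \<longleftrightarrow> h \<in> ext_darts G"
proof -
  have "opp G' (g h) = g h \<longleftrightarrow> opp G h = h"
    using assms point_diagram_opp_in[OF assms(1,4)] by (metis bij_betw_imp_inj_on inj_on_eq_iff)
  then show ?thesis using assms(2,4) by (auto simp: ext_darts_def bij_betw_def)
qed

lemma diagram_iso_refl: "diagram_iso G G"
  unfolding diagram_iso_def by (rule exI[of _ id]) simp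

lemma diagram_iso_sym:
  assumes "point_diagram n G" "point_diagram n G'" "diagram_iso G G'"
  shows "diagram_iso G' G"
proof -
  obtain g where g: "bij_betw g (darts G) (darts G')"
    and nxt: "\<And>h. h \<in> darts G \<Longrightarrow> g (nxt G h) = nxt G' (g h)"
    and opp: "\<And>h. h \<in> darts G \<Longrightarrow> g (opp G h) = opp G' (g h)"
    and mark: "\<And>h. h \<in> ext_darts G \<Longrightarrow> mark G' (g h) = mark G h"
    using assms(3) unfolding diagram_iso_def by blast
  define g' where "g' = inv_into (darts G) g"
  have g': "bij_betw g' (darts G') (darts G)" unfolding g'_def by (rule bij_betw_inv_into[OF g])
  have gg': "g (g' h) = h" if "h \<in> darts G'" for h
    using bij_betw_inv_into_right[OF g that] by (simp add: g'_def)
  have g'g: "g' (g h) = h" if "h \<in> darts G" for h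
    using bij_betw_inv_into_left[OF g that] by (simp add: g'_def)
  have in': "g' h \<in> darts G" if "h \<in> darts G'" for h
    using g' that by (auto simp: bij_betw_def)
  show ?thesis
    unfolding diagram_iso_def
  proof (intro exI[of _ g'] conjI ballI g')
    fix h assume h: "h \<in> darts G'"
    show "g' (nxt G' h) = nxt G (g' h)"
      using nxt[OF in'[OF h]] gg'[OF h] g'g[OF point_diagram_nxt_in[OF assms(1) in'[OF h]]] by simp
    show "g' (opp G' h) = opp G (g' h)"
      using opp[OF in'[OF h]] gg'[OF h] g'g[OF point_diagram_opp_in[OF assms(1) in'[OF h]]] by simp
  next
    fix h assume h: "h \<in> ext_darts G'"
    then have hd: "h \<in> darts G'" by (simp add: ext_darts_def)
    have "g' h \<in> ext_darts G"
      using iso_ext_iff[OF assms(1) g opp in'[OF hd]] gg'[OF hd] h by simp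
    then show "mark G (g' h) = mark G' h" using mark gg'[OF hd] by metis
  qed
qed

lemma diagram_iso_trans:
  assumes "point_diagram n G" "diagram_iso G G'" "diagram_iso G' G''"
  shows "diagram_iso G G''"
proof -
  obtain g where g: "bij_betw g (darts G) (darts G')"
    and nxt: "\<And>h. h \<in> darts G \<Longrightarrow> g (nxt G h) = nxt G' (g h)"
    and opp: "\<And>h. h \<in> darts G \<Longrightarrow> g (opp G h) = opp G' (g h)"
    and mark: "\<And>h. h \<in> ext_darts G \<Longrightarrow> mark G' (g h) = mark G h"
    using assms(2) unfolding diagram_iso_def by blast
  obtain k where k: "bij_betw k (darts G') (darts G'')"
    and nxt': "\<And>h. h \<in> darts G' \<Longrightarrow> k (nxt G' h) = nxt G'' (k h)"
    and opp': "\<And>h. h \<in> darts G' \<Longrightarrow> k (opp G' h) = opp G'' (k h)"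
    and mark': "\<And>h. h \<in> ext_darts G' \<Longrightarrow> mark G'' (k h) = mark G' h"
    using assms(3) unfolding diagram_iso_def by blast
  have g_in: "g h \<in> darts G'" if "h \<in> darts G" for h
    using g that by (auto simp: bij_betw_def)
  show ?thesis
    unfolding diagram_iso_def
  proof (intro exI[of _ "k \<circ> g"] conjI ballI bij_betw_trans[OF g k])
    fix h assume "h \<in> ext_darts G"
    then have "g h \<in> ext_darts G'" "h \<in> ext_darts G"
      using iso_ext_iff[OF assms(1) g opp] by (auto simp: ext_darts_def)
    then show "mark G'' ((k \<circ> g) h) = mark G h" using mark mark' by simp
  qed (use g_in nxt nxt' opp opp' in auto)
qed

text \<open>Preserved marks force the isomorphism to fix all external darts. Whether the dart after
  an external dart is again external is invariant and detects the cuts.\<close>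

lemma loop_diagram_iso_unique:
  assumes "cut_points n S" "cut_points n T" "diagram_iso (loop_diagram n S) (loop_diagram n T)"
  shows "S = T"
proof -
  interpret S: cut_points n S by fact
  interpret T: cut_points n T by fact
  let ?S = "loop_diagram n S" and ?T = "loop_diagram n T"
  obtain g where g: "bij_betw g (darts ?S) (darts ?T)"
    and nxt: "\<And>h. h \<in> darts ?S \<Longrightarrow> g (nxt ?S h) = nxt ?T (g h)"
    and opp: "\<And>h. h \<in> darts ?S \<Longrightarrow> g (opp ?S h) = opp ?T (g h)"
    and mark: "\<And>h. h \<in> ext_darts ?S \<Longrightarrow> mark ?T (g h) = mark ?S h"
    using assms(3) unfolding diagram_iso_def by blast
  have ext: "g h \<in> ext_darts ?T \<longleftrightarrow> h \<in> ext_darts ?S" if "h \<in> darts ?S" for h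
    by (rule iso_ext_iff[OF S.point_diagram_loop g opp that])
  have fix_ext: "g (3 * m) = 3 * m" if "m < n" for m
  proof -
    have "3 * m \<in> darts ?S" "3 * m \<in> ext_darts ?S"
      using that S.ext_darts_loop by (auto simp: loop_diagram_def)
    with ext mark have "g (3 * m) \<in> ext_darts ?T" "mark ?T (g (3 * m)) = mark ?S (3 * m)" by auto
    then show ?thesis unfolding T.ext_darts_loop by (auto simp: loop_diagram_def)
  qed
  have "csucc n m \<in> S \<longleftrightarrow> csucc n m \<in> T" if "m < n" for m
  proof -
    have d: "3 * m \<in> darts ?S" using that by (simp add: loop_diagram_def)
    have "nxt ?S (3 * m) \<in> darts ?S" by (rule point_diagram_nxt_in[OF S.point_diagram_loop d])
    from ext[OF this] nxt[OF d] fix_ext[OF that]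
    have "nxt ?T (3 * m) \<in> ext_darts ?T \<longleftrightarrow> nxt ?S (3 * m) \<in> ext_darts ?S" by simp
    moreover have "nxt ?T (3 * m) \<in> ext_darts ?T \<longleftrightarrow> csucc n m \<notin> T"
      unfolding T.ext_darts_loop using that T.csucc_less[OF that] by (auto simp: loop_diagram_def)
    moreover have "nxt ?S (3 * m) \<in> ext_darts ?S \<longleftrightarrow> csucc n m \<notin> S"
      unfolding S.ext_darts_loop using that S.csucc_less[OF that] by (auto simp: loop_diagram_def)
    ultimately show ?thesis by blast
  qed
  then have "m \<in> S \<longleftrightarrow> m \<in> T" if "m < n" for m
    using S.csucc_cpred[OF that] S.cpred_less[OF that] by metis
  then show ?thesis using S.S_less T.S_less by blast
qed

text \<open>By the classification each isomorphism class contains the loop diagram of exactly one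
  nonempty set of cuts; invariance of \<open>val\<close> makes the value independent of the chosen
  representative.\<close>

theorem sum_one_loop_diagrams:
  fixes val :: "nc_diagram \<Rightarrow> complex"
  assumes "n > 0"
    and val: "\<And>G G'. one_loop_diagram n G \<Longrightarrow> one_loop_diagram n G' \<Longrightarrow> diagram_iso G G' \<Longrightarrow> val G = val G'"
  shows "(\<Sum>C \<in> {G. one_loop_diagram n G} //
      {(G, G'). one_loop_diagram n G \<and> one_loop_diagram n G' \<and> diagram_iso G G'}. val (SOME G. G \<in> C))
    = (\<Sum>S \<in> Pow {..<n} - {{}}. val (loop_diagram n S))"
proof -
  let ?A = "{G. one_loop_diagram n G}"
  let ?R = "{(G, G'). one_loop_diagram n G \<and> one_loop_diagram n G' \<and> diagram_iso G G'}"
  let ?D = "\<lambda>S. ?R `` {loop_diagram n S}"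
  have pt: "one_loop_diagram n G \<Longrightarrow> point_diagram n G" for G
    by (simp add: one_loop_diagram_def)
  have R: "equiv ?A ?R"
  proof (rule equivI)
    show "?R \<subseteq> ?A \<times> ?A" by auto
    show "refl_on ?A ?R" by (auto simp: refl_on_def diagram_iso_refl)
    show "sym ?R" by (auto simp: sym_def intro: diagram_iso_sym pt)
    show "trans ?R" by (auto simp: trans_def intro: diagram_iso_trans pt)
  qed
  have cp: "cut_points n S" if "S \<in> Pow {..<n} - {{}}" for S
    using that by unfold_locales auto
  have ol: "one_loop_diagram n (loop_diagram n S)" if "S \<in> Pow {..<n} - {{}}" for S
    using cut_points.one_loop_diagram_loop[OF cp[OF that]] .
  have "bij_betw ?D (Pow {..<n} - {{}}) (?A // ?R)"
    unfolding bij_betw_def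
  proof
    show "inj_on ?D (Pow {..<n} - {{}})"
    proof (rule inj_onI)
      fix S T assume S: "S \<in> Pow {..<n} - {{}}" and T: "T \<in> Pow {..<n} - {{}}" and eq: "?D S = ?D T"
      then have "(loop_diagram n S, loop_diagram n T) \<in> ?R"
        by (intro eq_equiv_class[OF eq R]) (use ol in auto)
      then show "S = T" using loop_diagram_iso_unique[OF cp[OF S] cp[OF T]] by simp
    qed
    show "?D ` (Pow {..<n} - {{}}) = ?A // ?R"
    proof
      show "?D ` (Pow {..<n} - {{}}) \<subseteq> ?A // ?R"
        by (rule image_subsetI, rule quotientI) (use ol in simp)
      show "?A // ?R \<subseteq> ?D ` (Pow {..<n} - {{}})"
      proof
        fix C assume "C \<in> ?A // ?R"
        then obtain G where G: "one_loop_diagram n G" "C = ?R `` {G}" by (auto elim!: quotientE)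
        interpret one_loop G n using G(1) assms(1) by unfold_locales
        have c: "cuts \<in> Pow {..<n} - {{}}" using S_sub S_ne by auto
        have "(G, loop_diagram n cuts) \<in> ?R" using G ol[OF c] iso_loop_diagram by simp
        then have "C = ?D cuts" using equiv_class_eq[OF R] G(2) by blast
        then show "C \<in> ?D ` (Pow {..<n} - {{}})" using c by blast
      qed
    qed
  qed
  then have "(\<Sum>C \<in> ?A // ?R. val (SOME G. G \<in> C)) = (\<Sum>S \<in> Pow {..<n} - {{}}. val (SOME G. G \<in> ?D S))"
    by (rule sum.reindex_bij_betw[symmetric])
  also have "\<dots> = (\<Sum>S \<in> Pow {..<n} - {{}}. val (loop_diagram n S))"
  proof (rule sum.cong)
    fix S assume S: "S \<in> Pow {..<n} - {{}}"
    have "loop_diagram n S \<in> ?D S" using ol[OF S] diagram_iso_refl by simp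
    then have "(SOME G. G \<in> ?D S) \<in> ?D S" by (rule someI[of "\<lambda>G. G \<in> ?D S"])
    then show "val (SOME G. G \<in> ?D S) = val (loop_diagram n S)" using val by (auto simp del: Image_singleton_iff simp: Image_def)
  qed simp
  finally show ?thesis .
qed

section \<open>Gaussian integration over the Hermitian matrices\<close>

lemma gaussian_moments:
  assumes "c > (0 :: real)"
  shows "integrable lborel (\<lambda>t. t ^ k * exp (- c * t\<^sup>2))"
    and "(LINT t|lborel. t ^ 0 * exp (- c * t\<^sup>2)) > 0"
    and "(LINT t|lborel. t ^ 1 * exp (- c * t\<^sup>2)) = 0"
    and "(LINT t|lborel. t ^ 2 * exp (- c * t\<^sup>2)) = (LINT t|lborel. t ^ 0 * exp (- c * t\<^sup>2)) / (2 * c)"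
proof -
  \<comment> \<open>The standard deviation for which the normal density is proportional to
    \<open>exp (- c * t\<^sup>2)\<close>.\<close>
  define s where "s = sqrt (1 / (2 * c))"
  have s: "s > 0" "s\<^sup>2 = 1 / (2 * c)" using assms by (simp_all add: s_def)
  define K where "K = sqrt (2 * pi * s\<^sup>2)"
  have K: "K > 0" using s(1) by (simp add: K_def)
  have eq: "t ^ k * exp (- c * t\<^sup>2) = K * (normal_density 0 s t * (t - 0) ^ k)" for t k
  proof -
    have "sqrt (pi / c) = K" using assms by (simp add: K_def s(2))
    then show ?thesis using K by (simp add: normal_density_def s(2) mult.commute)
  qed
  have int: "(LINT t|lborel. t ^ k * exp (- c * t\<^sup>2)) = K * (LINT t|lborel. normal_density 0 s t * (t - 0) ^ k)" for k
    unfolding eq by simp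
  show "integrable lborel (\<lambda>t. t ^ k * exp (- c * t\<^sup>2))"
    unfolding eq by (intro integrable_mult_right integrable_normal_moment s(1))
  show "(LINT t|lborel. t ^ 0 * exp (- c * t\<^sup>2)) > 0"
    unfolding int using integral_normal_moment_even[OF s(1), of 0 0] K by simp
  show "(LINT t|lborel. t ^ 1 * exp (- c * t\<^sup>2)) = 0"
    unfolding int using integral_normal_moment_odd[OF s(1), of 0 0] by simp
  show "(LINT t|lborel. t ^ 2 * exp (- c * t\<^sup>2)) = (LINT t|lborel. t ^ 0 * exp (- c * t\<^sup>2)) / (2 * c)"
    unfolding int using integral_normal_moment_even[OF s(1), of 0 1] integral_normal_moment_even[OF s(1), of 0 0]
    by (simp add: s(2)[unfolded power2_eq_square] power2_eq_square)
qed

lemma gaussian_product_moments: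
  fixes c :: "'i \<Rightarrow> real"
  assumes "finite I" "\<And>w. w \<in> I \<Longrightarrow> c w > 0"
  defines "g \<equiv> \<lambda>x. \<Prod>w\<in>I. exp (- c w * (x w)\<^sup>2)"
  defines "Z \<equiv> LINT x|Pi\<^sub>M I (\<lambda>_. lborel). g x"
  shows "integrable (Pi\<^sub>M I (\<lambda>_. lborel)) g" "Z > 0"
    and "u \<in> I \<Longrightarrow> v \<in> I \<Longrightarrow> integrable (Pi\<^sub>M I (\<lambda>_. lborel)) (\<lambda>x. x u * x v * g x)"
    and "u \<in> I \<Longrightarrow> v \<in> I \<Longrightarrow> (LINT x|Pi\<^sub>M I (\<lambda>_. lborel). x u * x v * g x) = (if u = v then Z / (2 * c u) else 0)"
proof -
  interpret product_sigma_finite "\<lambda>_ :: 'i. lborel :: real measure"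
    by standard
  define M where "M k w = (LINT t|lborel. t ^ k * exp (- c w * t\<^sup>2))" for k :: nat and w
  have int: "integrable (Pi\<^sub>M I (\<lambda>_. lborel)) (\<lambda>x. \<Prod>w\<in>I. x w ^ k w * exp (- c w * (x w)\<^sup>2))"
    and val: "(LINT x|Pi\<^sub>M I (\<lambda>_. lborel). (\<Prod>w\<in>I. x w ^ k w * exp (- c w * (x w)\<^sup>2))) = (\<Prod>w\<in>I. M (k w) w)"
    for k :: "'i \<Rightarrow> nat"
  proof -
    have i: "integrable lborel (\<lambda>t. t ^ k w * exp (- c w * t\<^sup>2))" if "w \<in> I" for w
      by (rule gaussian_moments(1)) (use assms that in auto)
    show "integrable (Pi\<^sub>M I (\<lambda>_. lborel)) (\<lambda>x. \<Prod>w\<in>I. x w ^ k w * exp (- c w * (x w)\<^sup>2))"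
      using product_integrable_prod[OF assms(1), of "\<lambda>w t. t ^ k w * exp (- c w * t\<^sup>2)"] i by simp
    show "(LINT x|Pi\<^sub>M I (\<lambda>_. lborel). (\<Prod>w\<in>I. x w ^ k w * exp (- c w * (x w)\<^sup>2))) = (\<Prod>w\<in>I. M (k w) w)"
      using product_integral_prod[OF assms(1), of "\<lambda>w t. t ^ k w * exp (- c w * t\<^sup>2)"] i
      by (simp add: M_def)
  qed
  have g0: "g = (\<lambda>x. \<Prod>w\<in>I. x w ^ (0 :: nat) * exp (- c w * (x w)\<^sup>2))"
    by (simp add: g_def)
  show "integrable (Pi\<^sub>M I (\<lambda>_. lborel)) g" unfolding g0 by (rule int)
  have Z: "Z = (\<Prod>w\<in>I. M 0 w)" unfolding Z_def g0 by (rule val)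
  have M0: "M 0 w > 0" if "w \<in> I" for w
    using gaussian_moments(2)[OF assms(2)[OF that]] by (simp add: M_def)
  then show "Z > 0" unfolding Z by (rule prod_pos)
  assume uv: "u \<in> I" "v \<in> I"
  \<comment> \<open>The exponent of each coordinate in \<open>x u * x v\<close>; it is 2 at
    \<open>u = v\<close>, so both cases reduce to one-dimensional moments.\<close>
  define k where "k w = (if w = u then 1 else 0) + (if w = v then 1 else 0 :: nat)" for w
  have split: "x u * x v * g x = (\<Prod>w\<in>I. x w ^ k w * exp (- c w * (x w)\<^sup>2))" for x :: "'i \<Rightarrow> real"
  proof -
    have "(\<Prod>w\<in>I. x w ^ k w) = (\<Prod>w\<in>I. (if w = u then x w else 1) * (if w = v then x w else 1))"
      by (rule prod.cong) (auto simp: k_def power2_eq_square)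
    also have "\<dots> = x u * x v"
      using uv assms(1) by (simp add: prod.distrib prod.delta)
    finally show ?thesis by (simp add: g_def prod.distrib)
  qed
  show "integrable (Pi\<^sub>M I (\<lambda>_. lborel)) (\<lambda>x. x u * x v * g x)"
    unfolding split by (rule int)
  show "(LINT x|Pi\<^sub>M I (\<lambda>_. lborel). x u * x v * g x) = (if u = v then Z / (2 * c u) else 0)"
  proof (cases "u = v")
    case True
    have "(\<Prod>w\<in>I. M (k w) w) = M (k u) u * (\<Prod>w\<in>I - {u}. M (k w) w)"
      by (rule prod.remove[OF assms(1) uv(1)])
    also have "(\<Prod>w\<in>I - {u}. M (k w) w) = (\<Prod>w\<in>I - {u}. M 0 w)"
      by (rule prod.cong) (auto simp: k_def True)
    also have "M (k u) u = M 0 u / (2 * c u)"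
      using gaussian_moments(4)[OF assms(2)[OF uv(1)]] True by (simp add: M_def k_def numeral_2_eq_2)
    also have "M 0 u / (2 * c u) * (\<Prod>w\<in>I - {u}. M 0 w) = Z / (2 * c u)"
      unfolding Z by (simp add: prod.remove[OF assms(1) uv(1)])
    finally show ?thesis unfolding split val using True by simp
  next
    case False
    have "M (k u) u = 0"
      using gaussian_moments(3)[OF assms(2)[OF uv(1)]] False by (simp add: M_def k_def)
    then have "(\<Prod>w\<in>I. M (k w) w) = 0" using uv(1) assms(1) by auto
    then show ?thesis unfolding split val using False by simp
  qed
qed

section \<open>The Gaussian measure defined by the classical bracket\<close>

locale spectral_data =
  fixes \<phi> :: "nat \<Rightarrow> 'h :: hilbert_space" and lam :: "nat \<Rightarrow> real" and f :: "real \<Rightarrow> real" and N :: nat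
  assumes basis: "inj \<phi>" "is_onb (range \<phi>)"
    and smooth_f: "smooth f"
    and pos: "\<And>i j. i < N \<Longrightarrow> j < N \<Longrightarrow> ddiff (deriv f) [lam i, lam j] > 0"
begin

text \<open>Divided differences are symmetric, so the factor of a vertex depends only on the
  multiset of its indices.\<close>

definition dd :: "nat multiset \<Rightarrow> complex" where
  "dd M = complex_of_real (ddiff (deriv f) (map lam (sorted_list_of_multiset M)))"

lemma ddiff_dd: "complex_of_real (ddiff (deriv f) (map lam is)) = dd (mset is)"
  unfolding dd_def
  by (subst ddiff_permute[OF smooth_deriv[OF smooth_f], of "map lam is" "map lam (sorted_list_of_multiset (mset is))"])
     simp_all

lemma dd_step:
  "complex_of_real (lam i - lam j) * dd (add_mset i (add_mset j M)) = dd (add_mset i M) - dd (add_mset j M)"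
proof -
  obtain ks where ks: "mset ks = M" using ex_mset by blast
  have "(lam i - lam j) * ddiff (deriv f) (map lam (i # j # ks))
      = ddiff (deriv f) (map lam (i # ks)) - ddiff (deriv f) (map lam (j # ks))"
    using ddiff_step[OF smooth_deriv[OF smooth_f]] by simp
  from arg_cong[where f = complex_of_real, OF this] show ?thesis
    by (simp only: of_real_mult of_real_diff ddiff_dd) (simp add: ks)
qed

definition p :: "nat \<Rightarrow> nat \<Rightarrow> real" where
  "p i j = ddiff (deriv f) [lam i, lam j]"

lemma p_sym: "p i j = p j i"
  unfolding p_def by (rule ddiff_permute[OF smooth_deriv[OF smooth_f]]) simp

lemma p_pos: "i < N \<Longrightarrow> j < N \<Longrightarrow> p i j > 0"
  using pos by (simp add: p_def)

lemma dd_p: "dd {#i, j#} = complex_of_real (p i j)"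
  using ddiff_dd[of "[i, j]"] by (simp add: p_def)

lemma cinner_basis: "cinner (\<phi> i) (\<phi> j) = (if i = j then 1 else 0)"
  using basis unfolding is_onb_def by (auto simp: inj_def)

lemma cinner_sum_right: "cinner (x :: 'h) (\<Sum>i\<in>I. y i) = (\<Sum>i\<in>I. cinner x (y i))"
proof (induction I rule: infinite_finite_induct)
  case empty
  then show ?case using cinner_cscale_right[of x 0 0] by simp
next
  case (infinite A)
  then show ?case using cinner_cscale_right[of x 0 0] by simp
qed (simp_all add: cinner_add_right)

lemma cinner_mat_op:
  "cinner (\<phi> i) (mat_op \<phi> K q v) = (if i < K then \<Sum>j<K. q i j * cinner (\<phi> j) v else 0)"
proof -
  have "cinner (\<phi> i) (mat_op \<phi> K q v) = (\<Sum>k<K. \<Sum>j<K. (q k j * cinner (\<phi> j) v) * cinner (\<phi> i) (\<phi> k))"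
    by (simp add: mat_op_def cinner_sum_right cinner_cscale_right)
  also have "\<dots> = (\<Sum>k<K. if k = i then \<Sum>j<K. q k j * cinner (\<phi> j) v else 0)"
    by (intro sum.cong) (auto simp: cinner_basis)
  finally show ?thesis by (simp add: sum.delta)
qed

lemma entry_mat_op: "entry \<phi> (mat_op \<phi> K q) i j = (if i < K \<and> j < K then q i j else 0)"
proof -
  have "(\<Sum>k<K. q i k * cinner (\<phi> k) (\<phi> j)) = (\<Sum>k<K. if k = j then q i k else 0)"
    by (intro sum.cong) (auto simp: cinner_basis)
  then show ?thesis by (simp add: entry_def cinner_mat_op sum.delta)
qed

definition supported :: "nat \<Rightarrow> ('h \<Rightarrow> 'h) \<Rightarrow> bool" where
  "supported K V \<longleftrightarrow> (\<forall>i j. K \<le> i \<or> K \<le> j \<longrightarrow> entry \<phi> V i j = 0)"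

lemma supported_MK: "V \<in> MK \<phi> K \<Longrightarrow> K \<le> L \<Longrightarrow> supported L V"
  by (auto simp: MK_def supported_def entry_mat_op)

lemma supported_HK: "Q \<in> HK \<phi> N \<Longrightarrow> N \<le> L \<Longrightarrow> supported L Q"
  by (auto simp: HK_def intro: supported_MK)

text \<open>Each index of the tuple is the row index of one factor, so an index outside the common
  support kills the product and the infinite sum becomes finite.\<close>

lemma bracket_supported:
  assumes "Vs \<noteq> []" "\<And>V. V \<in> set Vs \<Longrightarrow> supported K V"
  shows "bracket \<phi> lam f Vs = (\<Sum>is | set is \<subseteq> {..<K} \<and> length is = length Vs.
     dd (mset is) * (\<Prod>k<length Vs. entry \<phi> (Vs ! k) (is ! k) (is ! (Suc k mod length Vs))))"
proof -
  let ?A = "{is. set is \<subseteq> {..<K} \<and> length is = length Vs}"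
  have "finite ?A" by (rule finite_lists_length_eq) simp
  moreover have "bracket \<phi> lam f Vs = (\<Sum>\<^sub>\<infinity>is\<in>?A.
      dd (mset is) * (\<Prod>k<length Vs. entry \<phi> (Vs ! k) (is ! k) (is ! (Suc k mod length Vs))))"
    unfolding bracket_def ddiff_dd
  proof (rule infsum_cong_neutral)
    fix "is" assume "is \<in> {is. length is = length Vs} - ?A"
    then obtain k where k: "k < length Vs" "is ! k \<ge> K"
      by (auto simp: in_set_conv_nth subset_iff not_less)
    then have "entry \<phi> (Vs ! k) (is ! k) (is ! (Suc k mod length Vs)) = 0"
      using assms(2)[of "Vs ! k"] by (auto simp: supported_def)
    then have "(\<Prod>k<length Vs. entry \<phi> (Vs ! k) (is ! k) (is ! (Suc k mod length Vs))) = 0"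
      using k(1) by (intro prod_zero) auto
    then show "dd (mset is) * (\<Prod>k<length Vs. entry \<phi> (Vs ! k) (is ! k) (is ! (Suc k mod length Vs))) = 0"
      by simp
  qed auto
  ultimately show ?thesis by simp
qed

lemma bracket_pair:
  assumes "supported K V" "supported K W"
  shows "bracket \<phi> lam f [V, W] = (\<Sum>i<K. \<Sum>j<K. complex_of_real (p i j) * (entry \<phi> V i j * entry \<phi> W j i))"
proof -
  have "bracket \<phi> lam f [V, W] = (\<Sum>is | set is \<subseteq> {..<K} \<and> length is = 2.
      dd (mset is) * (entry \<phi> V (is ! 0) (is ! 1) * entry \<phi> W (is ! 1) (is ! 0)))"
    using assms by (subst bracket_supported[where K = K]) (auto simp: numeral_2_eq_2 lessThan_Suc mult.commute)
  also have "\<dots> = (\<Sum>(i, j)\<in>{..<K} \<times> {..<K}. complex_of_real (p i j) * (entry \<phi> V i j * entry \<phi> W j i))"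
    by (rule sum.reindex_bij_witness[of _ "\<lambda>(i, j). [i, j]" "\<lambda>is. (is ! 0, is ! 1)"])
       (auto simp: length_Suc_conv numeral_2_eq_2 dd_p[symmetric])
  finally show ?thesis by (simp add: sum.cartesian_product)
qed

abbreviation Q_of :: "(nat \<times> nat \<Rightarrow> real) \<Rightarrow> 'h \<Rightarrow> 'h" where
  "Q_of x \<equiv> mat_op \<phi> N (herm_mat x)"

lemma Q_of_HK: "Q_of x \<in> HK \<phi> N"
proof -
  have herm: "cnj (herm_mat x i j) = herm_mat x j i" for i j
    by (auto simp: herm_mat_def complex_eq_iff)
  have left: "cinner (Q_of x u) v = (\<Sum>i<N. \<Sum>j<N. cnj (herm_mat x i j * cinner (\<phi> j) u) * cinner (\<phi> i) v)" for u v
  proof -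
    have "cinner v (Q_of x u) = (\<Sum>i<N. \<Sum>j<N. (herm_mat x i j * cinner (\<phi> j) u) * cinner v (\<phi> i))"
      by (simp add: mat_op_def cinner_sum_right cinner_cscale_right)
    then show ?thesis
      by (subst cinner_commute) (simp add: cinner_commute[of _ v, symmetric] cinner_commute[symmetric])
  qed
  have "cinner (Q_of x u) v = cinner u (Q_of x v)" for u v
  proof -
    have "cinner (Q_of x u) v = (\<Sum>i<N. \<Sum>j<N. herm_mat x j i * cinner u (\<phi> j) * cinner (\<phi> i) v)"
      unfolding left by (simp add: herm cinner_commute[symmetric])
    also have "\<dots> = (\<Sum>j<N. \<Sum>i<N. herm_mat x j i * cinner u (\<phi> j) * cinner (\<phi> i) v)"
      by (rule sum.swap)
    also have "\<dots> = cinner u (Q_of x v)"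
      by (simp add: mat_op_def cinner_sum_right cinner_cscale_right mult_ac)
    finally show ?thesis .
  qed
  then show ?thesis by (simp add: HK_def MK_def)
qed

text \<open>The coefficients of half of \<open>bracket \<phi> lam f [Q, Q]\<close> in real
  coordinates: an off-diagonal entry and its conjugate contribute twice to the trace, a diagonal
  entry once.\<close>

definition weight :: "nat \<times> nat \<Rightarrow> real" where
  "weight w = (if fst w = snd w then p (fst w) (snd w) / 2 else p (fst w) (snd w))"

abbreviation pairs :: "(nat \<times> nat) set" where
  "pairs \<equiv> {..<N} \<times> {..<N}"

abbreviation gauss :: "(nat \<times> nat \<Rightarrow> real) \<Rightarrow> real" where
  "gauss x \<equiv> \<Prod>w\<in>pairs. exp (- weight w * (x w)\<^sup>2)"

lemma exp_bracket: "exp (- bracket \<phi> lam f [Q_of x, Q_of x] / 2) = complex_of_real (gauss x)"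
proof -
  have "bracket \<phi> lam f [Q_of x, Q_of x]
      = (\<Sum>i<N. \<Sum>j<N. complex_of_real (p i j) * (herm_mat x i j * herm_mat x j i))"
    by (simp add: bracket_pair[OF supported_HK[OF Q_of_HK order_refl] supported_HK[OF Q_of_HK order_refl]] entry_mat_op)
  also have "\<dots> = complex_of_real (\<Sum>i<N. \<Sum>j<N. p i j * (if i = j then (x (i, j))\<^sup>2 else (x (i, j))\<^sup>2 + (x (j, i))\<^sup>2))"
    unfolding of_real_sum
    by (intro sum.cong) (auto simp: herm_mat_def complex_eq_iff power2_eq_square)
  also have "(\<Sum>i<N. \<Sum>j<N. p i j * (if i = j then (x (i, j))\<^sup>2 else (x (i, j))\<^sup>2 + (x (j, i))\<^sup>2))
      = (\<Sum>i<N. \<Sum>j<N. weight (i, j) * (x (i, j))\<^sup>2) + (\<Sum>i<N. \<Sum>j<N. weight (j, i) * (x (j, i))\<^sup>2)"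
    unfolding sum.distrib[symmetric]
    by (intro sum.cong) (auto simp: weight_def p_sym[of "_" "_"] algebra_simps p_sym)
  also have "(\<Sum>i<N. \<Sum>j<N. weight (j, i) * (x (j, i))\<^sup>2) = (\<Sum>i<N. \<Sum>j<N. weight (i, j) * (x (i, j))\<^sup>2)"
    by (rule sum.swap)
  finally have "bracket \<phi> lam f [Q_of x, Q_of x]
      = complex_of_real (2 * (\<Sum>w\<in>pairs. weight w * (x w)\<^sup>2))"
    by (simp add: sum.cartesian_product)
  then have "exp (- bracket \<phi> lam f [Q_of x, Q_of x] / 2) = exp (complex_of_real (- (\<Sum>w\<in>pairs. weight w * (x w)\<^sup>2)))"
    by simp
  also have "\<dots> = complex_of_real (exp (\<Sum>w\<in>pairs. - weight w * (x w)\<^sup>2))"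
    by (simp only: exp_of_real) (simp add: sum_negf)
  finally show ?thesis by (simp only: exp_sum finite_cartesian_product finite_lessThan)
qed

lemma weight_pos: "w \<in> pairs \<Longrightarrow> weight w > 0"
  using p_pos by (auto simp: weight_def)

abbreviation "gauss_measure \<equiv> Pi\<^sub>M pairs (\<lambda>_. lborel :: real measure)"

lemma gauss_norm:
  "HK_integral \<phi> N (\<lambda>Q. exp (- bracket \<phi> lam f [Q, Q] / 2)) = complex_of_real (LINT x|gauss_measure. gauss x)"
  "(LINT x|gauss_measure. gauss x) > 0"
  using gaussian_product_moments(2)[of pairs weight, OF _ weight_pos]
  unfolding HK_integral_def exp_bracket integral_complex_of_real by simp_all

text \<open>The covariance of the entries \<open>(a, b)\<close> and \<open>(c, d)\<close> of a
  Gaussian Hermitian matrix: an entry is correlated only with its conjugate.\<close>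

definition propagator :: "nat \<Rightarrow> nat \<Rightarrow> nat \<Rightarrow> nat \<Rightarrow> complex" where
  "propagator a b c d = (if a = d \<and> b = c \<and> a < N \<and> b < N then 1 / complex_of_real (p a b) else 0)"

lemma covariance:
  "integrable gauss_measure (\<lambda>x. entry \<phi> (Q_of x) a b * entry \<phi> (Q_of x) c d * complex_of_real (gauss x))"
  "(LINT x|gauss_measure. entry \<phi> (Q_of x) a b * entry \<phi> (Q_of x) c d * complex_of_real (gauss x))
    = propagator a b c d * complex_of_real (LINT x|gauss_measure. gauss x)"
proof -
  define Z where "Z = (LINT x|gauss_measure. gauss x)"
  have mi: "integrable gauss_measure (\<lambda>x. complex_of_real (x u * x v * gauss x))"
    and mv: "(LINT x|gauss_measure. complex_of_real (x u * x v * gauss x)) = complex_of_real (if u = v then Z / (2 * weight u) else 0)"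
    if "u \<in> pairs" "v \<in> pairs" for u v
    using gaussian_product_moments(3,4)[of pairs weight u v, OF _ weight_pos] that
    by (simp_all only: Z_def integrable_of_real integral_complex_of_real finite_cartesian_product finite_lessThan)
  show "integrable gauss_measure (\<lambda>x. entry \<phi> (Q_of x) a b * entry \<phi> (Q_of x) c d * complex_of_real (gauss x))"
    "(LINT x|gauss_measure. entry \<phi> (Q_of x) a b * entry \<phi> (Q_of x) c d * complex_of_real (gauss x))
      = propagator a b c d * complex_of_real (LINT x|gauss_measure. gauss x)"
  proof (atomize (full), cases "a < N \<and> b < N \<and> c < N \<and> d < N")
    case False
    then show "integrable gauss_measure (\<lambda>x. entry \<phi> (Q_of x) a b * entry \<phi> (Q_of x) c d * complex_of_real (gauss x)) \<and>
      (LINT x|gauss_measure. entry \<phi> (Q_of x) a b * entry \<phi> (Q_of x) c d * complex_of_real (gauss x))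
        = propagator a b c d * complex_of_real (LINT x|gauss_measure. gauss x)"
      by (auto simp: entry_mat_op propagator_def)
  next
    case True
    \<comment> \<open>The sign with which the imaginary coordinate enters an entry above or below
      the diagonal; the value 0 removes the imaginary part on the diagonal.\<close>
    define s where "s i j = (if i < j then 1 else if i = j then 0 else - 1 :: complex)" for i j :: nat
    have H: "entry \<phi> (Q_of x) i j = complex_of_real (x (min i j, max i j)) + s i j * \<i> * complex_of_real (x (max i j, min i j))"
      if "i < N" "j < N" for i j x
      using that by (auto simp: entry_mat_op herm_mat_def s_def complex_eq_iff min_def max_def)
    let ?u = "(min a b, max a b)" and ?u' = "(max a b, min a b)" and ?v = "(min c d, max c d)" and ?v' = "(max c d, min c d)"
    have in_pairs: "?u \<in> pairs" "?u' \<in> pairs" "?v \<in> pairs" "?v' \<in> pairs" using True by auto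
    have expand: "entry \<phi> (Q_of x) a b * entry \<phi> (Q_of x) c d * complex_of_real (gauss x)
        = complex_of_real (x ?u * x ?v * gauss x) + s c d * \<i> * complex_of_real (x ?u * x ?v' * gauss x)
          + s a b * \<i> * complex_of_real (x ?u' * x ?v * gauss x)
          - s a b * s c d * complex_of_real (x ?u' * x ?v' * gauss x)" for x
      using True by (simp add: H algebra_simps del: of_real_prod)
    have "integrable gauss_measure (\<lambda>x. entry \<phi> (Q_of x) a b * entry \<phi> (Q_of x) c d * complex_of_real (gauss x))"
      unfolding expand by (intro Bochner_Integration.integrable_add Bochner_Integration.integrable_diff integrable_mult_right mi in_pairs)
    moreover have "(LINT x|gauss_measure. entry \<phi> (Q_of x) a b * entry \<phi> (Q_of x) c d * complex_of_real (gauss x))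
        = complex_of_real (if ?u = ?v then Z / (2 * weight ?u) else 0)
          + s c d * \<i> * complex_of_real (if ?u = ?v' then Z / (2 * weight ?u) else 0)
          + s a b * \<i> * complex_of_real (if ?u' = ?v then Z / (2 * weight ?u') else 0)
          - s a b * s c d * complex_of_real (if ?u' = ?v' then Z / (2 * weight ?u') else 0)"
      unfolding expand
      by (simp only: Bochner_Integration.integral_add Bochner_Integration.integral_diff Bochner_Integration.integrable_add integrable_mult_right integral_mult_right_zero mi mv in_pairs)
    \<comment> \<open>Off the diagonal real and imaginary parts have equal variance: they cancel for
      an entry paired with itself and add up for an entry paired with its conjugate.\<close>
    moreover have "\<dots> = propagator a b c d * complex_of_real Z"
      using True p_sym[of a b]
      by (cases a b rule: linorder_cases; cases c d rule: linorder_cases)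
         (auto simp: s_def propagator_def weight_def min_def max_def)
    ultimately show "integrable gauss_measure (\<lambda>x. entry \<phi> (Q_of x) a b * entry \<phi> (Q_of x) c d * complex_of_real (gauss x)) \<and>
      (LINT x|gauss_measure. entry \<phi> (Q_of x) a b * entry \<phi> (Q_of x) c d * complex_of_real (gauss x))
        = propagator a b c d * complex_of_real (LINT x|gauss_measure. gauss x)"
      by (simp add: Z_def)
  qed
qed

text \<open>Connecting two external edges places \<open>Q\<close> in two slots, so the integrands
  are sums of products of two entries of \<open>Q\<close>, and the covariance evaluates
  them.\<close>

theorem HK_expectation:
  assumes "finite J" "\<And>Q. Q \<in> HK \<phi> N \<Longrightarrow> F Q = (\<Sum>j\<in>J. C j * (entry \<phi> Q (a j) (b j) * entry \<phi> Q (c j) (d j)))"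
  shows "HK_integral \<phi> N (\<lambda>Q. F Q * exp (- bracket \<phi> lam f [Q, Q] / 2))
      / HK_integral \<phi> N (\<lambda>Q. exp (- bracket \<phi> lam f [Q, Q] / 2))
    = (\<Sum>j\<in>J. C j * propagator (a j) (b j) (c j) (d j))"
proof -
  have "HK_integral \<phi> N (\<lambda>Q. F Q * exp (- bracket \<phi> lam f [Q, Q] / 2))
      = (LINT x|gauss_measure. (\<Sum>j\<in>J. C j *
          (entry \<phi> (Q_of x) (a j) (b j) * entry \<phi> (Q_of x) (c j) (d j) * complex_of_real (gauss x))))"
    unfolding HK_integral_def exp_bracket assms(2)[OF Q_of_HK]
    by (simp add: sum_distrib_right mult.assoc)
  also have "\<dots> = (\<Sum>j\<in>J. C j * (propagator (a j) (b j) (c j) (d j) * complex_of_real (LINT x|gauss_measure. gauss x)))"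
    by (subst Bochner_Integration.integral_sum) (simp_all only: covariance integrable_mult_right integral_mult_right_zero)
  also have "\<dots> = (\<Sum>j\<in>J. C j * propagator (a j) (b j) (c j) (d j)) * complex_of_real (LINT x|gauss_measure. gauss x)"
    by (simp add: sum_distrib_right mult.assoc)
  finally show ?thesis using gauss_norm by simp
qed

end

section \<open>The amplitude of a diagram\<close>

lemma cycle_from_properties:
  assumes "permutation \<sigma>"
  shows "distinct (cycle_from \<sigma> h)" "set (cycle_from \<sigma> h) = orbit \<sigma> h"
    "length (cycle_from \<sigma> h) = card (orbit \<sigma> h)" "cycle_from \<sigma> h \<noteq> []"
    and "k < card (orbit \<sigma> h) \<Longrightarrow>
      \<sigma> (cycle_from \<sigma> h ! k) = cycle_from \<sigma> h ! (Suc k mod card (orbit \<sigma> h))"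
proof -
  have self: "h \<in> orbit \<sigma> h" by (rule permutation_self_in_orbit[OF assms])
  define n where "n = funpow_dist1 \<sigma> h h"
  have inj: "inj_on (\<lambda>k. (\<sigma> ^^ k) h) {0..<n}" unfolding n_def by (rule inj_on_funpow_dist1[OF self])
  have orb: "orbit \<sigma> h = (\<lambda>k. (\<sigma> ^^ k) h) ` {0..<n}" unfolding n_def by (rule orbit_conv_funpow_dist1[OF self])
  have card: "card (orbit \<sigma> h) = n" unfolding orb by (simp add: card_image[OF inj])
  have period: "(\<sigma> ^^ n) h = h" unfolding n_def by (rule funpow_dist1_prop[OF self])
  have npos: "n > 0" by (simp add: n_def)
  show "distinct (cycle_from \<sigma> h)" "set (cycle_from \<sigma> h) = orbit \<sigma> h"
    "length (cycle_from \<sigma> h) = card (orbit \<sigma> h)" "cycle_from \<sigma> h \<noteq> []"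
    unfolding cycle_from_def card using inj orb[symmetric] npos by (simp_all add: distinct_map)
  show "\<sigma> (cycle_from \<sigma> h ! k) = cycle_from \<sigma> h ! (Suc k mod card (orbit \<sigma> h))" if "k < card (orbit \<sigma> h)"
  proof (cases "Suc k = n")
    case True
    then have "\<sigma> ((\<sigma> ^^ k) h) = h" using period by (metis comp_apply funpow.simps(2))
    then show ?thesis using True that npos by (simp add: cycle_from_def card)
  next
    case False
    then show ?thesis using that by (simp add: cycle_from_def card)
  qed
qed

context spectral_data
begin

text \<open>The two darts of an internal edge share its propagator evenly; the square root makes the
  amplitude a product over darts.\<close>

definition dart_factor :: "(nat \<Rightarrow> nat) \<Rightarrow> (nat \<Rightarrow> nat) \<Rightarrow> (nat \<Rightarrow> 'h \<Rightarrow> 'h) \<Rightarrow> (nat \<Rightarrow> nat) \<Rightarrow> nat \<Rightarrow> complex" where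
  "dart_factor \<sigma> \<alpha> V i x = (if \<alpha> x = x then entry \<phi> (V x) (i x) (i (\<sigma> x))
     else if i x = i (\<sigma> (\<alpha> x)) \<and> i x < N \<and> i (\<sigma> x) < N then csqrt (- 1 / complex_of_real (p (i x) (i (\<sigma> x)))) else 0)"

text \<open>Indices live on corners: \<open>i x\<close> belongs to the corner of the vertex just
  before the dart \<open>x\<close>, so \<open>x\<close> carries the matrix entry from
  \<open>i x\<close> to \<open>i (\<sigma> x)\<close>.\<close>

definition amp_term :: "(nat \<Rightarrow> nat) \<Rightarrow> nat set \<Rightarrow> (nat \<Rightarrow> nat) \<Rightarrow> (nat \<Rightarrow> 'h \<Rightarrow> 'h) \<Rightarrow> (nat \<Rightarrow> nat) \<Rightarrow> complex" where
  "amp_term \<sigma> H \<alpha> V i = (\<Prod>v\<in>orbit \<sigma> ` H. dd (image_mset i (mset_set v))) * (\<Prod>x\<in>H. dart_factor \<sigma> \<alpha> V i x)"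

definition amp_value :: "nat \<Rightarrow> (nat \<Rightarrow> nat) \<Rightarrow> nat set \<Rightarrow> (nat \<Rightarrow> nat) \<Rightarrow> (nat \<Rightarrow> 'h \<Rightarrow> 'h) \<Rightarrow> complex" where
  "amp_value K \<sigma> H \<alpha> V = (\<Sum>i \<in> H \<rightarrow>\<^sub>E {..<K}. amp_term \<sigma> H \<alpha> V i)"

text \<open>Reading index assignments along the cycle of \<open>h\<close> matches functions on the
  orbit with the index tuples of the bracket.\<close>

lemma amp_value_vertex:
  assumes \<sigma>: "permutation \<sigma>" and H: "H = orbit \<sigma> h" and ext: "\<And>x. x \<in> H \<Longrightarrow> \<alpha> x = x"
    and supp: "\<And>x. x \<in> H \<Longrightarrow> supported K (V x)"
  shows "bracket \<phi> lam f (map V (cycle_from \<sigma> h)) = amp_value K \<sigma> H \<alpha> V"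
proof -
  let ?c = "cycle_from \<sigma> h" and ?n = "card H"
  note c = cycle_from_properties(1-4)[OF \<sigma>, of h, folded H]
  have self: "h \<in> H" unfolding H by (rule permutation_self_in_orbit[OF \<sigma>])
  have "orbit \<sigma> x = H" if "x \<in> H" for x
    using orbit_cyclic_eq3[OF cyclic_on_orbit'[OF \<sigma>]] that H by blast
  then have orbs: "orbit \<sigma> ` H = {H}" using self by auto
  have bij: "bij_betw (\<lambda>k. ?c ! k) {..<?n} H"
    using bij_betw_nth[OF c(1)] c(2,3) by (metis lessThan_iff)
  define idx where "idx = inv_into {..<?n} (\<lambda>k. ?c ! k)"
  have idx: "idx x < ?n" "?c ! idx x = x" if "x \<in> H" for x
    using bij_betw_inv_into[OF bij] bij_betw_inv_into_right[OF bij that] that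
    by (auto simp: idx_def bij_betw_def)
  have idx_nth: "idx (?c ! k) = k" "?c ! k \<in> H" if "k < ?n" for k
    using bij_betw_inv_into_left[OF bij, of k] bij that by (auto simp: idx_def bij_betw_def)
  have bij_lists: "bij_betw (\<lambda>i. map i ?c) (H \<rightarrow>\<^sub>E {..<K}) {is. set is \<subseteq> {..<K} \<and> length is = ?n}"
  proof (rule bij_betwI[where g = "\<lambda>is. \<lambda>x\<in>H. is ! idx x"])
    show "(\<lambda>i. map i ?c) \<in> (H \<rightarrow>\<^sub>E {..<K}) \<rightarrow> {is. set is \<subseteq> {..<K} \<and> length is = ?n}"
    proof
      fix i assume "i \<in> H \<rightarrow>\<^sub>E {..<K}"
      then show "map i ?c \<in> {is. set is \<subseteq> {..<K} \<and> length is = ?n}"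
        by (auto simp: c(2,3))
    qed
    show "(\<lambda>is. \<lambda>x\<in>H. is ! idx x) \<in> {is. set is \<subseteq> {..<K} \<and> length is = ?n} \<rightarrow> (H \<rightarrow>\<^sub>E {..<K})"
    proof
      fix "is" assume "is \<in> {is. set is \<subseteq> {..<K} \<and> length is = ?n}"
      then have is': "set is \<subseteq> {..<K}" "length is = ?n" by auto
      have "is ! idx x < K" if "x \<in> H" for x
      proof -
        have "is ! idx x \<in> set is" using idx(1)[OF that] is'(2) by (intro nth_mem) simp
        then show ?thesis using is'(1) by auto
      qed
      then show "(\<lambda>x\<in>H. is ! idx x) \<in> H \<rightarrow>\<^sub>E {..<K}" by auto
    qed
    show "(\<lambda>x\<in>H. map i ?c ! idx x) = i" if i: "i \<in> H \<rightarrow>\<^sub>E {..<K}" for i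
    proof
      fix x
      show "(\<lambda>x\<in>H. map i ?c ! idx x) x = i x"
        using PiE_arb[OF i, of x] idx[of x] c(3) by (cases "x \<in> H") simp_all
    qed
    show "map (\<lambda>x\<in>H. is ! idx x) ?c = is" if "is \<in> {is. set is \<subseteq> {..<K} \<and> length is = ?n}" for "is"
      by (rule nth_equalityI) (use that c(3) idx_nth in auto)
  qed
  have "bracket \<phi> lam f (map V ?c) = (\<Sum>is | set is \<subseteq> {..<K} \<and> length is = length (map V ?c).
     dd (mset is) * (\<Prod>k<length (map V ?c). entry \<phi> (map V ?c ! k) (is ! k) (is ! (Suc k mod length (map V ?c)))))"
    by (rule bracket_supported) (use c supp in auto)
  also have "\<dots> = (\<Sum>is | set is \<subseteq> {..<K} \<and> length is = ?n.
     dd (mset is) * (\<Prod>k<?n. entry \<phi> (V (?c ! k)) (is ! k) (is ! (Suc k mod ?n))))"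
    using c(3) by (intro sum.cong prod.cong arg_cong2[where f = "(*)"]) auto
  also have "\<dots> = (\<Sum>i \<in> H \<rightarrow>\<^sub>E {..<K}. dd (mset (map i ?c)) *
      (\<Prod>k<?n. entry \<phi> (V (?c ! k)) (map i ?c ! k) (map i ?c ! (Suc k mod ?n))))"
    by (rule sum.reindex_bij_betw[OF bij_lists, symmetric])
  also have "\<dots> = (\<Sum>i \<in> H \<rightarrow>\<^sub>E {..<K}. amp_term \<sigma> H \<alpha> V i)"
  proof (rule sum.cong)
    fix i assume "i \<in> H \<rightarrow>\<^sub>E {..<K}"
    have "mset (map i ?c) = image_mset i (mset_set H)"
      using mset_set_set[OF c(1)] c(2) by simp
    moreover have "(\<Prod>k<?n. entry \<phi> (V (?c ! k)) (map i ?c ! k) (map i ?c ! (Suc k mod ?n)))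
        = (\<Prod>k<?n. dart_factor \<sigma> \<alpha> V i (?c ! k))"
    proof (rule prod.cong)
      fix k assume "k \<in> {..<?n}"
      then have k: "k < ?n" "Suc k mod ?n < ?n" by auto
      then have "?c ! k \<in> H" using c(2,3) nth_mem by metis
      then show "entry \<phi> (V (?c ! k)) (map i ?c ! k) (map i ?c ! (Suc k mod ?n)) = dart_factor \<sigma> \<alpha> V i (?c ! k)"
        using k c(3) cycle_from_properties(5)[OF \<sigma>, of k h, folded H] ext by (simp add: dart_factor_def)
    qed simp
    moreover have "(\<Prod>k<?n. dart_factor \<sigma> \<alpha> V i (?c ! k)) = (\<Prod>x\<in>H. dart_factor \<sigma> \<alpha> V i x)"
      by (rule prod.reindex_bij_betw[OF bij])
    ultimately show "dd (mset (map i ?c)) *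
      (\<Prod>k<?n. entry \<phi> (V (?c ! k)) (map i ?c ! k) (map i ?c ! (Suc k mod ?n))) = amp_term \<sigma> H \<alpha> V i"
      by (simp add: amp_term_def orbs)
  qed simp
  finally show ?thesis by (simp add: amp_value_def)
qed

lemma amp_term_cong:
  assumes \<sigma>: "permutation \<sigma>" and closed: "\<sigma> ` H \<subseteq> H" "\<alpha> ` H \<subseteq> H" and eq: "\<And>x. x \<in> H \<Longrightarrow> i x = j x"
  shows "amp_term \<sigma> H \<alpha> V i = amp_term \<sigma> H \<alpha> V j"
proof -
  have "orbit \<sigma> h \<subseteq> H" if "h \<in> H" for h
  proof
    fix x assume "x \<in> orbit \<sigma> h"
    then show "x \<in> H" by induction (use that closed in auto)
  qed
  moreover have "finite (orbit \<sigma> h)" for h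
    by (rule finite_orbit[OF permutation_self_in_orbit[OF \<sigma>]])
  ultimately have "image_mset i (mset_set v) = image_mset j (mset_set v)" if "v \<in> orbit \<sigma> ` H" for v
  proof -
    have "finite v" "v \<subseteq> H" using that \<open>\<And>h. h \<in> H \<Longrightarrow> orbit \<sigma> h \<subseteq> H\<close> \<open>\<And>h. finite (orbit \<sigma> h)\<close> by auto
    then show ?thesis by (intro image_mset_cong) (use eq in auto)
  qed
  moreover have "dart_factor \<sigma> \<alpha> V i x = dart_factor \<sigma> \<alpha> V j x" if "x \<in> H" for x
  proof -
    have "\<sigma> x \<in> H" "\<sigma> (\<alpha> x) \<in> H" using that closed by auto
    then show ?thesis using eq that by (simp add: dart_factor_def)
  qed
  ultimately show ?thesis unfolding amp_term_def by (simp cong: prod.cong)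
qed

lemma amp_value_union:
  assumes \<sigma>: "permutation \<sigma>" and fin: "finite H1" "finite H2" and disj: "H1 \<inter> H2 = {}"
    and closed: "\<sigma> ` H1 \<subseteq> H1" "\<alpha> ` H1 \<subseteq> H1" "\<sigma> ` H2 \<subseteq> H2" "\<alpha> ` H2 \<subseteq> H2"
  shows "amp_value K \<sigma> (H1 \<union> H2) \<alpha> V = amp_value K \<sigma> H1 \<alpha> V * amp_value K \<sigma> H2 \<alpha> V"
proof -
  have orb_sub: "orbit \<sigma> h \<subseteq> H" if "h \<in> H" "\<sigma> ` H \<subseteq> H" for h H
  proof
    fix x assume "x \<in> orbit \<sigma> h"
    then show "x \<in> H" by induction (use that in auto)
  qed
  have self: "h \<in> orbit \<sigma> h" for h by (rule permutation_self_in_orbit[OF \<sigma>])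
  have "orbit \<sigma> ` H1 \<inter> orbit \<sigma> ` H2 = {}"
  proof (rule equals0I)
    fix v assume "v \<in> orbit \<sigma> ` H1 \<inter> orbit \<sigma> ` H2"
    then obtain a b where "a \<in> H1" "v = orbit \<sigma> a" "b \<in> H2" "v = orbit \<sigma> b" by auto
    then have "a \<in> H1 \<inter> H2" using self[of a] orb_sub closed by blast
    then show False using disj by simp
  qed
  then have factor: "amp_term \<sigma> (H1 \<union> H2) \<alpha> V i = amp_term \<sigma> H1 \<alpha> V i * amp_term \<sigma> H2 \<alpha> V i" for i
    using fin disj by (simp add: amp_term_def image_Un prod.union_disjoint)
  have bij: "bij_betw (\<lambda>i. (restrict i H1, restrict i H2)) ((H1 \<union> H2) \<rightarrow>\<^sub>E {..<K})
      ((H1 \<rightarrow>\<^sub>E {..<K}) \<times> (H2 \<rightarrow>\<^sub>E {..<K}))"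
    by (rule bij_betwI[where g = "\<lambda>(a, b) x. if x \<in> H1 then a x else if x \<in> H2 then b x else undefined"])
       (use disj in \<open>auto simp: fun_eq_iff PiE_def extensional_def Pi_def\<close>)
  have "amp_value K \<sigma> (H1 \<union> H2) \<alpha> V
      = (\<Sum>i \<in> (H1 \<union> H2) \<rightarrow>\<^sub>E {..<K}. amp_term \<sigma> H1 \<alpha> V (restrict i H1) * amp_term \<sigma> H2 \<alpha> V (restrict i H2))"
    unfolding amp_value_def factor
    by (intro sum.cong arg_cong2[where f = "(*)"] amp_term_cong \<sigma> closed) auto
  also have "\<dots> = (\<Sum>(a, b) \<in> (H1 \<rightarrow>\<^sub>E {..<K}) \<times> (H2 \<rightarrow>\<^sub>E {..<K}). amp_term \<sigma> H1 \<alpha> V a * amp_term \<sigma> H2 \<alpha> V b)"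
    using sum.reindex_bij_betw[OF bij, of "\<lambda>(a, b). amp_term \<sigma> H1 \<alpha> V a * amp_term \<sigma> H2 \<alpha> V b"] by simp
  finally show ?thesis by (simp add: amp_value_def sum_product sum.cartesian_product)
qed

text \<open>For fixed indices the integrand is a constant times two entries of \<open>Q\<close>,
  whose expectation is the propagator. The support of the propagator is the index matching across
  the new edge, and its negative is the product of the two square roots in
  \<open>dart_factor\<close>.\<close>

lemma amp_value_connect:
  assumes fin: "finite H" and h: "h \<in> H" "h' \<in> H" "h \<noteq> h'" "\<alpha> h = h" "\<alpha> h' = h'"
    and F: "\<And>Q. Q \<in> HK \<phi> N \<Longrightarrow> F Q = amp_value K \<sigma> H \<alpha> (V(h := Q, h' := Q))"
  shows "- (HK_integral \<phi> N (\<lambda>Q. F Q * exp (- bracket \<phi> lam f [Q, Q] / 2))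
      / HK_integral \<phi> N (\<lambda>Q. exp (- bracket \<phi> lam f [Q, Q] / 2)))
    = amp_value K \<sigma> H (\<alpha>(h := h', h' := h)) V"
proof -
  let ?\<alpha> = "\<alpha>(h := h', h' := h)"
  define C where "C i = (\<Prod>v\<in>orbit \<sigma> ` H. dd (image_mset i (mset_set v)))
      * (\<Prod>x\<in>H - {h, h'}. dart_factor \<sigma> \<alpha> V i x)" for i
  have split: "(\<Prod>x\<in>H. g x) = g h * g h' * (\<Prod>x\<in>H - {h, h'}. g x)" for g :: "nat \<Rightarrow> complex"
  proof -
    have "(\<Prod>x\<in>H. g x) = g h * (\<Prod>x\<in>H - {h}. g x)" by (rule prod.remove[OF fin h(1)])
    also have "(\<Prod>x\<in>H - {h}. g x) = g h' * (\<Prod>x\<in>H - {h} - {h'}. g x)"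
      using fin h by (intro prod.remove) auto
    also have "H - {h} - {h'} = H - {h, h'}" by auto
    finally show ?thesis by (simp add: mult.assoc)
  qed
  have before: "amp_term \<sigma> H \<alpha> (V(h := Q, h' := Q)) i
      = C i * (entry \<phi> Q (i h) (i (\<sigma> h)) * entry \<phi> Q (i h') (i (\<sigma> h')))" for Q i
  proof -
    have "(\<Prod>x\<in>H - {h, h'}. dart_factor \<sigma> \<alpha> (V(h := Q, h' := Q)) i x) = (\<Prod>x\<in>H - {h, h'}. dart_factor \<sigma> \<alpha> V i x)"
      by (rule prod.cong) (auto simp: dart_factor_def)
    then show ?thesis
      unfolding amp_term_def split C_def using h by (simp add: dart_factor_def mult_ac)
  qed
  have after: "amp_term \<sigma> H ?\<alpha> V i = - (C i * propagator (i h) (i (\<sigma> h)) (i h') (i (\<sigma> h')))" for i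
  proof -
    have "(\<Prod>x\<in>H - {h, h'}. dart_factor \<sigma> ?\<alpha> V i x) = (\<Prod>x\<in>H - {h, h'}. dart_factor \<sigma> \<alpha> V i x)"
      by (rule prod.cong) (auto simp: dart_factor_def)
    moreover have "dart_factor \<sigma> ?\<alpha> V i h * dart_factor \<sigma> ?\<alpha> V i h'
        = - propagator (i h) (i (\<sigma> h)) (i h') (i (\<sigma> h'))"
      using h(3) p_sym[of "i h" "i h'"]
      by (auto simp: dart_factor_def propagator_def power2_eq_square[symmetric])
    ultimately show ?thesis
      unfolding amp_term_def split C_def by (simp add: mult_ac)
  qed
  have "HK_integral \<phi> N (\<lambda>Q. F Q * exp (- bracket \<phi> lam f [Q, Q] / 2))
      / HK_integral \<phi> N (\<lambda>Q. exp (- bracket \<phi> lam f [Q, Q] / 2))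
    = (\<Sum>i \<in> H \<rightarrow>\<^sub>E {..<K}. C i * propagator (i h) (i (\<sigma> h)) (i h') (i (\<sigma> h')))"
    by (rule HK_expectation) (use fin in \<open>simp_all add: finite_PiE F amp_value_def before\<close>)
  then show ?thesis by (simp add: amp_value_def after sum_negf)
qed

text \<open>The closed formula does not record the order in which edges were connected, so all
  derivations give the same amplitude. The bound \<open>N \<le> K\<close> covers the matrices
  \<open>Q\<close> inserted at connected darts.\<close>

lemma amplitude_value:
  assumes "amplitude \<phi> lam f N \<sigma> H \<alpha> V z" and \<sigma>: "permutation \<sigma>" and "finite H" "\<sigma> ` H \<subseteq> H" "\<alpha> ` H \<subseteq> H"
    and "\<And>x. x \<in> H \<Longrightarrow> \<alpha> (\<alpha> x) = x" "\<And>x. x \<in> H \<Longrightarrow> \<alpha> x = x \<Longrightarrow> supported K (V x)" and NK: "N \<le> K"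
  shows "z = amp_value K \<sigma> H \<alpha> V"
  using assms(1,3-7)
proof induction
  case (vertex h H \<alpha> V)
  show ?case by (rule amp_value_vertex[OF \<sigma>]) (use vertex in auto)
next
  case (union H1 \<alpha> V z1 H2 z2)
  have "z1 = amp_value K \<sigma> H1 \<alpha> V"
    by (rule union.IH(1)) (use union.prems union.hyps in auto)
  moreover have "z2 = amp_value K \<sigma> H2 \<alpha> V"
    by (rule union.IH(2)) (use union.prems union.hyps in auto)
  ultimately show ?case
    using amp_value_union[OF \<sigma> _ _ union.hyps(3-7), of K V] union.prems(1) by simp
next
  case (connect h H h' \<alpha> V F)
  have \<alpha>_eq: "\<alpha> x = (\<alpha>(h := h', h' := h)) x" if "x \<noteq> h" "x \<noteq> h'" for x using that by simp
  \<comment> \<open>The new opposite map is an involution exchanging \<open>h\<close> and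
    \<open>h'\<close>, so no third dart is sent to either of them.\<close>
  have keep: "\<alpha> x \<noteq> h \<and> \<alpha> x \<noteq> h'" if "x \<in> H" "x \<noteq> h" "x \<noteq> h'" for x
    using connect.prems(4)[OF that(1)] that connect.hyps(3) by (auto split: if_splits)
  show ?case
  proof (rule amp_value_connect)
    fix Q assume Q: "Q \<in> HK \<phi> N"
    show "F Q = amp_value K \<sigma> H \<alpha> (V(h := Q, h' := Q))"
    proof (rule conjunct2[OF connect.IH[rule_format, OF Q], rule_format])
      show "finite H" "\<sigma> ` H \<subseteq> H" by (fact connect.prems)+
      show "\<alpha> ` H \<subseteq> H"
        using connect.prems(3) connect.hyps by (auto simp: image_subset_iff split: if_splits)
      show "\<alpha> (\<alpha> x) = x" if "x \<in> H" for x
        using connect.prems(4)[OF that] connect.hyps keep[OF that] by (auto split: if_splits)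
      show "supported K ((V(h := Q, h' := Q)) x)" if "x \<in> H" "\<alpha> x = x" for x
        using connect.prems(5)[OF that(1)] that supported_HK[OF Q NK] by auto
    qed
  qed (use connect in auto)
qed

text \<open>Cutting internal edges one at a time reduces the claim to isolated vertices, which the
  union rule puts together.\<close>

lemma amplitude_exists:
  assumes \<sigma>: "permutation \<sigma>" and "finite H" "H \<noteq> {}" "\<sigma> ` H \<subseteq> H" "\<alpha> ` H \<subseteq> H" "\<And>x. x \<in> H \<Longrightarrow> \<alpha> (\<alpha> x) = x"
  shows "\<exists>z. amplitude \<phi> lam f N \<sigma> H \<alpha> V z"
  using assms(2-)
proof (induction "card {x \<in> H. \<alpha> x \<noteq> x}" arbitrary: \<alpha> V rule: less_induct)
  case (less \<alpha> V)
  show ?case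
  proof (cases "\<exists>h\<in>H. \<alpha> h \<noteq> h")
    case True
    then obtain h where h: "h \<in> H" "\<alpha> h \<noteq> h" by auto
    define h' where "h' = \<alpha> h"
    have h': "h' \<in> H" "\<alpha> h' = h" "h' \<noteq> h" using h less.prems by (auto simp: h'_def)
    define \<beta> where "\<beta> = \<alpha>(h := h, h' := h')"
    have ex: "\<exists>z. amplitude \<phi> lam f N \<sigma> H \<beta> W z" for W
    proof (rule less.hyps)
      have "{x \<in> H. \<beta> x \<noteq> x} \<subset> {x \<in> H. \<alpha> x \<noteq> x}" using h by (auto simp: \<beta>_def)
      then show "card {x \<in> H. \<beta> x \<noteq> x} < card {x \<in> H. \<alpha> x \<noteq> x}"
        using less.prems(1) by (intro psubset_card_mono) auto
      show "finite H" "H \<noteq> {}" "\<sigma> ` H \<subseteq> H" by (fact less.prems)+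
      show "\<beta> ` H \<subseteq> H" using less.prems(4) h h' by (auto simp: \<beta>_def)
      show "\<beta> (\<beta> x) = x" if "x \<in> H" for x
        using less.prems(5)[OF that] h' by (auto simp: \<beta>_def h'_def)
    qed
    then have "\<forall>Q. \<exists>z. amplitude \<phi> lam f N \<sigma> H \<beta> (V(h := Q, h' := Q)) z" by blast
    then obtain F where F: "\<forall>Q. amplitude \<phi> lam f N \<sigma> H \<beta> (V(h := Q, h' := Q)) (F Q)" by (auto dest: choice)
    have "amplitude \<phi> lam f N \<sigma> H (\<beta>(h := h', h' := h)) V
        (- (HK_integral \<phi> N (\<lambda>Q. F Q * exp (- bracket \<phi> lam f [Q, Q] / 2))
          / HK_integral \<phi> N (\<lambda>Q. exp (- bracket \<phi> lam f [Q, Q] / 2))))"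
      by (rule amplitude.connect[OF h(1) h'(1) h'(3)[symmetric]]) (use F in \<open>auto simp: \<beta>_def\<close>)
    moreover have "\<beta>(h := h', h' := h) = \<alpha>" using h' by (auto simp: \<beta>_def h'_def)
    ultimately show ?thesis by auto
  next
    case False
    then have fix_all: "\<alpha> x = x" if "x \<in> H" for x using that by auto
    have "\<exists>z. amplitude \<phi> lam f N \<sigma> H' \<alpha> V z" if "H' \<subseteq> H" "H' \<noteq> {}" "\<sigma> ` H' \<subseteq> H'" for H'
      using that
    proof (induction "card H'" arbitrary: H' rule: less_induct)
      case (less H')
      obtain h where h: "h \<in> H'" using less.prems by auto
      have sub: "orbit \<sigma> h \<subseteq> H'"
      proof
        fix x assume "x \<in> orbit \<sigma> h"
        then show "x \<in> H'" by induction (use less.prems h in auto)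
      qed
      have self: "h \<in> orbit \<sigma> h" by (rule permutation_self_in_orbit[OF \<sigma>])
      have v: "\<exists>z. amplitude \<phi> lam f N \<sigma> (orbit \<sigma> h) \<alpha> V z"
      proof -
        have "\<forall>x\<in>orbit \<sigma> h. \<alpha> x = x" using sub less.prems(1) fix_all by auto
        from amplitude.vertex[OF self refl this] show ?thesis by blast
      qed
      show ?case
      proof (cases "H' = orbit \<sigma> h")
        case True
        then show ?thesis using v by simp
      next
        case False
        have finH: "finite H'" using less.prems(1) \<open>finite H\<close> finite_subset by blast
        have rest: "\<sigma> ` (H' - orbit \<sigma> h) \<subseteq> H' - orbit \<sigma> h"
        proof
          fix y assume "y \<in> \<sigma> ` (H' - orbit \<sigma> h)"
          then obtain x where x: "x \<in> H'" "x \<notin> orbit \<sigma> h" "y = \<sigma> x" by auto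
          have "y \<notin> orbit \<sigma> h"
          proof
            assume "y \<in> orbit \<sigma> h"
            then have "orbit \<sigma> (\<sigma> x) = orbit \<sigma> h"
              using orbit_cyclic_eq3[OF cyclic_on_orbit'[OF \<sigma>]] x by simp
            then have "orbit \<sigma> x = orbit \<sigma> h" by (simp add: permutation_orbit_step[OF \<sigma>])
            then show False using x permutation_self_in_orbit[OF \<sigma>, of x] by simp
          qed
          then show "y \<in> H' - orbit \<sigma> h" using x less.prems by auto
        qed
        have "\<exists>z. amplitude \<phi> lam f N \<sigma> (H' - orbit \<sigma> h) \<alpha> V z"
        proof (rule less.hyps)
          show "card (H' - orbit \<sigma> h) < card H'"
            using finH h self by (intro psubset_card_mono) auto
        qed (use less.prems rest sub False in auto)
        then obtain z1 z2 where "amplitude \<phi> lam f N \<sigma> (orbit \<sigma> h) \<alpha> V z1"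
          "amplitude \<phi> lam f N \<sigma> (H' - orbit \<sigma> h) \<alpha> V z2" using v by auto
        then have "amplitude \<phi> lam f N \<sigma> (orbit \<sigma> h \<union> (H' - orbit \<sigma> h)) \<alpha> V (z1 * z2)"
        proof (rule amplitude.union)
          show "\<sigma> ` orbit \<sigma> h \<subseteq> orbit \<sigma> h" by (auto intro: orbit.step)
          show "\<alpha> ` orbit \<sigma> h \<subseteq> orbit \<sigma> h" "\<alpha> ` (H' - orbit \<sigma> h) \<subseteq> H' - orbit \<sigma> h"
            using fix_all sub less.prems(1) by auto
        qed (use rest in auto)
        moreover have "orbit \<sigma> h \<union> (H' - orbit \<sigma> h) = H'" using sub by auto
        ultimately show ?thesis by auto
      qed
    qed
    then show ?thesis using less.prems by blast
  qed
qed

lemma Gamma_amp_value: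
  assumes "point_diagram n G" "darts G \<noteq> {}" "N \<le> K" "length Vs = n" "\<And>V. V \<in> set Vs \<Longrightarrow> supported K V"
  shows "Gamma_amp \<phi> lam f N G Vs = amp_value K (nxt G) (darts G) (opp G) (\<lambda>h. Vs ! mark G h)"
proof -
  have fin: "finite (darts G)" and \<sigma>: "nxt G permutes darts G" and \<alpha>: "opp G permutes darts G"
    and inv: "\<And>h. opp G (opp G h) = h" and mark: "bij_betw (mark G) (ext_darts G) {..<n}"
    using assms(1) by (auto simp: point_diagram_def)
  have perm: "permutation (nxt G)" using fin \<sigma> by (auto simp: permutation_permutes)
  have closed: "nxt G ` darts G \<subseteq> darts G" "opp G ` darts G \<subseteq> darts G"
    using permutes_image[OF \<sigma>] permutes_image[OF \<alpha>] by auto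
  have supp: "supported K (Vs ! mark G x)" if "x \<in> darts G" "opp G x = x" for x
  proof -
    have "x \<in> ext_darts G" using that by (simp add: ext_darts_def)
    then have "mark G x < n" using mark by (auto simp: bij_betw_def)
    then show ?thesis using assms(4,5) by simp
  qed
  obtain z where z: "amplitude \<phi> lam f N (nxt G) (darts G) (opp G) (\<lambda>h. Vs ! mark G h) z"
    using amplitude_exists[OF perm fin assms(2) closed inv] by blast
  have unique: "y = amp_value K (nxt G) (darts G) (opp G) (\<lambda>h. Vs ! mark G h)"
    if "amplitude \<phi> lam f N (nxt G) (darts G) (opp G) (\<lambda>h. Vs ! mark G h) y" for y
    by (rule amplitude_value[OF that perm fin closed inv supp assms(3)])
  show ?thesis unfolding Gamma_amp_def
    by (rule the_equality) (use z unique in auto)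
qed

end

section \<open>The one-loop bracket as a finite sum\<close>

context spectral_data
begin

lemma amp_value_iso:
  assumes "point_diagram n G" "point_diagram n G'" "diagram_iso G G'"
  shows "amp_value K (nxt G) (darts G) (opp G) (\<lambda>h. Vs ! mark G h)
    = amp_value K (nxt G') (darts G') (opp G') (\<lambda>h. Vs ! mark G' h)"
proof -
  obtain g where g: "bij_betw g (darts G) (darts G')"
    and nxt: "\<And>h. h \<in> darts G \<Longrightarrow> g (nxt G h) = nxt G' (g h)"
    and opp: "\<And>h. h \<in> darts G \<Longrightarrow> g (opp G h) = opp G' (g h)"
    and mark: "\<And>h. h \<in> ext_darts G \<Longrightarrow> mark G' (g h) = mark G h"
    using assms(3) unfolding diagram_iso_def by blast
  have fin: "finite (darts G)" and \<sigma>: "nxt G permutes darts G" and \<alpha>: "opp G permutes darts G"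
    using assms(1) by (auto simp: point_diagram_def)
  have inj: "inj_on g (darts G)" and img: "g ` darts G = darts G'" using g by (auto simp: bij_betw_def)
  have \<sigma>in: "nxt G h \<in> darts G" and \<alpha>in: "opp G h \<in> darts G" if "h \<in> darts G" for h
    using that permutes_in_image[OF \<sigma>] permutes_in_image[OF \<alpha>] by auto
  have orb_sub: "orbit (nxt G) h \<subseteq> darts G" if "h \<in> darts G" for h
    by (rule permutes_orbit_subset[OF \<sigma> that])
  have orb: "orbit (nxt G') (g h) = g ` orbit (nxt G) h" if "h \<in> darts G" for h
  proof (rule orbit_inverse[symmetric])
    show "h \<in> orbit (nxt G) h"
      by (intro permutation_self_in_orbit permutes_imp_permutation[OF fin \<sigma>])
    show "nxt G' (g x) = g (nxt G x)" if "x \<in> orbit (nxt G) h" for x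
      using nxt[of x] that orb_sub[OF \<open>h \<in> darts G\<close>] by auto
  qed
  have vertices: "orbit (nxt G') ` darts G' = (\<lambda>v. g ` v) ` (orbit (nxt G) ` darts G)"
    unfolding img[symmetric] image_image by (rule image_cong) (simp_all add: orb)
  have inj_img: "inj_on (\<lambda>v. g ` v) (orbit (nxt G) ` darts G)"
    by (rule inj_on_subset[OF inj_on_image_Pow[OF inj]]) (use orb_sub in auto)
  have opp_eq: "opp G' (g x) = g x \<longleftrightarrow> opp G x = x" if "x \<in> darts G" for x
    using opp[OF that] inj_on_eq_iff[OF inj \<alpha>in[OF that] that] by simp
  define T where "T i = restrict (i \<circ> g) (darts G)" for i :: "nat \<Rightarrow> nat"
  have "bij_betw T (darts G' \<rightarrow>\<^sub>E {..<K}) (darts G \<rightarrow>\<^sub>E {..<K})"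
  proof (rule bij_betwI[where g = "\<lambda>i. restrict (i \<circ> inv_into (darts G) g) (darts G')"])
    show "T \<in> (darts G' \<rightarrow>\<^sub>E {..<K}) \<rightarrow> (darts G \<rightarrow>\<^sub>E {..<K})"
    proof
      fix i assume i: "i \<in> darts G' \<rightarrow>\<^sub>E {..<K}"
      have "i (g h) < K" if "h \<in> darts G" for h
        using PiE_mem[OF i, of "g h"] img that by auto
      then show "T i \<in> darts G \<rightarrow>\<^sub>E {..<K}" by (auto simp: T_def)
    qed
    show "(\<lambda>i. restrict (i \<circ> inv_into (darts G) g) (darts G')) \<in> (darts G \<rightarrow>\<^sub>E {..<K}) \<rightarrow> (darts G' \<rightarrow>\<^sub>E {..<K})"
      using bij_betw_inv_into[OF g] by (auto simp: bij_betw_def PiE_def Pi_def)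
    show "restrict (T i \<circ> inv_into (darts G) g) (darts G') = i" if "i \<in> darts G' \<rightarrow>\<^sub>E {..<K}" for i
    proof
      fix x
      show "restrict (T i \<circ> inv_into (darts G) g) (darts G') x = i x"
        using PiE_arb[OF that, of x] bij_betw_inv_into_right[OF g, of x]
          bij_betw_inv_into[OF g] by (cases "x \<in> darts G'") (auto simp: T_def bij_betw_def)
    qed
    show "T (restrict (i \<circ> inv_into (darts G) g) (darts G')) = i" if "i \<in> darts G \<rightarrow>\<^sub>E {..<K}" for i
    proof
      fix x
      show "T (restrict (i \<circ> inv_into (darts G) g) (darts G')) x = i x"
        using PiE_arb[OF that, of x] bij_betw_inv_into_left[OF g, of x] img
        by (cases "x \<in> darts G") (auto simp: T_def)
    qed
  qed
  from sum.reindex_bij_betw[OF this, of "amp_term (nxt G) (darts G) (opp G) (\<lambda>h. Vs ! mark G h)"]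
  have "amp_value K (nxt G) (darts G) (opp G) (\<lambda>h. Vs ! mark G h)
      = (\<Sum>i \<in> darts G' \<rightarrow>\<^sub>E {..<K}. amp_term (nxt G) (darts G) (opp G) (\<lambda>h. Vs ! mark G h) (T i))"
    by (simp add: amp_value_def)
  also have "\<dots> = (\<Sum>i \<in> darts G' \<rightarrow>\<^sub>E {..<K}. amp_term (nxt G') (darts G') (opp G') (\<lambda>h. Vs ! mark G' h) i)"
  proof (rule sum.cong)
    fix i assume "i \<in> darts G' \<rightarrow>\<^sub>E {..<K}"
    have "(\<Prod>v\<in>orbit (nxt G') ` darts G'. dd (image_mset i (mset_set v)))
        = (\<Prod>v\<in>orbit (nxt G) ` darts G. dd (image_mset (T i) (mset_set v)))"
      unfolding vertices prod.reindex[OF inj_img] comp_def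
    proof (rule prod.cong)
      fix v assume v: "v \<in> orbit (nxt G) ` darts G"
      then have sub: "v \<subseteq> darts G" using orb_sub by auto
      then have "finite v" using fin finite_subset by blast
      moreover have "mset_set (g ` v) = image_mset g (mset_set v)"
        by (rule image_mset_mset_set[symmetric]) (rule inj_on_subset[OF inj sub])
      moreover have "image_mset (\<lambda>x. i (g x)) (mset_set v) = image_mset (T i) (mset_set v)"
        using sub \<open>finite v\<close> by (intro image_mset_cong) (auto simp: T_def)
      ultimately show "dd (image_mset i (mset_set (g ` v))) = dd (image_mset (T i) (mset_set v))"
        by (simp add: multiset.map_comp comp_def)
    qed simp
    moreover have "(\<Prod>x\<in>darts G'. dart_factor (nxt G') (opp G') (\<lambda>h. Vs ! mark G' h) i x)
        = (\<Prod>x\<in>darts G. dart_factor (nxt G) (opp G) (\<lambda>h. Vs ! mark G h) (T i) x)"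
      unfolding img[symmetric] prod.reindex[OF inj] comp_def
    proof (rule prod.cong)
      fix x assume x: "x \<in> darts G"
      have "T i x = i (g x)" "T i (nxt G x) = i (nxt G' (g x))"
        "T i (nxt G (opp G x)) = i (nxt G' (opp G' (g x)))"
        using x \<sigma>in \<alpha>in nxt opp by (simp_all add: T_def)
      moreover have "mark G' (g x) = mark G x" if "opp G x = x"
        using mark[of x] that x by (simp add: ext_darts_def)
      ultimately show "dart_factor (nxt G') (opp G') (\<lambda>h. Vs ! mark G' h) i (g x)
          = dart_factor (nxt G) (opp G) (\<lambda>h. Vs ! mark G h) (T i) x"
        using opp_eq[OF x] by (auto simp: dart_factor_def)
    qed simp
    ultimately show "amp_term (nxt G) (darts G) (opp G) (\<lambda>h. Vs ! mark G h) (T i)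
        = amp_term (nxt G') (darts G') (opp G') (\<lambda>h. Vs ! mark G' h) i"
      by (simp add: amp_term_def)
  qed simp
  finally show ?thesis by (simp add: amp_value_def)
qed

text \<open>The corner indices at the vertex of \<open>s\<close> outside the loop: one before each
  external dart and one before the outgoing dart, the latter shared with the next vertex.\<close>

definition window :: "nat \<Rightarrow> nat set \<Rightarrow> (nat \<Rightarrow> nat) \<Rightarrow> nat \<Rightarrow> nat multiset" where
  "window n S j s = image_mset j (mset_set {m \<in> {..<n}. owner S m = s})
     + image_mset j (mset_set {m \<in> S. owner S (cpred n m) = s})"

definition cut_weight :: "nat \<Rightarrow> nat set \<Rightarrow> nat \<Rightarrow> (nat \<Rightarrow> nat) \<Rightarrow> complex" where
  "cut_weight n S k j = (\<Prod>s\<in>S. - 1 / complex_of_real (p k (j s)) * dd (add_mset k (window n S j s)))"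

text \<open>Index matching across the loop edges gives all inner corners one index \<open>k\<close>,
  and gives the corner before \<open>3 m + 2\<close> the index of the external corner facing it
  across the edge.\<close>

definition loop_index :: "nat \<Rightarrow> nat set \<Rightarrow> nat \<Rightarrow> (nat \<Rightarrow> nat) \<Rightarrow> nat \<Rightarrow> nat" where
  "loop_index n S k j = (\<lambda>h\<in>loop_darts n S. if h mod 3 = 1 then k else j (h div 3))"

text \<open>An assignment of any other form violates a condition at a loop edge and contributes
  zero. What survives is one vertex factor and one propagator per cut, all involving the inner index
  \<open>k\<close>.\<close>

lemma amp_value_loop:
  assumes "cut_points n S" "N \<le> K"
  shows "amp_value K (nxt (loop_diagram n S)) (darts (loop_diagram n S)) (opp (loop_diagram n S))
      (\<lambda>h. Vs ! mark (loop_diagram n S) h)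
    = (\<Sum>k<N. \<Sum>j | j \<in> {..<n} \<rightarrow>\<^sub>E {..<K} \<and> (\<forall>s\<in>S. j s < N).
        cut_weight n S k j * (\<Prod>m<n. entry \<phi> (Vs ! m) (j m) (j (csucc n m))))"
proof -
  interpret cut_points n S by fact
  let ?L = "loop_darts n S" and ?\<sigma> = "loop_nxt n S" and ?\<alpha> = "loop_opp n S" and ?V = "\<lambda>h. Vs ! (h div 3)"
  let ?J = "{j \<in> {..<n} \<rightarrow>\<^sub>E {..<K}. \<forall>s\<in>S. j s < N}"
  let ?I = "loop_index n S"
  have I_simps: "m < n \<Longrightarrow> ?I k j (3 * m) = j m" "m \<in> S \<Longrightarrow> ?I k j (Suc (3 * m)) = k"
    "m \<in> S \<Longrightarrow> ?I k j (Suc (Suc (3 * m))) = j m" for m k j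
    by (simp_all add: loop_index_def)
  have split: "(\<Prod>x\<in>?L. F x) = (\<Prod>m<n. F (3 * m)) * (\<Prod>m\<in>S. F (Suc (3 * m)) * F (Suc (Suc (3 * m))))"
    for F :: "nat \<Rightarrow> complex"
  proof -
    have "?L = ((\<lambda>m. 3 * m) ` {..<n} \<union> (\<lambda>m. Suc (3 * m)) ` S) \<union> (\<lambda>m. Suc (Suc (3 * m))) ` S"
      by (auto simp: loop_darts_def)
    then have "(\<Prod>x\<in>?L. F x) = (\<Prod>x\<in>(\<lambda>m. 3 * m) ` {..<n}. F x) * (\<Prod>x\<in>(\<lambda>m. Suc (3 * m)) ` S. F x)
        * (\<Prod>x\<in>(\<lambda>m. Suc (Suc (3 * m))) ` S. F x)"
      using fin_S by (simp only:) (subst prod.union_disjoint, simp, simp, force, subst prod.union_disjoint, auto)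
    then show ?thesis by (simp add: prod.reindex inj_on_def prod.distrib mult.assoc)
  qed
  have on_image: "amp_term ?\<sigma> ?L ?\<alpha> ?V (?I k j)
      = cut_weight n S k j * (\<Prod>m<n. entry \<phi> (Vs ! m) (j m) (j (csucc n m)))"
    if k: "k < N" and j: "j \<in> ?J" for k j
  proof -
    have jS: "j s < N" if "s \<in> S" for s using j that by auto
    have "dart_factor ?\<sigma> ?\<alpha> ?V (?I k j) (3 * m) = entry \<phi> (Vs ! m) (j m) (j (csucc n m))" if "m < n" for m
      using that csucc_less[OF that] by (simp add: dart_factor_def I_simps)
    moreover have "dart_factor ?\<sigma> ?\<alpha> ?V (?I k j) (Suc (3 * m)) * dart_factor ?\<sigma> ?\<alpha> ?V (?I k j) (Suc (Suc (3 * m)))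
        = - 1 / complex_of_real (p k (j m))" if "m \<in> S" for m
      using that k jS[OF that] p_sym[of k "j m"]
      by (simp add: dart_factor_def I_simps owner_in S_less power2_eq_square[symmetric])
    moreover have "(\<Prod>v\<in>orbit ?\<sigma> ` ?L. dd (image_mset (?I k j) (mset_set v))) = (\<Prod>s\<in>S. dd (add_mset k (window n S j s)))"
    proof -
      have "orbit ?\<sigma> ` ?L = (\<lambda>s. {h \<in> ?L. vertex_of h = s}) ` S"
        using vertices_loop by (simp add: vertices_def loop_diagram_def)
      then have "(\<Prod>v\<in>orbit ?\<sigma> ` ?L. dd (image_mset (?I k j) (mset_set v)))
          = (\<Prod>s\<in>S. dd (image_mset (?I k j) (mset_set {h \<in> ?L. vertex_of h = s})))"
        by (simp add: prod.reindex[OF inj_loop_vertex])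
      also have "\<dots> = (\<Prod>s\<in>S. dd (add_mset k (window n S j s)))"
      proof (rule prod.cong)
        fix s assume s: "s \<in> S"
        let ?A = "{m \<in> {..<n}. owner S m = s}" and ?B = "{m \<in> S. owner S (cpred n m) = s}"
        have "{h \<in> ?L. vertex_of h = s} = insert (Suc (3 * s)) ((\<lambda>m. 3 * m) ` ?A \<union> (\<lambda>m. Suc (Suc (3 * m))) ` ?B)"
          using s by (auto elim!: loop_dart_cases)
        then have "mset_set {h \<in> ?L. vertex_of h = s} = add_mset (Suc (3 * s))
            (mset_set ((\<lambda>m. 3 * m) ` ?A) + mset_set ((\<lambda>m. Suc (Suc (3 * m))) ` ?B))"
          using fin_S by (simp only:) (subst mset_set.insert, auto intro: mset_set_Union)
        also have "\<dots> = add_mset (Suc (3 * s)) (image_mset (\<lambda>m. 3 * m) (mset_set ?A)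
            + image_mset (\<lambda>m. Suc (Suc (3 * m))) (mset_set ?B))"
          by (simp add: image_mset_mset_set inj_on_def)
        finally have "image_mset (?I k j) (mset_set {h \<in> ?L. vertex_of h = s})
            = add_mset (?I k j (Suc (3 * s))) (image_mset (\<lambda>m. ?I k j (3 * m)) (mset_set ?A)
              + image_mset (\<lambda>m. ?I k j (Suc (Suc (3 * m)))) (mset_set ?B))"
          by (simp add: multiset.map_comp comp_def)
        also have "image_mset (\<lambda>m. ?I k j (3 * m)) (mset_set ?A) = image_mset j (mset_set ?A)"
          by (intro image_mset_cong) (auto simp: I_simps)
        also have "image_mset (\<lambda>m. ?I k j (Suc (Suc (3 * m)))) (mset_set ?B) = image_mset j (mset_set ?B)"
          using fin_S by (intro image_mset_cong) (auto simp: I_simps)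
        finally show "dd (image_mset (?I k j) (mset_set {h \<in> ?L. vertex_of h = s})) = dd (add_mset k (window n S j s))"
          using s by (simp add: window_def I_simps)
      qed simp
      finally show ?thesis .
    qed
    ultimately have "amp_term ?\<sigma> ?L ?\<alpha> ?V (?I k j) = (\<Prod>s\<in>S. dd (add_mset k (window n S j s)))
        * ((\<Prod>m<n. entry \<phi> (Vs ! m) (j m) (j (csucc n m))) * (\<Prod>s\<in>S. - 1 / complex_of_real (p k (j s))))"
      unfolding amp_term_def split by (intro arg_cong2[where f = "(*)"] prod.cong) simp_all
    then show ?thesis
      unfolding cut_weight_def prod.distrib by (simp only: mult_ac)
  qed
  have inj: "inj_on (\<lambda>(k, j). ?I k j) ({..<N} \<times> ?J)"
  proof (rule inj_onI, clarify)
    fix k j k' j' assume kj: "j \<in> {..<n} \<rightarrow>\<^sub>E {..<K}" "j' \<in> {..<n} \<rightarrow>\<^sub>E {..<K}" and eq: "?I k j = ?I k' j'"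
    obtain s where s: "s \<in> S" using S_ne by auto
    have "k = k'" using fun_cong[OF eq, of "Suc (3 * s)"] s by (simp add: I_simps)
    moreover have "j = j'"
    proof (rule PiE_ext[OF kj])
      show "j m = j' m" if "m \<in> {..<n}" for m
        using fun_cong[OF eq, of "3 * m"] that by (simp add: I_simps)
    qed
    ultimately show "k = k' \<and> j = j'" by simp
  qed
  have sub: "(\<lambda>(k, j). ?I k j) ` ({..<N} \<times> ?J) \<subseteq> ?L \<rightarrow>\<^sub>E {..<K}"
  proof clarify
    fix k j assume k: "k < N" and j: "j \<in> {..<n} \<rightarrow>\<^sub>E {..<K}"
    have "?I k j h < K" if "h \<in> ?L" for h
      using that
    proof (cases rule: loop_dart_cases)
      case (ext m)
      then show ?thesis using j by (auto simp: I_simps)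
    next
      case (into m)
      then show ?thesis using k assms(2) by (simp add: I_simps)
    next
      case (out m)
      then show ?thesis using j S_less[of m] by (auto simp: I_simps)
    qed
    then show "?I k j \<in> ?L \<rightarrow>\<^sub>E {..<K}" by (auto simp: loop_index_def)
  qed
  have zero: "amp_term ?\<sigma> ?L ?\<alpha> ?V i = 0"
    if i: "i \<in> (?L \<rightarrow>\<^sub>E {..<K}) - (\<lambda>(k, j). ?I k j) ` ({..<N} \<times> ?J)" for i
  proof (rule ccontr)
    assume "amp_term ?\<sigma> ?L ?\<alpha> ?V i \<noteq> 0"
    then have nz: "dart_factor ?\<sigma> ?\<alpha> ?V i x \<noteq> 0" if "x \<in> ?L" for x
      using that by (auto simp: amp_term_def)
    have into: "i (Suc (3 * m)) = i (Suc (3 * owner S (cpred n m)))" "i (Suc (3 * m)) < N" "i (3 * m) < N" if "m \<in> S" for m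
      using nz[of "Suc (3 * m)"] that by (auto simp: dart_factor_def split: if_splits)
    have out: "i (Suc (Suc (3 * m))) = i (3 * m)" if "m \<in> S" for m
      using nz[of "Suc (Suc (3 * m))"] that by (auto simp: dart_factor_def split: if_splits)
    \<comment> \<open>The matching condition passes the inner index from a cut to an earlier one,
      down to the smallest.\<close>
    have const: "m \<in> S \<Longrightarrow> i (Suc (3 * m)) = i (Suc (3 * Min S))" for m
    proof (induction m rule: less_induct)
      case (less m)
      show ?case
      proof (cases "m = Min S")
        case False
        then have lt: "Min S < m" using less.prems fin_S by (simp add: order_neq_le_trans)
        moreover have "Min S \<in> S" using fin_S S_ne by simp
        ultimately have "owner S (cpred n m) \<le> cpred n m" "cpred n m < m"
          using owner_le[of "Min S" "cpred n m"] by (auto simp: cpred_def)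
        then show ?thesis using less.IH[of "owner S (cpred n m)"] owner_in into(1)[OF less.prems] by simp
      qed simp
    qed
    define k where "k = i (Suc (3 * Min S))"
    define j where "j = (\<lambda>m\<in>{..<n}. i (3 * m))"
    have "k < N" using into(2)[of "Min S"] fin_S S_ne by (simp add: k_def)
    moreover have "j \<in> ?J" using i into(3) S_less by (auto simp: j_def PiE_def Pi_def)
    moreover have "i = ?I k j"
    proof
      fix h
      show "i h = ?I k j h"
      proof (cases "h \<in> ?L")
        case True
        then show ?thesis
          by (cases rule: loop_dart_cases) (use const out S_less in \<open>auto simp: I_simps k_def j_def\<close>)
      next
        case False
        then show ?thesis using i by (auto simp: loop_index_def)
      qed
    qed
    ultimately show False using i by auto
  qed
  have "amp_value K ?\<sigma> ?L ?\<alpha> ?V = (\<Sum>i\<in>(\<lambda>(k, j). ?I k j) ` ({..<N} \<times> ?J). amp_term ?\<sigma> ?L ?\<alpha> ?V i)"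
    unfolding amp_value_def using sub zero by (intro sum.mono_neutral_right) (simp_all add: finite_PiE)
  also have "\<dots> = (\<Sum>(k, j)\<in>{..<N} \<times> ?J. amp_term ?\<sigma> ?L ?\<alpha> ?V (?I k j))"
    by (subst sum.reindex[OF inj]) (simp add: comp_def case_prod_unfold)
  also have "\<dots> = (\<Sum>(k, j)\<in>{..<N} \<times> ?J. cut_weight n S k j * (\<Prod>m<n. entry \<phi> (Vs ! m) (j m) (j (csucc n m))))"
    by (rule sum.cong) (use on_image in auto)
  finally show ?thesis by (simp add: loop_diagram_def sum.cartesian_product)
qed

definition block :: "('h \<Rightarrow> 'h) \<Rightarrow> bool" where
  "block V \<longleftrightarrow> (\<exists>K. supported K V) \<and> (\<forall>i j. i < N \<longrightarrow> N \<le> j \<longrightarrow> entry \<phi> V i j = 0 \<and> entry \<phi> V j i = 0)"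

lemma supported_mono: "supported K V \<Longrightarrow> K \<le> L \<Longrightarrow> supported L V"
  by (auto simp: supported_def)

lemma common_support:
  "(\<And>V. V \<in> set Vs \<Longrightarrow> \<exists>K. supported K V) \<Longrightarrow> \<exists>K\<ge>N. \<forall>V\<in>set Vs. supported K V"
proof (induction Vs)
  case (Cons V Vs)
  obtain L where L: "supported L V" using Cons.prems[of V] by auto
  have "\<exists>K\<ge>N. \<forall>V\<in>set Vs. supported K V" by (rule Cons.IH) (simp add: Cons.prems)
  then obtain K where "K \<ge> N" "\<forall>V\<in>set Vs. supported K V" by auto
  then show ?case using L by (intro exI[of _ "max K L"]) (auto intro: supported_mono)
qed auto

theorem one_loop_bracket_sum:
  assumes "Vs \<noteq> []" "\<And>V. V \<in> set Vs \<Longrightarrow> block V"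
  defines "n \<equiv> length Vs"
  shows "one_loop_bracket \<phi> lam f N Vs = (\<Sum>j \<in> {..<n} \<rightarrow>\<^sub>E {..<N}.
    (\<Sum>k<N. \<Sum>S\<in>Pow {..<n} - {{}}. cut_weight n S k j) * (\<Prod>m<n. entry \<phi> (Vs ! m) (j m) (j (csucc n m))))"
proof -
  have n: "n > 0" using assms(1) by (simp add: n_def)
  obtain K where K: "N \<le> K" "\<And>V. V \<in> set Vs \<Longrightarrow> supported K V"
    using common_support[of Vs] assms(2) unfolding block_def by blast
  have dne: "darts G \<noteq> {}" if "one_loop_diagram n G" for G
  proof -
    have "bij_betw (mark G) (ext_darts G) {..<n}" using that by (simp add: one_loop_diagram_def point_diagram_def)
    then have "ext_darts G \<noteq> {}" using n by (auto simp: bij_betw_def)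
    then show ?thesis by (auto simp: ext_darts_def)
  qed
  have \<Gamma>: "Gamma_amp \<phi> lam f N G Vs = amp_value K (nxt G) (darts G) (opp G) (\<lambda>h. Vs ! mark G h)"
    if "one_loop_diagram n G" for G
    by (rule Gamma_amp_value[where n = n]) (use that K dne in \<open>auto simp: one_loop_diagram_def n_def\<close>)
  have cp: "cut_points n S" if "S \<in> Pow {..<n} - {{}}" for S
    using that by unfold_locales auto
  let ?E = "\<lambda>j. \<Prod>m<n. entry \<phi> (Vs ! m) (j m) (j (csucc n m))"
  \<comment> \<open>A cut forces one outer index below \<open>N\<close>; the block form of the
    operators carries this bound around the circle unless the product vanishes.\<close>
  have vanish: "?E j = 0" if j: "j \<in> {..<n} \<rightarrow>\<^sub>E {..<K}" "j \<notin> {..<n} \<rightarrow>\<^sub>E {..<N}" and s: "s < n" "j s < N" for j s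
  proof (rule ccontr)
    assume "?E j \<noteq> 0"
    then have nz: "entry \<phi> (Vs ! m) (j m) (j (csucc n m)) \<noteq> 0" if "m < n" for m using that by auto
    have step: "j (csucc n m) < N" if "m < n" "j m < N" for m
    proof (rule ccontr)
      assume "\<not> j (csucc n m) < N"
      moreover have "block (Vs ! m)" using assms(2) that(1) by (simp add: n_def)
      ultimately have "entry \<phi> (Vs ! m) (j m) (j (csucc n m)) = 0" using that(2) by (simp add: block_def)
      then show False using nz[OF that(1)] by simp
    qed
    have up: "s + d < n \<Longrightarrow> j (s + d) < N" for d
    proof (induction d)
      case (Suc d)
      then show ?case using step[of "s + d"] by (simp add: csucc_def split: if_splits)
    qed (use s in simp)
    have "j 0 < N" using step[of "n - 1"] up[of "n - 1 - s"] s n by (simp add: csucc_def)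
    have "m < n \<Longrightarrow> j m < N" for m
    proof (induction m)
      case (Suc m)
      then show ?case using step[of m] by (simp add: csucc_def split: if_splits)
    qed (use \<open>j 0 < N\<close> in simp)
    then have "j \<in> {..<n} \<rightarrow>\<^sub>E {..<N}" using j(1) by (auto simp: PiE_def)
    then show False using j(2) by simp
  qed
  have "one_loop_bracket \<phi> lam f N Vs = (\<Sum>S \<in> Pow {..<n} - {{}}. Gamma_amp \<phi> lam f N (loop_diagram n S) Vs)"
    unfolding one_loop_bracket_def n_def[symmetric]
  proof (rule sum_one_loop_diagrams[OF n])
    fix G G' assume GG': "one_loop_diagram n G" "one_loop_diagram n G'" "diagram_iso G G'"
    then have "point_diagram n G" "point_diagram n G'" by (simp_all add: one_loop_diagram_def)
    then show "Gamma_amp \<phi> lam f N G Vs = Gamma_amp \<phi> lam f N G' Vs"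
      using \<Gamma> GG' amp_value_iso by simp
  qed
  also have "\<dots> = (\<Sum>S \<in> Pow {..<n} - {{}}. \<Sum>k<N. \<Sum>j \<in> {..<n} \<rightarrow>\<^sub>E {..<N}. cut_weight n S k j * ?E j)"
  proof (rule sum.cong)
    fix S assume S: "S \<in> Pow {..<n} - {{}}"
    have "Gamma_amp \<phi> lam f N (loop_diagram n S) Vs
      = (\<Sum>k<N. \<Sum>j | j \<in> {..<n} \<rightarrow>\<^sub>E {..<K} \<and> (\<forall>s\<in>S. j s < N). cut_weight n S k j * ?E j)"
      using \<Gamma>[OF cut_points.one_loop_diagram_loop[OF cp[OF S]]] amp_value_loop[OF cp[OF S] K(1)] by simp
    also have "\<dots> = (\<Sum>k<N. \<Sum>j \<in> {..<n} \<rightarrow>\<^sub>E {..<N}. cut_weight n S k j * ?E j)"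
    proof (rule sum.cong[OF refl], rule sum.mono_neutral_right)
      show "finite {j. j \<in> {..<n} \<rightarrow>\<^sub>E {..<K} \<and> (\<forall>s\<in>S. j s < N)}"
        by (rule finite_subset[of _ "{..<n} \<rightarrow>\<^sub>E {..<K}"]) (auto simp: finite_PiE)
      show "{..<n} \<rightarrow>\<^sub>E {..<N} \<subseteq> {j. j \<in> {..<n} \<rightarrow>\<^sub>E {..<K} \<and> (\<forall>s\<in>S. j s < N)}"
      proof
        fix j assume j: "j \<in> {..<n} \<rightarrow>\<^sub>E {..<N}"
        then have "j m < N" if "m < n" for m using that by auto
        then show "j \<in> {j. j \<in> {..<n} \<rightarrow>\<^sub>E {..<K} \<and> (\<forall>s\<in>S. j s < N)}"
          using j K(1) S by (auto simp: PiE_def Pi_def intro: less_le_trans)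
      qed
      show "\<forall>j\<in>{j. j \<in> {..<n} \<rightarrow>\<^sub>E {..<K} \<and> (\<forall>s\<in>S. j s < N)} - ({..<n} \<rightarrow>\<^sub>E {..<N}). cut_weight n S k j * ?E j = 0" for k
      proof
        fix j assume j: "j \<in> {j. j \<in> {..<n} \<rightarrow>\<^sub>E {..<K} \<and> (\<forall>s\<in>S. j s < N)} - ({..<n} \<rightarrow>\<^sub>E {..<N})"
        obtain s where "s \<in> S" "s < n" using S by auto
        then have "?E j = 0" using vanish[of j s] j by auto
        then show "cut_weight n S k j * ?E j = 0" by simp
      qed
    qed
    finally show "Gamma_amp \<phi> lam f N (loop_diagram n S) Vs
        = (\<Sum>k<N. \<Sum>j \<in> {..<n} \<rightarrow>\<^sub>E {..<N}. cut_weight n S k j * ?E j)" .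
  qed simp
  also have "\<dots> = (\<Sum>S \<in> Pow {..<n} - {{}}. \<Sum>j \<in> {..<n} \<rightarrow>\<^sub>E {..<N}. \<Sum>k<N. cut_weight n S k j * ?E j)"
    by (intro sum.cong refl sum.swap)
  also have "\<dots> = (\<Sum>j \<in> {..<n} \<rightarrow>\<^sub>E {..<N}. \<Sum>S \<in> Pow {..<n} - {{}}. \<Sum>k<N. cut_weight n S k j * ?E j)"
    by (rule sum.swap)
  also have "\<dots> = (\<Sum>j \<in> {..<n} \<rightarrow>\<^sub>E {..<N}. \<Sum>k<N. \<Sum>S \<in> Pow {..<n} - {{}}. cut_weight n S k j * ?E j)"
    by (intro sum.cong refl sum.swap)
  finally show ?thesis by (simp add: sum_distrib_right)
qed

end

section \<open>Cyclicity and the Ward identity of the loop coefficients\<close>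

text \<open>Cutting a word in all possible ways: \<open>A\<close> is the window that is open at the beginning of the word
  and \<open>Z\<close> is added to the window that is open at its end.\<close>

fun line_cuts :: "('i multiset \<Rightarrow> complex) \<Rightarrow> ('i \<Rightarrow> complex) \<Rightarrow> 'i multiset \<Rightarrow> 'i list \<Rightarrow> 'i multiset \<Rightarrow> complex" where
  "line_cuts g q A [] Z = g (A + Z)"
| "line_cuts g q A (x # w) Z = line_cuts g q (add_mset x A) w Z + q x * g (add_mset x A) * line_cuts g q {#x#} w Z"

text \<open>Cutting a circle at least once, where \<open>B\<close> precedes the word: what comes before the first cut
  belongs to the window of the last one.\<close>

fun circle_cuts :: "('i multiset \<Rightarrow> complex) \<Rightarrow> ('i \<Rightarrow> complex) \<Rightarrow> 'i multiset \<Rightarrow> 'i list \<Rightarrow> complex" where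
  "circle_cuts g q B [] = 0"
| "circle_cuts g q B (x # w) = circle_cuts g q (add_mset x B) w + q x * line_cuts g q {#x#} w (add_mset x B)"

text \<open>Peeling off the last letter instead of the first; comparing both recursions for the
  circle yields invariance under rotation.\<close>

lemma line_cuts_snoc:
  "line_cuts g q A (w @ [x]) Z = line_cuts g q A w (add_mset x Z) + q x * g (add_mset x Z) * line_cuts g q A w {#x#}"
  by (induction w arbitrary: A) (simp_all add: algebra_simps)

lemma circle_cuts_snoc:
  "circle_cuts g q B (w @ [x]) = circle_cuts g q (add_mset x B) w + q x * line_cuts g q (add_mset x B) w {#x#}"
  by (induction w arbitrary: B) (simp_all add: line_cuts_snoc algebra_simps add_mset_commute)

lemma circle_cuts_rotate: "circle_cuts g q {#} (w @ [x]) = circle_cuts g q {#} (x # w)"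
  by (simp add: circle_cuts_snoc)

section \<open>The Ward identity for cut words\<close>

locale cut_ward =
  fixes g :: "'i multiset \<Rightarrow> complex" and q :: "'i \<Rightarrow> complex" and l :: "'i \<Rightarrow> complex"
  assumes g_step: "(l x - l y) * g (add_mset x (add_mset y M)) = g (add_mset x M) - g (add_mset y M)"
begin

text \<open>The letters \<open>x\<close> and \<open>y\<close> sit in the window open at the
  beginning, which is a single factor \<open>g\<close> in every term, so \<open>g_step\<close>
  applies termwise.\<close>

lemma line_cuts_step_left:
  "(l x - l y) * line_cuts g q (add_mset x (add_mset y A)) w Z
    = line_cuts g q (add_mset x A) w Z - line_cuts g q (add_mset y A) w Z"
proof (induction w arbitrary: A)
  case Nil
  then show ?case using g_step[of x y "A + Z"] by simp
next
  case (Cons v w)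
  have "(l x - l y) * line_cuts g q (add_mset x (add_mset y A)) (v # w) Z
      = (l x - l y) * line_cuts g q (add_mset x (add_mset y (add_mset v A))) w Z
        + q v * ((l x - l y) * g (add_mset x (add_mset y (add_mset v A)))) * line_cuts g q {#v#} w Z"
    by (simp add: algebra_simps add_mset_commute)
  also have "\<dots> = line_cuts g q (add_mset x A) (v # w) Z - line_cuts g q (add_mset y A) (v # w) Z"
    unfolding Cons.IH g_step by (simp add: algebra_simps add_mset_commute)
  finally show ?case .
qed

lemma line_cuts_step_right:
  "(l x - l y) * line_cuts g q A w (add_mset x (add_mset y Z))
    = line_cuts g q A w (add_mset x Z) - line_cuts g q A w (add_mset y Z)"
proof (induction w arbitrary: A)
  case Nil
  then show ?case using g_step[of x y "A + Z"] by simp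
next
  case (Cons v w)
  have "(l x - l y) * line_cuts g q A (v # w) (add_mset x (add_mset y Z))
      = (l x - l y) * line_cuts g q (add_mset v A) w (add_mset x (add_mset y Z))
        + q v * g (add_mset v A) * ((l x - l y) * line_cuts g q {#v#} w (add_mset x (add_mset y Z)))"
    by (simp add: algebra_simps)
  then show ?case unfolding Cons.IH by (simp add: algebra_simps)
qed

lemma circle_cuts_step_prefix:
  "(l x - l y) * circle_cuts g q (add_mset x (add_mset y B)) w
    = circle_cuts g q (add_mset x B) w - circle_cuts g q (add_mset y B) w"
proof (induction w arbitrary: B)
  case (Cons v w)
  have "(l x - l y) * circle_cuts g q (add_mset x (add_mset y B)) (v # w)
      = (l x - l y) * circle_cuts g q (add_mset x (add_mset y (add_mset v B))) w
        + q v * ((l x - l y) * line_cuts g q {#v#} w (add_mset x (add_mset y (add_mset v B))))"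
    by (simp add: algebra_simps add_mset_commute)
  then show ?case
    unfolding Cons.IH line_cuts_step_right by (simp add: algebra_simps add_mset_commute)
qed simp

text \<open>The expansion by cuts at \<open>x\<close> and at \<open>y\<close> has four parts.
  Telescoping gives the right side up to multiples of \<open>line_cuts g q {#y#} w {#x#}\<close>;
  these cancel because a cut is minus the inverse of the two-point function.\<close>

lemma circle_cuts_step:
  assumes "q x * g {#x#} = - 1" "q y * g {#y#} = - 1"
  shows "(l x - l y) * circle_cuts g q {#} (x # y # w)
    = circle_cuts g q {#} (x # w) - circle_cuts g q {#} (y # w)"
proof -
  have "(l x - l y) * circle_cuts g q {#} (x # y # w)
      = (l x - l y) * circle_cuts g q (add_mset x (add_mset y {#})) w
        + q y * ((l x - l y) * line_cuts g q {#y#} w (add_mset x (add_mset y {#})))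
        + q x * ((l x - l y) * line_cuts g q (add_mset x (add_mset y {#})) w {#x#})
        + q x * q y * ((l x - l y) * g (add_mset x (add_mset y {#}))) * line_cuts g q {#y#} w {#x#}"
    by (simp add: algebra_simps add_mset_commute)
  also have "\<dots> = circle_cuts g q {#} (x # w) - circle_cuts g q {#} (y # w)
      + line_cuts g q {#y#} w {#x#} * (q y - q x + q y * (q x * g {#x#}) - q x * (q y * g {#y#}))"
    unfolding circle_cuts_step_prefix line_cuts_step_right line_cuts_step_left g_step
    by (simp add: algebra_simps)
  finally show ?thesis by (simp add: assms)
qed

end

text \<open>The window of the cut \<open>s\<close> reaches up to and including the next cut.\<close>

definition line_window :: "nat \<Rightarrow> (nat \<Rightarrow> 'i) \<Rightarrow> nat set \<Rightarrow> 'i multiset \<Rightarrow> nat \<Rightarrow> 'i multiset" where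
  "line_window n j S Z s = (if \<exists>s'\<in>S. s < s' then image_mset j (mset_set {s..Min {s'\<in>S. s < s'}})
     else image_mset j (mset_set {s..<n}) + Z)"

definition cut_product :: "('i multiset \<Rightarrow> complex) \<Rightarrow> ('i \<Rightarrow> complex) \<Rightarrow> nat \<Rightarrow> (nat \<Rightarrow> 'i) \<Rightarrow> nat set \<Rightarrow> 'i multiset \<Rightarrow> complex" where
  "cut_product g q n j S Z = (\<Prod>s\<in>S. q (j s) * g (line_window n j S Z s))"

text \<open>What the word from position \<open>a\<close> adds to the window open at its
  beginning.\<close>

definition first_window :: "nat \<Rightarrow> (nat \<Rightarrow> 'i) \<Rightarrow> nat set \<Rightarrow> 'i multiset \<Rightarrow> nat \<Rightarrow> 'i multiset" where
  "first_window n j S Z a = (if S = {} then image_mset j (mset_set {a..<n}) + Z else image_mset j (mset_set {a..Min S}))"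

lemma mset_interval_Suc: "a < n \<Longrightarrow> mset_set {a..<n} = add_mset a (mset_set {Suc a..<n})"
proof -
  assume "a < n"
  then have "{a..<n} = insert a {Suc a..<n}" by auto
  then show ?thesis by simp
qed

lemma sum_Pow_interval:
  assumes "a < n"
  shows "(\<Sum>S\<in>Pow {a..<n}. F S) = (\<Sum>S\<in>Pow {Suc a..<n}. F S + F (insert a S) :: complex)"
proof -
  have eq: "{a..<n} = insert a {Suc a..<n}" using assms by auto
  have "(\<Sum>S\<in>Pow {a..<n}. F S) = (\<Sum>S\<in>Pow {Suc a..<n}. F S) + (\<Sum>S\<in>insert a ` Pow {Suc a..<n}. F S)"
    unfolding eq Pow_insert by (rule sum.union_disjoint) auto
  also have "(\<Sum>S\<in>insert a ` Pow {Suc a..<n}. F S) = (\<Sum>S\<in>Pow {Suc a..<n}. F (insert a S))"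
  proof (rule sum.reindex_cong[of "insert a"])
    show "inj_on (insert a) (Pow {Suc a..<n})"
      by (rule inj_on_inverseI[of _ "\<lambda>S. S - {a}"]) auto
  qed auto
  finally show ?thesis by (simp add: sum.distrib)
qed

context
  fixes g :: "'i multiset \<Rightarrow> complex" and q :: "'i \<Rightarrow> complex" and n :: nat and j :: "nat \<Rightarrow> 'i"
begin

lemma first_window_Suc:
  assumes "a < n" "S \<subseteq> {Suc a..<n}"
  shows "first_window n j S Z a = add_mset (j a) (first_window n j S Z (Suc a))"
proof (cases "S = {}")
  case True
  then show ?thesis using assms by (simp add: first_window_def mset_interval_Suc)
next
  case False
  then have "Min S \<in> S" using assms finite_subset by (intro Min_in) auto
  then have "a < Min S" using assms by auto
  then have "{a..Min S} = insert a {Suc a..Min S}" by auto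
  then show ?thesis using False by (simp add: first_window_def)
qed

lemma cut_product_insert:
  assumes "a < n" "S \<subseteq> {Suc a..<n}"
  shows "cut_product g q n j (insert a S) Z = q (j a) * g (first_window n j S Z a) * cut_product g q n j S Z"
proof -
  have fin: "finite S" using assms finite_subset by auto
  have "{s' \<in> insert a S. a < s'} = S" using assms by auto
  moreover from this have "(\<exists>s'\<in>insert a S. a < s') \<longleftrightarrow> S \<noteq> {}" by auto
  ultimately have "line_window n j (insert a S) Z a = first_window n j S Z a"
    by (simp only: line_window_def first_window_def if_not_P split: if_splits) simp
  moreover have "line_window n j (insert a S) Z s = line_window n j S Z s" if "s \<in> S" for s
  proof -
    have "{s' \<in> insert a S. s < s'} = {s' \<in> S. s < s'}" using assms that by auto
    moreover from this have "(\<exists>s'\<in>insert a S. s < s') \<longleftrightarrow> (\<exists>s'\<in>S. s < s')" by auto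
    ultimately show ?thesis by (simp only: line_window_def)
  qed
  moreover have "a \<notin> S" using assms by auto
  ultimately show ?thesis using fin by (simp add: cut_product_def)
qed

text \<open>The recursion at a letter is the split of the subsets of \<open>{a..<n}\<close> into
  those without and those with \<open>a\<close>.\<close>

lemma line_cuts_sum:
  "a \<le> n \<Longrightarrow> line_cuts g q A (map j [a..<n]) Z = (\<Sum>S\<in>Pow {a..<n}. g (A + first_window n j S Z a) * cut_product g q n j S Z)"
proof (induction a arbitrary: A rule: inc_induct)
  case base
  then show ?case by (simp add: first_window_def cut_product_def)
next
  case (step a)
  have "line_cuts g q A (map j [a..<n]) Z
      = line_cuts g q (add_mset (j a) A) (map j [Suc a..<n]) Z
        + q (j a) * g (add_mset (j a) A) * line_cuts g q {#j a#} (map j [Suc a..<n]) Z"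
    using step(2) by (simp add: upt_conv_Cons)
  also have "\<dots> = (\<Sum>S\<in>Pow {Suc a..<n}. g (A + first_window n j S Z a) * cut_product g q n j S Z
      + g (A + first_window n j (insert a S) Z a) * cut_product g q n j (insert a S) Z)"
    unfolding step.IH sum_distrib_left sum.distrib[symmetric]
  proof (rule sum.cong)
    fix S assume S: "S \<in> Pow {Suc a..<n}"
    then have "Min (insert a S) = a" using finite_subset by (intro Min_eqI) auto
    then have "first_window n j (insert a S) Z a = {#j a#}" by (simp add: first_window_def)
    then show "g (add_mset (j a) A + first_window n j S Z (Suc a)) * cut_product g q n j S Z
        + q (j a) * g (add_mset (j a) A) * (g ({#j a#} + first_window n j S Z (Suc a)) * cut_product g q n j S Z)
      = g (A + first_window n j S Z a) * cut_product g q n j S Z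
        + g (A + first_window n j (insert a S) Z a) * cut_product g q n j (insert a S) Z"
      using first_window_Suc[of a S Z] cut_product_insert[of a S Z] S step(2) by simp
  qed simp
  finally show ?case using sum_Pow_interval[OF step(2)] by simp
qed

text \<open>The letters up to and including \<open>Min S\<close> close the window of the last cut,
  which is why they appear as its \<open>Z\<close>.\<close>

lemma circle_cuts_sum:
  "a \<le> n \<Longrightarrow> circle_cuts g q B (map j [a..<n])
    = (\<Sum>S\<in>Pow {a..<n} - {{}}. cut_product g q n j S (B + image_mset j (mset_set {a..Min S})))"
proof (induction a arbitrary: B rule: inc_induct)
  case base
  then show ?case by simp
next
  case (step a)
  let ?F = "\<lambda>S. if S = {} then 0 else cut_product g q n j S (B + image_mset j (mset_set {a..Min S}))"
  have drop: "(\<Sum>S\<in>Pow X - {{}}. G S) = (\<Sum>S\<in>Pow X. if S = {} then 0 else G S)" if "finite X" for X :: "nat set" and G :: "nat set \<Rightarrow> complex"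
    using that by (intro sum.mono_neutral_cong_left) auto
  have "circle_cuts g q B (map j [a..<n])
      = circle_cuts g q (add_mset (j a) B) (map j [Suc a..<n]) + q (j a) * line_cuts g q {#j a#} (map j [Suc a..<n]) (add_mset (j a) B)"
    using step(2) by (simp add: upt_conv_Cons)
  also have "\<dots> = (\<Sum>S\<in>Pow {Suc a..<n}. ?F S + ?F (insert a S))"
    unfolding step.IH line_cuts_sum[OF Suc_leI[OF step(2)]] sum_distrib_left drop[OF finite_atLeastLessThan] sum.distrib[symmetric]
  proof (rule sum.cong)
    fix S assume S: "S \<in> Pow {Suc a..<n}"
    then have fin: "finite S" using finite_subset by auto
    have "Min (insert a S) = a" using S fin by (intro Min_eqI) auto
    then have "?F (insert a S) = q (j a) * (g ({#j a#} + first_window n j S (add_mset (j a) B) (Suc a))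
        * cut_product g q n j S (add_mset (j a) B))"
      using first_window_Suc[of a S "add_mset (j a) B"] cut_product_insert[of a S "add_mset (j a) B"] S step(2) by simp
    moreover have "mset_set {a..Min S} = add_mset a (mset_set {Suc a..Min S})" if "S \<noteq> {}"
    proof -
      have "Min S \<in> S" using that fin by simp
      then have "{a..Min S} = insert a {Suc a..Min S}" using S by auto
      then show ?thesis by simp
    qed
    ultimately show "(if S = {} then 0 else cut_product g q n j S (add_mset (j a) B + image_mset j (mset_set {Suc a..Min S})))
        + q (j a) * (g ({#j a#} + first_window n j S (add_mset (j a) B) (Suc a)) * cut_product g q n j S (add_mset (j a) B))
      = ?F S + ?F (insert a S)"
      by simp
  qed simp
  also have "\<dots> = (\<Sum>S\<in>Pow {a..<n}. ?F S)" using sum_Pow_interval[OF step(2)] by simp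
  also have "\<dots> = (\<Sum>S\<in>Pow {a..<n} - {{}}. cut_product g q n j S (B + image_mset j (mset_set {a..Min S})))"
    by (rule drop[symmetric]) simp
  finally show ?case .
qed

end

context cut_points
begin

text \<open>For a cut other than the last, the owned external edges run up to the next cut, whose
  loop edge adds the endpoint. For the last cut they wrap around past 0 and end at
  \<open>Min S\<close>.\<close>

lemma window_eq_line_window:
  assumes s: "s \<in> S"
  shows "image_mset j (mset_set {m \<in> {..<n}. owner S m = s}) + image_mset j (mset_set {m \<in> S. owner S (cpred n m) = s})
    = line_window n j S (image_mset j (mset_set {0..Min S})) s"
proof (cases "\<exists>s'\<in>S. s < s'")
  case True
  let ?T = "{s' \<in> S. s < s'}" and ?x = "Min {s' \<in> S. s < s'}"
  have "?x \<in> ?T" using True fin_S by (intro Min_in) auto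
  then have x: "?x \<in> S" "s < ?x" by auto
  have least: "?x \<le> s'" if "s' \<in> S" "s < s'" for s' using that fin_S by (intro Min_le) auto
  have owner_iff: "owner S m = s \<longleftrightarrow> s \<le> m \<and> m < ?x" for m
  proof
    assume m: "owner S m = s"
    have "s \<le> m"
    proof (rule ccontr)
      assume "\<not> s \<le> m"
      then have "\<not> (\<exists>s'\<in>S. s' \<le> m)" using owner_le m by fastforce
      then have "s = Max S" using owner_none m by simp
      then have "?x \<le> s" using x fin_S by simp
      then show False using x by simp
    qed
    moreover have "m < ?x" using owner_le[OF x(1), of m] m x(2) by (cases "?x \<le> m") auto
    ultimately show "s \<le> m \<and> m < ?x" by simp
  next
    assume m: "s \<le> m \<and> m < ?x"
    then have o: "s \<le> owner S m" "owner S m \<le> m" using owner_le[OF s] by auto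
    show "owner S m = s"
    proof (rule ccontr)
      assume "owner S m \<noteq> s"
      then have "?x \<le> owner S m" using o owner_in by (intro least) auto
      then show False using o m by simp
    qed
  qed
  have A: "{m \<in> {..<n}. owner S m = s} = {s..<?x}"
    unfolding owner_iff using S_less[OF x(1)] by auto
  have B: "{m \<in> S. owner S (cpred n m) = s} = {?x}"
  proof -
    have "owner S (cpred n m) = s \<longleftrightarrow> m = ?x" if m: "m \<in> S" for m
    proof (cases "m = 0")
      case True
      have "\<not> n - 1 < ?x" using S_less[OF x(1)] by simp
      then show ?thesis using True x by (simp add: cpred_def owner_iff)
    next
      case False
      show ?thesis
      proof (cases "s < m")
        case True
        then have "?x \<le> m" using m least by simp
        then show ?thesis using True False unfolding owner_iff cpred_def by (simp del: Min_le_iff) linarith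
      next
        case False
        then show ?thesis using \<open>m \<noteq> 0\<close> x unfolding owner_iff by (auto simp: cpred_def)
      qed
    qed
    then show ?thesis using x(1) by auto
  qed
  have "{s..?x} = insert ?x {s..<?x}" using x(2) by auto
  then have "mset_set {s..?x} = add_mset ?x (mset_set {s..<?x})" by simp
  then show ?thesis using True unfolding A B line_window_def by simp
next
  case False
  then have max: "Max S = s" using s fin_S by (intro Max_eqI) (auto simp: not_less)
  have Min: "Min S \<in> S" "Min S \<le> s" using fin_S S_ne s by auto
  have owner_iff: "owner S m = s \<longleftrightarrow> s \<le> m \<or> m < Min S" for m
  proof
    assume "owner S m = s"
    then show "s \<le> m \<or> m < Min S" using owner_le[OF Min(1), of m] by (cases "Min S \<le> m") auto
  next
    assume "s \<le> m \<or> m < Min S"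
    then show "owner S m = s"
    proof
      assume "s \<le> m"
      then have "s \<le> owner S m" using owner_le[OF s] by simp
      moreover have "owner S m \<le> s" using max owner_in fin_S by (metis Max_ge)
      ultimately show ?thesis by simp
    next
      assume "m < Min S"
      moreover have "Min S \<le> t" if "t \<in> S" for t using that fin_S by simp
      ultimately have "\<not> (\<exists>t\<in>S. t \<le> m)" by (meson le_less_trans not_less)
      then show ?thesis using owner_none max by simp
    qed
  qed
  have A: "{m \<in> {..<n}. owner S m = s} = {s..<n} \<union> {0..<Min S}"
    unfolding owner_iff using S_less[OF Min(1)] Min(2) by auto
  have B: "{m \<in> S. owner S (cpred n m) = s} = {Min S}"
  proof -
    have "owner S (cpred n m) = s \<longleftrightarrow> m = Min S" if m: "m \<in> S" for m
    proof -
      have "Min S \<le> m" "m \<le> s" "m < n" using m fin_S max S_less by auto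
      then show ?thesis unfolding owner_iff using S_less[OF s] by (auto simp: cpred_def)
    qed
    then show ?thesis using Min(1) by auto
  qed
  have "mset_set ({s..<n} \<union> {0..<Min S}) = mset_set {s..<n} + mset_set {0..<Min S}"
    using Min by (intro mset_set_Union) auto
  moreover have "{0..Min S} = insert (Min S) {0..<Min S}" by auto
  then have "mset_set {0..Min S} = add_mset (Min S) (mset_set {0..<Min S})" by simp
  ultimately show ?thesis using False unfolding A B line_window_def by simp
qed

end

text \<open>The product of matrix entries along an index list, left open at the final index
  \<open>z\<close>; taking the head for \<open>z\<close> gives the cyclic product. The last equation
  is a default value.\<close>

fun chain :: "(nat \<Rightarrow> nat \<Rightarrow> complex) list \<Rightarrow> nat list \<Rightarrow> nat \<Rightarrow> complex" where
  "chain (M # Ms) (i # is) z = M i (hd (is @ [z])) * chain Ms is z"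
| "chain [] is z = 1"
| "chain (M # Ms) [] z = 1"

lemma chain_prod:
  "length is = length Ms \<Longrightarrow> chain Ms is z = (\<Prod>m<length Ms. (Ms ! m) (is ! m) ((is @ [z]) ! Suc m))"
proof (induction Ms "is" rule: list_induct2')
  case (4 M Ms i "is")
  then show ?case by (simp add: prod.lessThan_Suc_shift hd_conv_nth del: prod.lessThan_Suc)
qed simp_all

lemma chain_snoc:
  "length is = length Ms \<Longrightarrow> chain (Ms @ [M]) (is @ [x]) z = chain Ms is x * M x z"
  by (induction Ms "is" rule: list_induct2') (simp_all add: hd_append)

definition mat_mult :: "nat \<Rightarrow> (nat \<Rightarrow> nat \<Rightarrow> complex) \<Rightarrow> (nat \<Rightarrow> nat \<Rightarrow> complex) \<Rightarrow> nat \<Rightarrow> nat \<Rightarrow> complex" where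
  "mat_mult N a b i j = (\<Sum>k<N. a i k * b k j)"

lemma chain_mult_last:
  "length is = Suc (length Ns) \<Longrightarrow> (\<Sum>x<N. chain (Ns @ [L]) is x * a x z) = chain (Ns @ [mat_mult N L a]) is z"
proof (induction Ns arbitrary: "is")
  case Nil
  then obtain i where "is = [i]" by (auto simp: length_Suc_conv)
  then show ?case by (simp add: mat_mult_def)
next
  case (Cons M Ns)
  then obtain i i' is' where "is": "is = i # i' # is'" "length (i' # is') = Suc (length Ns)"
    by (auto simp: length_Suc_conv)
  have "(\<Sum>x<N. chain ((M # Ns) @ [L]) is x * a x z) = M i i' * (\<Sum>x<N. chain (Ns @ [L]) (i' # is') x * a x z)"
    by (simp add: "is"(1) sum_distrib_left mult.assoc)
  then show ?case using Cons.IH[OF "is"(2)] "is"(1) by simp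
qed

abbreviation index_lists :: "nat \<Rightarrow> nat \<Rightarrow> nat list set" where
  "index_lists N n \<equiv> {is. set is \<subseteq> {..<N} \<and> length is = n}"

lemma sum_index_lists_Cons:
  "(\<Sum>is\<in>index_lists N (Suc n). F is) = (\<Sum>x<N. \<Sum>is\<in>index_lists N n. F (x # is) :: complex)"
proof -
  have "(\<Sum>is\<in>index_lists N (Suc n). F is) = (\<Sum>(x, is)\<in>{..<N} \<times> index_lists N n. F (x # is))"
    by (rule sum.reindex_bij_witness[of _ "\<lambda>(x, is). x # is" "\<lambda>is. (hd is, tl is)"])
       (auto simp: length_Suc_conv)
  then show ?thesis by (simp add: sum.cartesian_product)
qed

lemma sum_index_lists_snoc:
  "(\<Sum>is\<in>index_lists N (Suc n). F is) = (\<Sum>x<N. \<Sum>is\<in>index_lists N n. F (is @ [x]) :: complex)"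
proof -
  have "(\<Sum>is\<in>index_lists N (Suc n). F is) = (\<Sum>(x, is)\<in>{..<N} \<times> index_lists N n. F (is @ [x]))"
    by (rule sum.reindex_bij_witness[of _ "\<lambda>(x, is). is @ [x]" "\<lambda>is. (last is, butlast is)"])
       (auto simp: length_Suc_conv_rev)
  then show ?thesis by (simp add: sum.cartesian_product)
qed

section \<open>The coefficients of the loop and the bracket of truncated matrices\<close>

context spectral_data
begin

definition coeff :: "nat list \<Rightarrow> complex" where
  "coeff is = (\<Sum>k<N. circle_cuts (\<lambda>M. dd (add_mset k M)) (\<lambda>x. - 1 / complex_of_real (p k x)) {#} is)"

definition mat_bracket :: "(nat \<Rightarrow> nat \<Rightarrow> complex) list \<Rightarrow> complex" where
  "mat_bracket Ms = (\<Sum>is\<in>index_lists N (length Ms). coeff is * chain Ms is (hd is))"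

lemma coeff_rotate: "coeff (w @ [x]) = coeff (x # w)"
  unfolding coeff_def circle_cuts_rotate ..

text \<open>For indices below \<open>N\<close> the two-point value \<open>p\<close> is positive, so
  the factor of a cut is its negative inverse, as \<open>circle_cuts_step\<close> requires.\<close>

lemma coeff_step:
  assumes "x < N" "y < N"
  shows "complex_of_real (lam x - lam y) * coeff (x # y # w) = coeff (x # w) - coeff (y # w)"
  unfolding coeff_def sum_distrib_left sum_subtractf[symmetric]
proof (rule sum.cong)
  fix k assume k: "k \<in> {..<N}"
  interpret cut_ward "\<lambda>M. dd (add_mset k M)" "\<lambda>x. - 1 / complex_of_real (p k x)" "\<lambda>x. complex_of_real (lam x)"
  proof
    show "(complex_of_real (lam x) - complex_of_real (lam y)) * dd (add_mset k (add_mset x (add_mset y M)))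
        = dd (add_mset k (add_mset x M)) - dd (add_mset k (add_mset y M))" for x y M
      using dd_step[of x y "add_mset k M"] by (simp add: add_mset_commute)
  qed
  have "- 1 / complex_of_real (p k z) * dd (add_mset k {#z#}) = - 1" if "z < N" for z
    using p_pos[of k z] k that by (simp add: dd_p)
  then show "complex_of_real (lam x - lam y) * circle_cuts (\<lambda>M. dd (add_mset k M)) (\<lambda>x. - 1 / complex_of_real (p k x)) {#} (x # y # w)
      = circle_cuts (\<lambda>M. dd (add_mset k M)) (\<lambda>x. - 1 / complex_of_real (p k x)) {#} (x # w)
        - circle_cuts (\<lambda>M. dd (add_mset k M)) (\<lambda>x. - 1 / complex_of_real (p k x)) {#} (y # w)"
    using circle_cuts_step assms by simp
qed simp

lemma coeff_cut_weight:
  "(\<Sum>k<N. \<Sum>S\<in>Pow {..<n} - {{}}. cut_weight n S k j) = coeff (map j [0..<n])"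
  unfolding coeff_def
proof (rule sum.cong)
  fix k assume "k \<in> {..<N}"
  have "(\<Sum>S\<in>Pow {..<n} - {{}}. cut_weight n S k j) = (\<Sum>S\<in>Pow {0..<n} - {{}}.
      cut_product (\<lambda>M. dd (add_mset k M)) (\<lambda>x. - 1 / complex_of_real (p k x)) n j S ({#} + image_mset j (mset_set {0..Min S})))"
  proof (rule sum.cong)
    fix S assume S: "S \<in> Pow {0..<n} - {{}}"
    then interpret cut_points n S by unfold_locales auto
    show "cut_weight n S k j = cut_product (\<lambda>M. dd (add_mset k M)) (\<lambda>x. - 1 / complex_of_real (p k x)) n j S
        ({#} + image_mset j (mset_set {0..Min S}))"
      unfolding cut_weight_def cut_product_def window_def
      by (rule prod.cong) (simp_all only: window_eq_line_window add_0)
  qed (simp add: lessThan_atLeast0)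
  then show "(\<Sum>S\<in>Pow {..<n} - {{}}. cut_weight n S k j)
      = circle_cuts (\<lambda>M. dd (add_mset k M)) (\<lambda>x. - 1 / complex_of_real (p k x)) {#} (map j [0..<n])"
    by (simp only: circle_cuts_sum[OF le0])
qed simp

theorem one_loop_bracket_mat_bracket:
  assumes "Vs \<noteq> []" "\<And>V. V \<in> set Vs \<Longrightarrow> block V"
  shows "one_loop_bracket \<phi> lam f N Vs = mat_bracket (map (entry \<phi>) Vs)"
proof -
  let ?n = "length Vs"
  have n: "?n > 0" using assms(1) by simp
  have bij: "bij_betw (\<lambda>j. map j [0..<?n]) ({..<?n} \<rightarrow>\<^sub>E {..<N}) (index_lists N ?n)"
  proof (rule bij_betwI[where g = "\<lambda>is. \<lambda>m\<in>{..<?n}. is ! m"])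
    show "(\<lambda>j. map j [0..<?n]) \<in> ({..<?n} \<rightarrow>\<^sub>E {..<N}) \<rightarrow> index_lists N ?n"
    proof
      fix j assume j: "j \<in> {..<?n} \<rightarrow>\<^sub>E {..<N}"
      have "j m < N" if "m < ?n" for m using PiE_mem[OF j] that by auto
      then show "map j [0..<?n] \<in> index_lists N ?n" by auto
    qed
    show "(\<lambda>is. \<lambda>m\<in>{..<?n}. is ! m) \<in> index_lists N ?n \<rightarrow> ({..<?n} \<rightarrow>\<^sub>E {..<N})"
    proof
      fix "is" assume is': "is \<in> index_lists N ?n"
      have "is ! m < N" if "m < ?n" for m
      proof -
        have "is ! m \<in> set is" using is' that by (intro nth_mem) simp
        then show ?thesis using is' by auto
      qed
      then show "(\<lambda>m\<in>{..<?n}. is ! m) \<in> {..<?n} \<rightarrow>\<^sub>E {..<N}" by auto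
    qed
    show "(\<lambda>m\<in>{..<?n}. map j [0..<?n] ! m) = j" if j: "j \<in> {..<?n} \<rightarrow>\<^sub>E {..<N}" for j
    proof
      fix x
      show "(\<lambda>m\<in>{..<?n}. map j [0..<?n] ! m) x = j x"
        using PiE_arb[OF j, of x] by (cases "x < ?n") simp_all
    qed
    show "map (\<lambda>m\<in>{..<?n}. is ! m) [0..<?n] = is" if "is \<in> index_lists N ?n" for "is"
      by (rule nth_equalityI) (use that in auto)
  qed
  have "one_loop_bracket \<phi> lam f N Vs = (\<Sum>j \<in> {..<?n} \<rightarrow>\<^sub>E {..<N}.
      coeff (map j [0..<?n]) * (\<Prod>m<?n. entry \<phi> (Vs ! m) (j m) (j (csucc ?n m))))"
    using one_loop_bracket_sum[OF assms] by (simp only: coeff_cut_weight)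
  also have "\<dots> = (\<Sum>j \<in> {..<?n} \<rightarrow>\<^sub>E {..<N}.
      coeff (map j [0..<?n]) * chain (map (entry \<phi>) Vs) (map j [0..<?n]) (hd (map j [0..<?n])))"
  proof (intro sum.cong arg_cong2[where f = "(*)"] refl)
    fix j
    have "(\<Prod>m<?n. entry \<phi> (Vs ! m) (j m) (j (csucc ?n m)))
        = (\<Prod>m<?n. (map (entry \<phi>) Vs ! m) (map j [0..<?n] ! m) ((map j [0..<?n] @ [hd (map j [0..<?n])]) ! Suc m))"
    proof (rule prod.cong)
      fix m assume "m \<in> {..<?n}"
      then show "entry \<phi> (Vs ! m) (j m) (j (csucc ?n m))
          = (map (entry \<phi>) Vs ! m) (map j [0..<?n] ! m) ((map j [0..<?n] @ [hd (map j [0..<?n])]) ! Suc m)"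
        using n by (auto simp: csucc_def nth_append hd_map)
    qed simp
    then show "(\<Prod>m<?n. entry \<phi> (Vs ! m) (j m) (j (csucc ?n m)))
        = chain (map (entry \<phi>) Vs) (map j [0..<?n]) (hd (map j [0..<?n]))"
      by (simp add: chain_prod)
  qed
  also have "\<dots> = (\<Sum>is\<in>index_lists N ?n. coeff is * chain (map (entry \<phi>) Vs) is (hd is))"
    by (rule sum.reindex_bij_betw[OF bij])
  finally show ?thesis by (simp add: mat_bracket_def)
qed

lemma mat_bracket_rotate: "mat_bracket (Ms @ [M]) = mat_bracket (M # Ms)"
proof -
  have "chain (Ms @ [M]) (is @ [x]) (hd (is @ [x])) = chain (M # Ms) (x # is) x" if "length is = length Ms" for x "is"
    using that by (cases "is"; cases Ms) (simp_all add: chain_snoc mult.commute flip: append_Cons)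
  note chains = this
  have "mat_bracket (Ms @ [M]) = (\<Sum>x<N. \<Sum>is\<in>index_lists N (length Ms).
      coeff (is @ [x]) * chain (Ms @ [M]) (is @ [x]) (hd (is @ [x])))"
    by (simp add: mat_bracket_def sum_index_lists_snoc)
  also have "\<dots> = (\<Sum>x<N. \<Sum>is\<in>index_lists N (length Ms). coeff (x # is) * chain (M # Ms) (x # is) x)"
    by (intro sum.cong refl) (simp only: chains coeff_rotate mem_Collect_eq)
  also have "\<dots> = mat_bracket (M # Ms)"
    by (simp add: mat_bracket_def sum_index_lists_Cons)
  finally show ?thesis .
qed

text \<open>The factor \<open>lam x - lam y\<close> in \<open>d\<close> turns the coefficient of
  \<open>x # y # w\<close> into a difference. In the first part \<open>y\<close> is free and sums to
  the product of \<open>a\<close> with the first matrix, in the second \<open>x\<close> is free and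
  sums to the product of the last matrix with \<open>a\<close>. The hypothesis \<open>eq\<close>
  reads one nonempty list from both ends, a single matrix included.\<close>

lemma mat_bracket_ward:
  assumes d: "\<And>x y. x < N \<Longrightarrow> y < N \<Longrightarrow> d x y = complex_of_real (lam x - lam y) * a x y"
    and eq: "M # Ms = Ns @ [L]"
  shows "mat_bracket (d # M # Ms) = mat_bracket (mat_mult N a M # Ms) - mat_bracket (Ns @ [mat_mult N L a])"
proof -
  let ?n = "length Ms"
  have len: "length Ns = ?n" using eq by (metis length_Cons length_append_singleton old.nat.inject)
  have "mat_bracket (d # M # Ms) = (\<Sum>x<N. \<Sum>y<N. \<Sum>w\<in>index_lists N ?n. coeff (x # y # w) * (d x y * chain (M # Ms) (y # w) x))"
    by (simp add: mat_bracket_def sum_index_lists_Cons)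
  also have "\<dots> = (\<Sum>x<N. \<Sum>y<N. \<Sum>w\<in>index_lists N ?n.
      coeff (x # w) * a x y * chain (M # Ms) (y # w) x - coeff (y # w) * a x y * chain (M # Ms) (y # w) x)"
  proof (intro sum.cong refl)
    fix x y w assume "x \<in> {..<N}" "y \<in> {..<N}"
    then have "coeff (x # y # w) * d x y = (coeff (x # w) - coeff (y # w)) * a x y"
      using d[of x y] coeff_step[of x y w] by (simp add: mult_ac)
    then show "coeff (x # y # w) * (d x y * chain (M # Ms) (y # w) x)
        = coeff (x # w) * a x y * chain (M # Ms) (y # w) x - coeff (y # w) * a x y * chain (M # Ms) (y # w) x"
      by (simp only: mult.assoc[symmetric]) (simp only: left_diff_distrib)
  qed
  also have "\<dots> = (\<Sum>x<N. \<Sum>y<N. \<Sum>w\<in>index_lists N ?n. coeff (x # w) * a x y * chain (M # Ms) (y # w) x)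
      - (\<Sum>x<N. \<Sum>y<N. \<Sum>w\<in>index_lists N ?n. coeff (y # w) * a x y * chain (M # Ms) (y # w) x)"
    by (simp only: sum_subtractf)
  also have "(\<Sum>x<N. \<Sum>y<N. \<Sum>w\<in>index_lists N ?n. coeff (x # w) * a x y * chain (M # Ms) (y # w) x)
      = (\<Sum>x<N. \<Sum>w\<in>index_lists N ?n. \<Sum>y<N. coeff (x # w) * a x y * chain (M # Ms) (y # w) x)"
    by (rule sum.cong[OF refl], rule sum.swap)
  also have "\<dots> = mat_bracket (mat_mult N a M # Ms)"
    by (simp add: mat_bracket_def sum_index_lists_Cons mat_mult_def sum_distrib_left sum_distrib_right mult_ac)
  also have "(\<Sum>x<N. \<Sum>y<N. \<Sum>w\<in>index_lists N ?n. coeff (y # w) * a x y * chain (M # Ms) (y # w) x)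
      = (\<Sum>y<N. \<Sum>x<N. \<Sum>w\<in>index_lists N ?n. coeff (y # w) * a x y * chain (M # Ms) (y # w) x)"
    by (rule sum.swap)
  also have "\<dots> = (\<Sum>y<N. \<Sum>w\<in>index_lists N ?n. \<Sum>x<N. coeff (y # w) * a x y * chain (M # Ms) (y # w) x)"
    by (rule sum.cong[OF refl], rule sum.swap)
  also have "\<dots> = (\<Sum>y<N. \<Sum>w\<in>index_lists N ?n. coeff (y # w) * chain (Ns @ [mat_mult N L a]) (y # w) y)"
  proof (intro sum.cong refl)
    fix y w assume "w \<in> index_lists N ?n"
    then have "(\<Sum>x<N. chain (Ns @ [L]) (y # w) x * a x y) = chain (Ns @ [mat_mult N L a]) (y # w) y"
      by (intro chain_mult_last) (simp add: len)
    moreover have "(\<Sum>x<N. coeff (y # w) * a x y * chain (Ns @ [L]) (y # w) x)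
        = coeff (y # w) * (\<Sum>x<N. chain (Ns @ [L]) (y # w) x * a x y)"
      by (simp add: sum_distrib_left mult_ac)
    ultimately show "(\<Sum>x<N. coeff (y # w) * a x y * chain (M # Ms) (y # w) x)
        = coeff (y # w) * chain (Ns @ [mat_mult N L a]) (y # w) y"
      unfolding eq by simp
  qed
  also have "\<dots> = mat_bracket (Ns @ [mat_mult N L a])"
    by (simp add: mat_bracket_def len sum_index_lists_Cons)
  finally show ?thesis .
qed

lemma mat_bracket_comm:
  assumes "\<And>x. x < N \<Longrightarrow> d x x = 0"
  shows "mat_bracket [d] = 0"
  by (simp add: mat_bracket_def sum_index_lists_Cons[where n = 0, simplified] assms)

lemma chain_cong:
  assumes "length Ms' = length Ms" "\<And>k x y. k < length Ms \<Longrightarrow> x < N \<Longrightarrow> y < N \<Longrightarrow> (Ms ! k) x y = (Ms' ! k) x y"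
    "set is \<subseteq> {..<N}" "length is = length Ms" "z < N"
  shows "chain Ms is z = chain Ms' is z"
proof -
  have lt: "is ! k < N" if "k < length Ms" for k
  proof -
    have "is ! k \<in> set is" using assms(4) that by (intro nth_mem) simp
    then show ?thesis using assms(3) by auto
  qed
  have "(is @ [z]) ! Suc k < N" if "k < length Ms" for k
    using lt[of "Suc k"] assms(4,5) that by (cases "Suc k = length Ms") (simp_all add: nth_append)
  then show ?thesis
    using assms(1,4) lt by (simp add: chain_prod assms(2))
qed

lemma mat_bracket_cong:
  assumes "length Ms' = length Ms" "\<And>k x y. k < length Ms \<Longrightarrow> x < N \<Longrightarrow> y < N \<Longrightarrow> (Ms ! k) x y = (Ms' ! k) x y" "Ms \<noteq> []"
  shows "mat_bracket Ms = mat_bracket Ms'"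
  unfolding mat_bracket_def assms(1)
proof (intro sum.cong refl arg_cong2[where f = "(*)"])
  fix "is" assume is': "is \<in> index_lists N (length Ms)"
  then have "is \<noteq> []" using assms(3) by auto
  then have "hd is < N" using is' by (cases "is") auto
  then show "chain Ms is (hd is) = chain Ms' is (hd is)"
    using is' by (intro chain_cong assms) auto
qed

lemma chain_linear:
  "length is = length us + Suc (length vs) \<Longrightarrow>
    chain (us @ (\<lambda>x y. c * M x y + c' * M' x y) # vs) is z = c * chain (us @ M # vs) is z + c' * chain (us @ M' # vs) is z"
proof (induction us arbitrary: "is")
  case Nil
  then show ?case by (cases "is") (auto simp: algebra_simps)
next
  case (Cons u us)
  then show ?case by (cases "is") (auto simp: algebra_simps)
qed

lemma mat_bracket_linear:
  "mat_bracket (us @ (\<lambda>x y. c * M x y + c' * M' x y) # vs) = c * mat_bracket (us @ M # vs) + c' * mat_bracket (us @ M' # vs)"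
proof -
  have "(\<Sum>is\<in>index_lists N (length us + Suc (length vs)).
      coeff is * chain (us @ (\<lambda>x y. c * M x y + c' * M' x y) # vs) is (hd is))
    = (\<Sum>is\<in>index_lists N (length us + Suc (length vs)).
      c * (coeff is * chain (us @ M # vs) is (hd is)) + c' * (coeff is * chain (us @ M' # vs) is (hd is)))"
    by (rule sum.cong) (auto simp: chain_linear algebra_simps)
  then show ?thesis by (simp add: mat_bracket_def sum.distrib sum_distrib_left)
qed

end

section \<open>The Fedosov product on forms\<close>

lemma one_form_word: "(1 :: 'a :: complex_algebra_1 form) = word_form (1, [])"
  by transfer (simp add: form_null.zero)

lemma word_act_one: "word_act w 1 = word_form w"
  using times_word[of w 1] by simp

lemma word_form_snoc: "word_form (a, as @ [b]) = word_form (a, as) * word_form (1, [b])"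
proof -
  have "foldr fdleft [b] 1 = word_form (1, [b])"
    using word_act_one[of "(1, [b])"] by (simp add: word_act_def fleft_one)
  then have "word_act (a, as @ [b]) 1 = word_act (a, as) (word_form (1, [b]))"
    by (simp add: word_act_def)
  then show ?thesis by (simp add: word_act_one times_word)
qed

lemma word_form_left: "word_form (a, []) * \<omega> = fleft a \<omega>"
  by (simp add: times_word word_act_def)

lemma word_form_dleft: "word_form (1, [a]) * \<omega> = fdleft a \<omega>"
  by (simp add: times_word word_act_def fleft_one)

lemma fd_minus: "fd (- \<omega>) = - fd \<omega>"
  using fd_cscale[of "- 1" \<omega>] by (simp add: cscale_minus_left cscale_one)

lemma fd_diff: "fd (\<omega> - \<eta>) = fd \<omega> - fd \<eta>"
  using fd_add[of \<omega> "- \<eta>"] by (simp add: fd_minus)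

lemma fd_sum: "fd (\<Sum>i\<in>I. g i) = (\<Sum>i\<in>I. fd (g i))"
  by (induction I rule: infinite_finite_induct) (simp_all add: fd_zero fd_add)

text \<open>The parity automorphism, by which graded sign rules can be stated for forms of mixed
  degree.\<close>

lift_definition fgrade :: "'a :: complex_algebra_1 form \<Rightarrow> 'a form"
  is "lext (\<lambda>(a, as). (- 1) ^ length as *\<^sub>C word_form (a, as))"
proof -
  fix x y :: "('a word, complex) poly_mapping"
  assume "x - y \<in> form_null"
  then have "lext (\<lambda>(a, as). (- 1) ^ length as *\<^sub>C word_form (a, as)) (x - y) = 0"
    by (rule lext_null_zero)
       (simp_all add: word_form_head_add word_form_head_scale word_form_tail_add word_form_tail_scale
          word_form_tail_one cscale_add_right cscale_cscale mult.commute)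
  then show "lext (\<lambda>(a, as). (- 1) ^ length as *\<^sub>C word_form (a, as)) x
      = lext (\<lambda>(a, as). (- 1) ^ length as *\<^sub>C word_form (a, as)) y"
    by (simp add: lext_diff)
qed

lemma fgrade_add: "fgrade (\<omega> + \<eta>) = fgrade \<omega> + fgrade \<eta>"
  by transfer (simp add: lext_add)

lemma fgrade_cscale: "fgrade (c *\<^sub>C \<omega>) = c *\<^sub>C fgrade \<omega>"
  by transfer (simp add: lext_pscale)

lemma fgrade_zero: "fgrade 0 = 0"
  using fgrade_cscale[of 0 0] by simp

lemma fgrade_minus: "fgrade (- \<omega>) = - fgrade \<omega>"
  using fgrade_cscale[of "- 1" \<omega>] by (simp add: cscale_minus_left cscale_one)

lemma fgrade_diff: "fgrade (\<omega> - \<eta>) = fgrade \<omega> - fgrade \<eta>"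
  using fgrade_add[of \<omega> "- \<eta>"] by (simp add: fgrade_minus)

lemma fgrade_word: "fgrade (word_form (a, as)) = (- 1) ^ length as *\<^sub>C word_form (a, as)"
  by transfer (simp add: cscale_one)

lemma fgrade_fgrade: "fgrade (fgrade \<omega>) = \<omega>"
  by (induction \<omega> rule: form_induct)
     (simp_all add: fgrade_zero fgrade_add fgrade_cscale fgrade_word cscale_cscale cscale_one
        flip: power_add mult_2)

lemma fgrade_fd: "fgrade (fd \<omega>) = - fd (fgrade \<omega>)"
  by (induction \<omega> rule: form_induct)
     (simp_all add: fgrade_zero fd_zero fgrade_add fd_add fgrade_cscale fd_cscale fgrade_word fd_word
        cscale_minus_left cscale_minus_right)

lemma fgrade_fleft: "fgrade (fleft a \<omega>) = fleft a (fgrade \<omega>)"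
  by (induction \<omega> rule: form_induct)
     (simp_all add: fgrade_zero fleft_zero fgrade_add fleft_add fgrade_cscale fleft_cscale fgrade_word fleft_word)

lemma fleft_minus: "fleft a (- \<omega>) = - fleft a \<omega>"
  using fleft_diff[of a 0 \<omega>] by (simp add: fleft_zero)

lemma fgrade_fdleft: "fgrade (fdleft a \<omega>) = - fdleft a (fgrade \<omega>)"
  by (simp add: fdleft_def fgrade_diff fgrade_fd fgrade_fleft fleft_minus)

lemma fgrade_times: "fgrade (\<omega> * \<eta>) = fgrade \<omega> * fgrade \<eta>"
proof (induction \<omega> rule: form_induct)
  case (word a as)
  have "fgrade (foldr fdleft as \<eta>) = (- 1) ^ length as *\<^sub>C foldr fdleft as (fgrade \<eta>)"
    by (induction as) (simp_all add: cscale_one fgrade_fdleft fdleft_cscale cscale_minus_left cscale_minus_right)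
  then show ?case
    by (simp add: times_word fgrade_word cscale_mult_left word_act_def fgrade_fleft fleft_cscale)
qed (simp_all add: fgrade_zero fgrade_add fgrade_cscale distrib_right cscale_mult_left)

lemma fd_fleft: "fd (fleft a \<omega>) = fdleft a \<omega> + fleft a (fd \<omega>)"
  by (simp add: fdleft_def)

lemma fd_fdleft: "fd (fdleft a \<omega>) = - fdleft a (fd \<omega>)"
  by (simp add: fdleft_def fd_diff fd_fd fleft_zero)

theorem fd_times: "fd (\<omega> * \<eta>) = fd \<omega> * \<eta> + fgrade \<omega> * fd \<eta>"
proof (induction \<omega> rule: form_induct)
  case (word a as)
  have "fd (foldr fdleft as \<eta>) = (- 1) ^ length as *\<^sub>C foldr fdleft as (fd \<eta>)"
    by (induction as) (simp_all add: cscale_one fd_fdleft fdleft_cscale cscale_minus_left cscale_minus_right)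
  then show ?case
    by (simp add: times_word fgrade_word fd_word cscale_mult_left word_act_def fd_fleft fleft_cscale fleft_one)
qed (simp_all add: fd_zero fgrade_zero fgrade_add fgrade_cscale fd_add fd_cscale distrib_right cscale_mult_left
      cscale_add_right algebra_simps)

definition fodd :: "'a :: complex_algebra_1 form \<Rightarrow> 'a form" where
  "fodd \<omega> = (1 / 2) *\<^sub>C (\<omega> - fgrade \<omega>)"

lemma fodd_add: "fodd (\<omega> + \<eta>) = fodd \<omega> + fodd \<eta>"
  by (simp add: fodd_def fgrade_add cscale_add_right[symmetric] algebra_simps)

lemma fodd_cscale: "fodd (c *\<^sub>C \<omega>) = c *\<^sub>C fodd \<omega>"
  by (simp add: fodd_def fgrade_cscale cscale_diff_right cscale_cscale mult.commute)

lemma fodd_even: "fgrade \<omega> = \<omega> \<Longrightarrow> fodd \<omega> = 0"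
  by (simp add: fodd_def)

lemma fodd_odd: "fgrade \<omega> = - \<omega> \<Longrightarrow> fodd \<omega> = \<omega>"
proof -
  have "(1 / 2) *\<^sub>C (\<omega> + \<omega>) = (1 / 2 + 1 / 2) *\<^sub>C \<omega>"
    unfolding cscale_add_left cscale_add_right ..
  then show "fgrade \<omega> = - \<omega> \<Longrightarrow> fodd \<omega> = \<omega>" by (simp add: fodd_def cscale_one)
qed

lemma fodd_times: "fodd (\<omega> * \<eta>) = \<omega> * fodd \<eta> + fodd \<omega> * fgrade \<eta>"
  unfolding fodd_def cscale_mult_left cscale_mult_right cscale_add_right[symmetric] fgrade_times
  by (simp add: algebra_simps)

lemma fgrade_fodd: "fgrade (fodd \<omega>) = - fodd \<omega>"
  unfolding fodd_def fgrade_cscale cscale_minus_right[symmetric]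
  by (simp add: fgrade_diff fgrade_fgrade)

text \<open>An odd factor selects the even part of \<open>fd \<eta>\<close>, which is the
  differential of the odd part of \<eta>. Associativity of the Fedosov product rests on
  this.\<close>

lemma fodd_fodd_fd: "fodd (fodd \<omega> * fd \<eta>) = fodd \<omega> * fd (fodd \<eta>)"
proof -
  have "fodd (fodd \<omega> * fd \<eta>) = (1 / 2) *\<^sub>C (fodd \<omega> * fd \<eta> - fodd \<omega> * fd (fgrade \<eta>))"
    by (subst fodd_def) (simp add: fgrade_times fgrade_fodd fgrade_fd)
  also have "\<dots> = fodd \<omega> * ((1 / 2) *\<^sub>C (fd \<eta> - fd (fgrade \<eta>)))"
    by (simp add: cscale_mult_right right_diff_distrib)
  also have "(1 / 2) *\<^sub>C (fd \<eta> - fd (fgrade \<eta>)) = fd (fodd \<eta>)"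
    unfolding fodd_def[of \<eta>] by (simp add: fd_cscale fd_diff)
  finally show ?thesis .
qed

text \<open>A copy of the type of forms, whose product is the Fedosov product
  \<open>\<omega>\<eta> + \<omega>\<^sub>o\<^sub>d\<^sub>d d\<eta>\<close>.  The bracket turns out to be a trace for this product.\<close>

typedef (overloaded) 'a fedosov = "UNIV :: 'a :: complex_algebra_1 form set"
  morphisms form_of fedosov ..

setup_lifting type_definition_fedosov

instantiation fedosov :: (complex_algebra_1) complex_algebra_1
begin

lift_definition zero_fedosov :: "'a fedosov" is 0 .
lift_definition one_fedosov :: "'a fedosov" is 1 .
lift_definition plus_fedosov :: "'a fedosov \<Rightarrow> 'a fedosov \<Rightarrow> 'a fedosov" is "(+)" .
lift_definition minus_fedosov :: "'a fedosov \<Rightarrow> 'a fedosov \<Rightarrow> 'a fedosov" is "(-)" .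
lift_definition uminus_fedosov :: "'a fedosov \<Rightarrow> 'a fedosov" is uminus .
lift_definition cscale_fedosov :: "complex \<Rightarrow> 'a fedosov \<Rightarrow> 'a fedosov" is cscale .
lift_definition times_fedosov :: "'a fedosov \<Rightarrow> 'a fedosov \<Rightarrow> 'a fedosov" is "\<lambda>\<omega> \<eta>. \<omega> * \<eta> + fodd \<omega> * fd \<eta>" .

instance
proof
  fix x y z :: "'a fedosov" and c d :: complex
  show "x + y + z = x + (y + z)" by transfer (simp add: add.assoc)
  show "x + y = y + x" by transfer (simp add: add.commute)
  show "0 + x = x" by transfer simp
  show "- x + x = 0" by transfer simp
  show "x - y = x + - y" by transfer simp
  show "c *\<^sub>C (x + y) = c *\<^sub>C x + c *\<^sub>C y" by transfer (rule cscale_add_right)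
  show "(c + d) *\<^sub>C x = c *\<^sub>C x + d *\<^sub>C x" by transfer (rule cscale_add_left)
  show "c *\<^sub>C d *\<^sub>C x = (c * d) *\<^sub>C x" by transfer (rule cscale_cscale)
  show "1 *\<^sub>C x = x" by transfer (rule cscale_one)
  show "x * y * z = x * (y * z)"
  proof transfer
    fix \<omega> \<eta> \<zeta> :: "'a form"
    show "(\<omega> * \<eta> + fodd \<omega> * fd \<eta>) * \<zeta> + fodd (\<omega> * \<eta> + fodd \<omega> * fd \<eta>) * fd \<zeta>
        = \<omega> * (\<eta> * \<zeta> + fodd \<eta> * fd \<zeta>) + fodd \<omega> * fd (\<eta> * \<zeta> + fodd \<eta> * fd \<zeta>)"
    proof -
      have "fodd (\<omega> * \<eta> + fodd \<omega> * fd \<eta>) = \<omega> * fodd \<eta> + fodd \<omega> * fgrade \<eta> + fodd \<omega> * fd (fodd \<eta>)"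
        by (simp only: fodd_add fodd_times[of \<omega> \<eta>] fodd_fodd_fd)
      then show ?thesis by (simp add: fd_add fd_times fd_fd algebra_simps)
    qed
  qed
  have fd_one: "fd (1 :: 'a form) = 0"
    using word_form_tail_one[of 1 "[]" "[]"] by (simp add: one_form_word fd_word)
  have fgrade_one: "fgrade (1 :: 'a form) = 1"
    by (simp add: one_form_word fgrade_word cscale_one)
  show "1 * x = x" by transfer (simp add: fodd_even fgrade_one)
  show "x * 1 = x" by transfer (simp add: fd_one)
  show "(x + y) * z = x * z + y * z" by transfer (simp add: fodd_add algebra_simps)
  show "x * (y + z) = x * y + x * z" by transfer (simp add: fd_add algebra_simps)
  show "(c *\<^sub>C x) * y = c *\<^sub>C (x * y)"
    by transfer (simp add: fodd_cscale cscale_mult_left cscale_add_right)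
  show "x * (c *\<^sub>C y) = c *\<^sub>C (x * y)"
    by transfer (simp add: fd_cscale cscale_mult_right cscale_add_right)
  show "(0 :: 'a fedosov) \<noteq> 1" by transfer simp
qed

end

lemma form_of_fedosov [simp]: "form_of (fedosov \<omega>) = \<omega>"
  by (simp add: fedosov_inverse)

lemma fedosov_form_of [simp]: "fedosov (form_of x) = x"
  by (rule form_of_inverse)

lemma fedosov_add: "fedosov (\<omega> + \<eta>) = fedosov \<omega> + fedosov \<eta>"
  and fedosov_diff: "fedosov (\<omega> - \<eta>) = fedosov \<omega> - fedosov \<eta>"
  and fedosov_cscale: "fedosov (c *\<^sub>C \<omega>) = c *\<^sub>C fedosov \<omega>"
  and fedosov_zero: "fedosov 0 = 0"
  and fedosov_one: "fedosov 1 = 1"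
  and fedosov_times: "fedosov \<omega> * fedosov \<eta> = fedosov (\<omega> * \<eta> + fodd \<omega> * fd \<eta>)"
  by (simp_all add: plus_fedosov_def minus_fedosov_def cscale_fedosov_def zero_fedosov_def one_fedosov_def
      times_fedosov_def)

lemma form_of_add: "form_of (x + y) = form_of x + form_of y"
  and form_of_cscale: "form_of (c *\<^sub>C x) = c *\<^sub>C form_of x"
  by (simp_all add: plus_fedosov_def cscale_fedosov_def)

lemma fedosov_even: "fgrade \<omega> = \<omega> \<Longrightarrow> fedosov \<omega> * fedosov \<eta> = fedosov (\<omega> * \<eta>)"
  by (simp add: fedosov_times fodd_even)
lemma fedosov_odd: "fgrade \<omega> = - \<omega> \<Longrightarrow> fedosov \<omega> * fedosov \<eta> = fedosov (\<omega> * \<eta> + \<omega> * fd \<eta>)"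
  by (simp add: fedosov_times fodd_odd)
lemma fedosov_closed: "fd \<eta> = 0 \<Longrightarrow> fedosov \<omega> * fedosov \<eta> = fedosov (\<omega> * \<eta>)"
  by (simp add: fedosov_times)

lemma fedosov_even_power: "fgrade \<omega> = \<omega> \<Longrightarrow> fedosov \<omega> ^ j = fedosov (\<omega> ^ j)"
  by (induction j) (simp_all add: fedosov_one fedosov_even)

lemma fgrade_one: "fgrade (1 :: 'a :: complex_algebra_1 form) = 1"
  by (simp add: one_form_word fgrade_word cscale_one)

lemma fgrade_even_power: "fgrade \<omega> = \<omega> \<Longrightarrow> fgrade (\<omega> ^ j) = \<omega> ^ j"
  by (induction j) (simp_all add: fgrade_one fgrade_times)

lemma fedosov_word_snoc: "fedosov (word_form (a, as @ [b])) = fedosov (word_form (a, as)) * fedosov (word_form (1, [b]))"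
proof -
  have "fd (word_form (1, [b])) = 0"
    using word_form_tail_one[of 1 "[]" "[b]"] by (simp add: fd_word)
  then show ?thesis by (simp add: word_form_snoc fedosov_closed)
qed

text \<open>Elements that the trace lets pass every other element form a subalgebra, and
  \<open>fedosov_word_snoc\<close> generates all words from elements of the algebra and their
  differentials.\<close>

lemma fedosov_trace:
  fixes T :: "'a :: complex_algebra_1 form \<Rightarrow> complex"
  assumes lin: "clinear_map T"
    and gen0: "\<And>a \<omega>. T (form_of (fedosov (word_form (a, [])) * fedosov \<omega>)) = T (form_of (fedosov \<omega> * fedosov (word_form (a, []))))"
    and gen1: "\<And>a \<omega>. T (form_of (fedosov (word_form (1, [a])) * fedosov \<omega>)) = T (form_of (fedosov \<omega> * fedosov (word_form (1, [a]))))"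
  shows "T (form_of (x * y)) = T (form_of (y * x))"
proof -
  define C where "C = {x :: 'a fedosov. \<forall>y. T (form_of (x * y)) = T (form_of (y * x))}"
  have T_add: "T (\<omega> + \<eta>) = T \<omega> + T \<eta>" and T_scale: "T (c *\<^sub>C \<omega>) = c * T \<omega>" for \<omega> \<eta> c
    using lin by (simp_all add: clinear_map_def cscale_complex_def)
  note form_add = form_of_add and form_scale = form_of_cscale
  have g0: "fedosov (word_form (a, [])) \<in> C" for a
    using gen0[of a "form_of y" for y] by (simp add: C_def)
  have g1: "fedosov (word_form (1, [a])) \<in> C" for a
    using gen1[of a "form_of y" for y] by (simp add: C_def)
  have mult: "x * y \<in> C" if "x \<in> C" "y \<in> C" for x y
    using that by (simp add: C_def) (metis mult.assoc)
  have add: "x + y \<in> C" if "x \<in> C" "y \<in> C" for x y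
    using that by (simp add: C_def distrib_left distrib_right form_add T_add)
  have scale: "c *\<^sub>C x \<in> C" if "x \<in> C" for x c
    using that by (simp add: C_def cscale_mult_left cscale_mult_right form_scale T_scale)
  have words: "fedosov (word_form (a, as)) \<in> C" for a as
    by (induction as rule: rev_induct) (auto simp: g0 fedosov_word_snoc intro: mult g1)
  have "fedosov \<omega> \<in> C" for \<omega>
  proof (induction \<omega> rule: form_induct)
    case zero
    then show ?case by (simp add: C_def fedosov_zero)
  qed (simp_all add: fedosov_add fedosov_cscale add scale words)
  from this[of "form_of x"] show ?thesis by (simp add: C_def)
qed

text \<open>With \<open>P = 1 - x\<close> and \<open>Q = 1 + y\<close> the two elements in question are \<open>1 - P Q\<close> and \<open>1 - Q P\<close>.\<close>

lemma trace_curvature_swap: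
  fixes T :: "'r :: ring_1 \<Rightarrow> complex" and x y :: 'r
  assumes add: "\<And>u v. T (u + v) = T u + T v" and comm: "\<And>u v. T (u * v) = T (v * u)"
  shows "T (x * (x - y + y * x) ^ j * y) = T (x * y * (x - y + x * y) ^ j)"
proof -
  let ?F = "x - y + x * y" and ?O = "x - y + y * x" and ?P = "1 - x" and ?Q = "1 + y"
  have diff: "T (u - v) = T u - T v" for u v
    using add[of "u - v" v] by simp
  have F: "?F = 1 - ?P * ?Q" and O: "?O = 1 - ?Q * ?P" by (simp_all add: algebra_simps)
  \<comment> \<open>From \<open>?Q * (1 - ?P * ?Q) = (1 - ?Q * ?P) * ?Q\<close>, iterated.\<close>
  have QF: "?Q * ?F ^ j = ?O ^ j * ?Q" for j
  proof (induction j)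
    case (Suc j)
    have "?Q * ?F = ?O * ?Q" unfolding F O by (simp add: algebra_simps)
    then show ?case using Suc by (metis mult.assoc power_Suc)
  qed simp
  have FP: "?F ^ j * ?P = ?P * ?O ^ j" for j
  proof (induction j)
    case (Suc j)
    have "?F * ?P = ?P * ?O" unfolding F O by (simp add: algebra_simps)
    then show ?case using Suc by (metis mult.assoc power_Suc)
  qed simp
  have powers: "T (?O ^ j) = T (?F ^ j)" for j
  proof (induction j)
    case (Suc j)
    have "?O ^ Suc j = ?O ^ j - ?O ^ j * ?Q * ?P" "?F ^ Suc j = ?F ^ j - ?F ^ j * (?P * ?Q)"
      unfolding power_Suc2 by (subst O F, simp add: algebra_simps)+
    moreover have "T (?O ^ j * ?Q * ?P) = T (?F ^ j * (?P * ?Q))"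
      unfolding QF[symmetric] using comm[of ?Q "?F ^ j * ?P"] by (simp add: mult.assoc)
    ultimately show ?case using Suc by (simp only: diff)
  qed simp
  have "T ((x - y) * ?O ^ j) = T ((x - y) * ?F ^ j)"
  proof -
    \<comment> \<open>Writing \<open>x - y\<close> through \<open>?P\<close> and \<open>?Q\<close>
      reduces the claim to powers and to the intertwining relations, where the trace swaps
      factors.\<close>
    have "x - y = 1 + 1 - ?P - ?Q" by simp
    then have split: "(x - y) * z = z + z - ?P * z - ?Q * z" for z
      by (simp add: algebra_simps)
    have "T (?P * ?O ^ j) = T (?P * ?F ^ j)" unfolding FP[symmetric] by (rule comm)
    moreover have "T (?Q * ?O ^ j) = T (?Q * ?F ^ j)" unfolding QF by (rule comm)
    ultimately show ?thesis using powers[of j] by (simp only: split diff add)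
  qed
  moreover have "T (x * ?O ^ j * y) = T (y * x * ?O ^ j)"
    using comm[of "x * ?O ^ j" y] by (simp add: mult.assoc)
  moreover have "y * x * ?O ^ j = ?O ^ Suc j - (x - y) * ?O ^ j" "x * y * ?F ^ j = ?F ^ Suc j - (x - y) * ?F ^ j"
    by (simp_all add: algebra_simps)
  ultimately show ?thesis using powers[of "Suc j"] by (simp only: diff)
qed

text \<open>With \<open>x = A\<close> and \<open>y = A - fd A\<close> as Fedosov elements, the
  correction term gives \<open>x * y = A * A\<close>, so the two elements of
  \<open>trace_curvature_swap\<close> are the curvature F and \<open>F - fd F\<close>. A lone odd
  factor cannot be moved directly, since the trace is one for the Fedosov product, which adds a
  differential to it.\<close>

lemma curvature_swap:
  fixes T :: "'a :: complex_algebra_1 form \<Rightarrow> complex"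
  assumes add: "\<And>\<omega> \<eta>. T (\<omega> + \<eta>) = T \<omega> + T \<eta>" and comm: "\<And>x y. T (form_of (x * y)) = T (form_of (y * x))"
    and odd: "fgrade A = - A"
  shows "T (A * (fd A + A * A) ^ j * A) = T (A * A * (fd A + A * A) ^ j)"
proof -
  let ?F = "fd A + A * A" and ?x = "fedosov A" and ?y = "fedosov (A - fd A)"
  have even: "fgrade ?F = ?F" by (simp add: fgrade_add fgrade_fd fgrade_times odd fd_minus)
  have xy: "?x * ?y = fedosov (A * A)"
    using odd by (simp add: fedosov_odd fd_diff fd_fd right_diff_distrib)
  have F: "?x - ?y + ?x * ?y = fedosov ?F"
    unfolding xy by (simp add: fedosov_diff fedosov_add)
  have dd: "fd (A * A) = fd A * A - A * fd A" by (simp add: fd_times odd)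
  have "?y * ?x = fedosov (A * A + A * fd A - fd A * A)"
    using fedosov_odd[OF odd, of A] fedosov_even[of "fd A" A]
    by (simp add: fedosov_diff left_diff_distrib fgrade_fd odd fd_minus)
  then have O: "?x - ?y + ?y * ?x = fedosov (?F - fd ?F)"
    by (simp add: fd_add fd_fd dd flip: fedosov_diff fedosov_add) (simp add: algebra_simps)
  \<comment> \<open>Subtracting the differential is multiplicative from even forms to the Fedosov
    product, which computes the powers of \<open>F - fd F\<close>.\<close>
  have mult: "fedosov (u - fd u) * fedosov (v - fd v) = fedosov (u * v - fd (u * v))"
    if "fgrade u = u" "fgrade v = v" for u v :: "'a form"
  proof -
    have "fgrade (fd u) = - fd u" using that by (simp add: fgrade_fd)
    then have "fodd (u - fd u) = - fd u"
      using fodd_odd[of "- fd u"] fodd_even[OF that(1)] fodd_add[of u "- fd u"] by (simp add: fgrade_minus)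
    then show ?thesis
      by (simp add: fedosov_times fd_diff fd_fd fd_times that algebra_simps)
  qed
  have O_pow: "fedosov (?F - fd ?F) ^ j = fedosov (?F ^ j - fd (?F ^ j))" for j
  proof (induction j)
    case 0
    have "fd (1 :: 'a form) = 0"
      using word_form_tail_one[of 1 "[]" "[]"] by (simp add: one_form_word fd_word)
    then show ?case by (simp add: fedosov_one)
  next
    case (Suc j)
    then show ?case using mult[OF even fgrade_even_power[OF even], of j] by simp
  qed
  have xO: "?x * fedosov (?F ^ j - fd (?F ^ j)) = fedosov (A * ?F ^ j)"
    using odd by (simp add: fedosov_odd fd_diff fd_fd right_diff_distrib)
  have "fgrade (A * ?F ^ j) = - (A * ?F ^ j)"
    by (simp add: fgrade_times odd fgrade_even_power[OF even])
  then have "fedosov (A * ?F ^ j) * ?y = fedosov (A * ?F ^ j * A)"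
    by (simp add: fedosov_odd fd_diff fd_fd right_diff_distrib)
  then have lhs: "?x * (?x - ?y + ?y * ?x) ^ j * ?y = fedosov (A * ?F ^ j * A)"
    unfolding O O_pow xO .
  have rhs: "?x * ?y * (?x - ?y + ?x * ?y) ^ j = fedosov (A * A * ?F ^ j)"
    unfolding F unfolding xy
    by (simp add: fedosov_even_power[OF even] fedosov_even fgrade_times odd)
  have "T (form_of (?x * (?x - ?y + ?y * ?x) ^ j * ?y)) = T (form_of (?x * ?y * (?x - ?y + ?x * ?y) ^ j))"
  proof (rule trace_curvature_swap[where T = "\<lambda>x. T (form_of x)"])
    show "T (form_of (u + v)) = T (form_of u) + T (form_of v)" for u v
      by (simp add: form_of_add add)
  qed (rule comm)
  then show ?thesis unfolding lhs rhs by simp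
qed

section \<open>Homogeneous forms\<close>

lemma abs_form_single: "abs_form (Poly_Mapping.single w c) = c *\<^sub>C word_form w"
  unfolding word_form.abs_eq cscale_form.abs_eq
  by (rule arg_cong[where f = abs_form], rule poly_mapping_eqI) (simp add: lookup_single when_def)

lemma abs_form_sum: "finite I \<Longrightarrow> abs_form (\<Sum>i\<in>I. x i) = (\<Sum>i\<in>I. abs_form (x i))"
  by (induction I rule: finite_induct) (simp_all add: zero_form.abs_eq plus_form.abs_eq[symmetric])

lemma abs_form_lext: "abs_form x = lext word_form x"
proof -
  have "abs_form x = abs_form (\<Sum>w\<in>Poly_Mapping.keys x. Poly_Mapping.single w (Poly_Mapping.lookup x w))"
    by (intro arg_cong[where f = abs_form] poly_mapping_eqI)
       (auto simp: lookup_sum lookup_single when_def sum.delta in_keys_iff)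
  then show ?thesis by (simp add: abs_form_sum abs_form_single lext_def)
qed

lemma Omega_add: "\<omega> \<in> Omega n \<Longrightarrow> \<eta> \<in> Omega n \<Longrightarrow> \<omega> + \<eta> \<in> Omega n"
proof -
  assume "\<omega> \<in> Omega n" "\<eta> \<in> Omega n"
  then obtain x y where "\<omega> = abs_form x" "\<eta> = abs_form y"
    "\<forall>w\<in>Poly_Mapping.keys x. length (snd w) = n" "\<forall>w\<in>Poly_Mapping.keys y. length (snd w) = n"
    by (auto simp: Omega_def)
  then show ?thesis
    unfolding Omega_def mem_Collect_eq
    by (intro exI[of _ "x + y"]) (use Poly_Mapping.keys_add[of x y] in \<open>auto simp: plus_form.abs_eq\<close>)
qed

lemma Omega_cscale: "\<omega> \<in> Omega n \<Longrightarrow> c *\<^sub>C \<omega> \<in> Omega n"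
proof -
  assume "\<omega> \<in> Omega n"
  then obtain x where "\<omega> = abs_form x" "\<forall>w\<in>Poly_Mapping.keys x. length (snd w) = n"
    by (auto simp: Omega_def)
  then show ?thesis
    unfolding Omega_def mem_Collect_eq
    by (intro exI[of _ "pscale c x"]) (auto simp: cscale_form.abs_eq in_keys_iff)
qed

lemma Omega_zero: "0 \<in> Omega n"
  unfolding Omega_def zero_form.abs_eq by (intro CollectI exI[of _ 0]) simp

lemma Omega_word: "length as = n \<Longrightarrow> word_form (a, as) \<in> Omega n"
  unfolding Omega_def word_form.abs_eq by (intro CollectI exI[of _ "word1 (a, as)"]) simp

lemma Omega_sum: "(\<And>i. i \<in> I \<Longrightarrow> g i \<in> Omega n) \<Longrightarrow> (\<Sum>i\<in>I. g i) \<in> Omega n"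
  by (induction I rule: infinite_finite_induct) (simp_all add: Omega_zero Omega_add)

lemma Omega_minus: "\<omega> \<in> Omega n \<Longrightarrow> - \<omega> \<in> Omega n"
  using Omega_cscale[of \<omega> n "- 1"] by (simp add: cscale_minus_left cscale_one)

lemma Omega_induct [consumes 1, case_names zero add cscale word]:
  assumes "\<omega> \<in> Omega n" "P 0" "\<And>\<omega> \<eta>. P \<omega> \<Longrightarrow> P \<eta> \<Longrightarrow> P (\<omega> + \<eta>)" "\<And>c \<omega>. P \<omega> \<Longrightarrow> P (c *\<^sub>C \<omega>)"
    and "\<And>a as. length as = n \<Longrightarrow> P (word_form (a, as))"
  shows "P \<omega>"
proof -
  obtain x where x: "\<omega> = abs_form x" "\<forall>w\<in>Poly_Mapping.keys x. length (snd w) = n"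
    using assms(1) by (auto simp: Omega_def)
  have sums: "finite I \<Longrightarrow> (\<And>i. i \<in> I \<Longrightarrow> P (g i)) \<Longrightarrow> P (\<Sum>i\<in>I. g i)" for I :: "'a word set" and g
    by (induction I rule: finite_induct) (simp_all add: assms(2,3))
  have "P (word_form w)" if "w \<in> Poly_Mapping.keys x" for w
    using assms(5)[of "snd w" "fst w"] x(2) that by simp
  then show ?thesis
    unfolding x(1) abs_form_lext lext_def by (intro sums assms(4)) auto
qed

lemma Omega_fd: "\<omega> \<in> Omega n \<Longrightarrow> fd \<omega> \<in> Omega (Suc n)"
  by (induction rule: Omega_induct) (simp_all add: fd_zero fd_add fd_cscale fd_word Omega_zero Omega_add Omega_cscale Omega_word)

lemma Omega_fleft: "\<omega> \<in> Omega n \<Longrightarrow> fleft a \<omega> \<in> Omega n"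
  by (induction rule: Omega_induct)
     (simp_all add: fleft_zero fleft_add fleft_cscale fleft_word Omega_zero Omega_add Omega_cscale Omega_word)

lemma Omega_fdleft: "\<omega> \<in> Omega n \<Longrightarrow> fdleft a \<omega> \<in> Omega (Suc n)"
  unfolding fdleft_def diff_conv_add_uminus by (intro Omega_add Omega_minus Omega_fd Omega_fleft)

lemma Omega_times: "\<omega> \<in> Omega m \<Longrightarrow> \<eta> \<in> Omega n \<Longrightarrow> \<omega> * \<eta> \<in> Omega (m + n)"
proof (induction rule: Omega_induct)
  case (word a as)
  have "foldr fdleft as \<eta> \<in> Omega (length as + n)"
    using word.prems by (induction as) (simp_all add: Omega_fdleft)
  then show ?case using word.hyps by (simp add: times_word word_act_def Omega_fleft)
qed (simp_all add: Omega_zero distrib_right Omega_add cscale_mult_left Omega_cscale)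

lemma Omega_one: "1 \<in> Omega 0"
  by (simp add: one_form_word Omega_word)

lemma fgrade_Omega: "\<omega> \<in> Omega n \<Longrightarrow> fgrade \<omega> = (- 1) ^ n *\<^sub>C \<omega>"
  by (induction rule: Omega_induct)
     (simp_all add: fgrade_zero fgrade_add fgrade_cscale fgrade_word cscale_add_right cscale_cscale mult.commute)

lemma cint_Omega:
  assumes "\<phi> \<in> cochains n" "clinear_map T" "\<omega> \<in> Omega n"
    and "\<And>a as. length as = n \<Longrightarrow> T (word_form (a, as)) = \<phi> (a # as)"
  shows "cint n \<phi> \<omega> = T \<omega>"
proof -
  obtain x where x: "\<omega> = abs_form x" "\<forall>w\<in>Poly_Mapping.keys x. length (snd w) = n"
    using assms(3) by (auto simp: Omega_def)
  have T: "T 0 = 0" "T (u + v) = T u + T v" "T (c *\<^sub>C u) = c *\<^sub>C T u" for u v c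
    using assms(2) unfolding clinear_map_def by (auto simp: cscale_complex_def) (metis add_cancel_right_right)
  have T_sum: "T (\<Sum>i\<in>I. g i) = (\<Sum>i\<in>I. T (g i))" for I :: "'a word set" and g
    by (induction I rule: infinite_finite_induct) (simp_all add: T)
  have "cint n \<phi> \<omega> = (\<Sum>w\<in>Poly_Mapping.keys x. Poly_Mapping.lookup x w *\<^sub>C (case w of (a, as) \<Rightarrow> if length as = n then \<phi> (a # as) else 0))"
    unfolding x(1) cint_abs_form[OF assms(1)] lext_def ..
  also have "\<dots> = (\<Sum>w\<in>Poly_Mapping.keys x. Poly_Mapping.lookup x w *\<^sub>C T (word_form w))"
    by (rule sum.cong) (use x(2) assms(4) in auto)
  also have "\<dots> = T \<omega>"
    unfolding x(1) abs_form_lext lext_def by (simp add: T_sum T)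
  finally show ?thesis .
qed

text \<open>Supplies the uniqueness of the weak integral that defines
  \<open>form_integral\<close>.\<close>

lemma separating_functional:
  fixes x :: "'v :: complex_vs"
  assumes "x \<noteq> 0"
  shows "\<exists>l :: 'v \<Rightarrow> complex. clinear_map l \<and> l x \<noteq> 0"
proof -
  interpret V: vector_space "cscale :: complex \<Rightarrow> 'v \<Rightarrow> 'v"
    by unfold_locales (simp_all add: cscale_add_right cscale_add_left cscale_cscale cscale_one)
  interpret C: vector_space "cscale :: complex \<Rightarrow> complex \<Rightarrow> complex"
    by unfold_locales (simp_all add: cscale_add_right cscale_add_left cscale_cscale cscale_one)
  interpret vector_space_pair "cscale :: complex \<Rightarrow> 'v \<Rightarrow> 'v" "cscale :: complex \<Rightarrow> complex \<Rightarrow> complex" ..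
  have "V.independent {x}" using assms by simp
  from linear_independent_extend[OF this, of "\<lambda>_. 1"]
  obtain g :: "'v \<Rightarrow> complex"
    where g: "Vector_Spaces.linear (cscale :: complex \<Rightarrow> 'v \<Rightarrow> 'v) (cscale :: complex \<Rightarrow> complex \<Rightarrow> complex) g" "g x = 1"
    by auto
  interpret g: Vector_Spaces.linear "cscale :: complex \<Rightarrow> 'v \<Rightarrow> 'v" "cscale :: complex \<Rightarrow> complex \<Rightarrow> complex" g by fact
  have "clinear_map g" unfolding clinear_map_def by (simp add: g.add g.scale)
  then show ?thesis using g(2) by (intro exI[of _ g]) simp
qed

section \<open>Expansion of the Chern--Simons forms\<close>

text \<open>The sum of all words of length \<open>j\<close> in two letters in which the second letter occurs \<open>i\<close> times.\<close>

fun mixed :: "'r :: ring_1 \<Rightarrow> 'r \<Rightarrow> nat \<Rightarrow> nat \<Rightarrow> 'r" where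
  "mixed u v 0 i = (if i = 0 then 1 else 0)"
| "mixed u v (Suc j) 0 = mixed u v j 0 * u"
| "mixed u v (Suc j) (Suc i) = mixed u v j (Suc i) * u + mixed u v j i * v"

lemma mixed_zero: "j < i \<Longrightarrow> mixed u v j i = 0"
  by (induction u v j i rule: mixed.induct) auto

text \<open>Each \<open>u\<close> carries one power of \<open>t\<close> and each \<open>v\<close>
  two, so a word of length \<open>j\<close> with \<open>i\<close> letters \<open>v\<close> carries
  \<open>t ^ (j + i)\<close>.\<close>

lemma pencil_power:
  fixes u v :: "'r :: complex_algebra_1"
  shows "(t *\<^sub>C u + t\<^sup>2 *\<^sub>C v) ^ j = (\<Sum>i\<le>j. t ^ (j + i) *\<^sub>C mixed u v j i)"
proof (induction j)
  case 0
  then show ?case by (simp add: cscale_one)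
next
  case (Suc j)
  have scale_sum: "(\<Sum>i\<in>I. g i *\<^sub>C x i) * y = (\<Sum>i\<in>I. g i *\<^sub>C (x i * y))" for I :: "nat set" and g and x :: "nat \<Rightarrow> 'r" and y
    by (simp add: sum_distrib_right cscale_mult_left)
  have "(t *\<^sub>C u + t\<^sup>2 *\<^sub>C v) ^ Suc j = (\<Sum>i\<le>j. t ^ (j + i) *\<^sub>C mixed u v j i) * (t *\<^sub>C u + t\<^sup>2 *\<^sub>C v)"
    by (simp only: power_Suc2 Suc)
  also have "\<dots> = (\<Sum>i\<le>j. t ^ Suc (j + i) *\<^sub>C (mixed u v j i * u)) + (\<Sum>i\<le>j. t ^ Suc (Suc (j + i)) *\<^sub>C (mixed u v j i * v))"
    by (simp add: distrib_left scale_sum cscale_mult_right cscale_cscale cscale_sum_right sum.distrib power2_eq_square mult_ac)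
  also have "(\<Sum>i\<le>j. t ^ Suc (j + i) *\<^sub>C (mixed u v j i * u)) = (\<Sum>i\<le>Suc j. t ^ Suc (j + i) *\<^sub>C (mixed u v j i * u))"
    by (simp add: mixed_zero)
  also have "\<dots> = t ^ Suc j *\<^sub>C (mixed u v j 0 * u) + (\<Sum>i\<le>j. t ^ Suc (Suc (j + i)) *\<^sub>C (mixed u v j (Suc i) * u))"
    by (simp only: sum.atMost_Suc_shift) simp
  also have "\<dots> + (\<Sum>i\<le>j. t ^ Suc (Suc (j + i)) *\<^sub>C (mixed u v j i * v))
      = t ^ (Suc j + 0) *\<^sub>C mixed u v (Suc j) 0 + (\<Sum>i\<le>j. t ^ (Suc j + Suc i) *\<^sub>C mixed u v (Suc j) (Suc i))"
    by (simp add: cscale_add_right sum.distrib)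
  also have "\<dots> = (\<Sum>i\<le>Suc j. t ^ (Suc j + i) *\<^sub>C mixed u v (Suc j) i)"
    by (simp only: sum.atMost_Suc_shift)
  finally show ?case .
qed

text \<open>All words of weight \<open>n\<close>, where \<open>u\<close> counts 1 and
  \<open>v\<close> counts 2: with \<open>i\<close> letters \<open>v\<close> such a word has length
  \<open>n - i\<close>.\<close>

definition weight_sum :: "'r :: ring_1 \<Rightarrow> 'r \<Rightarrow> nat \<Rightarrow> 'r" where
  "weight_sum u v n = (\<Sum>i\<le>n. mixed u v (n - i) i)"

lemma weight_sum_Suc:
  "weight_sum u v (Suc n) = weight_sum u v n * u + (if n = 0 then 0 else weight_sum u v (n - 1)) * v"
proof -
  have "weight_sum u v (Suc n) = (\<Sum>i\<le>n. mixed u v (Suc (n - i)) i)"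
    by (simp add: weight_sum_def Suc_diff_le)
  also have "\<dots> = (\<Sum>i\<le>n. mixed u v (n - i) i * u + (case i of 0 \<Rightarrow> 0 | Suc i' \<Rightarrow> mixed u v (n - i) i' * v))"
    by (rule sum.cong) (auto split: nat.splits)
  also have "\<dots> = weight_sum u v n * u + (\<Sum>i\<le>n. case i of 0 \<Rightarrow> 0 | Suc i' \<Rightarrow> mixed u v (n - i) i' * v)"
    by (simp add: sum.distrib weight_sum_def sum_distrib_right)
  also have "(\<Sum>i\<le>n. case i of 0 \<Rightarrow> 0 | Suc i' \<Rightarrow> mixed u v (n - i) i' * v)
      = (if n = 0 then 0 else weight_sum u v (n - 1)) * v"
    by (cases n) (simp_all add: sum.atMost_Suc_shift weight_sum_def sum_distrib_right del: sum.atMost_Suc)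
  finally show ?thesis .
qed

text \<open>A word in \<open>A * mixed (fd A) (A * A) j i\<close> contains \<open>A\<close>
  altogether \<open>j + i + 1\<close> times, so the coefficient is both the integral of
  \<open>t ^ (j + i)\<close> and the \<open>1 / n\<close> of the action.\<close>

definition cs_form :: "nat \<Rightarrow> 'a :: complex_algebra_1 form \<Rightarrow> 'a form" where
  "cs_form j A = (\<Sum>i\<le>j. (1 / of_nat (j + i + 1)) *\<^sub>C (A * mixed (fd A) (A * A) j i))"

text \<open>The terms of the action of degree \<open>2 j + 2\<close>; the final \<open>A\<close>
  raises the number of factors \<open>A\<close> to \<open>j + i + 2\<close>.\<close>

definition even_form :: "nat \<Rightarrow> 'a :: complex_algebra_1 form \<Rightarrow> 'a form" where
  "even_form j A = (\<Sum>i\<le>j. (1 / of_nat (j + i + 2)) *\<^sub>C (A * mixed (fd A) (A * A) j i * A))"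

lemma monomial_integral:
  "((\<lambda>t. complex_of_real t ^ m * c) has_integral (1 / of_nat (m + 1) * c)) {0..1}"
proof -
  have "((\<lambda>t. complex_of_real t ^ Suc m * (1 / of_nat (Suc m)) * c) has_vector_derivative complex_of_real t ^ m * c) (at t within {0..1})" for t
  proof (rule has_vector_derivative_real_field)
    show "((\<lambda>t. t ^ Suc m * (1 / of_nat (Suc m)) * c) has_field_derivative complex_of_real t ^ m * c) (at (complex_of_real t))"
    proof -
      have nz: "1 + complex_of_nat m \<noteq> 0" by (metis of_nat_Suc of_nat_neq_0)
      show ?thesis by (rule derivative_eq_intros refl | simp add: nz)+
    qed
  qed
  from fundamental_theorem_of_calculus[of 0 1, OF _ this] show ?thesis by simp
qed

lemma clinear_sum: "clinear_map T \<Longrightarrow> T (\<Sum>i\<in>I. g i) = (\<Sum>i\<in>I. T (g i))"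
  and clinear_cscale: "clinear_map T \<Longrightarrow> T (c *\<^sub>C x) = c * T x"
  and clinear_add: "clinear_map T \<Longrightarrow> T (x + y) = T x + T y"
  and clinear_zero: "clinear_map T \<Longrightarrow> T 0 = 0"
  and clinear_diff: "clinear_map T \<Longrightarrow> T (x - y) = T x - T y"
  for T :: "'v :: complex_vs \<Rightarrow> complex"
proof -
  assume T: "clinear_map T"
  show add: "T (x + y) = T x + T y" for x y using T by (simp add: clinear_map_def)
  show "T (c *\<^sub>C x) = c * T x" using T by (simp add: clinear_map_def cscale_complex_def)
  show zero: "T 0 = 0" using add[of 0 0] by simp
  show "T (x - y) = T x - T y" using add[of "x - y" y] by simp
  show "T (\<Sum>i\<in>I. g i) = (\<Sum>i\<in>I. T (g i))"
    by (induction I rule: infinite_finite_induct) (simp_all add: add zero)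
qed

lemma chern_simons_eq: "chern_simons (Suc j) A = cs_form j A"
proof -
  let ?g = "\<lambda>t. A * (complex_of_real t *\<^sub>C fd A + complex_of_real (t\<^sup>2) *\<^sub>C A ^ 2) ^ j"
  have expand: "?g t = (\<Sum>i\<le>j. complex_of_real t ^ (j + i) *\<^sub>C (A * mixed (fd A) (A * A) j i))" for t
    using pencil_power[of "complex_of_real t" "fd A" "A * A" j]
    by (simp add: power2_eq_square[of A] sum_distrib_left cscale_mult_right)
  have int: "((\<lambda>t. l (?g t)) has_integral l (cs_form j A)) {0..1}" if "clinear_map l" for l :: "'a form \<Rightarrow> complex"
    unfolding expand cs_form_def clinear_sum[OF that] clinear_cscale[OF that]
    by (intro has_integral_sum monomial_integral) simp
  have "form_integral ?g = cs_form j A"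
    unfolding form_integral_def
  proof (rule the_equality)
    fix \<eta> assume \<eta>: "\<forall>l :: 'a form \<Rightarrow> complex. clinear_map l \<longrightarrow> ((\<lambda>t. l (?g t)) has_integral l \<eta>) {0..1}"
    show "\<eta> = cs_form j A"
    proof (rule ccontr)
      assume "\<eta> \<noteq> cs_form j A"
      then obtain l :: "'a form \<Rightarrow> complex" where l: "clinear_map l" "l (\<eta> - cs_form j A) \<noteq> 0"
        using separating_functional[of "\<eta> - cs_form j A"] by auto
      have "l \<eta> = l (cs_form j A)" using has_integral_unique \<eta> l(1) int[OF l(1)] by blast
      then show False using l by (simp add: clinear_diff)
    qed
  qed (use int in blast)
  then show ?thesis by (simp add: chern_simons_def)
qed

lemma power_diff_sum:
  fixes x y :: "'r :: ring_1"
  shows "x ^ k - y ^ k = (\<Sum>r<k. x ^ r * (x - y) * y ^ (k - Suc r))"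
proof (induction k)
  case (Suc k)
  have "(\<Sum>r<Suc k. x ^ r * (x - y) * y ^ (Suc k - Suc r)) = (\<Sum>r<k. x ^ r * (x - y) * y ^ (k - Suc r)) * y + x ^ k * (x - y)"
    unfolding sum_distrib_right
    by (simp add: mult.assoc power_Suc2[symmetric] Suc_diff_Suc del: power_Suc)
  also have "\<dots> = x ^ Suc k - y ^ Suc k"
    unfolding Suc[symmetric] by (simp add: power_Suc2 algebra_simps del: power_Suc)
  finally show ?case by simp
qed simp

section \<open>Traces for the Fedosov product and the transgression formula\<close>

locale fedosov_trace =
  fixes T :: "'a :: complex_algebra_1 form \<Rightarrow> complex"
  assumes T: "clinear_map T" and comm: "T (form_of (x * y)) = T (form_of (y * x))"
begin

lemmas T_simps = clinear_add[OF T] clinear_cscale[OF T] clinear_zero[OF T] clinear_diff[OF T] clinear_sum[OF T]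

lemma comm_even: "fgrade \<omega> = \<omega> \<Longrightarrow> fgrade \<eta> = \<eta> \<Longrightarrow> T (\<omega> * \<eta>) = T (\<eta> * \<omega>)"
  using comm[of "fedosov \<omega>" "fedosov \<eta>"] by (simp add: fedosov_even)

context
  fixes A :: "'a form"
  assumes odd: "fgrade A = - A"
begin

abbreviation "u \<equiv> fd A"
abbreviation "v \<equiv> A * A"

lemma even_u: "fgrade u = u" and even_v: "fgrade v = v"
  by (simp_all add: fgrade_fd fgrade_times odd fd_minus)

lemma even_mixed: "fgrade (mixed u v j i) = mixed u v j i"
proof -
  have "fgrade (mixed u' v' j i) = mixed u' v' j i" if "fgrade u' = u'" "fgrade v' = v'" for u' v' :: "'a form"
    using that by (induction u' v' j i rule: mixed.induct) (auto simp: fgrade_one fgrade_zero fgrade_add fgrade_times)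
  then show ?thesis using even_u even_v by blast
qed

lemma even_weight_sum: "fgrade (weight_sum u v n) = weight_sum u v n"
proof -
  have "fgrade (\<Sum>i\<in>I. g i) = (\<Sum>i\<in>I. fgrade (g i))" for I :: "nat set" and g :: "nat \<Rightarrow> 'a form"
    by (induction I rule: infinite_finite_induct) (simp_all add: fgrade_zero fgrade_add)
  then show ?thesis by (simp add: weight_sum_def even_mixed)
qed

text \<open>Multiplying an odd word by \<open>A\<close> yields the word followed by \<open>A\<close>
  and, from the correction term, by \<open>fd A\<close>; an even word ending in \<open>A\<close> has
  its end completed to \<open>A * A\<close>. So no other words appear.\<close>

lemma fedosov_power:
  "fedosov A ^ Suc n = fedosov (A * weight_sum u v n + A * (if n = 0 then 0 else weight_sum u v (n - 1)) * A)"
proof (induction n)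
  case 0
  then show ?case by (simp add: weight_sum_def)
next
  case (Suc n)
  let ?U = "weight_sum u v n" and ?W = "if n = 0 then 0 else weight_sum u v (n - 1)"
  have W: "fgrade ?W = ?W" by (simp add: even_weight_sum fgrade_zero)
  have "fedosov (A * ?U) * fedosov A = fedosov (A * ?U * A + A * ?U * u)"
    by (rule fedosov_odd) (simp add: fgrade_times odd even_weight_sum)
  moreover have "fedosov (A * ?W * A) * fedosov A = fedosov (A * ?W * A * A)"
    by (rule fedosov_even) (simp add: fgrade_times odd W del: if_split split del: if_split)
  moreover have "fedosov A ^ Suc (Suc n) = fedosov (A * ?U + A * ?W * A) * fedosov A"
    by (simp only: power_Suc2[of _ "Suc n"] Suc)
  ultimately have "fedosov A ^ Suc (Suc n) = fedosov (A * ?U * A + A * ?U * u + A * ?W * A * A)"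
    by (simp only: fedosov_add distrib_right)
  also have "A * ?U * A + A * ?U * u + A * ?W * A * A = A * weight_sum u v (Suc n) + A * ?U * A"
    unfolding weight_sum_Suc by (simp add: algebra_simps)
  finally show ?case by simp
qed

definition pencil :: "complex \<Rightarrow> 'a form" where
  "pencil t = t *\<^sub>C u + t\<^sup>2 *\<^sub>C v"

lemma even_pencil: "fgrade (pencil t ^ j) = pencil t ^ j"
  by (intro fgrade_even_power) (simp add: pencil_def fgrade_add fgrade_cscale even_u even_v)

lemma T_pencil: "T (x * pencil t ^ j * y) = (\<Sum>i\<le>j. t ^ (j + i) * T (x * mixed u v j i * y))"
  by (simp add: pencil_def pencil_power sum_distrib_left sum_distrib_right cscale_mult_left cscale_mult_right T_simps)

text \<open>\<open>pencil t\<close> is the curvature of \<open>t *\<^sub>C A\<close>, and the two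
  outer factors \<open>t\<close> cancel unless \<open>t = 0\<close>, where the powers of the pencil
  are 0 or 1.\<close>

lemma swap_pencil: "T (A * pencil t ^ j * A) = T (v * pencil t ^ j)"
proof (cases "t = 0")
  case True
  then show ?thesis by (cases j) (simp_all add: pencil_def T_simps)
next
  case False
  have eq: "fd (t *\<^sub>C A) + (t *\<^sub>C A) * (t *\<^sub>C A) = pencil t"
    by (simp add: pencil_def fd_cscale cscale_mult_left cscale_mult_right cscale_cscale power2_eq_square)
  have "T ((t *\<^sub>C A) * (fd (t *\<^sub>C A) + (t *\<^sub>C A) * (t *\<^sub>C A)) ^ j * (t *\<^sub>C A))
      = T ((t *\<^sub>C A) * (t *\<^sub>C A) * (fd (t *\<^sub>C A) + (t *\<^sub>C A) * (t *\<^sub>C A)) ^ j)"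
    by (rule curvature_swap[OF clinear_add[OF T] comm])
       (simp add: fgrade_cscale odd cscale_minus_right)
  then have "t * t * T (A * pencil t ^ j * A) = t * t * T (v * pencil t ^ j)"
    unfolding eq by (simp add: cscale_mult_left cscale_mult_right T_simps mult.assoc)
  then show ?thesis using False by simp
qed

text \<open>The Bianchi identity for the curvature of \<open>t *\<^sub>C A\<close>, extended to
  powers by the Leibniz rule for even forms.\<close>

lemma fd_pencil_power: "fd (pencil t ^ j) = t *\<^sub>C (pencil t ^ j * A - A * pencil t ^ j)"
proof (induction j)
  case 0
  have "fd (1 :: 'a form) = 0"
    using word_form_tail_one[of 1 "[]" "[]"] by (simp add: one_form_word fd_word)
  then show ?case by simp
next
  case (Suc j)
  have dv: "fd v = u * A - A * u" by (simp add: fd_times odd)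
  have d1: "fd (pencil t) = t *\<^sub>C (pencil t * A - A * pencil t)"
    by (simp add: pencil_def fd_add fd_cscale fd_fd dv cscale_diff_right cscale_add_right distrib_left distrib_right
        cscale_mult_left cscale_mult_right cscale_cscale power2_eq_square mult.assoc)
  have "fgrade (pencil t) = pencil t" using even_pencil[of t 1] by simp
  then have "fd (pencil t ^ Suc j) = fd (pencil t) * pencil t ^ j + pencil t * fd (pencil t ^ j)"
    by (simp add: fd_times)
  also have "\<dots> = t *\<^sub>C (pencil t ^ Suc j * A - A * pencil t ^ Suc j)"
    unfolding Suc d1 cscale_mult_left cscale_mult_right cscale_add_right[symmetric] by (simp add: algebra_simps)
  finally show ?case .
qed

text \<open>The noncommutative difference of powers gives a continuous slope function, as in
  Caratheodory's form of the derivative. Its factors are even, where the Fedosov product is the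
  ordinary one, so at \<open>t\<close> the trace collects the powers behind \<open>u\<close> and
  \<open>v\<close>.\<close>

lemma T_pencil_derivative:
  "((\<lambda>z. T (pencil z ^ Suc j)) has_field_derivative of_nat (Suc j) * (T (u * pencil t ^ j) + 2 * t * T (v * pencil t ^ j))) (at t)"
proof -
  define g where "g z = (\<Sum>r<Suc j. T (pencil z ^ r * (u * pencil t ^ (j - r))) + (z + t) * T (pencil z ^ r * (v * pencil t ^ (j - r))))" for z
  have diff: "T (pencil z ^ Suc j) - T (pencil t ^ Suc j) = g z * (z - t)" for z
  proof -
    have cscale_diff_left: "(c - d) *\<^sub>C x = c *\<^sub>C x - d *\<^sub>C x" for c d and x :: "'a form"
      using cscale_add_left[of "c - d" d x] by simp
    have "(z - t) *\<^sub>C (u + (z + t) *\<^sub>C v) = (z - t) *\<^sub>C u + (z\<^sup>2 - t\<^sup>2) *\<^sub>C v"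
      by (simp only: cscale_add_right cscale_cscale square_diff_square_factored mult.commute power2_eq_square)
    then have step: "pencil z - pencil t = (z - t) *\<^sub>C (u + (z + t) *\<^sub>C v)"
      unfolding pencil_def cscale_diff_left by simp
    have "T (pencil z ^ Suc j) - T (pencil t ^ Suc j) = (\<Sum>r<Suc j. T (pencil z ^ r * (pencil z - pencil t) * pencil t ^ (j - r)))"
      unfolding T_simps(4)[symmetric] power_diff_sum T_simps(5) by simp
    also have "\<dots> = (\<Sum>r<Suc j. (z - t) * (T (pencil z ^ r * (u * pencil t ^ (j - r))) + (z + t) * T (pencil z ^ r * (v * pencil t ^ (j - r)))))"
      unfolding step by (intro sum.cong refl)
        (simp only: cscale_mult_left cscale_mult_right distrib_left distrib_right T_simps mult.assoc)
    finally show ?thesis unfolding g_def sum_distrib_left[symmetric] by (simp only: mult.commute)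
  qed
  have cont: "isCont (\<lambda>z. T (pencil z ^ r * c)) t" for r c
  proof -
    have "T (pencil z ^ r * c) = (\<Sum>i\<le>r. z ^ (r + i) * T (mixed u v r i * c))" for z
      using T_pencil[of 1 z r c] by simp
    then show ?thesis by (simp add: continuous_intros)
  qed
  have "isCont g t" unfolding g_def by (intro continuous_intros cont)
  moreover have "g t = of_nat (Suc j) * (T (u * pencil t ^ j) + 2 * t * T (v * pencil t ^ j))"
  proof -
    have "T (pencil t ^ r * (w * pencil t ^ (j - r))) = T (w * pencil t ^ j)" if "r < Suc j" "fgrade w = w" for r w
    proof -
      have "T (pencil t ^ r * (w * pencil t ^ (j - r))) = T (w * pencil t ^ (j - r) * pencil t ^ r)"
        by (rule comm_even) (simp_all add: even_pencil fgrade_times that)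
      also have "w * pencil t ^ (j - r) * pencil t ^ r = w * pencil t ^ j"
        using that by (simp add: mult.assoc flip: power_add)
      finally show ?thesis .
    qed
    then have "g t = (\<Sum>r<Suc j. T (u * pencil t ^ j) + (t + t) * T (v * pencil t ^ j))"
      unfolding g_def by (intro sum.cong) (simp_all add: even_u even_v)
    then show ?thesis by (simp add: algebra_simps)
  qed
  ultimately show ?thesis
    unfolding CARAT_DERIV using diff by blast
qed

text \<open>Before integration over \<open>t\<close> both sides equal
  \<open>T (u * pencil t ^ j) / 2 + t * T (v * pencil t ^ j)\<close>: the Bianchi identity expands
  the differential of \<open>A * pencil t ^ j\<close>, and by \<open>swap_pencil\<close> its last
  two terms cancel under the trace.\<close>

theorem even_form_transgression:
  "T (even_form j A) + 1 / 2 * T (fd (cs_form j A)) = 1 / of_nat (2 * Suc j) * T ((u + v) ^ Suc j)"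
proof -
  let ?h = "\<lambda>t :: real. T (pencil (complex_of_real t) ^ Suc j)"
  let ?H = "\<lambda>t :: real. of_nat (Suc j) * (T (u * pencil (complex_of_real t) ^ j) + 2 * complex_of_real t * T (v * pencil (complex_of_real t) ^ j))"
  have "(?H has_integral (?h 1 - ?h 0)) {0..1}"
    by (rule fundamental_theorem_of_calculus, simp, rule has_vector_derivative_real_field, rule T_pencil_derivative)
  moreover have "?h 1 = T ((u + v) ^ Suc j)" by (simp add: pencil_def cscale_one)
  moreover have "?h 0 = 0" by (simp add: pencil_def T_simps)
  ultimately have "(?H has_integral T ((u + v) ^ Suc j)) {0..1}" by (simp only: diff_zero)
  then have "((\<lambda>t. (1 / of_nat (2 * Suc j)) * ?H t) has_integral (1 / of_nat (2 * Suc j)) * T ((u + v) ^ Suc j)) {0..1}"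
    by (rule has_integral_mult_right)
  moreover have "((\<lambda>t. (1 / of_nat (2 * Suc j)) * ?H t) has_integral (T (even_form j A) + 1 / 2 * T (fd (cs_form j A)))) {0..1}"
  proof -
    have pointwise: "(1 / of_nat (2 * Suc j)) * ?H t = complex_of_real t * T (A * pencil (complex_of_real t) ^ j * A)
        + 1 / 2 * T (fd (A * pencil (complex_of_real t) ^ j))" for t
    proof -
      let ?t = "complex_of_real t"
      have "fd (A * pencil ?t ^ j) = u * pencil ?t ^ j - ?t *\<^sub>C (A * pencil ?t ^ j * A) + ?t *\<^sub>C (v * pencil ?t ^ j)"
        by (simp add: fd_times odd fd_pencil_power cscale_mult_right cscale_diff_right cscale_minus_right algebra_simps)
      then have "T (fd (A * pencil ?t ^ j)) = T (u * pencil ?t ^ j)"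
        by (simp add: T_simps swap_pencil)
      moreover have "(1 / of_nat (2 * Suc j)) * (of_nat (Suc j) * c) = 1 / 2 * c" for c :: complex
      proof -
        have "complex_of_nat (Suc j) \<noteq> 0" by (rule of_nat_neq_0)
        then show ?thesis unfolding of_nat_mult by (simp del: of_nat_Suc)
      qed
      ultimately show ?thesis by (simp only: swap_pencil) (simp add: algebra_simps)
    qed
    have "((\<lambda>t. complex_of_real t * T (A * pencil (complex_of_real t) ^ j * A)) has_integral T (even_form j A)) {0..1}"
      unfolding T_pencil even_form_def T_simps sum_distrib_left
    proof (intro has_integral_sum)
      fix i
      have "((\<lambda>t. complex_of_real t ^ (j + i + 1) * T (A * mixed u v j i * A)) has_integral
          (1 / of_nat (j + i + 1 + 1) * T (A * mixed u v j i * A))) {0..1}"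
        by (rule monomial_integral)
      then show "((\<lambda>t. complex_of_real t * (complex_of_real t ^ (j + i) * T (A * mixed u v j i * A))) has_integral
          (1 / of_nat (j + i + 2) * T (A * mixed u v j i * A))) {0..1}"
        by (simp add: mult.assoc)
    qed simp
    moreover have "((\<lambda>t. 1 / 2 * T (fd (A * pencil (complex_of_real t) ^ j))) has_integral 1 / 2 * T (fd (cs_form j A))) {0..1}"
    proof (rule has_integral_mult_right)
      have "T (fd (A * pencil z ^ j)) = (\<Sum>i\<le>j. z ^ (j + i) * T (fd (A * mixed u v j i)))" for z
        by (simp add: pencil_def pencil_power sum_distrib_left cscale_mult_right fd_sum fd_cscale T_simps)
      moreover have "T (fd (cs_form j A)) = (\<Sum>i\<le>j. 1 / of_nat (j + i + 1) * T (fd (A * mixed u v j i)))"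
        by (simp add: cs_form_def fd_sum fd_cscale T_simps)
      ultimately show "((\<lambda>t. T (fd (A * pencil (complex_of_real t) ^ j))) has_integral T (fd (cs_form j A))) {0..1}"
        by (simp only:) (intro has_integral_sum monomial_integral, simp)
    qed
    ultimately show ?thesis unfolding pointwise by (rule has_integral_add)
  qed
  ultimately show ?thesis by (rule has_integral_unique[rotated])
qed

end

end

section \<open>Comparison of the action with its expansion, degree by degree\<close>

context fedosov_trace
begin

lemma sum_below_diagonal:
  fixes c :: "nat \<Rightarrow> nat \<Rightarrow> complex"
  assumes "\<And>j i. j < i \<Longrightarrow> c j i = 0"
  shows "(\<Sum>n<K. \<Sum>i\<le>n. c (n - i) i) = (\<Sum>j<K. \<Sum>i\<le>j. if j + i < K then c j i else 0)"
proof -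
  have "(\<Sum>n<K. \<Sum>i\<le>n. c (n - i) i) = (\<Sum>(i, j)\<in>{(i, j). i + j < K}. c j i)"
    by (rule sum.triangle_reindex[symmetric])
  also have "\<dots> = (\<Sum>(j, i)\<in>{(j, i). j + i < K}. c j i)"
    by (rule sum.reindex_bij_witness[of _ "\<lambda>(j, i). (i, j)" "\<lambda>(i, j). (j, i)"]) auto
  also have "\<dots> = (\<Sum>(j, i)\<in>{..<K} \<times> {..<K}. if j + i < K then c j i else 0)"
    by (rule sum.mono_neutral_cong_left) (auto split: if_splits)
  also have "\<dots> = (\<Sum>j<K. \<Sum>i<K. if j + i < K then c j i else 0)"
    by (simp add: sum.cartesian_product)
  also have "\<dots> = (\<Sum>j<K. \<Sum>i\<le>j. if j + i < K then c j i else 0)"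
    by (rule sum.cong[OF refl], rule sum.mono_neutral_right) (auto simp: assms)
  finally show ?thesis .
qed

text \<open>The terms of \<open>\<Sum>\<^sub>n A\<^sup>n / n\<close> of form degree at most \<open>K\<close> agree with those of the Chern--Simons
  expansion; what remains has degree above \<open>K\<close>.\<close>

definition remainder :: "nat \<Rightarrow> 'a form \<Rightarrow> nat \<Rightarrow> 'a form" where
  "remainder K A l = (if odd l
     then \<Sum>i\<le>l div 2. if l div 2 < K \<and> K \<le> l div 2 + i
       then (- (1 / of_nat (l div 2 + i + 1))) *\<^sub>C (A * mixed (fd A) (A * A) (l div 2) i) else 0
     else \<Sum>i\<le>l div 2 - 1. if 0 < l \<and> l div 2 - 1 < K \<and> K \<le> l div 2 + i
       then (- (1 / of_nat (l div 2 + i + 1))) *\<^sub>C (A * mixed (fd A) (A * A) (l div 2 - 1) i * A) else 0)"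

lemma Omega_mixed: "A \<in> Omega 1 \<Longrightarrow> mixed (fd A) (A * A) j i \<in> Omega (2 * j)" for A :: "'a form"
proof -
  assume A: "A \<in> Omega 1"
  have gen: "mixed u v j i \<in> Omega (2 * j)" if "u \<in> Omega 2" "v \<in> Omega 2" for u v :: "'a form"
    using that
  proof (induction u v j i rule: mixed.induct)
    case (2 u v j)
    then show ?case using Omega_times[of "mixed u v j 0" "2 * j" u 2] by simp
  next
    case (3 u v j i)
    then show ?case
      using Omega_times[of "mixed u v j (Suc i)" "2 * j" u 2] Omega_times[of "mixed u v j i" "2 * j" v 2]
      by (simp add: Omega_add)
  qed (simp_all add: Omega_one Omega_zero)
  have "fd A \<in> Omega 2" "A * A \<in> Omega 2"
    using Omega_fd[OF A] Omega_times[OF A A] by (simp_all add: numeral_2_eq_2)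
  then show "mixed (fd A) (A * A) j i \<in> Omega (2 * j)" by (rule gen)
qed

lemma Omega_remainder: "A \<in> Omega 1 \<Longrightarrow> remainder K A l \<in> Omega l"
proof -
  assume A: "A \<in> Omega 1"
  have 1: "A * mixed (fd A) (A * A) j i \<in> Omega (2 * j + 1)" for j i
    using Omega_times[OF A Omega_mixed[OF A, of j i]] by simp
  have 2: "A * mixed (fd A) (A * A) j i * A \<in> Omega (2 * j + 2)" for j i
    using Omega_times[OF 1 A, of j i] by simp
  show ?thesis
  proof (cases "odd l")
    case True
    then have "2 * (l div 2) + 1 = l" by simp
    then show ?thesis using True 1[of "l div 2"] by (simp add: remainder_def Omega_sum Omega_zero Omega_cscale)
  next
    case False
    show ?thesis
    proof (cases "l = 0")
      case True
      then show ?thesis by (simp add: remainder_def Omega_zero)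
    next
      case l: False
      then have "2 * (l div 2 - 1) + 2 = l" using False by (auto elim!: evenE)
      then show ?thesis using False 2[of "l div 2 - 1"]
        by (simp add: remainder_def Omega_sum Omega_zero Omega_cscale)
    qed
  qed
qed

lemma Omega_cs_form: "A \<in> Omega 1 \<Longrightarrow> cs_form j A \<in> Omega (2 * j + 1)" for A :: "'a form"
  unfolding cs_form_def
  by (intro Omega_sum Omega_cscale) (use Omega_times[of A 1 _ "2 * j"] Omega_mixed in auto)

text \<open>Both sums consist of the same numbers \<open>a j i\<close> and \<open>b j i\<close>: the
  action keeps those with at most \<open>K\<close> factors \<open>A\<close>, the expansion those
  with \<open>j < K\<close>. A term of the difference has more than \<open>K\<close> factors, and
  its degree is at least their number because \<open>i \<le> j\<close>.\<close>

theorem trace_expansion: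
  assumes A: "A \<in> Omega 1"
  shows "(\<Sum>n = 1..K. 1 / of_nat n * T (form_of (fedosov A ^ n)))
      - (\<Sum>k = 1..K. T (chern_simons k A) - 1 / 2 * T (fd (chern_simons k A))
          + 1 / of_nat (2 * k) * T (curvature A ^ k))
    = (\<Sum>l = K + 1..2 * K + 1. T (remainder K A l))"
proof -
  have odd: "fgrade A = - A" using fgrade_Omega[OF A] by (simp add: cscale_minus_left cscale_one)
  let ?E = "mixed (fd A) (A * A)"
  define a where "a j i = 1 / of_nat (j + i + 1) * T (A * ?E j i)" for j i
  define b where "b j i = 1 / of_nat (j + i + 2) * T (A * ?E j i * A)" for j i
  have zero: "a j i = 0" "b j i = 0" if "j < i" for j i
    using that by (simp_all add: a_def b_def mixed_zero T_simps)
  have shift: "(\<Sum>n = 1..K. g n) = (\<Sum>n<K. g (Suc n))" for g :: "nat \<Rightarrow> complex"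
    by (simp add: sum.atLeast1_atMost_eq)
  have summand: "1 / of_nat (Suc n) * T (form_of (fedosov A ^ Suc n))
      = (\<Sum>i\<le>n. a (n - i) i) + (case n of 0 \<Rightarrow> 0 | Suc n' \<Rightarrow> \<Sum>i\<le>n'. b (n' - i) i)" for n
  proof -
    have an: "a (n - i) i = 1 / of_nat (Suc n) * T (A * ?E (n - i) i)" if "i \<in> {..n}" for i
      using that by (simp add: a_def)
    have bn: "b (m - i) i = 1 / of_nat (Suc n) * T (A * ?E (m - i) i * A)" if "i \<in> {..m}" "n = Suc m" for i m
      using that by (simp add: b_def)
    have A1: "1 / of_nat (Suc n) * T (A * (\<Sum>i\<le>n. ?E (n - i) i)) = (\<Sum>i\<le>n. a (n - i) i)"
      unfolding sum_distrib_left T_simps by (rule sum.cong[OF refl]) (simp only: an)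
    show ?thesis
    proof (cases n)
      case 0
      then show ?thesis using A1 unfolding fedosov_power[OF odd] form_of_fedosov weight_sum_def by simp
    next
      case (Suc m)
      have A2: "1 / of_nat (Suc n) * T (A * (\<Sum>i\<le>m. ?E (m - i) i) * A) = (\<Sum>i\<le>m. b (m - i) i)"
        unfolding sum_distrib_left sum_distrib_right T_simps by (rule sum.cong[OF refl]) (simp only: bn[OF _ Suc])
      have "form_of (fedosov A ^ Suc n) = A * (\<Sum>i\<le>n. ?E (n - i) i) + A * (\<Sum>i\<le>m. ?E (m - i) i) * A"
        unfolding fedosov_power[OF odd] form_of_fedosov weight_sum_def using Suc by simp
      then show ?thesis using A1 A2 Suc by (simp only: T_simps distrib_left nat.case)
    qed
  qed
  have "(\<Sum>n = 1..K. 1 / of_nat n * T (form_of (fedosov A ^ n)))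
      = (\<Sum>n<K. \<Sum>i\<le>n. a (n - i) i) + (\<Sum>n<K. case n of 0 \<Rightarrow> 0 | Suc n' \<Rightarrow> \<Sum>i\<le>n'. b (n' - i) i)"
    unfolding shift summand sum.distrib ..
  also have "(\<Sum>n<K. case n of 0 \<Rightarrow> 0 | Suc n' \<Rightarrow> \<Sum>i\<le>n'. b (n' - i) i) = (\<Sum>n<K - 1. \<Sum>i\<le>n. b (n - i) i)"
    by (cases K) (simp_all add: sum.lessThan_Suc_shift del: sum.lessThan_Suc)
  also have "\<dots> = (\<Sum>j<K. \<Sum>i\<le>j. if j + i + 1 < K then b j i else 0)"
  proof -
    have "(\<Sum>n<K - 1. \<Sum>i\<le>n. b (n - i) i) = (\<Sum>j<K - 1. \<Sum>i\<le>j. if j + i < K - 1 then b j i else 0)"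
      by (rule sum_below_diagonal) (rule zero)
    also have "\<dots> = (\<Sum>j<K - 1. \<Sum>i\<le>j. if j + i + 1 < K then b j i else 0)"
      by (intro sum.cong if_cong) auto
    also have "\<dots> = (\<Sum>j<K. \<Sum>i\<le>j. if j + i + 1 < K then b j i else 0)"
      by (intro sum.mono_neutral_left) (auto intro!: sum.neutral)
    finally show ?thesis .
  qed
  also have "(\<Sum>n<K. \<Sum>i\<le>n. a (n - i) i) = (\<Sum>j<K. \<Sum>i\<le>j. if j + i < K then a j i else 0)"
    by (rule sum_below_diagonal) (rule zero)
  finally have lhs: "(\<Sum>n = 1..K. 1 / of_nat n * T (form_of (fedosov A ^ n)))
      = (\<Sum>j<K. \<Sum>i\<le>j. if j + i < K then a j i else 0) + (\<Sum>j<K. \<Sum>i\<le>j. if j + i + 1 < K then b j i else 0)" .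
  have cs: "T (cs_form j A) = (\<Sum>i\<le>j. a j i)" and ev: "T (even_form j A) = (\<Sum>i\<le>j. b j i)" for j
    by (simp_all add: cs_form_def even_form_def T_simps a_def b_def)
  have "T (chern_simons (Suc j) A) - 1 / 2 * T (fd (chern_simons (Suc j) A))
      + 1 / of_nat (2 * Suc j) * T (curvature A ^ Suc j) = (\<Sum>i\<le>j. a j i) + (\<Sum>i\<le>j. b j i)" for j
    using even_form_transgression[OF odd, of j]
    unfolding chern_simons_eq cs[symmetric] ev[symmetric] curvature_def power2_eq_square[of A] by (simp add: algebra_simps)
  then have rhs: "(\<Sum>k = 1..K. T (chern_simons k A) - 1 / 2 * T (fd (chern_simons k A))
      + 1 / of_nat (2 * k) * T (curvature A ^ k)) = (\<Sum>j<K. \<Sum>i\<le>j. a j i) + (\<Sum>j<K. \<Sum>i\<le>j. b j i)"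
    unfolding shift by (simp only: sum.distrib)
  have odd_rem: "T (remainder K A (2 * j + 1)) = (\<Sum>i\<le>j. if j < K \<and> K \<le> j + i then - a j i else 0)" for j
  proof -
    have "T (remainder K A (2 * j + 1)) = (\<Sum>i\<le>j. T (if j < K \<and> K \<le> j + i
        then (- (1 / of_nat (j + i + 1))) *\<^sub>C (A * ?E j i) else 0))"
    proof -
      have "(2 * j + 1) div 2 = j" "odd (2 * j + 1) = True" by simp_all
      then show ?thesis by (simp only: remainder_def if_True T_simps(5))
    qed
    also have "\<dots> = (\<Sum>i\<le>j. if j < K \<and> K \<le> j + i then - a j i else 0)"
      by (intro sum.cong refl) (auto simp only: T_simps a_def if_True if_False mult_minus_left split: if_split)
    finally show ?thesis .
  qed
  have even_rem: "T (remainder K A (2 * j + 2)) = (\<Sum>i\<le>j. if j < K \<and> K \<le> j + i + 1 then - b j i else 0)" for j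
  proof -
    have "T (remainder K A (2 * j + 2)) = (\<Sum>i\<le>j. T (if j < K \<and> K \<le> j + i + 1
        then (- (1 / of_nat (j + i + 2))) *\<^sub>C (A * ?E j i * A) else 0))"
    proof -
      have "(2 * j + 2) div 2 = Suc j" "odd (2 * j + 2) = False" "(0 < 2 * j + 2) = True" "Suc j - 1 = j" by simp_all
      moreover have "Suc j + i = j + i + 1" "j + i + 1 + 1 = j + i + 2" for i by simp_all
      ultimately show ?thesis by (simp only: remainder_def if_False simp_thms T_simps(5))
    qed
    also have "\<dots> = (\<Sum>i\<le>j. if j < K \<and> K \<le> j + i + 1 then - b j i else 0)"
      by (intro sum.cong refl) (auto simp only: T_simps b_def if_True if_False mult_minus_left split: if_split)
    finally show ?thesis .
  qed
  \<comment> \<open>Degrees up to \<open>K\<close> and the top degree \<open>2 * K + 1\<close>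
    contribute nothing, so the remainder can be summed from 1 to \<open>2 * K\<close> and paired
    into odd and even degrees.\<close>
  have low: "T (remainder K A l) = 0" if l: "1 \<le> l" "l \<le> K \<or> l = 2 * K + 1" for l
  proof (cases "odd l")
    case True
    then obtain j where j: "l = 2 * j + 1" by (elim oddE)
    have "\<not> (j < K \<and> K \<le> j + i)" if "i \<le> j" for i using l j that by auto
    then show ?thesis unfolding j odd_rem by (intro sum.neutral) auto
  next
    case False
    with l(1) obtain j where j: "l = 2 * j + 2" by (auto elim!: evenE) (metis Suc_pred mult_Suc_right add.commute add_2_eq_Suc' gr0I not_less_eq_eq mult_0_right zero_le)
    have "\<not> (j < K \<and> K \<le> j + i + 1)" if "i \<le> j" for i using l j that by presburger
    then show ?thesis unfolding j even_rem by (intro sum.neutral) auto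
  qed
  have "(\<Sum>l = K + 1..2 * K + 1. T (remainder K A l)) = (\<Sum>l = 1..2 * K. T (remainder K A l))"
  proof -
    have "(\<Sum>l = K + 1..2 * K + 1. T (remainder K A l)) = (\<Sum>l = 1..2 * K + 1. T (remainder K A l))"
      by (rule sum.mono_neutral_left) (auto intro: low)
    also have "\<dots> = (\<Sum>l = 1..2 * K. T (remainder K A l))" using low[of "2 * K + 1"] by simp
    finally show ?thesis .
  qed
  also have "\<dots> = (\<Sum>j<K. T (remainder K A (2 * j + 1)) + T (remainder K A (2 * j + 2)))"
  proof -
    have "(\<Sum>l = 1..2 * L. g l) = (\<Sum>j<L. g (2 * j + 1) + g (2 * j + 2))" for L and g :: "nat \<Rightarrow> complex"
      by (induction L) simp_all
    then show ?thesis .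
  qed
  also have "\<dots> = (\<Sum>j<K. \<Sum>i\<le>j. (if K \<le> j + i then - a j i else 0) + (if K \<le> j + i + 1 then - b j i else 0))"
    unfolding odd_rem even_rem sum.distrib[symmetric] by (intro sum.cong refl) auto
  also have "\<dots> = (\<Sum>j<K. \<Sum>i\<le>j. ((if j + i < K then a j i else 0) + (if j + i + 1 < K then b j i else 0)) - (a j i + b j i))"
    by (intro sum.cong refl) auto
  also have "\<dots> = (\<Sum>n = 1..K. 1 / of_nat n * T (form_of (fedosov A ^ n)))
      - (\<Sum>k = 1..K. T (chern_simons k A) - 1 / 2 * T (fd (chern_simons k A)) + 1 / of_nat (2 * k) * T (curvature A ^ k))"
    unfolding lhs rhs by (simp only: sum_subtractf sum.distrib)
  finally show ?thesis by simp
qed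

end

section \<open>The bracket of a spectral triple as a trace\<close>

lemma clinear_map_op: "bounded_op T \<Longrightarrow> T (x + y) = T x + T y" "bounded_op T \<Longrightarrow> T (c *\<^sub>C x) = c *\<^sub>C T x"
  for T :: "'h :: hilbert_space \<Rightarrow> 'h"
  by (simp_all add: bounded_op_def clinear_map_def)

lemma op_diff: "bounded_op T \<Longrightarrow> T (x - y) = T x - T y" for T :: "'h :: hilbert_space \<Rightarrow> 'h"
  using clinear_map_op(1)[of T "x - y" y] by simp

lemma op_sum: "bounded_op T \<Longrightarrow> T (\<Sum>i\<in>I. g i) = (\<Sum>i\<in>I. T (g i))" for T :: "'h :: hilbert_space \<Rightarrow> 'h"
proof -
  assume T: "bounded_op T"
  have "T 0 = 0" using clinear_map_op(1)[OF T, of 0 0] by simp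
  then show ?thesis
    by (induction I rule: infinite_finite_induct) (simp_all add: clinear_map_op[OF T])
qed

lemma bounded_op_eq_on_dense:
  fixes S T :: "'h :: hilbert_space \<Rightarrow> 'h"
  assumes "bounded_op S" "bounded_op T" "closure X = UNIV" "\<And>x. x \<in> X \<Longrightarrow> S x = T x"
  shows "S = T"
proof
  fix x
  have lim: "(\<lambda>n. U (xs n)) \<longlonglongrightarrow> U x" if U: "bounded_op U" and conv: "xs \<longlonglongrightarrow> x" for U :: "'h \<Rightarrow> 'h" and xs
  proof -
    obtain C where C: "\<And>y. norm (U y) \<le> C * norm y" using U by (auto simp: bounded_op_def)
    have "(\<lambda>n. xs n - x) \<longlonglongrightarrow> 0" using conv by (simp add: LIM_zero_iff)
    then have "(\<lambda>n. C * norm (xs n - x)) \<longlonglongrightarrow> 0"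
      by (intro tendsto_mult_right_zero tendsto_norm_zero)
    moreover have "norm (U (xs n) - U x) \<le> C * norm (xs n - x)" for n
      using C[of "xs n - x"] by (simp only: op_diff[OF U])
    ultimately have "(\<lambda>n. U (xs n) - U x) \<longlonglongrightarrow> 0"
      by (intro Lim_null_comparison[of "\<lambda>n. U (xs n) - U x" "\<lambda>n. C * norm (xs n - x)"]) simp_all
    then show ?thesis by (simp add: LIM_zero_iff)
  qed
  have "x \<in> closure X" using assms(3) by simp
  then obtain xs where xs: "\<And>n. xs n \<in> X" "xs \<longlonglongrightarrow> x" by (auto simp: closure_sequential)
  have "(\<lambda>n. S (xs n)) \<longlonglongrightarrow> T x" using lim[OF assms(2) xs(2)] assms(4)[OF xs(1)] by simp
  then show "S x = T x" using lim[OF assms(1) xs(2)] LIMSEQ_unique by blast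
qed

lemma cinner_cscale_left: "cinner (c *\<^sub>C x) y = cnj c * cinner x y" for x y :: "'h :: hilbert_space"
  by (subst (1 2) cinner_commute) (simp add: cinner_cscale_right)

lemma cinner_diff_right: "cinner x (y - z) = cinner x y - cinner x z" for x y z :: "'h :: hilbert_space"
  using cinner_add_right[of x "y - z" z] by simp

section \<open>Truncated matrices of a spectral triple\<close>

locale finite_spectral_triple = spectral_data \<phi> lam f N
  for \<phi> :: "nat \<Rightarrow> 'h :: hilbert_space" and lam :: "nat \<Rightarrow> real" and f :: "real \<Rightarrow> real" and N :: nat +
  fixes \<pi> :: "'a :: star_algebra \<Rightarrow> 'h \<Rightarrow> 'h" and Dom :: "'h set" and D :: "'h \<Rightarrow> 'h"
  assumes triple: "spectral_triple \<pi> Dom D"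
    and eigen: "\<And>i. \<phi> i \<in> Dom \<and> D (\<phi> i) = complex_of_real (lam i) *\<^sub>C \<phi> i"
    and finite_rank: "\<And>a b. \<exists>K. one_form_op \<pi> Dom D a b \<in> MK \<phi> K"
    and cutoff: "cutoff_compatible \<pi> Dom D \<phi> N"
begin

lemma rep: "bounded_op (\<pi> a)" "\<pi> (a + b) x = \<pi> a x + \<pi> b x" "\<pi> (c *\<^sub>C a) x = c *\<^sub>C \<pi> a x"
  "\<pi> (a * b) x = \<pi> a (\<pi> b x)" "\<pi> 1 x = x"
  using triple by (simp_all add: spectral_triple_def star_representation_def)

lemma dense: "closure Dom = UNIV"
  using triple by (simp add: spectral_triple_def selfadjoint_def)

lemma D_sym: "x \<in> Dom \<Longrightarrow> y \<in> Dom \<Longrightarrow> cinner y (D x) = cinner (D y) x"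
proof -
  assume x: "x \<in> Dom" and y: "y \<in> Dom"
  have "\<forall>y z. (\<forall>x\<in>Dom. cinner y (D x) = cinner z x) \<longleftrightarrow> y \<in> Dom \<and> z = D y"
    using triple by (simp add: spectral_triple_def selfadjoint_def)
  from this[THEN spec, THEN spec, of y "D y"] y have "\<forall>x\<in>Dom. cinner y (D x) = cinner (D y) x" by simp
  then show ?thesis using x by (rule bspec)
qed

lemma is_comm: "is_comm Dom D (\<pi> a) (comm Dom D (\<pi> a))"
proof -
  obtain T where T: "is_comm Dom D (\<pi> a) T" using triple by (auto simp: spectral_triple_def)
  show ?thesis
    unfolding comm_def
  proof (rule theI[of "is_comm Dom D (\<pi> a)"])
    show "is_comm Dom D (\<pi> a) T" by (rule T)
    fix S assume "is_comm Dom D (\<pi> a) S"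
    then show "S = T"
      using T by (intro bounded_op_eq_on_dense[of S T Dom] dense) (simp_all add: is_comm_def)
  qed
qed

lemma rep_Dom: "x \<in> Dom \<Longrightarrow> \<pi> a x \<in> Dom"
  and comm_eq: "x \<in> Dom \<Longrightarrow> comm Dom D (\<pi> a) x = D (\<pi> a x) - \<pi> a (D x)"
  using is_comm[of a] by (simp_all add: is_comm_def)

definition \<alpha> :: "'a \<Rightarrow> nat \<Rightarrow> nat \<Rightarrow> complex" where "\<alpha> a = entry \<phi> (\<pi> a)"
definition \<delta> :: "'a \<Rightarrow> nat \<Rightarrow> nat \<Rightarrow> complex" where "\<delta> a = entry \<phi> (comm Dom D (\<pi> a))"

lemma \<delta>_eq: "\<delta> a i j = complex_of_real (lam i - lam j) * \<alpha> a i j"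
proof -
  have "cinner (\<phi> i) (D (\<pi> a (\<phi> j))) = complex_of_real (lam i) * cinner (\<phi> i) (\<pi> a (\<phi> j))"
    using D_sym[OF rep_Dom, of "\<phi> j" "\<phi> i" a] eigen by (simp add: cinner_cscale_left)
  then show ?thesis
    using eigen[of j] comm_eq[of "\<phi> j" a] clinear_map_op(2)[OF rep(1)]
    by (simp add: \<delta>_def \<alpha>_def entry_def cinner_diff_right cinner_cscale_right left_diff_distrib)
qed

lemma \<alpha>_add: "\<alpha> (a + b) = (\<lambda>x y. \<alpha> a x y + \<alpha> b x y)"
  and \<alpha>_cscale: "\<alpha> (c *\<^sub>C a) = (\<lambda>x y. c * \<alpha> a x y)"
  and \<alpha>_one: "\<alpha> 1 = (\<lambda>x y. if x = y then 1 else 0)"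
  by (simp_all add: fun_eq_iff \<alpha>_def entry_def rep cinner_add_right cinner_cscale_right cinner_basis)

lemma \<delta>_add: "\<delta> (a + b) = (\<lambda>x y. \<delta> a x y + \<delta> b x y)"
  and \<delta>_cscale: "\<delta> (c *\<^sub>C a) = (\<lambda>x y. c * \<delta> a x y)"
  and \<delta>_one: "\<delta> 1 = (\<lambda>x y. 0)"
  by (simp_all add: fun_eq_iff \<delta>_eq \<alpha>_add \<alpha>_cscale \<alpha>_one algebra_simps)

lemma one_form_one: "one_form_op \<pi> Dom D 1 b = comm Dom D (\<pi> b)"
  by (simp add: fun_eq_iff one_form_op_def rep)

lemma block_one_form: "block (one_form_op \<pi> Dom D a b)"
  using finite_rank[of a b] supported_MK cutoff unfolding block_def cutoff_compatible_def by blast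

lemma block_comm: "block (comm Dom D (\<pi> b))"
  using block_one_form[of 1 b] by (simp add: one_form_one)

lemma sum_block:
  assumes "\<And>k. k < K \<Longrightarrow> N \<le> k \<Longrightarrow> g k = 0" "\<And>k. K \<le> k \<Longrightarrow> g k = 0"
  shows "(\<Sum>k<K. g k) = (\<Sum>k<N. g k :: complex)"
proof -
  have "(\<Sum>k<K. g k) = (\<Sum>k<max K N. g k)" by (rule sum.mono_neutral_left) (use assms(2) in auto)
  moreover have "(\<Sum>k<N. g k) = (\<Sum>k<max K N. g k)"
    by (rule sum.mono_neutral_left) (use assms in \<open>auto simp: not_less max_def split: if_splits\<close>)
  ultimately show ?thesis by simp
qed

lemma mat_op_basis: "mat_op \<phi> K q (\<phi> j) = (\<Sum>i<K. (if j < K then q i j else 0) *\<^sub>C \<phi> i)"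
proof -
  have "(\<Sum>k<K. (q i k * cinner (\<phi> k) (\<phi> j)) *\<^sub>C \<phi> i) = (\<Sum>k<K. if k = j then q i k *\<^sub>C \<phi> i else 0)" for i
    by (intro sum.cong) (auto simp: cinner_basis)
  then show ?thesis by (simp add: mat_op_def sum.delta if_distrib[of "\<lambda>c. c *\<^sub>C _"] cong: if_cong)
qed

text \<open>Finite rank makes the expansion in the basis a finite sum, and the block form removes
  the summands with index at least \<open>N\<close>.\<close>

lemma entry_left:
  assumes W: "W \<in> MK \<phi> K" "block W" and j: "j < N"
  shows "cinner (\<phi> i) (\<pi> a (W (\<phi> j))) = mat_mult N (\<alpha> a) (entry \<phi> W) i j"
proof -
  obtain q where q: "W = mat_op \<phi> K q" using W(1) by (auto simp: MK_def)
  have "cinner (\<phi> i) (\<pi> a (W (\<phi> j))) = (\<Sum>k<K. (if j < K then q k j else 0) * \<alpha> a i k)"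
    unfolding q mat_op_basis
    by (simp add: op_sum[OF rep(1)] clinear_map_op(2)[OF rep(1)] cinner_sum_right cinner_cscale_right \<alpha>_def entry_def)
  also have "\<dots> = (\<Sum>k<K. \<alpha> a i k * entry \<phi> W k j)"
    by (intro sum.cong) (auto simp: q entry_mat_op)
  also have "\<dots> = (\<Sum>k<N. \<alpha> a i k * entry \<phi> W k j)"
  proof (rule sum_block)
    show "\<alpha> a i k * entry \<phi> W k j = 0" if "N \<le> k" for k using W(2) j that by (simp add: block_def)
    show "\<alpha> a i k * entry \<phi> W k j = 0" if "K \<le> k" for k using that by (simp add: q entry_mat_op)
  qed
  finally show ?thesis by (simp add: mat_mult_def)
qed

lemma entry_one_form: "j < N \<Longrightarrow> entry \<phi> (one_form_op \<pi> Dom D a b) i j = mat_mult N (\<alpha> a) (\<delta> b) i j"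
proof -
  assume j: "j < N"
  obtain K where "comm Dom D (\<pi> b) \<in> MK \<phi> K" using finite_rank[of 1 b] by (auto simp: one_form_one)
  from entry_left[OF this block_comm j] show ?thesis by (simp add: entry_def one_form_op_def \<delta>_def)
qed

text \<open>Truncated matrices of algebra elements need not multiply like the elements. In front of
  \<open>[D, c]\<close> they do, because \<open>b [D, c]\<close> is again a block and no
  intermediate index beyond \<open>N\<close> survives.\<close>

lemma \<alpha>_mult_\<delta>:
  assumes "i < N" "j < N"
  shows "mat_mult N (\<alpha> (a * b)) (\<delta> c) i j = mat_mult N (\<alpha> a) (mat_mult N (\<alpha> b) (\<delta> c)) i j"
proof -
  obtain K where "one_form_op \<pi> Dom D b c \<in> MK \<phi> K" using finite_rank by blast
  from entry_left[OF this block_one_form assms(2), of i a]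
  have "entry \<phi> (one_form_op \<pi> Dom D (a * b) c) i j = mat_mult N (\<alpha> a) (entry \<phi> (one_form_op \<pi> Dom D b c)) i j"
    by (simp add: entry_def one_form_op_def rep)
  then show ?thesis
    using entry_one_form[OF assms(2), of "a * b" c i] entry_one_form[OF assms(2), of b c]
    by (simp add: mat_mult_def)
qed

text \<open>The Leibniz rule; in each product the commutator is a block and truncates the
  intermediate sum at \<open>N\<close>.\<close>

lemma \<delta>_mult:
  assumes "i < N" "j < N"
  shows "\<delta> (a * b) i j = mat_mult N (\<delta> a) (\<alpha> b) i j + mat_mult N (\<alpha> a) (\<delta> b) i j"
proof -
  obtain K q where q: "comm Dom D (\<pi> a) = mat_op \<phi> K q" using finite_rank[of 1 a] by (auto simp: one_form_one MK_def)
  have j: "\<phi> j \<in> Dom" using eigen by simp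
  have "comm Dom D (\<pi> (a * b)) (\<phi> j) = comm Dom D (\<pi> a) (\<pi> b (\<phi> j)) + \<pi> a (comm Dom D (\<pi> b) (\<phi> j))"
    using comm_eq[OF j] comm_eq[OF rep_Dom[OF j]] by (simp add: rep op_diff[OF rep(1)])
  then have "\<delta> (a * b) i j = cinner (\<phi> i) (comm Dom D (\<pi> a) (\<pi> b (\<phi> j))) + mat_mult N (\<alpha> a) (\<delta> b) i j"
    using entry_one_form[OF assms(2), of a b i] by (simp add: \<delta>_def entry_def one_form_op_def cinner_add_right)
  also have "cinner (\<phi> i) (comm Dom D (\<pi> a) (\<pi> b (\<phi> j))) = (\<Sum>k<K. \<delta> a i k * \<alpha> b k j)"
    unfolding q cinner_mat_op \<delta>_def entry_mat_op by (auto simp: \<alpha>_def entry_def intro!: sum.cong)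
  also have "\<dots> = (\<Sum>k<N. \<delta> a i k * \<alpha> b k j)"
  proof (rule sum_block)
    show "\<delta> a i k * \<alpha> b k j = 0" if "N \<le> k" for k
      using block_comm[of a] assms(1) that by (simp add: block_def \<delta>_def)
    show "\<delta> a i k * \<alpha> b k j = 0" if "K \<le> k" for k using that by (simp add: \<delta>_def q entry_mat_op)
  qed
  finally show ?thesis by (simp add: mat_mult_def)
qed

lemma mat_mult_assoc: "mat_mult N (mat_mult N a b) c = mat_mult N a (mat_mult N b c)"
proof -
  have "(\<Sum>k<N. (\<Sum>l<N. a i l * b l k) * c k j) = (\<Sum>l<N. a i l * (\<Sum>k<N. b l k * c k j))" for i j
    unfolding sum_distrib_left sum_distrib_right by (subst sum.swap) (simp add: mult.assoc)
  then show ?thesis by (simp add: fun_eq_iff mat_mult_def)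
qed

lemma mat_mult_one: "x < N \<Longrightarrow> mat_mult N (\<alpha> 1) M x y = M x y"
proof -
  assume x: "x < N"
  have "(\<Sum>k<N. (if x = k then 1 else 0) * M k y) = (\<Sum>k<N. if k = x then M k y else 0)"
    by (intro sum.cong) auto
  then show ?thesis using x by (simp add: mat_mult_def \<alpha>_one sum.delta)
qed

lemma mat_bracket_swap: "mat_bracket (us @ vs) = mat_bracket (vs @ us)"
proof (induction us arbitrary: vs)
  case (Cons u us)
  have "mat_bracket ((u # us) @ vs) = mat_bracket ((us @ vs) @ [u])" by (simp only: mat_bracket_rotate append_Cons)
  also have "\<dots> = mat_bracket (vs @ u # us)" using Cons[of "vs @ [u]"] by simp
  finally show ?case .
qed simp

lemma mat_bracket_cong1:
  assumes "\<And>x y. x < N \<Longrightarrow> y < N \<Longrightarrow> M x y = M' x y"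
  shows "mat_bracket (us @ M # vs) = mat_bracket (us @ M' # vs)"
  by (rule mat_bracket_cong) (use assms in \<open>auto simp: nth_append nth_Cons split: nat.splits\<close>)

text \<open>Rotation makes \<open>X\<close> the last matrix, where the Ward identity sees it as the
  left neighbour of \<open>M\<close>.\<close>

lemma mat_bracket_ward_mid:
  "mat_bracket (us @ X # mat_mult N (\<alpha> b) M # vs)
    = mat_bracket (us @ mat_mult N X (\<alpha> b) # M # vs) + mat_bracket (us @ X # \<delta> b # M # vs)"
proof -
  have "mat_bracket (\<delta> b # M # vs @ us @ [X])
      = mat_bracket (mat_mult N (\<alpha> b) M # vs @ us @ [X]) - mat_bracket ((M # vs @ us) @ [mat_mult N X (\<alpha> b)])"
    by (rule mat_bracket_ward) (simp_all add: \<delta>_eq)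
  moreover have "mat_bracket (us @ X # Ys) = mat_bracket (Ys @ us @ [X])" for X Ys
    using mat_bracket_swap[of "us @ [X]" Ys] by simp
  ultimately show ?thesis by simp
qed

text \<open>\<open>slot a\<close> multiplies the first entry of a list of matrices by \<open>a\<close>; the word \<open>a\<^sub>0 da\<^sub>1 \<cdots> da\<^sub>n\<close>
  followed by the matrices \<open>Ms\<close> is sent to the bracket of \<open>a\<^sub>0 [D, a\<^sub>1], [D, a\<^sub>2], \<dots>, [D, a\<^sub>n], Ms\<close>.\<close>

definition slot :: "'a \<Rightarrow> (nat \<Rightarrow> nat \<Rightarrow> complex) list \<Rightarrow> complex" where
  "slot a Ms = (case Ms of [] \<Rightarrow> 0 | M # Ms' \<Rightarrow> mat_bracket (mat_mult N (\<alpha> a) M # Ms'))"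

definition word_bracket :: "(nat \<Rightarrow> nat \<Rightarrow> complex) list \<Rightarrow> 'a word \<Rightarrow> complex" where
  "word_bracket Ms = (\<lambda>(a, as). slot a (map \<delta> as @ Ms))"

definition form_bracket :: "(nat \<Rightarrow> nat \<Rightarrow> complex) list \<Rightarrow> 'a form \<Rightarrow> complex" where
  "form_bracket Ms \<omega> = lext (word_bracket Ms) (rep_form \<omega>)"

lemma slot_linear: "slot a (us @ (\<lambda>x y. c * M x y + c' * M' x y) # vs) = c * slot a (us @ M # vs) + c' * slot a (us @ M' # vs)"
proof (cases us)
  case Nil
  have "mat_mult N (\<alpha> a) (\<lambda>x y. c * M x y + c' * M' x y)
      = (\<lambda>x y. c * mat_mult N (\<alpha> a) M x y + c' * mat_mult N (\<alpha> a) M' x y)"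
    by (simp add: fun_eq_iff mat_mult_def sum_distrib_left sum.distrib[symmetric] algebra_simps)
  then show ?thesis using mat_bracket_linear[of "[]"] Nil by (simp add: slot_def)
next
  case (Cons u us')
  then show ?thesis using mat_bracket_linear[of "mat_mult N (\<alpha> a) u # us'"] by (simp add: slot_def)
qed

lemma slot_head_linear: "slot (c *\<^sub>C a + c' *\<^sub>C b) Ms = c * slot a Ms + c' * slot b Ms"
proof (cases Ms)
  case (Cons M Ms')
  have "mat_mult N (\<alpha> (c *\<^sub>C a + c' *\<^sub>C b)) M
      = (\<lambda>x y. c * mat_mult N (\<alpha> a) M x y + c' * mat_mult N (\<alpha> b) M x y)"
    by (simp add: fun_eq_iff mat_mult_def \<alpha>_add \<alpha>_cscale sum_distrib_left sum.distrib[symmetric] algebra_simps)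
  then show ?thesis using mat_bracket_linear[of "[]"] Cons by (simp add: slot_def)
qed (simp add: slot_def)

lemma slot_cong:
  assumes "\<And>x y. x < N \<Longrightarrow> y < N \<Longrightarrow> M x y = M' x y"
  shows "slot a (us @ M # vs) = slot a (us @ M' # vs)"
proof (cases us)
  case Nil
  have "mat_mult N (\<alpha> a) M x y = mat_mult N (\<alpha> a) M' x y" if "x < N" "y < N" for x y
    unfolding mat_mult_def by (rule sum.cong) (use assms that in simp_all)
  from mat_bracket_cong1[of "mat_mult N (\<alpha> a) M" "mat_mult N (\<alpha> a) M'" "[]" vs, OF this]
  show ?thesis unfolding Nil by (simp add: slot_def)
next
  case (Cons u us')
  from mat_bracket_cong1[of M M' "mat_mult N (\<alpha> a) u # us'" vs, OF assms]
  show ?thesis unfolding Cons by (simp add: slot_def)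
qed

lemma slot_ward:
  "slot a (us @ X # mat_mult N (\<alpha> b) M # vs) = slot a (us @ mat_mult N X (\<alpha> b) # M # vs) + slot a (us @ X # \<delta> b # M # vs)"
proof (cases us)
  case Nil
  then show ?thesis using mat_bracket_ward_mid[of "[]"] by (simp add: slot_def mat_mult_assoc)
next
  case (Cons u us')
  then show ?thesis using mat_bracket_ward_mid[of "mat_mult N (\<alpha> a) u # us'"] by (simp add: slot_def)
qed

lemma slot_\<delta>_mult:
  "slot a (us @ mat_mult N (\<delta> c) (\<alpha> b) # vs) = slot a (us @ \<delta> (c * b) # vs) - slot a (us @ mat_mult N (\<alpha> c) (\<delta> b) # vs)"
proof -
  have "slot a (us @ mat_mult N (\<delta> c) (\<alpha> b) # vs)
      = slot a (us @ (\<lambda>x y. 1 * \<delta> (c * b) x y + (- 1) * mat_mult N (\<alpha> c) (\<delta> b) x y) # vs)"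
    by (rule slot_cong) (simp add: \<delta>_mult)
  then show ?thesis unfolding slot_linear by simp
qed

lemma word_bracket_multilinear:
  "word_bracket Ms (a + b, ws) = word_bracket Ms (a, ws) + word_bracket Ms (b, ws)"
  "word_bracket Ms (c *\<^sub>C a, ws) = c * word_bracket Ms (a, ws)"
  "word_bracket Ms (a, us @ (x + y) # vs) = word_bracket Ms (a, us @ x # vs) + word_bracket Ms (a, us @ y # vs)"
  "word_bracket Ms (a, us @ (c *\<^sub>C x) # vs) = c * word_bracket Ms (a, us @ x # vs)"
  "word_bracket Ms (a, us @ 1 # vs) = 0"
proof -
  have lin: "slot a (map \<delta> us @ (\<lambda>i j. c * \<delta> x i j + c' * \<delta> y i j) # zs)
      = c * slot a (map \<delta> us @ \<delta> x # zs) + c' * slot a (map \<delta> us @ \<delta> y # zs)" for c c' x y zs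
    by (rule slot_linear[of a "map \<delta> us" c "\<delta> x" c' "\<delta> y" zs])
  show "word_bracket Ms (a + b, ws) = word_bracket Ms (a, ws) + word_bracket Ms (b, ws)"
    using slot_head_linear[of 1 a 1 b] by (simp add: word_bracket_def cscale_one)
  show "word_bracket Ms (c *\<^sub>C a, ws) = c * word_bracket Ms (a, ws)"
    using slot_head_linear[of c a 0 0] by (simp add: word_bracket_def)
  show "word_bracket Ms (a, us @ (x + y) # vs) = word_bracket Ms (a, us @ x # vs) + word_bracket Ms (a, us @ y # vs)"
    using lin[of 1 x 1 y "map \<delta> vs @ Ms"] by (simp add: word_bracket_def \<delta>_add)
  show "word_bracket Ms (a, us @ (c *\<^sub>C x) # vs) = c * word_bracket Ms (a, us @ x # vs)"
    using lin[of c x 0 x "map \<delta> vs @ Ms"] by (simp add: word_bracket_def \<delta>_cscale)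
  show "word_bracket Ms (a, us @ 1 # vs) = 0"
    using lin[of 0 1 0 1 "map \<delta> vs @ Ms"] by (simp add: word_bracket_def \<delta>_one)
qed

lemma lext_rep_form:
  fixes g :: "'a word \<Rightarrow> complex"
  assumes "\<And>x. x \<in> form_null \<Longrightarrow> lext g x = 0"
  shows "lext g (rep_form (abs_form x)) = lext g x" "clinear_map (\<lambda>\<omega>. lext g (rep_form \<omega>))"
    "lext g (rep_form (word_form w)) = g w"
proof -
  have abs: "lext g (rep_form (abs_form x)) = lext g x" for x
    using assms[OF rep_form_rel[of x]] by (simp add: lext_diff)
  have abs_rep: "abs_form (rep_form \<omega>) = \<omega>" for \<omega> :: "'a form"
    by (rule Quotient3_abs_rep[OF Quotient3_form])
  show "lext g (rep_form (abs_form x)) = lext g x" by (rule abs)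
  show "clinear_map (\<lambda>\<omega>. lext g (rep_form \<omega>))"
    unfolding clinear_map_def
  proof (intro conjI allI)
    fix \<omega> \<eta> :: "'a form" and c
    show "lext g (rep_form (\<omega> + \<eta>)) = lext g (rep_form \<omega>) + lext g (rep_form \<eta>)"
    proof -
      have "abs_form (rep_form \<omega> + rep_form \<eta>) = \<omega> + \<eta>" by (simp only: plus_form.abs_eq[symmetric] abs_rep)
      then show ?thesis using abs[of "rep_form \<omega> + rep_form \<eta>"] by (simp only: lext_add)
    qed
    show "lext g (rep_form (c *\<^sub>C \<omega>)) = c *\<^sub>C lext g (rep_form \<omega>)"
    proof -
      have "abs_form (pscale c (rep_form \<omega>)) = c *\<^sub>C \<omega>" by (simp only: cscale_form.abs_eq[symmetric] abs_rep)
      then show ?thesis using abs[of "pscale c (rep_form \<omega>)"] by (simp only: lext_pscale)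
    qed
  qed
  show "lext g (rep_form (word_form w)) = g w"
    unfolding word_form.abs_eq abs by (simp add: cscale_complex_def)
qed

lemma word_bracket_null: "x \<in> form_null \<Longrightarrow> lext (word_bracket Ms) x = 0"
  by (rule lext_null_zero) (simp_all add: word_bracket_multilinear cscale_complex_def)

lemma form_bracket_clinear: "clinear_map (form_bracket Ms)"
  unfolding form_bracket_def[abs_def] by (rule lext_rep_form(2)[OF word_bracket_null])

lemma form_bracket_word: "form_bracket Ms (word_form w) = word_bracket Ms w"
  unfolding form_bracket_def by (rule lext_rep_form(3)[OF word_bracket_null])

lemmas fb_simps = clinear_add[OF form_bracket_clinear] clinear_cscale[OF form_bracket_clinear]
  clinear_zero[OF form_bracket_clinear] clinear_diff[OF form_bracket_clinear] clinear_sum[OF form_bracket_clinear]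

section \<open>Fedosov multiplication inside the bracket\<close>

abbreviation ds :: "'a \<Rightarrow> 'a fedosov" where "ds a \<equiv> fedosov (word_form (1, [a]))"
abbreviation al :: "'a \<Rightarrow> 'a fedosov" where "al a \<equiv> fedosov (word_form (a, []))"

lemma al_mult_word: "al b * fedosov (word_form (a, as)) = fedosov (word_form (b * a, as))"
  by (subst fedosov_even) (simp_all add: fgrade_word cscale_one word_form_left fleft_word)

text \<open>The first two terms are the Leibniz rule for \<open>dc\<close> times \<open>b\<close>;
  the last is the Fedosov correction, which will match the extra commutator of the Ward
  identity.\<close>

lemma ds_al: "ds c * al b = ds (c * b) - fedosov (word_form (c, [b])) + fedosov (word_form (1, [c, b]))"
proof -
  have "ds c * al b = fedosov (fdleft c (word_form (b, [])) + fdleft c (word_form (1, [b])))"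
    by (subst fedosov_odd) (simp_all add: fgrade_word cscale_minus_left cscale_one fd_word word_form_dleft)
  moreover have "fdleft c (word_form (1, [b])) = word_form (1, [c, b])"
    using word_form_tail_one[of c "[]" "[b]"] by (simp add: fdleft_def fleft_word fd_word)
  ultimately show ?thesis
    by (simp add: fdleft_def fleft_word fd_word fedosov_add fedosov_diff fedosov_zero)
qed

lemma word_cons: "fedosov (word_form (a, b # bs)) = al a * ds b * fedosov (word_form (1, bs))"
proof (induction bs rule: rev_induct)
  case Nil
  then show ?case using fedosov_word_snoc[of a "[]" b] by (simp add: fedosov_one flip: one_form_word)
next
  case (snoc c bs)
  then show ?case using fedosov_word_snoc[of a "b # bs" c] fedosov_word_snoc[of 1 bs c] by (simp add: mult.assoc)
qed

lemma word_snoc_al: "fedosov (word_form (a, as @ [c])) * al b = fedosov (word_form (a, as @ [c * b]))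
    - fedosov (word_form (a, as)) * al c * ds b + fedosov (word_form (a, as @ [c, b]))"
proof -
  have "fedosov (word_form (c, [b])) = al c * ds b" using fedosov_word_snoc[of c "[]" b] by simp
  moreover have "fedosov (word_form (1, [c, b])) = ds c * ds b" using fedosov_word_snoc[of 1 "[c]" b] by simp
  moreover have "fedosov (word_form (a, as @ [c, b])) = fedosov (word_form (a, as)) * ds c * ds b"
    using fedosov_word_snoc[of a "as @ [c]" b] by (simp add: fedosov_word_snoc)
  ultimately show ?thesis
    by (simp add: fedosov_word_snoc mult.assoc ds_al algebra_simps)
qed

lemma form_bracket_ds: "form_bracket Ms (form_of (x * ds b)) = form_bracket (\<delta> b # Ms) (form_of x)"
proof -
  have "form_bracket Ms (form_of (fedosov \<omega> * ds b)) = form_bracket (\<delta> b # Ms) \<omega>" for \<omega>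
  proof (induction \<omega> rule: form_induct)
    case (word a as)
    have "form_bracket Ms (word_form (a, as @ [b])) = form_bracket (\<delta> b # Ms) (word_form (a, as))"
      by (simp add: form_bracket_word word_bracket_def)
    then show ?case by (simp flip: fedosov_word_snoc)
  qed (simp_all add: fedosov_zero fedosov_add fedosov_cscale distrib_right cscale_mult_left form_of_add form_of_cscale
        fb_simps zero_fedosov.rep_eq)
  from this[of "form_of x"] show ?thesis by simp
qed

lemma form_of_diff: "form_of (x - y) = form_of x - form_of y" for x y :: "'a fedosov"
  by (simp add: minus_fedosov_def)

lemma slot_\<alpha>_mult: "slot a (mat_mult N (\<alpha> b) (\<delta> e) # Ms) = slot (a * b) (\<delta> e # Ms)"
proof -
  have "mat_bracket ([] @ mat_mult N (\<alpha> a) (mat_mult N (\<alpha> b) (\<delta> e)) # Ms)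
      = mat_bracket ([] @ mat_mult N (\<alpha> (a * b)) (\<delta> e) # Ms)"
    by (rule mat_bracket_cong1) (simp add: \<alpha>_mult_\<delta>)
  then show ?thesis by (simp add: slot_def)
qed

text \<open>Fedosov multiplication by \<open>b\<close> splits into the Leibniz rule and a
  correction, and \<open>slot_ward\<close> recombines them into \<open>b\<close> acting on the next
  matrix. That matrix is a commutator, so that \<open>slot_\<alpha>_mult\<close> settles the word of
  degree 0.\<close>

lemma form_bracket_word_al:
  "form_bracket (\<delta> e # Ms) (form_of (fedosov (word_form (a, as)) * al b))
    = form_bracket (mat_mult N (\<alpha> b) (\<delta> e) # Ms) (word_form (a, as))"
proof (induction as arbitrary: b e Ms rule: rev_induct)
  case Nil
  then show ?case by (simp add: al_mult_word form_bracket_word word_bracket_def slot_\<alpha>_mult)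
next
  case (snoc c as)
  have "form_bracket (\<delta> e # Ms) (form_of (fedosov (word_form (a, as @ [c])) * al b))
      = word_bracket (\<delta> e # Ms) (a, as @ [c * b]) - form_bracket (\<delta> b # \<delta> e # Ms) (form_of (fedosov (word_form (a, as)) * al c))
        + word_bracket (\<delta> e # Ms) (a, as @ [c, b])"
    unfolding word_snoc_al by (simp add: form_of_add form_of_diff fb_simps form_bracket_word form_bracket_ds)
  also have "\<dots> = slot a (map \<delta> as @ mat_mult N (\<delta> c) (\<alpha> b) # \<delta> e # Ms) + slot a (map \<delta> as @ \<delta> c # \<delta> b # \<delta> e # Ms)"
    unfolding snoc.IH form_bracket_word word_bracket_def slot_\<delta>_mult by simp
  also have "\<dots> = slot a (map \<delta> as @ \<delta> c # mat_mult N (\<alpha> b) (\<delta> e) # Ms)"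
    by (rule slot_ward[symmetric])
  finally show ?case by (simp add: form_bracket_word word_bracket_def)
qed

lemma form_bracket_al:
  "form_bracket (\<delta> e # Ms) (form_of (x * al b)) = form_bracket (mat_mult N (\<alpha> b) (\<delta> e) # Ms) (form_of x)"
proof -
  have "form_bracket (\<delta> e # Ms) (form_of (fedosov \<omega> * al b)) = form_bracket (mat_mult N (\<alpha> b) (\<delta> e) # Ms) \<omega>" for \<omega>
    by (induction \<omega> rule: form_induct)
       (simp_all add: fedosov_zero fedosov_add fedosov_cscale distrib_right cscale_mult_left form_of_add form_of_cscale
        fb_simps zero_fedosov.rep_eq form_bracket_word_al)
  from this[of "form_of x"] show ?thesis by simp
qed

text \<open>No matrix follows the last one, so \<open>b\<close> acts on the end of the list and the
  cyclic Ward identity carries it over to the front.\<close>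

lemma trace_al: "form_bracket [] (form_of (al b * fedosov \<omega>)) = form_bracket [] (form_of (fedosov \<omega> * al b))"
proof (induction \<omega> rule: form_induct)
  case (word a as)
  show ?case
  proof (cases as rule: rev_cases)
    case Nil
    then show ?thesis by (simp add: al_mult_word form_bracket_word word_bracket_def slot_def)
  next
    case (snoc as' c)
    from snoc have "as \<noteq> []" by simp
    then obtain e es where e: "as = e # es" by (cases as) auto
    have "form_bracket [] (form_of (fedosov (word_form (a, as)) * al b))
        = word_bracket [] (a, as' @ [c * b]) - form_bracket [\<delta> b] (form_of (fedosov (word_form (a, as')) * al c))
          + word_bracket [] (a, as' @ [c, b])"
      unfolding snoc word_snoc_al by (simp add: form_of_add form_of_diff fb_simps form_bracket_word form_bracket_ds)
    also have "\<dots> = slot a (map \<delta> as' @ [mat_mult N (\<delta> c) (\<alpha> b)]) + slot a (map \<delta> as' @ [\<delta> c, \<delta> b])"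
      unfolding form_bracket_word_al form_bracket_word word_bracket_def slot_\<delta>_mult by simp
    finally have rhs: "form_bracket [] (form_of (fedosov (word_form (a, as)) * al b))
        = slot a (map \<delta> as' @ [mat_mult N (\<delta> c) (\<alpha> b)]) + slot a (map \<delta> as' @ [\<delta> c, \<delta> b])" .
    define Y where "Y = mat_mult N (\<alpha> a) (\<delta> e)"
    \<comment> \<open>The same list is read from the front through \<open>Y\<close> and from the
      back through \<open>L\<close>, as \<open>mat_bracket_ward\<close> asks; with a single
      commutator both are the same matrix.\<close>
    obtain Zs L where L: "Y # map \<delta> es = Zs @ [L]" "slot a (map \<delta> as' @ [mat_mult N (\<delta> c) (\<alpha> b)]) = mat_bracket (Zs @ [mat_mult N L (\<alpha> b)])"
      "slot a (map \<delta> as' @ [\<delta> c, \<delta> b]) = mat_bracket ((Y # map \<delta> es) @ [\<delta> b])"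
    proof (cases as')
      case Nil
      then show ?thesis using that[of "[]" Y] e snoc by (simp add: slot_def Y_def mat_mult_assoc)
    next
      case (Cons e' as'')
      then show ?thesis using that[of "Y # map \<delta> as''" "\<delta> c"] e snoc by (auto simp: slot_def Y_def)
    qed
    have "mat_bracket (\<delta> b # Y # map \<delta> es)
        = mat_bracket (mat_mult N (\<alpha> b) Y # map \<delta> es) - mat_bracket (Zs @ [mat_mult N L (\<alpha> b)])"
      by (rule mat_bracket_ward[OF _ L(1)]) (simp add: \<delta>_eq)
    then have "form_bracket [] (form_of (fedosov (word_form (a, as)) * al b)) = mat_bracket (mat_mult N (\<alpha> b) Y # map \<delta> es)"
      unfolding rhs L(2,3) by (simp add: mat_bracket_rotate flip: append_Cons)
    also have "\<dots> = slot (b * a) (\<delta> e # map \<delta> es)"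
      using slot_\<alpha>_mult[of b a e] by (simp add: slot_def Y_def)
    also have "\<dots> = form_bracket [] (form_of (al b * fedosov (word_form (a, as))))"
      by (simp add: al_mult_word form_bracket_word word_bracket_def e)
    finally show ?thesis by simp
  qed
qed (simp_all add: fedosov_zero fedosov_add fedosov_cscale distrib_right distrib_left cscale_mult_left cscale_mult_right
      form_of_add form_of_cscale fb_simps zero_fedosov.rep_eq)

lemma slot_one: "slot 1 (M # Ms) = mat_bracket (M # Ms)"
  using mat_bracket_cong1[of "mat_mult N (\<alpha> 1) M" M "[]" Ms] by (simp add: slot_def mat_mult_one)

text \<open>The product of \<open>db\<close> and \<open>a\<close> yields the bracket starting with
  \<open>[D, b] a\<close> and the one starting with \<open>[D, b], [D, a]\<close>. The Ward identity
  merges them into \<open>a\<close> acting on the cyclically next matrix, and rotation brings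
  \<open>[D, b]\<close> to the end.\<close>

lemma trace_ds: "form_bracket [] (form_of (ds b * fedosov \<omega>)) = form_bracket [] (form_of (fedosov \<omega> * ds b))"
proof (induction \<omega> rule: form_induct)
  case (word a as)
  have "ds b * al a * fedosov (word_form (1, as)) = fedosov (word_form (1, (b * a) # as)) - fedosov (word_form (b, a # as)) + fedosov (word_form (1, b # a # as))"
  proof -
    define W where "W = fedosov (word_form (1, as))"
    have one: "al 1 = 1" by (simp add: fedosov_one flip: one_form_word)
    have w: "fedosov (word_form (1, c # as)) = ds c * W" for c using word_cons[of 1 c as] by (simp only: one W_def mult_1_left)
    have "fedosov (word_form (b, a # as)) = al b * ds a * W" by (simp only: word_cons[of b a as] W_def)
    moreover have "fedosov (word_form (1, b # a # as)) = ds b * (ds a * W)"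
      using word_cons[of 1 b "a # as"] by (simp only: one w mult_1_left)
    moreover have "fedosov (word_form (b, [a])) = al b * ds a" "fedosov (word_form (1, [b, a])) = ds b * ds a"
      using fedosov_word_snoc[of b "[]" a] fedosov_word_snoc[of 1 "[b]" a] by simp_all
    ultimately show ?thesis
      unfolding W_def[symmetric] by (simp only: ds_al w distrib_right left_diff_distrib mult.assoc)
  qed
  moreover have "fedosov (word_form (a, as)) = al a * fedosov (word_form (1, as))" by (simp add: al_mult_word)
  ultimately have "form_bracket [] (form_of (ds b * fedosov (word_form (a, as))))
      = slot 1 (\<delta> (b * a) # map \<delta> as) - slot b (\<delta> a # map \<delta> as) + slot 1 (\<delta> b # \<delta> a # map \<delta> as)"
    by (simp add: mult.assoc[symmetric] form_of_add form_of_diff fb_simps form_bracket_word word_bracket_def)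
  also have "\<dots> = slot 1 (mat_mult N (\<delta> b) (\<alpha> a) # map \<delta> as) + slot 1 (\<delta> b # \<delta> a # map \<delta> as)"
    using slot_\<delta>_mult[of 1 "[]" b a "map \<delta> as"] slot_\<alpha>_mult[of 1 b a "map \<delta> as"] by simp
  also have "\<dots> = mat_bracket (mat_mult N (\<delta> b) (\<alpha> a) # map \<delta> as) + mat_bracket (\<delta> b # \<delta> a # map \<delta> as)"
    by (simp add: slot_one)
  also have "\<dots> = slot a (map \<delta> as @ [\<delta> b])"
  proof (cases as)
    case Nil
    have "mat_bracket (\<delta> a # \<delta> b # []) = mat_bracket (mat_mult N (\<alpha> a) (\<delta> b) # []) - mat_bracket ([] @ [mat_mult N (\<delta> b) (\<alpha> a)])"
      by (rule mat_bracket_ward) (simp_all add: \<delta>_eq)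
    then show ?thesis using Nil mat_bracket_rotate[of "[\<delta> a]" "\<delta> b"] by (simp add: slot_def diff_eq_eq add.commute)
  next
    case (Cons a1 as')
    have "slot a (map \<delta> as @ [\<delta> b]) = mat_bracket (\<delta> b # mat_mult N (\<alpha> a) (\<delta> a1) # map \<delta> as')"
      using Cons mat_bracket_rotate[of "mat_mult N (\<alpha> a) (\<delta> a1) # map \<delta> as'" "\<delta> b"] by (simp add: slot_def)
    then show ?thesis using mat_bracket_ward_mid[of "[]" "\<delta> b" a "\<delta> a1" "map \<delta> as'"] Cons by simp
  qed
  also have "\<dots> = form_bracket [] (form_of (fedosov (word_form (a, as)) * ds b))"
    by (simp add: form_bracket_ds form_bracket_word word_bracket_def)
  finally show ?case .
qed (simp_all add: fedosov_zero fedosov_add fedosov_cscale distrib_right distrib_left cscale_mult_left cscale_mult_right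
      form_of_add form_of_cscale fb_simps zero_fedosov.rep_eq)

sublocale fedosov_trace "form_bracket []"
proof
  show "clinear_map (form_bracket [])" by (rule form_bracket_clinear)
  show "form_bracket [] (form_of (x * y)) = form_bracket [] (form_of (y * x))" for x y
    by (rule fedosov_trace[OF form_bracket_clinear trace_al trace_ds])
qed

text \<open>The matrix of a commutator with \<open>D\<close> has zero diagonal, and a bracket with
  one argument sees only the diagonal.\<close>

lemma form_bracket_exact: "form_bracket [] (word_form (1, [a])) = 0"
  using mat_bracket_comm[of "\<delta> a"] by (simp add: form_bracket_word word_bracket_def slot_one \<delta>_eq)

end

section \<open>The cocycle of a trace\<close>

text \<open>Repeated use of \<open>(dc) b = d (c b) - c db\<close> moves \<open>b\<close> to the
  left through the word, and each step contributes one contraction of the Hochschild sum.\<close>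

lemma word_form_times_algebra:
  assumes "length as = n + 2"
  shows "(\<Sum>j\<le>n. (- 1) ^ j *\<^sub>C (\<lambda>bs. word_form (hd bs, tl bs)) (take j as @ (as ! j * as ! Suc j) # drop (j + 2) as))
    = (- 1) ^ n *\<^sub>C (word_form (hd as, tl (butlast as)) * word_form (last as, []))"
  using assms
proof (induction n arbitrary: as)
  case 0
  then obtain a b where "as = [a, b]" by (auto simp: length_Suc_conv numeral_2_eq_2)
  then show ?case by (simp add: word_form_left fleft_word cscale_one)
next
  case (Suc n)
  define W where "W = (\<lambda>bs :: 'a list. word_form (hd bs, tl bs))"
  define contract where "contract j as = take j as @ (as ! j * as ! Suc j) # drop (j + 2) as" for j and as :: "'a list"
  obtain xs b where xs: "as = xs @ [b]" "length xs = n + 2" using Suc.prems by (cases as rule: rev_cases) auto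
  obtain ys c where ys: "xs = ys @ [c]" "length ys = n + 1" using xs(2) by (cases xs rule: rev_cases) auto
  have W_snoc: "W (zs @ [x]) = W zs * word_form (1, [x])" if "zs \<noteq> []" for zs x
    using that by (cases zs) (simp_all add: W_def word_form_snoc)
  have contract_snoc: "contract j as = contract j xs @ [b]" if "j \<le> n" for j
    using that xs by (simp add: contract_def nth_append)
  have contract_last: "contract (Suc n) as = ys @ [c * b]"
    using xs ys by (simp add: contract_def nth_append)
  have "W (contract j as) = W (contract j xs) * word_form (1, [b])" if "j \<le> n" for j
    unfolding contract_snoc[OF that] by (rule W_snoc) (simp add: contract_def)
  then have "(\<Sum>j\<le>n. (- 1) ^ j *\<^sub>C W (contract j as)) = (\<Sum>j\<le>n. (- 1) ^ j *\<^sub>C W (contract j xs)) * word_form (1, [b])"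
    unfolding sum_distrib_right by (intro sum.cong refl) (simp add: cscale_mult_left)
  also have "\<dots> = (- 1) ^ n *\<^sub>C (W ys * word_form (c, []) * word_form (1, [b]))"
    using Suc.IH[OF xs(2)] ys by (cases ys) (simp_all add: W_def contract_def cscale_mult_left)
  also have "\<dots> = (- 1) ^ n *\<^sub>C (W ys * word_form (c, [b]))"
    by (simp add: mult.assoc word_form_left fleft_word)
  finally have left: "(\<Sum>j\<le>n. (- 1) ^ j *\<^sub>C W (contract j as)) = (- 1) ^ n *\<^sub>C (W ys * word_form (c, [b]))" .
  have "word_form (1, [c]) * word_form (b, []) = word_form (1, [c * b]) - word_form (c, [b])"
    by (simp add: word_form_dleft fdleft_def fleft_word fd_word)
  then have "W xs * word_form (b, []) = W (ys @ [c * b]) - W ys * word_form (c, [b])"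
    using ys W_snoc[of ys] by (cases ys) (simp_all add: mult.assoc right_diff_distrib)
  then have "(\<Sum>j\<le>Suc n. (- 1) ^ j *\<^sub>C W (contract j as)) = (- 1) ^ Suc n *\<^sub>C (W xs * word_form (b, []))"
    by (simp add: left contract_last cscale_diff_right cscale_minus_left)
  moreover have "W xs = word_form (hd as, tl (butlast as))" using xs by (cases xs) (simp_all add: W_def)
  ultimately show ?case using xs(1) by (simp add: W_def contract_def)
qed

lemma hoch_b_cong:
  assumes "\<And>bs. length bs = n + 1 \<Longrightarrow> \<phi> bs = \<psi> bs" "length as = n + 2"
  shows "hoch_b n \<phi> as = hoch_b n \<psi> as"
  unfolding hoch_b_def using assms by (intro arg_cong2[where f = "(+)"] sum.cong) auto

lemma hoch_b_linear: "hoch_b n (\<lambda>bs. c * (\<phi> bs + d * \<psi> bs)) as = c * (hoch_b n \<phi> as + d * hoch_b n \<psi> as)"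
  by (simp add: hoch_b_def sum.distrib sum_distrib_left algebra_simps)

lemma cochains_cong:
  assumes "\<psi> \<in> cochains n" "\<And>bs. length bs = n + 1 \<Longrightarrow> \<phi> bs = \<psi> bs"
  shows "\<phi> \<in> cochains n"
  using assms unfolding cochains_def by simp

lemma cochains_linear:
  assumes "\<phi> \<in> cochains n" "\<psi> \<in> cochains n"
  shows "(\<lambda>bs. c * (\<phi> bs + d * \<psi> bs)) \<in> cochains n"
  using assms unfolding cochains_def by (simp add: algebra_simps)

context fedosov_trace
begin

text \<open>The degree is read off from the length of the list, so one function contains the
  cochains of all degrees.\<close>

definition trace_cochain :: "'a cochain" where
  "trace_cochain as = T (word_form (hd as, tl as))"

lemma trace_cochain_Cons: "trace_cochain (a # as) = T (word_form (a, as))"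
  by (simp add: trace_cochain_def)

lemma trace_cochain_in_cochains: "trace_cochain \<in> cochains n"
proof -
  have "trace_cochain (us @ (x + y) # vs) = trace_cochain (us @ x # vs) + trace_cochain (us @ y # vs)" for us vs x y
    by (cases us) (simp_all add: trace_cochain_def word_form_head_add word_form_tail_add T_simps)
  moreover have "trace_cochain (us @ (c *\<^sub>C x) # vs) = c * trace_cochain (us @ x # vs)" for us vs c x
    by (cases us) (simp_all add: trace_cochain_def word_form_head_scale word_form_tail_scale T_simps)
  moreover have "trace_cochain (us @ 1 # vs) = 0" if "us \<noteq> []" for us vs
    using that by (cases us) (simp_all add: trace_cochain_def word_form_tail_one T_simps)
  ultimately show ?thesis by (simp add: cochains_def)
qed

lemma B0_trace_cochain: "B0 trace_cochain as = T (word_form (1, as))"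
  by (simp add: B0_def trace_cochain_def)

lemma B0_in_cochains: "B0 trace_cochain \<in> cochains n"
  using trace_cochain_in_cochains[of "Suc n"] unfolding cochains_def B0_def
  by (simp flip: append_Cons)

text \<open>The trace property against an element of the algebra; the Fedosov correction is present
  when the word is odd.\<close>

lemma trace_algebra:
  assumes "length as = n"
  shows "T (word_form (a, as) * word_form (b, [])) = T (word_form (b * a, as)) - (if odd n then T (word_form (a, as @ [b])) else 0)"
proof -
  have "T (form_of (fedosov (word_form (a, as)) * fedosov (word_form (b, []))))
      = T (form_of (fedosov (word_form (b, [])) * fedosov (word_form (a, as))))" by (rule comm)
  also have "\<dots> = T (word_form (b * a, as))"
    by (subst fedosov_even) (simp_all add: fgrade_word cscale_one word_form_left fleft_word)
  finally have *: "T (form_of (fedosov (word_form (a, as)) * fedosov (word_form (b, [])))) = T (word_form (b * a, as))" .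
  show ?thesis
  proof (cases "odd n")
    case True
    have "fedosov (word_form (a, as)) * fedosov (word_form (b, []))
        = fedosov (word_form (a, as) * word_form (b, []) + word_form (a, as @ [b]))"
      by (subst fedosov_odd) (use True assms in \<open>simp_all add: fgrade_word cscale_minus_left cscale_one fd_word word_form_snoc\<close>)
    then show ?thesis using * True by (simp add: T_simps eq_diff_eq)
  next
    case False
    have "fedosov (word_form (a, as)) * fedosov (word_form (b, [])) = fedosov (word_form (a, as) * word_form (b, []))"
      by (rule fedosov_even) (use False assms in \<open>simp_all add: fgrade_word cscale_one\<close>)
    then show ?thesis using * False by simp
  qed
qed

lemma trace_differential:
  "T (word_form (1, (b * a) # as)) - T (word_form (b, a # as)) + T (word_form (1, b # a # as)) = T (word_form (a, as @ [b]))"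
proof -
  have "fedosov (word_form (1, [b])) * fedosov (word_form (a, as))
      = fedosov (word_form (1, (b * a) # as) - word_form (b, a # as) + word_form (1, b # a # as))"
    using word_form_tail_one[of b "[]" "a # as"]
    by (subst fedosov_odd) (simp_all add: fgrade_word cscale_minus_left cscale_one fd_word word_form_dleft fdleft_def fleft_word)
  then show ?thesis
    using comm[of "fedosov (word_form (1, [b]))" "fedosov (word_form (a, as))"]
    by (simp add: T_simps flip: fedosov_word_snoc)
qed

text \<open>The case \<open>a = 1\<close> of \<open>trace_differential\<close>, where the words
  containing \<open>d1\<close> vanish.\<close>

lemma trace_word_rotate: "T (word_form (1, rotate j as)) = T (word_form (1, as))"
proof (induction j)
  case (Suc j)
  have "T (word_form (1, bs @ [b])) = T (word_form (1, b # bs))" for b bs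
    using trace_differential[of b 1 bs] word_form_tail_one[of b "[]" bs] word_form_tail_one[of 1 "[b]" bs] by (simp add: T_simps)
  then have "T (word_form (1, rotate1 cs)) = T (word_form (1, cs))" for cs by (cases cs) simp_all
  then show ?case using Suc by simp
qed simp

text \<open>All cyclic rotations have the same value, so only the sum of the signs matters: it is
  \<open>n + 1\<close> for even \<open>n\<close> and cancels in pairs for odd
  \<open>n\<close>.\<close>

lemma connes_B_trace_cochain:
  "connes_B n trace_cochain as = (if even n then of_nat (n + 1) * T (word_form (1, as)) else 0)"
proof -
  have "(\<Sum>j\<le>n. (- 1 :: complex) ^ (n * j)) = (if even n then of_nat (n + 1) else 0)"
  proof (cases "even n")
    case False
    then have "(\<Sum>j\<le>n. (- 1 :: complex) ^ (n * j)) = (\<Sum>j\<le>n. (- 1) ^ j)" by (simp add: power_mult)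
    also have "\<dots> = 0" using False
    proof -
      have "(\<Sum>j\<le>m. (- 1 :: complex) ^ j) = (if even m then 1 else 0)" for m by (induction m) auto
      then show ?thesis using False by simp
    qed
    finally show ?thesis using False by simp
  qed (simp add: power_mult)
  then show ?thesis
    unfolding connes_B_def trace_cochain_Cons trace_word_rotate sum_distrib_right[symmetric] by simp
qed

text \<open>By \<open>word_form_times_algebra\<close> the coboundary measures how far
  \<open>T\<close> is from a trace for the ordinary product, and \<open>trace_algebra\<close>
  computes this.\<close>

lemma hoch_b_trace_cochain:
  assumes "length as = n + 2"
  shows "hoch_b n trace_cochain as = (if odd n then trace_cochain as else 0)"
proof -
  obtain a bs b where as: "as = a # bs @ [b]" "length bs = n"
    using assms by (cases as; cases "tl as" rule: rev_cases) auto
  have tail: "map ((!) as) [1..<n + 1] = bs"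
    by (rule nth_equalityI) (use as in \<open>auto simp: nth_append simp del: upt_Suc\<close>)
  have "(\<Sum>j\<le>n. (- 1) ^ j * trace_cochain (take j as @ (as ! j * as ! Suc j) # drop (j + 2) as))
      = T (\<Sum>j\<le>n. (- 1) ^ j *\<^sub>C (\<lambda>bs. word_form (hd bs, tl bs)) (take j as @ (as ! j * as ! Suc j) # drop (j + 2) as))"
    by (simp add: T_simps trace_cochain_def)
  also have "\<dots> = (- 1) ^ n * T (word_form (a, bs) * word_form (b, []))"
    unfolding word_form_times_algebra[OF assms] using as by (simp add: T_simps butlast_append)
  finally have "hoch_b n trace_cochain as = (- 1) ^ n * (T (word_form (a, bs) * word_form (b, [])) - T (word_form (b * a, bs)))"
    using as tail by (simp add: hoch_b_def trace_cochain_Cons nth_append algebra_simps)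
  then show ?thesis using as by (simp add: trace_algebra trace_cochain_Cons)
qed

text \<open>With 1 put in front, the Hochschild sum of one degree higher applies; its zeroth
  contraction is one copy of \<open>trace_cochain as\<close>, and \<open>trace_differential\<close>
  supplies the second.\<close>

lemma hoch_b_B0_trace_cochain:
  assumes "length as = n + 2" "odd n"
  shows "hoch_b n (B0 trace_cochain) as = 2 * trace_cochain as - T (word_form (1, as))"
proof -
  obtain a bs b where as: "as = a # bs @ [b]" "length bs = n"
    using assms by (cases as; cases "tl as" rule: rev_cases) auto
  have tail: "map ((!) as) [1..<n + 1] = bs"
    by (rule nth_equalityI) (use as in \<open>auto simp: nth_append simp del: upt_Suc\<close>)
  let ?xs = "1 # as"
  have "(\<Sum>j\<le>Suc n. (- 1) ^ j * trace_cochain (take j ?xs @ (?xs ! j * ?xs ! Suc j) # drop (j + 2) ?xs))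
      = T (\<Sum>j\<le>Suc n. (- 1) ^ j *\<^sub>C (\<lambda>bs. word_form (hd bs, tl bs)) (take j ?xs @ (?xs ! j * ?xs ! Suc j) # drop (j + 2) ?xs))"
    unfolding T_simps trace_cochain_def ..
  also have "\<dots> = (- 1) ^ Suc n * T (word_form (1, a # bs) * word_form (b, []))"
    using as assms(1) by (subst word_form_times_algebra) (simp_all add: T_simps butlast_append)
  also have "\<dots> = T (word_form (b, a # bs))"
    using assms(2) as by (simp add: trace_algebra)
  also have "(\<Sum>j\<le>Suc n. (- 1) ^ j * trace_cochain (take j ?xs @ (?xs ! j * ?xs ! Suc j) # drop (j + 2) ?xs))
      = trace_cochain as - (\<Sum>j\<le>n. (- 1) ^ j * B0 trace_cochain (take j as @ (as ! j * as ! Suc j) # drop (j + 2) as))"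
    unfolding sum.atMost_Suc_shift using as by (simp add: B0_def sum_negf)
  finally have "hoch_b n (B0 trace_cochain) as = trace_cochain as - T (word_form (b, a # bs)) + T (word_form (1, (b * a) # bs))"
    using as tail assms(2) by (simp add: hoch_b_def B0_trace_cochain nth_append algebra_simps)
  moreover have "T (word_form (1, b # a # bs)) = T (word_form (1, as))"
    using trace_word_rotate[of 1 "b # a # bs"] as by simp
  moreover have "T (word_form (1, (b * a) # bs)) = T (word_form (a, bs @ [b])) + T (word_form (b, a # bs)) - T (word_form (1, b # a # bs))"
    using trace_differential[of b a bs] by (simp add: algebra_simps)
  ultimately show ?thesis using as by (simp add: trace_cochain_Cons)
qed

end

section \<open>The one-loop bracket and its expansion\<close>

context finite_spectral_triple
begin

lemma phi_N_eq:
  assumes "length as = n + 1" "n \<ge> 1"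
  shows "phi_N \<pi> Dom D \<phi> lam f N n as = trace_cochain as"
proof -
  obtain a b bs where as: "as = a # b # bs" using assms by (cases as; cases "tl as") auto
  let ?V = "one_form_op \<pi> Dom D a b"
  have tail: "map (\<lambda>j. comm Dom D (\<pi> (as ! j))) [2..<n + 1] = map (\<lambda>c. comm Dom D (\<pi> c)) bs"
    by (rule nth_equalityI) (use as assms in \<open>auto simp del: upt_Suc\<close>)
  have "phi_N \<pi> Dom D \<phi> lam f N n as = one_loop_bracket \<phi> lam f N (?V # map (\<lambda>c. comm Dom D (\<pi> c)) bs)"
    unfolding phi_N_def tail using as by simp
  also have "\<dots> = mat_bracket (map (entry \<phi>) (?V # map (\<lambda>c. comm Dom D (\<pi> c)) bs))"
    by (rule one_loop_bracket_mat_bracket) (use block_one_form block_comm in auto)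
  also have "map (entry \<phi>) (?V # map (\<lambda>c. comm Dom D (\<pi> c)) bs) = [] @ entry \<phi> ?V # map \<delta> bs"
    by (simp add: \<delta>_def)
  also have "mat_bracket \<dots> = mat_bracket ([] @ mat_mult N (\<alpha> a) (\<delta> b) # map \<delta> bs)"
    by (rule mat_bracket_cong1) (rule entry_one_form)
  also have "\<dots> = trace_cochain as"
    by (simp add: as trace_cochain_Cons form_bracket_word word_bracket_def slot_def)
  finally show ?thesis .
qed

text \<open>The truncated matrix of \<open>pi_D \<pi> Dom D A\<close>, assembled from truncated
  products, so that linearity in the form can be checked word by word.\<close>

definition field_mat :: "'a form \<Rightarrow> nat \<Rightarrow> nat \<Rightarrow> complex" where
  "field_mat A x y = lext (\<lambda>(a, as). if length as = 1 then mat_mult N (\<alpha> a) (\<delta> (hd as)) x y else 0) (rep_form A)"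

lemma field_mat:
  shows field_mat_clinear: "clinear_map (\<lambda>A. field_mat A x y)"
    and field_mat_word: "field_mat (word_form (a, [b])) x y = mat_mult N (\<alpha> a) (\<delta> b) x y"
proof -
  define g where "g = (\<lambda>(a :: 'a, as :: 'a list). if length as = 1 then mat_mult N (\<alpha> a) (\<delta> (hd as)) x y else 0)"
  have null: "lext g z = 0" if "z \<in> form_null" for z
    using that
    by (rule lext_null_zero)
       (auto simp: g_def cscale_complex_def mat_mult_def \<alpha>_add \<alpha>_cscale \<delta>_add \<delta>_cscale \<delta>_one
          sum.distrib sum_distrib_left algebra_simps)
  show "clinear_map (\<lambda>A. field_mat A x y)"
    using lext_rep_form(2)[of g, OF null] by (simp add: field_mat_def g_def)
  show "field_mat (word_form (a, [b])) x y = mat_mult N (\<alpha> a) (\<delta> b) x y"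
    using lext_rep_form(3)[of g "(a, [b])", OF null] by (simp add: field_mat_def g_def)
qed

lemma form_bracket_linear:
  "form_bracket ((\<lambda>x y. c * M x y + c' * M' x y) # Ms) \<omega> = c * form_bracket (M # Ms) \<omega> + c' * form_bracket (M' # Ms) \<omega>"
proof -
  have "word_bracket ((\<lambda>x y. c * M x y + c' * M' x y) # Ms) w = c * word_bracket (M # Ms) w + c' * word_bracket (M' # Ms) w" for w
    by (cases w) (simp add: word_bracket_def slot_linear)
  then show ?thesis
    by (simp add: form_bracket_def lext_def cscale_complex_def sum.distrib sum_distrib_left algebra_simps)
qed

text \<open>Since \<open>a db\<close> is the Fedosov product of \<open>a\<close> and
  \<open>db\<close>, multiplying by it appends \<open>[D, b]\<close> and then lets \<open>a\<close>
  act on it; linearity does the rest.\<close>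

lemma form_bracket_field:
  assumes "A \<in> Omega 1"
  shows "form_bracket Ms (form_of (x * fedosov A)) = form_bracket (field_mat A # Ms) (form_of x)"
  using assms
proof (induction rule: Omega_induct)
  case zero
  have "field_mat 0 = (\<lambda>x y. 0 * \<delta> 0 x y + 0 * \<delta> 0 x y)"
    by (simp add: fun_eq_iff clinear_zero[OF field_mat_clinear])
  then have "form_bracket (field_mat 0 # Ms) (form_of x) = 0" by (simp only: form_bracket_linear) simp
  then show ?case by (simp add: fedosov_zero zero_fedosov.rep_eq fb_simps)
next
  case (add \<omega> \<eta>)
  have "field_mat (\<omega> + \<eta>) = (\<lambda>x y. 1 * field_mat \<omega> x y + 1 * field_mat \<eta> x y)"
    by (simp add: fun_eq_iff clinear_add[OF field_mat_clinear])
  then have "form_bracket (field_mat (\<omega> + \<eta>) # Ms) (form_of x) = form_bracket (field_mat \<omega> # Ms) (form_of x) + form_bracket (field_mat \<eta> # Ms) (form_of x)"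
    by (simp only: form_bracket_linear) simp
  then show ?case by (simp add: fedosov_add distrib_left form_of_add fb_simps add)
next
  case (cscale c \<omega>)
  have "field_mat (c *\<^sub>C \<omega>) = (\<lambda>x y. c * field_mat \<omega> x y + 0 * field_mat \<omega> x y)"
    by (simp add: fun_eq_iff clinear_cscale[OF field_mat_clinear])
  then have "form_bracket (field_mat (c *\<^sub>C \<omega>) # Ms) (form_of x) = c * form_bracket (field_mat \<omega> # Ms) (form_of x)"
    by (simp only: form_bracket_linear) simp
  then show ?case by (simp add: fedosov_cscale cscale_mult_right form_of_cscale fb_simps cscale)
next
  case (word a as)
  then obtain b where b: "as = [b]" by (auto simp: length_Suc_conv)
  have "fedosov (word_form (a, [b])) = al a * ds b" using fedosov_word_snoc[of a "[]" b] by simp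
  moreover have "field_mat (word_form (a, [b])) = mat_mult N (\<alpha> a) (\<delta> b)"
    by (simp add: fun_eq_iff field_mat_word)
  ultimately show ?case unfolding b by (simp add: mult.assoc[symmetric] form_bracket_ds form_bracket_al)
qed

lemma form_bracket_power:
  assumes "A \<in> Omega 1" "n \<ge> 1"
  shows "form_bracket [] (form_of (fedosov A ^ n)) = mat_bracket (replicate n (field_mat A))"
proof -
  have "form_bracket Ms (form_of (fedosov A ^ m)) = form_bracket (replicate m (field_mat A) @ Ms) (form_of 1)" for m Ms
  proof (induction m arbitrary: Ms)
    case (Suc m)
    have "form_bracket Ms (form_of (fedosov A ^ Suc m)) = form_bracket (field_mat A # Ms) (form_of (fedosov A ^ m))"
      unfolding power_Suc2 by (rule form_bracket_field[OF assms(1)])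
    then show ?case unfolding Suc by (simp add: replicate_append_same[symmetric])
  qed simp
  from this[of "[]" n] have "form_bracket [] (form_of (fedosov A ^ n)) = form_bracket (replicate n (field_mat A)) (word_form (1, []))"
    by (simp add: one_fedosov.rep_eq one_form_word)
  also have "\<dots> = mat_bracket (replicate n (field_mat A))"
    using assms(2) by (cases n) (simp_all add: form_bracket_word word_bracket_def slot_one)
  finally show ?thesis .
qed

lemma entry_pi_D:
  "entry \<phi> (pi_D \<pi> Dom D A) x y
    = (\<Sum>w\<in>Poly_Mapping.keys (rep_form A). (if length (snd w) = 1 then Poly_Mapping.lookup (rep_form A) w else 0)
        * entry \<phi> (one_form_op \<pi> Dom D (fst w) (hd (snd w))) x y)"
proof -
  have zero: "cinner z 0 = 0" for z :: 'h using cinner_add_right[of z 0 0] by simp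
  show ?thesis
    unfolding pi_D_def entry_def lext_def cinner_sum_right
    by (intro sum.cong refl) (auto simp: cinner_cscale_right zero split: prod.splits)
qed

lemma entry_pi_D_field: "y < N \<Longrightarrow> entry \<phi> (pi_D \<pi> Dom D A) x y = field_mat A x y"
  unfolding entry_pi_D field_mat_def lext_def
  by (intro sum.cong refl) (auto simp: entry_one_form cscale_complex_def split: prod.splits)

lemma block_pi_D: "block (pi_D \<pi> Dom D A)"
proof -
  let ?S = "Poly_Mapping.keys (rep_form A)" and ?V = "\<lambda>w. one_form_op \<pi> Dom D (fst w) (hd (snd w))"
  have "\<forall>w. \<exists>K. supported K (?V w)" using block_one_form by (simp add: block_def)
  then obtain k where k: "\<And>w. supported (k w) (?V w)" by metis
  \<comment> \<open>The sum of the finitely many bounds serves as a common bound.\<close>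
  have "supported (sum k ?S) (pi_D \<pi> Dom D A)"
    unfolding supported_def entry_pi_D
  proof (intro allI impI sum.neutral ballI)
    fix i j w assume ij: "sum k ?S \<le> i \<or> sum k ?S \<le> j" and w: "w \<in> ?S"
    have "k w \<le> sum k ?S" by (rule member_le_sum) (use w in auto)
    then show "(if length (snd w) = 1 then Poly_Mapping.lookup (rep_form A) w else 0) * entry \<phi> (?V w) i j = 0"
      using k[of w] ij by (auto simp: supported_def)
  qed
  then show ?thesis using block_one_form unfolding block_def by (auto simp: entry_pi_D)
qed

lemma one_loop_bracket_power:
  assumes "A \<in> Omega 1" "n \<ge> 1"
  shows "one_loop_bracket \<phi> lam f N (replicate n (pi_D \<pi> Dom D A)) = form_bracket [] (form_of (fedosov A ^ n))"
proof -
  have "one_loop_bracket \<phi> lam f N (replicate n (pi_D \<pi> Dom D A)) = mat_bracket (map (entry \<phi>) (replicate n (pi_D \<pi> Dom D A)))"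
    by (rule one_loop_bracket_mat_bracket) (use assms(2) block_pi_D in auto)
  also have "\<dots> = mat_bracket (replicate n (field_mat A))"
    by (rule mat_bracket_cong) (use assms(2) in \<open>auto simp: entry_pi_D_field\<close>)
  finally show ?thesis by (simp add: form_bracket_power[OF assms])
qed

section \<open>The even and the odd cocycle\<close>

lemma psi_N_eq:
  assumes "length as = 2 * k" "k \<ge> 1"
  shows "psi_N \<pi> Dom D \<phi> lam f N k as = trace_cochain as + (- 1 / 2) * B0 trace_cochain as"
  using assms by (simp add: psi_N_def phi_N_eq B0_def)

lemma phi_N_in_cochains: "n \<ge> 1 \<Longrightarrow> phi_N \<pi> Dom D \<phi> lam f N n \<in> cochains n"
  by (rule cochains_cong[OF trace_cochain_in_cochains]) (simp add: phi_N_eq)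

lemma psi_N_in_cochains: "k \<ge> 1 \<Longrightarrow> psi_N \<pi> Dom D \<phi> lam f N k \<in> cochains (2 * k - 1)"
  using cochains_linear[OF trace_cochain_in_cochains B0_in_cochains, of 1 "- 1 / 2"]
  by (rule cochains_cong) (simp add: psi_N_eq)

text \<open>Both terms vanish separately: b annihilates the trace cochain in even degree, and B
  lands in odd degree, where the signs cancel.\<close>

lemma phi_N_even_cocycle: "even_cocycle (\<lambda>k. if k = 0 then (\<lambda>_. 0) else phi_N \<pi> Dom D \<phi> lam f N (2 * k))"
  unfolding even_cocycle_def
proof (intro conjI allI impI)
  fix k
  show "(if k = 0 then (\<lambda>_. 0) else phi_N \<pi> Dom D \<phi> lam f N (2 * k)) \<in> cochains (2 * k)"
    using phi_N_in_cochains[of "2 * k"] by (auto simp: cochains_def)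
  fix as :: "'a list" assume as: "length as = 2 * k + 2"
  have "hoch_b (2 * k) (if k = 0 then (\<lambda>_. 0) else phi_N \<pi> Dom D \<phi> lam f N (2 * k)) as = 0"
  proof (cases "k = 0")
    case False
    then have "hoch_b (2 * k) (phi_N \<pi> Dom D \<phi> lam f N (2 * k)) as = hoch_b (2 * k) trace_cochain as"
      by (intro hoch_b_cong) (simp_all add: phi_N_eq as)
    then show ?thesis using False as by (simp add: hoch_b_trace_cochain)
  qed (simp add: hoch_b_def)
  moreover have "connes_B (2 * k + 1) (phi_N \<pi> Dom D \<phi> lam f N (2 * (k + 1))) as = connes_B (2 * k + 1) trace_cochain as"
    unfolding connes_B_def by (intro sum.cong refl) (simp add: phi_N_eq as)
  ultimately show "hoch_b (2 * k) (if k = 0 then (\<lambda>_. 0) else phi_N \<pi> Dom D \<phi> lam f N (2 * k)) as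
      + connes_B (2 * k + 1) (if k + 1 = 0 then (\<lambda>_. 0) else phi_N \<pi> Dom D \<phi> lam f N (2 * (k + 1))) as = 0"
    by (simp add: connes_B_trace_cochain)
qed

lemma psi_tilde_N_odd_cocycle: "odd_cocycle (\<lambda>k. psi_tilde_N \<pi> Dom D \<phi> lam f N (k + 1))"
proof -
  \<comment> \<open>Before normalization b gives half the trace of the word \<open>(1, as)\<close>
    and B gives \<open>2 * k + 3\<close> times it, so the cocycle condition is the recursion
    \<open>c_Suc\<close>, which the factorials solve.\<close>
  define c :: "nat \<Rightarrow> complex" where "c k = (- 1) ^ k * (fact k / fact (2 * k + 1))" for k
  have c_Suc: "c (k + 1) * of_nat (2 * k + 3) = - (c k / 2)" for k
  proof -
    have f: "(fact (2 * (k + 1) + 1) :: complex) = of_nat (2 * k + 3) * (2 * of_nat (k + 1) * fact (2 * k + 1))"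
      by (simp add: algebra_simps)
    have nz: "complex_of_nat (2 * k + 3) \<noteq> 0" "complex_of_nat (k + 1) \<noteq> 0" "(fact (2 * k + 1) :: complex) \<noteq> 0"
      by (simp_all del: of_nat_add of_nat_mult of_nat_Suc)
    have g: "(fact (k + 1) :: complex) = of_nat (k + 1) * fact k" by simp
    show ?thesis unfolding c_def f g using nz by (simp add: field_simps del: of_nat_add of_nat_mult of_nat_Suc fact_Suc)
  qed
  have psi: "psi_tilde_N \<pi> Dom D \<phi> lam f N (k + 1) as = c k * (trace_cochain as + (- 1 / 2) * B0 trace_cochain as)"
    if "length as = 2 * k + 2" for k as
    using that by (simp add: psi_tilde_N_def psi_N_eq c_def)
  have B: "connes_B (2 * k) (psi_tilde_N \<pi> Dom D \<phi> lam f N (k + 1)) as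
      = c k * (of_nat (2 * k + 1) * form_bracket [] (word_form (1, as)))" if "length as = 2 * k + 1" for k as
  proof -
    have "connes_B (2 * k) (psi_tilde_N \<pi> Dom D \<phi> lam f N (k + 1)) as = c k * connes_B (2 * k) trace_cochain as"
      unfolding connes_B_def sum_distrib_left
    proof (intro sum.cong refl)
      fix j
      \<comment> \<open>A second 1 stands behind the first, so the \<open>B0\<close> part of \<psi>
        does not contribute to B.\<close>
      have "B0 trace_cochain (1 # rotate j as) = 0"
        using word_form_tail_one[of 1 "[]" "rotate j as"] by (simp add: B0_trace_cochain fb_simps)
      then show "(- 1) ^ (2 * k * j) * psi_tilde_N \<pi> Dom D \<phi> lam f N (k + 1) (1 # rotate j as)
          = c k * ((- 1) ^ (2 * k * j) * trace_cochain (1 # rotate j as))"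
        using that psi[of "1 # rotate j as" k] by simp
    qed
    then show ?thesis by (simp add: connes_B_trace_cochain)
  qed
  show ?thesis
    unfolding odd_cocycle_def
  proof (intro conjI allI impI)
    fix k
    show "psi_tilde_N \<pi> Dom D \<phi> lam f N (k + 1) \<in> cochains (2 * k + 1)"
      using cochains_linear[OF trace_cochain_in_cochains B0_in_cochains, of "c k" "- 1 / 2"]
      by (rule cochains_cong) (rule psi, simp)
    fix as :: "'a list" assume as: "length as = 2 * k + 3"
    have "hoch_b (2 * k + 1) (psi_tilde_N \<pi> Dom D \<phi> lam f N (k + 1)) as
        = hoch_b (2 * k + 1) (\<lambda>bs. c k * (trace_cochain bs + (- 1 / 2) * B0 trace_cochain bs)) as"
      by (rule hoch_b_cong) (rule psi, simp, simp add: as)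
    also have "\<dots> = c k * (form_bracket [] (word_form (1, as)) / 2)"
      unfolding hoch_b_linear using as by (simp add: hoch_b_trace_cochain hoch_b_B0_trace_cochain diff_divide_distrib)
    finally have b: "hoch_b (2 * k + 1) (psi_tilde_N \<pi> Dom D \<phi> lam f N (k + 1)) as = c k / 2 * form_bracket [] (word_form (1, as))"
      by simp
    have "connes_B (2 * k + 2) (psi_tilde_N \<pi> Dom D \<phi> lam f N (k + 1 + 1)) as
        = c (k + 1) * of_nat (2 * k + 3) * form_bracket [] (word_form (1, as))"
      using B[of as "k + 1"] as by (simp add: mult.assoc)
    then show "hoch_b (2 * k + 1) (psi_tilde_N \<pi> Dom D \<phi> lam f N (k + 1)) as
        + connes_B (2 * k + 2) (psi_tilde_N \<pi> Dom D \<phi> lam f N (k + 1 + 1)) as = 0"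
      unfolding b c_Suc by simp
  next
    fix as :: "'a list" assume "length as = 1"
    then obtain a where "as = [a]" by (auto simp: length_Suc_conv)
    then show "connes_B 0 (psi_tilde_N \<pi> Dom D \<phi> lam f N (0 + 1)) as = 0"
      using B[of as 0] by (simp add: form_bracket_exact)
  qed
qed

lemma cint_phi_N:
  assumes "n \<ge> 1" "\<omega> \<in> Omega n"
  shows "cint n (phi_N \<pi> Dom D \<phi> lam f N n) \<omega> = form_bracket [] \<omega>"
  using phi_N_in_cochains[OF assms(1)] form_bracket_clinear assms(2)
  by (rule cint_Omega) (use assms(1) in \<open>simp add: phi_N_eq trace_cochain_Cons\<close>)

text \<open>Integrating against \<open>B0\<close> of a trace cochain is applying the trace to the
  differential; this is how the half differential of the transgression formula enters.\<close>

lemma cint_psi_N: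
  assumes "k \<ge> 1" "\<omega> \<in> Omega (2 * k - 1)"
  shows "cint (2 * k - 1) (psi_N \<pi> Dom D \<phi> lam f N k) \<omega> = form_bracket [] \<omega> - 1 / 2 * form_bracket [] (fd \<omega>)"
proof -
  have "clinear_map (\<lambda>\<omega>. form_bracket [] \<omega> - 1 / 2 * form_bracket [] (fd \<omega>))"
    by (simp add: clinear_map_def fd_add fd_cscale fb_simps cscale_complex_def algebra_simps)
  from psi_N_in_cochains[OF assms(1)] this assms(2) show ?thesis
    by (rule cint_Omega) (use assms(1) in \<open>simp add: psi_N_eq trace_cochain_Cons B0_trace_cochain fd_word\<close>)
qed

theorem effective_action_expansion:
  assumes A: "A \<in> Omega 1"
  shows "(\<Sum>n = 1..K. 1 / of_nat n * one_loop_bracket \<phi> lam f N (replicate n (pi_D \<pi> Dom D A)))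
      - (\<Sum>k = 1..K. cint (2 * k - 1) (psi_N \<pi> Dom D \<phi> lam f N k) (chern_simons k A)
          + 1 / of_nat (2 * k) * cint (2 * k) (phi_N \<pi> Dom D \<phi> lam f N (2 * k)) (curvature A ^ k))
      = (\<Sum>l = K + 1..2 * K + 1. cint l (phi_N \<pi> Dom D \<phi> lam f N l) (remainder K A l))"
proof -
  have pow: "curvature A ^ k \<in> Omega (2 * k)" for k
  proof (induction k)
    case (Suc k)
    have "curvature A \<in> Omega 2"
      unfolding curvature_def using Omega_fd[OF A] Omega_times[OF A A] by (intro Omega_add) (simp_all add: power2_eq_square numeral_2_eq_2)
    from Omega_times[OF this Suc] show ?case by simp
  qed (simp add: Omega_one)
  have cs: "chern_simons k A \<in> Omega (2 * k - 1)" if "k \<ge> 1" for k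
    using that Omega_cs_form[OF A, of "k - 1"] by (cases k) (simp_all add: chern_simons_eq)
  have "(\<Sum>n = 1..K. 1 / of_nat n * one_loop_bracket \<phi> lam f N (replicate n (pi_D \<pi> Dom D A)))
      = (\<Sum>n = 1..K. 1 / of_nat n * form_bracket [] (form_of (fedosov A ^ n)))"
    by (intro sum.cong refl) (simp add: one_loop_bracket_power[OF A])
  moreover have "(\<Sum>k = 1..K. cint (2 * k - 1) (psi_N \<pi> Dom D \<phi> lam f N k) (chern_simons k A)
          + 1 / of_nat (2 * k) * cint (2 * k) (phi_N \<pi> Dom D \<phi> lam f N (2 * k)) (curvature A ^ k))
      = (\<Sum>k = 1..K. form_bracket [] (chern_simons k A) - 1 / 2 * form_bracket [] (fd (chern_simons k A))
          + 1 / of_nat (2 * k) * form_bracket [] (curvature A ^ k))"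
  proof (intro sum.cong refl)
    fix k assume "k \<in> {1..K}"
    then have k: "k \<ge> 1" by simp
    show "cint (2 * k - 1) (psi_N \<pi> Dom D \<phi> lam f N k) (chern_simons k A)
          + 1 / of_nat (2 * k) * cint (2 * k) (phi_N \<pi> Dom D \<phi> lam f N (2 * k)) (curvature A ^ k)
        = form_bracket [] (chern_simons k A) - 1 / 2 * form_bracket [] (fd (chern_simons k A))
          + 1 / of_nat (2 * k) * form_bracket [] (curvature A ^ k)"
      unfolding cint_psi_N[OF k cs[OF k]] using cint_phi_N[OF _ pow[of k]] k by simp
  qed
  moreover have "(\<Sum>l = K + 1..2 * K + 1. cint l (phi_N \<pi> Dom D \<phi> lam f N l) (remainder K A l))
      = (\<Sum>l = K + 1..2 * K + 1. form_bracket [] (remainder K A l))"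
    by (intro sum.cong refl cint_phi_N Omega_remainder A) simp
  ultimately show ?thesis by (simp only: trace_expansion[OF A])
qed

end

theorem theorem4p5:
  fixes \<pi> :: "'a :: star_algebra \<Rightarrow> 'h :: hilbert_space \<Rightarrow> 'h"
    and Dom :: "'h set" and D :: "'h \<Rightarrow> 'h"
    and \<phi> :: "nat \<Rightarrow> 'h" and lam :: "nat \<Rightarrow> real"
    and f :: "real \<Rightarrow> real" and N :: nat
  assumes triple: "spectral_triple \<pi> Dom D"
    and summable: "finitely_summable Dom D"
    and basis: "inj \<phi>" "is_onb (range \<phi>)"
    and eigen: "\<And>i. \<phi> i \<in> Dom \<and> D (\<phi> i) = complex_of_real (lam i) *\<^sub>C \<phi> i"
    and smooth: "smooth f"
    and pos: "\<And>i j. i < N \<Longrightarrow> j < N \<Longrightarrow> ddiff (deriv f) [lam i, lam j] > 0"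
    and finite_rank: "\<And>a b. \<exists>K. one_form_op \<pi> Dom D a b \<in> MK \<phi> K"
    and cutoff: "cutoff_compatible \<pi> Dom D \<phi> N"
  shows "even_cocycle (\<lambda>k. if k = 0 then (\<lambda>_. 0) else phi_N \<pi> Dom D \<phi> lam f N (2 * k))
    \<and> odd_cocycle (\<lambda>k. psi_tilde_N \<pi> Dom D \<phi> lam f N (k + 1))
    \<and> (\<forall>A \<in> Omega 1. \<forall>K. \<exists>\<omega>. (\<forall>l \<in> {K + 1..2 * K + 1}. \<omega> l \<in> Omega l) \<and>
        (\<Sum>n = 1..K. 1 / of_nat n * one_loop_bracket \<phi> lam f N (replicate n (pi_D \<pi> Dom D A)))
        - (\<Sum>k = 1..K. cint (2 * k - 1) (psi_N \<pi> Dom D \<phi> lam f N k) (chern_simons k A)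
            + 1 / of_nat (2 * k) * cint (2 * k) (phi_N \<pi> Dom D \<phi> lam f N (2 * k)) (curvature A ^ k))
        = (\<Sum>l = K + 1..2 * K + 1. cint l (phi_N \<pi> Dom D \<phi> lam f N l) (\<omega> l)))"
proof -
  interpret finite_spectral_triple \<phi> lam f N \<pi> Dom D
    by unfold_locales (fact basis smooth pos triple eigen finite_rank cutoff)+
  show ?thesis
    using phi_N_even_cocycle psi_tilde_N_odd_cocycle effective_action_expansion Omega_remainder by blast
qed

end
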